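(* Let $\psi\colon G\twoheadrightarrow H$ be an epimorphism of commutative groups, let $R$ be a $G$-graded commutative ring, and let $\mathfrak{a}\subseteq R$ be a graded ideal. If $\mathrm{Ker}(\psi)$ is finite, then the canonical morphism of $\delta$-functors $$(h_{R/\mathfrak{A},\psi}^i)_{i\in\mathbb{Z}}\colon({}^{G}H^{i}_{\mathfrak{a}}(\bullet)_{[\psi]})_{i\in\mathbb{Z}}\rightarrow({}^{H}H^{i}_{\mathfrak{a}_{[\psi]}}(\bullet_{[\psi]}))_{i\in\mathbb{Z}}$$ is an isomorphism.
   Context: Groups are written additively. For a commutative group $G$ and a $G$-graded commutative ring $R$, $\mathrm{GrMod}^G(R)$ is the category of $G$-graded $R$-modules with degree-preserving $R$-linear maps as morphisms; it is Abelian, satisfies AB5, and has enough projectives and injectives. For $g\in G$, $N(g)$ is the shift, $N(g)_{g'}=N_{g+g'}$. Graded Hom and Ext: ${}^{G}\mathrm{Hom}_{R}(M,N)=\bigoplus_{g\in G}\mathrm{Hom}_{\mathrm{GrMod}^G(R)}(M,N(g))$, a $G$-graded $R$-module. The bifunctors ${}^{G}\mathrm{Ext}^i_R(\bullet,\bullet)$ ($i\in\mathbb{Z}$, zero for $i<0$) are its right derived functors (in either variable), computed in $\mathrm{GrMod}^G(R)$. Graded local cohomology: for a graded ideal $\mathfrak{a}\subseteq R$, ${}^{G}H^i_{\mathfrak{a}}=\varinjlim_{n\in\mathbb{N}}{}^{G}\mathrm{Ext}^i_R(R/\mathfrak{a}^n,\bullet)$, where the transition maps are induced by the canonical projections $R/\mathfrak{a}^{n+1}\to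 R/\mathfrak{a}^n$. These form the right derived cohomological functor of the $\mathfrak{a}$-torsion functor ${}^{G}\Gamma_{\mathfrak{a}}:=\varinjlim_n{}^{G}\mathrm{Hom}_R(R/\mathfrak{a}^n,\bullet)$. Coarsening: $R_{[\psi]}$ is the $H$-graded ring $\bigoplus_{h\in H}\bigl(\bigoplus_{g\in\psi^{-1}(h)}R_g\bigr)$ (same underlying ring as $R$); the $\psi$-coarsening functor $\bullet_{[\psi]}\colon\mathrm{GrMod}^G(R)\to\mathrm{GrMod}^H(R_{[\psi]})$ is defined analogously, and it is exact. The $H$-graded functors over $R_{[\psi]}$ with respect to the graded ideal $\mathfrak{a}_{[\psi]}$ are the following: ${}^{H}\mathrm{Hom}_{R_{[\psi]}}(M,N)=\bigoplus_{h\in H}\mathrm{Hom}_{\mathrm{GrMod}^H(R_{[\psi]})}(M,N(h))$ for $H$-graded $R_{[\psi]}$-modules $M$ and $N$; its right derived functors ${}^{H}\mathrm{Ext}^i_{R_{[\psi]}}(\bullet,\bullet)$, computed in $\mathrm{GrMod}^H(R_{[\psi]})$; ${}^{H}H^i_{\mathfrak{a}_{[\psi]}}=\varinjlim_{n\in\mathbb{N}}{}^{H}\mathrm{Ext}^i_{R_{[\psi]}}(R_{[\psi]}/(\mathfrak{a}_{[\psi]})^n,\bullet)$, with transition maps induced by the canonical projections; and ${}^{H}\Gamma_{\mathfrak{a}_{[\psi]}}=\varinjlim_n{}^{H}\mathrm{Hom}_{R_{[\psi]}}(R_{[\psi]}/(\mathfrak{a}_{[\psi]})^n,\bullet)$.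 Canonical morphism: the map $u\mapsto u_{[\psi]}$ sending $\mathrm{Hom}_{\mathrm{GrMod}^G(R)}(M,N(g))$ into $\mathrm{Hom}_{\mathrm{GrMod}^H(R_{[\psi]})}(M_{[\psi]},N_{[\psi]}(\psi(g)))$ induces a natural monomorphism $h_\psi(M,N)\colon{}^{G}\mathrm{Hom}_R(M,N)_{[\psi]}\to{}^{H}\mathrm{Hom}_{R_{[\psi]}}(M_{[\psi]},N_{[\psi]})$. Let $R/\mathfrak{A}$ denote the projective system $(R/\mathfrak{a}^n)_{n\in\mathbb{N}}$ and let $h_{R/\mathfrak{A},\psi}=\varinjlim_n h_\psi(R/\mathfrak{a}^n,\bullet)\colon{}^{G}\Gamma_{\mathfrak{a}}(\bullet)_{[\psi]}\to{}^{H}\Gamma_{\mathfrak{a}_{[\psi]}}(\bullet_{[\psi]})$. Since $\bullet_{[\psi]}$ is exact, $({}^{G}H^{i}_{\mathfrak{a}}(\bullet)_{[\psi]})_{i}$ and $({}^{H}H^{i}_{\mathfrak{a}_{[\psi]}}(\bullet_{[\psi]}))_{i}$ are exact $\delta$-functors on $\mathrm{GrMod}^G(R)$, and the first is universal; $(h^i_{R/\mathfrak{A},\psi})_{i\in\mathbb{Z}}$ denotes the unique morphism of $\delta$-functors from the first to the second with $h^0_{R/\mathfrak{A},\psi}=h_{R/\mathfrak{A},\psi}$. *)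

theory Defs
  imports "HOL-Algebra.Module" "HOL-Algebra.Ideal_Product"
begin

section \<open>Graded rings and modules\<close>

text \<open>
  The grading groups are types of class \<^class>\<open>ab_group_add\<close>. Rings and modules are those
  of HOL-Algebra, so that the zero ring is allowed.
\<close>

definition grading :: "('a, 'm) ring_scheme \<Rightarrow> ('g \<Rightarrow> 'a set) \<Rightarrow> bool" where
  "grading A D \<longleftrightarrow>
     (\<forall>g. additive_subgroup (D g) A) \<and>
     (\<forall>x\<in>carrier A. \<exists>!c. (\<forall>g. c g \<in> D g) \<and> finite {g. c g \<noteq> \<zero>\<^bsub>A\<^esub>} \<and>
        x = finsum A c {g. c g \<noteq> \<zero>\<^bsub>A\<^esub>})"

record ('r, 'g) gring = "'r ring" +
  rgrade :: "'g \<Rightarrow> 'r set"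

text \<open>The fields \<open>mult\<close> and \<open>one\<close> of a module record carry no information.\<close>

record ('r, 'm, 'g) gmod = "('r, 'm) module" +
  mgrade :: "'g \<Rightarrow> 'm set"

definition graded_cring :: "('r, 'g::ab_group_add) gring \<Rightarrow> bool" where
  "graded_cring R \<longleftrightarrow> cring R \<and> grading R (rgrade R) \<and>
     (\<forall>g h. \<forall>x\<in>rgrade R g. \<forall>y\<in>rgrade R h. x \<otimes>\<^bsub>R\<^esub> y \<in> rgrade R (g + h))"

definition graded_ideal :: "'r set \<Rightarrow> ('r, 'g::ab_group_add) gring \<Rightarrow> bool" where
  "graded_ideal a R \<longleftrightarrow> ideal a R \<and> grading (R\<lparr>carrier := a\<rparr>) (\<lambda>g. a \<inter> rgrade R g)"

definition graded_module :: "('r, 'g::ab_group_add) gring \<Rightarrow> ('r, 'm, 'g) gmod \<Rightarrow> bool" where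
  "graded_module R M \<longleftrightarrow> module R M \<and> grading M (mgrade M) \<and>
     (\<forall>g h. \<forall>r\<in>rgrade R g. \<forall>x\<in>mgrade M h. r \<odot>\<^bsub>M\<^esub> x \<in> mgrade M (g + h))"

definition gr_hom ::
    "('r, 'g::ab_group_add) gring \<Rightarrow> ('r, 'm, 'g) gmod \<Rightarrow> ('r, 'n, 'g) gmod \<Rightarrow> ('m \<Rightarrow> 'n) set" where
  "gr_hom R M N = {u \<in> carrier M \<rightarrow>\<^sub>E carrier N.
     (\<forall>x\<in>carrier M. \<forall>y\<in>carrier M. u (x \<oplus>\<^bsub>M\<^esub> y) = u x \<oplus>\<^bsub>N\<^esub> u y) \<and>
     (\<forall>r\<in>carrier R. \<forall>x\<in>carrier M. u (r \<odot>\<^bsub>M\<^esub> x) = r \<odot>\<^bsub>N\<^esub> u x) \<and>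
     (\<forall>g. u ` mgrade M g \<subseteq> mgrade N g)}"

definition shift :: "('r, 'm, 'g::ab_group_add) gmod \<Rightarrow> 'g \<Rightarrow> ('r, 'm, 'g) gmod" where
  "shift N g = N\<lparr>mgrade := \<lambda>g'. mgrade N (g + g')\<rparr>"

definition regular :: "('r, 'g) gring \<Rightarrow> ('r, 'r, 'g) gmod" where
  "regular R = \<lparr>carrier = carrier R, mult = mult R, one = \<one>\<^bsub>R\<^esub>, zero = \<zero>\<^bsub>R\<^esub>, add = add R,
     smult = mult R, mgrade = rgrade R\<rparr>"

definition submod :: "('r, 'm, 'g) gmod \<Rightarrow> 'm set \<Rightarrow> ('r, 'm, 'g) gmod" where
  "submod M Z = M\<lparr>carrier := Z, mgrade := \<lambda>g. mgrade M g \<inter> Z\<rparr>"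

definition quotmod :: "('r, 'm, 'g) gmod \<Rightarrow> 'm set \<Rightarrow> ('r, 'm set, 'g) gmod" where
  "quotmod M K = \<lparr>carrier = a_rcosets\<^bsub>M\<^esub> K, mult = undefined, one = undefined, zero = K,
     add = set_add M, smult = \<lambda>r X. \<Union>x\<in>X. K +>\<^bsub>M\<^esub> (r \<odot>\<^bsub>M\<^esub> x),
     mgrade = \<lambda>g. {K +>\<^bsub>M\<^esub> x | x. x \<in> mgrade M g}\<rparr>"

text \<open>
  The map \<open>Q \<rightarrow> N/K\<close> induced by a map \<open>\<phi>\<close> into \<open>N\<close>, where the elements of \<open>Q\<close> are cosets.
  The value of \<open>\<phi>\<close> on any representative gives the same coset of \<open>K\<close>, so the union has
  just one member.
\<close>

definition induced ::
    "('r, 'm set, 'g) gmod \<Rightarrow> ('r, 'n, 'g) gmod \<Rightarrow> 'n set \<Rightarrow> ('m \<Rightarrow> 'n) \<Rightarrow> 'm set \<Rightarrow> 'n set" where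
  "induced Q N K \<phi> = (\<lambda>X\<in>carrier Q. \<Union>x\<in>X. K +>\<^bsub>N\<^esub> \<phi> x)"

text \<open>
  The graded Hom module \<open>\<Oplus>\<^sub>g Hom(M, N(g))\<close>, realised inside the module of all \<open>R\<close>-linear maps
  \<open>M \<rightarrow> N\<close> as the sum of the subgroups \<open>Hom(M, N(g))\<close>. This sum is direct
  (lemma \<open>ghom_grading\<close> below), and \<open>(r u)(x) = r u(x)\<close>.
\<close>

definition ghom ::
    "('r, 'g::ab_group_add) gring \<Rightarrow> ('r, 'm, 'g) gmod \<Rightarrow> ('r, 'n, 'g) gmod \<Rightarrow> ('r, 'm \<Rightarrow> 'n, 'g) gmod"
    where
  "ghom R M N = \<lparr>
     carrier = {u \<in> extensional (carrier M).
        \<exists>F c. finite F \<and> (\<forall>g\<in>F. c g \<in> gr_hom R M (shift N g)) \<and>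
          (\<forall>x\<in>carrier M. u x = (\<Oplus>\<^bsub>N\<^esub>g\<in>F. c g x))},
     mult = undefined, one = undefined,
     zero = (\<lambda>x\<in>carrier M. \<zero>\<^bsub>N\<^esub>),
     add = (\<lambda>u v. \<lambda>x\<in>carrier M. u x \<oplus>\<^bsub>N\<^esub> v x),
     smult = (\<lambda>r u. \<lambda>x\<in>carrier M. r \<odot>\<^bsub>N\<^esub> u x),
     mgrade = (\<lambda>g. gr_hom R M (shift N g))\<rparr>"

lemma ex1_eq: "\<exists>!x. P x \<Longrightarrow> P a \<Longrightarrow> P b \<Longrightarrow> a = b"
  by blast

lemma gr_hom_closed: "u \<in> gr_hom R M N \<Longrightarrow> x \<in> carrier M \<Longrightarrow> u x \<in> carrier N"
  by (auto simp: gr_hom_def)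

lemma gr_hom_degree:
  "u \<in> gr_hom R M (shift N g) \<Longrightarrow> x \<in> mgrade M k \<Longrightarrow> u x \<in> mgrade N (g + k)"
  unfolding gr_hom_def shift_def by (auto dest!: spec[of _ k])

lemma ghom_elem_closed:
  assumes "graded_module R N" "u \<in> carrier (ghom R M N)" "x \<in> carrier M"
  shows "u x \<in> carrier N"
proof -
  interpret N: module R N using assms(1) by (simp add: graded_module_def)
  obtain F c where "finite F" and c: "\<forall>g\<in>F. c g \<in> gr_hom R M (shift N g)"
    and u: "u x = (\<Oplus>\<^bsub>N\<^esub>g\<in>F. c g x)"
    using assms(2,3) by (auto simp: ghom_def)
  have "(\<lambda>g. c g x) \<in> F \<rightarrow> carrier N"
    using c assms(3) by (force simp: gr_hom_def shift_def)
  then show ?thesis unfolding u by (rule N.finsum_closed)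
qed

lemma ghom_abelian_group:
  assumes M: "graded_module R M" and N: "graded_module R N"
  shows "abelian_group (ghom R M N)"
    and "\<And>g. additive_subgroup (gr_hom R M (shift N g)) (ghom R M N)"
    and "\<And>g. gr_hom R M (shift N g) \<subseteq> carrier (ghom R M N)"
proof -
  interpret N: module R N using N by (simp add: graded_module_def)
  interpret M: module R M using M by (simp add: graded_module_def)
  have sg: "additive_subgroup (mgrade N g) N" for g
    using N by (simp add: graded_module_def grading_def)
  let ?z = "\<lambda>x\<in>carrier M. \<zero>\<^bsub>N\<^esub>"
  have z: "?z \<in> gr_hom R M (shift N g)" for g
    using additive_subgroup.zero_closed[OF sg] M
    by (auto simp: gr_hom_def shift_def graded_module_def grading_def
        dest: additive_subgroup.a_Hcarr)
  have add: "(\<lambda>x\<in>carrier M. u x \<oplus>\<^bsub>N\<^esub> v x) \<in> gr_hom R M (shift N g)"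
    if "u \<in> gr_hom R M (shift N g)" "v \<in> gr_hom R M (shift N g)" for u v g
  proof -
    have uv: "u x \<in> carrier N" "v x \<in> carrier N" if "x \<in> carrier M" for x
      using that \<open>u \<in> _\<close> \<open>v \<in> _\<close> by (auto simp: gr_hom_def shift_def)
    have "u x \<oplus>\<^bsub>N\<^esub> v x \<in> mgrade N (g + k)" if "x \<in> mgrade M k" for x k
      using that \<open>u \<in> _\<close> \<open>v \<in> _\<close> additive_subgroup.a_closed[OF sg]
      by (auto simp: gr_hom_def shift_def image_subset_iff)
    then show ?thesis using \<open>u \<in> _\<close> \<open>v \<in> _\<close> uv M
      by (auto simp: gr_hom_def shift_def graded_module_def grading_def N.smult_r_distr N.a_ac
          dest: additive_subgroup.a_Hcarr)
  qed
  have neg: "(\<lambda>x\<in>carrier M. \<ominus>\<^bsub>N\<^esub> u x) \<in> gr_hom R M (shift N g)"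
    if "u \<in> gr_hom R M (shift N g)" for u g
  proof -
    have uv: "u x \<in> carrier N" if "x \<in> carrier M" for x
      using that \<open>u \<in> _\<close> by (auto simp: gr_hom_def shift_def)
    have "\<ominus>\<^bsub>N\<^esub> u x \<in> mgrade N (g + k)" if "x \<in> mgrade M k" for x k
      using that \<open>u \<in> _\<close> additive_subgroup.a_inv_closed[OF sg]
      by (auto simp: gr_hom_def shift_def image_subset_iff)
    then show ?thesis using \<open>u \<in> _\<close> uv M
      by (auto simp: gr_hom_def shift_def graded_module_def grading_def N.smult_r_minus
           N.minus_add dest: additive_subgroup.a_Hcarr)
  qed
  show sub: "gr_hom R M (shift N g) \<subseteq> carrier (ghom R M N)" for g
  proof
    fix u assume u: "u \<in> gr_hom R M (shift N g)"
    then have "\<forall>x\<in>carrier M. u x = (\<Oplus>\<^bsub>N\<^esub>h\<in>{g}. u x)"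
      by (auto simp: gr_hom_def shift_def Pi_iff PiE_iff)
    then show "u \<in> carrier (ghom R M N)" using u
      by (auto simp: ghom_def gr_hom_def PiE_iff intro!: exI[of _ "{g}"] exI[of _ "\<lambda>_. u"])
  qed
  \<comment> \<open>representations with support in a larger finite set\<close>
  have rep: "\<exists>F c. finite F \<and> (\<forall>g. c g \<in> gr_hom R M (shift N g)) \<and>
      (\<forall>F'. finite F' \<and> F \<subseteq> F' \<longrightarrow> (\<forall>x\<in>carrier M. u x = (\<Oplus>\<^bsub>N\<^esub>g\<in>F'. c g x)))"
    if u: "u \<in> carrier (ghom R M N)" for u
  proof -
    obtain F c where F: "finite F" and c: "\<forall>g\<in>F. c g \<in> gr_hom R M (shift N g)"
      and ux: "\<forall>x\<in>carrier M. u x = (\<Oplus>\<^bsub>N\<^esub>g\<in>F. c g x)"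
      using u by (auto simp: ghom_def)
    let ?c = "\<lambda>g. if g \<in> F then c g else ?z"
    have c': "\<forall>g. ?c g \<in> gr_hom R M (shift N g)" using c z by simp
    moreover have "u x = (\<Oplus>\<^bsub>N\<^esub>g\<in>F'. ?c g x)"
      if "finite F'" "F \<subseteq> F'" "x \<in> carrier M" for F' x
    proof -
      have cl: "?c g x \<in> carrier N" for g
        using gr_hom_closed[OF c'[rule_format] that(3)] by (auto simp: shift_def)
      have "u x = (\<Oplus>\<^bsub>N\<^esub>g\<in>F. c g x)" using ux that by blast
      also have "\<dots> = (\<Oplus>\<^bsub>N\<^esub>g\<in>F. ?c g x)"
        using cl by (intro N.finsum_cong') auto
      also have "\<dots> = (\<Oplus>\<^bsub>N\<^esub>g\<in>F'. ?c g x)"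
        using that cl by (intro N.add.finprod_mono_neutral_cong_left) auto
      finally show ?thesis .
    qed
    ultimately show ?thesis using F by (intro exI[of _ F] exI[of _ ?c]) blast
  qed
  have ext: "u \<in> extensional (carrier M)" if "u \<in> carrier (ghom R M N)" for u
    using that by (simp add: ghom_def)
  have addc: "(\<lambda>x\<in>carrier M. u x \<oplus>\<^bsub>N\<^esub> v x) \<in> carrier (ghom R M N)"
    if u: "u \<in> carrier (ghom R M N)" and v: "v \<in> carrier (ghom R M N)" for u v
  proof -
    obtain F c where F: "finite F" "\<forall>g. c g \<in> gr_hom R M (shift N g)"
      "\<forall>F'. finite F' \<and> F \<subseteq> F' \<longrightarrow> (\<forall>x\<in>carrier M. u x = (\<Oplus>\<^bsub>N\<^esub>g\<in>F'. c g x))"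
      using rep[OF u] by blast
    obtain E e where E: "finite E" "\<forall>g. e g \<in> gr_hom R M (shift N g)"
      "\<forall>F'. finite F' \<and> E \<subseteq> F' \<longrightarrow> (\<forall>x\<in>carrier M. v x = (\<Oplus>\<^bsub>N\<^esub>g\<in>F'. e g x))"
      using rep[OF v] by blast
    have cl: "c g x \<in> carrier N" "e g x \<in> carrier N" if "x \<in> carrier M" for g x
      using gr_hom_closed[OF F(2)[rule_format] that] gr_hom_closed[OF E(2)[rule_format] that]
      by (auto simp: shift_def)
    have "u x \<oplus>\<^bsub>N\<^esub> v x = (\<Oplus>\<^bsub>N\<^esub>g\<in>F \<union> E. (\<lambda>x\<in>carrier M. c g x \<oplus>\<^bsub>N\<^esub> e g x) x)"
      if "x \<in> carrier M" for x
    proof -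
      have "u x = (\<Oplus>\<^bsub>N\<^esub>g\<in>F \<union> E. c g x)" "v x = (\<Oplus>\<^bsub>N\<^esub>g\<in>F \<union> E. e g x)"
        using F E that by auto
      then show ?thesis using cl that by (simp add: N.finsum_addf Pi_iff)
    qed
    then show ?thesis using F E add
      by (auto simp: ghom_def intro!: exI[of _ "F \<union> E"]
          exI[of _ "\<lambda>g. \<lambda>x\<in>carrier M. c g x \<oplus>\<^bsub>N\<^esub> e g x"])
  qed
  have negc: "(\<lambda>x\<in>carrier M. \<ominus>\<^bsub>N\<^esub> u x) \<in> carrier (ghom R M N)"
    if u: "u \<in> carrier (ghom R M N)" for u
  proof -
    obtain F c where F: "finite F" "\<forall>g. c g \<in> gr_hom R M (shift N g)"
      "\<forall>F'. finite F' \<and> F \<subseteq> F' \<longrightarrow> (\<forall>x\<in>carrier M. u x = (\<Oplus>\<^bsub>N\<^esub>g\<in>F'. c g x))"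
      using rep[OF u] by blast
    have cl: "c g x \<in> carrier N" if "x \<in> carrier M" for g x
      using gr_hom_closed[OF F(2)[rule_format] that] by (auto simp: shift_def)
    have "\<ominus>\<^bsub>N\<^esub> u x = (\<Oplus>\<^bsub>N\<^esub>g\<in>F. (\<lambda>x\<in>carrier M. \<ominus>\<^bsub>N\<^esub> c g x) x)" if x: "x \<in> carrier M" for x
    proof -
      have "(\<Oplus>\<^bsub>N\<^esub>g\<in>F. c g x) \<oplus>\<^bsub>N\<^esub> (\<Oplus>\<^bsub>N\<^esub>g\<in>F. \<ominus>\<^bsub>N\<^esub> c g x) = (\<Oplus>\<^bsub>N\<^esub>g\<in>F. \<zero>\<^bsub>N\<^esub>)"
        using cl x by (subst N.finsum_addf[symmetric]) (auto simp: N.r_neg)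
      moreover have "u x = (\<Oplus>\<^bsub>N\<^esub>g\<in>F. c g x)" using F x by blast
      ultimately show ?thesis using cl x
        by (simp add: Pi_iff N.add.inv_equality N.a_comm)
    qed
    then show ?thesis using F neg
      by (auto simp: ghom_def intro!: exI[of _ F] exI[of _ "\<lambda>g. \<lambda>x\<in>carrier M. \<ominus>\<^bsub>N\<^esub> c g x"])
  qed
  note cl = ghom_elem_closed[OF N]
  show ag: "abelian_group (ghom R M N)"
  proof (rule abelian_groupI)
    fix u assume u: "u \<in> carrier (ghom R M N)"
    show "\<zero>\<^bsub>ghom R M N\<^esub> \<oplus>\<^bsub>ghom R M N\<^esub> u = u"
      using cl[OF u] ext[OF u] by (auto simp: ghom_def extensional_def restrict_def fun_eq_iff)
    show "\<exists>y\<in>carrier (ghom R M N). y \<oplus>\<^bsub>ghom R M N\<^esub> u = \<zero>\<^bsub>ghom R M N\<^esub>"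
      using cl[OF u] by (intro bexI[OF _ negc[OF u]]) (auto simp: ghom_def restrict_def N.l_neg)
    fix v assume v: "v \<in> carrier (ghom R M N)"
    show "u \<oplus>\<^bsub>ghom R M N\<^esub> v \<in> carrier (ghom R M N)" using addc[OF u v] by (simp add: ghom_def)
    show "u \<oplus>\<^bsub>ghom R M N\<^esub> v = v \<oplus>\<^bsub>ghom R M N\<^esub> u"
      using cl[OF u] cl[OF v] by (auto simp: ghom_def restrict_def N.a_comm)
    fix w assume w: "w \<in> carrier (ghom R M N)"
    show "u \<oplus>\<^bsub>ghom R M N\<^esub> v \<oplus>\<^bsub>ghom R M N\<^esub> w = u \<oplus>\<^bsub>ghom R M N\<^esub> (v \<oplus>\<^bsub>ghom R M N\<^esub> w)"
      using cl[OF u] cl[OF v] cl[OF w] by (auto simp: ghom_def restrict_def N.a_assoc)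
  next
    show "\<zero>\<^bsub>ghom R M N\<^esub> \<in> carrier (ghom R M N)" using z sub by (auto simp: ghom_def)
  qed
  interpret G: abelian_group "ghom R M N" by (rule ag)
  show "additive_subgroup (gr_hom R M (shift N g)) (ghom R M N)" for g
  proof (rule additive_subgroup.intro, rule G.add.subgroupI)
    show "gr_hom R M (shift N g) \<subseteq> carrier (ghom R M N)" by (rule sub)
    show "gr_hom R M (shift N g) \<noteq> {}" using z by auto
  next
    fix u assume u: "u \<in> gr_hom R M (shift N g)"
    have "(\<lambda>x\<in>carrier M. \<ominus>\<^bsub>N\<^esub> u x) \<oplus>\<^bsub>ghom R M N\<^esub> u = \<zero>\<^bsub>ghom R M N\<^esub>"
      using cl[OF subsetD[OF sub u]] by (auto simp: ghom_def restrict_def N.l_neg)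
    then have "\<ominus>\<^bsub>ghom R M N\<^esub> u = (\<lambda>x\<in>carrier M. \<ominus>\<^bsub>N\<^esub> u x)"
      using negc subsetD[OF sub u] by (intro G.add.inv_equality) auto
    then show "\<ominus>\<^bsub>ghom R M N\<^esub> u \<in> gr_hom R M (shift N g)"
      using neg[OF u] by simp
  next
    fix u v assume "u \<in> gr_hom R M (shift N g)" "v \<in> gr_hom R M (shift N g)"
    then show "u \<oplus>\<^bsub>ghom R M N\<^esub> v \<in> gr_hom R M (shift N g)"
      using add by (simp add: ghom_def)
  qed
qed

lemma finsum_ghom:
  assumes M: "graded_module R M" and N: "graded_module R N"
    and "c \<in> F \<rightarrow> carrier (ghom R M N)" "x \<in> carrier M" "finite F"
  shows "finsum (ghom R M N) c F x = (\<Oplus>\<^bsub>N\<^esub>g\<in>F. c g x)"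
proof -
  interpret N: module R N using N by (simp add: graded_module_def)
  interpret G: abelian_group "ghom R M N" by (rule ghom_abelian_group[OF M N])
  show ?thesis using \<open>finite F\<close> \<open>c \<in> _\<close>
  proof (induction F)
    case empty then show ?case using assms(4) by simp (simp add: ghom_def)
  next
    case (insert g F)
    have "(\<lambda>g. c g x) \<in> insert g F \<rightarrow> carrier N"
      using insert.prems ghom_elem_closed[OF N _ assms(4)] by auto
    then show ?case using insert assms(4) by (simp add: Pi_iff) (simp add: ghom_def)
  qed
qed

lemma ghom_grading:
  assumes M: "graded_module R M" and N: "graded_module R N"
  shows "grading (ghom R M N) (\<lambda>g. gr_hom R M (shift N g))"
proof -
  interpret N: module R N using N by (simp add: graded_module_def)
  interpret M: module R M using M by (simp add: graded_module_def)
  interpret G: abelian_group "ghom R M N" by (rule ghom_abelian_group[OF M N])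
  note sub = ghom_abelian_group(3)[OF M N]
  let ?z = "\<zero>\<^bsub>ghom R M N\<^esub>"
  let ?dec = "\<lambda>u c. (\<forall>g. c g \<in> gr_hom R M (shift N g)) \<and> finite {g. c g \<noteq> ?z} \<and>
      u = finsum (ghom R M N) c {g. c g \<noteq> ?z}"
  have zx: "?z x = \<zero>\<^bsub>N\<^esub>" if "x \<in> carrier M" for x using that by (simp add: ghom_def)
  have hsg: "additive_subgroup (gr_hom R M (shift N g)) (ghom R M N)" for g
    by (rule ghom_abelian_group(2)[OF M N])
  have zg: "?z \<in> gr_hom R M (shift N g)" for g
    using additive_subgroup.zero_closed[OF hsg] .
  have ext: "c \<in> extensional (carrier M)" if "c \<in> gr_hom R M (shift N g)" for c g
    using that by (simp add: gr_hom_def PiE_iff)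
  have Mk: "mgrade M k \<subseteq> carrier M" for k
    using M by (auto simp: graded_module_def grading_def dest: additive_subgroup.a_Hcarr)
  have exist: "\<exists>c. ?dec u c" if u: "u \<in> carrier (ghom R M N)" for u
  proof -
    obtain F c where F: "finite F" and c: "\<forall>g\<in>F. c g \<in> gr_hom R M (shift N g)"
      and ux: "\<forall>x\<in>carrier M. u x = (\<Oplus>\<^bsub>N\<^esub>g\<in>F. c g x)" and ue: "u \<in> extensional (carrier M)"
      using u by (auto simp: ghom_def)
    let ?c = "\<lambda>g. if g \<in> F then c g else ?z"
    have cg: "?c g \<in> gr_hom R M (shift N g)" for g using c zg by simp
    have cF: "c \<in> F \<rightarrow> carrier (ghom R M N)" using c sub by blast
    have "u x = finsum (ghom R M N) c F x" for x
    proof (cases "x \<in> carrier M")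
      case True then show ?thesis using ux finsum_ghom[OF M N cF True F] by simp
    next
      case False
      have "finsum (ghom R M N) c F \<in> extensional (carrier M)"
        using G.finsum_closed[OF cF] by (simp add: ghom_def)
      then show ?thesis using ue False by (simp add: extensional_def)
    qed
    then have "u = finsum (ghom R M N) c F" by auto
    also have "\<dots> = finsum (ghom R M N) ?c {g. ?c g \<noteq> ?z}"
      using F cF by (intro G.add.finprod_mono_neutral_cong_right[symmetric, THEN sym]) (auto)
    finally show ?thesis using cg F
      by (intro exI[of _ ?c]) auto
  qed
  have component: "c g x = c' g x"
    if d: "?dec u c" and d': "?dec u c'" and x: "x \<in> mgrade M k" for u c c' g k x
  proof -
    have xc: "x \<in> carrier M" using x Mk by blast
    let ?y = "\<lambda>c j. c (j - k) x"
    have main: "(\<forall>j. ?y c j \<in> mgrade N j) \<and> finite {j. ?y c j \<noteq> \<zero>\<^bsub>N\<^esub>} \<and>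
        u x = finsum N (?y c) {j. ?y c j \<noteq> \<zero>\<^bsub>N\<^esub>}"
      if d: "?dec u c" for c
    proof -
      let ?F = "{g. c g \<noteq> ?z}"
      have hg: "c g \<in> gr_hom R M (shift N g)" for g using d by blast
      have cl: "c g x \<in> carrier N" for g using gr_hom_closed[OF hg xc] by (simp add: shift_def)
      have 1: "?y c j \<in> mgrade N j" for j
      proof -
        have "c (j - k) x \<in> mgrade N (j - k + k)"
          by (rule gr_hom_degree[OF hg x])
        then show ?thesis by simp
      qed
      have sup: "{j. ?y c j \<noteq> \<zero>\<^bsub>N\<^esub>} \<subseteq> (\<lambda>g. g + k) ` ?F"
      proof
        fix j assume "j \<in> {j. ?y c j \<noteq> \<zero>\<^bsub>N\<^esub>}"
        then have "j - k \<in> ?F" using zx[OF xc] by auto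
        then show "j \<in> (\<lambda>g. g + k) ` ?F" by (intro image_eqI[of _ _ "j - k"]) auto
      qed
      have fin: "finite ((\<lambda>g. g + k) ` ?F)" using d by blast
      have "u = finsum (ghom R M N) c ?F" using d by blast
      then have "u x = (\<Oplus>\<^bsub>N\<^esub>g\<in>?F. c g x)"
        using finsum_ghom[OF M N _ xc, of c ?F] d sub by blast
      also have "\<dots> = (\<Oplus>\<^bsub>N\<^esub>g\<in>?F. ?y c (g + k))" by simp
      also have "\<dots> = finsum N (?y c) ((\<lambda>g. g + k) ` ?F)"
        using cl by (intro N.add.finprod_reindex[symmetric]) (auto simp: inj_on_def)
      also have "\<dots> = finsum N (?y c) {j. ?y c j \<noteq> \<zero>\<^bsub>N\<^esub>}"
        using fin sup cl by (intro N.add.finprod_mono_neutral_cong_right) auto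
      finally show ?thesis using 1 finite_subset[OF sup fin] by blast
    qed
    have "u x \<in> carrier N"
      using main[OF d] N
      by (metis (no_types, lifting) N.finsum_closed Pi_I additive_subgroup.a_Hcarr graded_module_def grading_def)
    then have "\<exists>!y. (\<forall>j. y j \<in> mgrade N j) \<and> finite {j. y j \<noteq> \<zero>\<^bsub>N\<^esub>} \<and>
        u x = finsum N y {j. y j \<noteq> \<zero>\<^bsub>N\<^esub>}"
      using N by (simp add: graded_module_def grading_def)
    then have "?y c = ?y c'" by (rule ex1_eq) (rule main[OF d], rule main[OF d'])
    then have "?y c (g + k) = ?y c' (g + k)" by (rule fun_cong)
    then show ?thesis by simp
  qed
  have unique: "c = c'" if d: "?dec u c" and d': "?dec u c'" for u c c'
  proof (rule HOL.ext, rule HOL.ext)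
    fix g x
    have hg: "c g \<in> gr_hom R M (shift N g)" "c' g \<in> gr_hom R M (shift N g)" for g
      using d d' by blast+
    show "c g x = c' g x"
    proof (cases "x \<in> carrier M")
      case False
      then show ?thesis using ext[OF hg(1)] ext[OF hg(2)] by (simp add: extensional_def)
    next
      case True
      then obtain y where y: "\<forall>k. y k \<in> mgrade M k" "finite {k. y k \<noteq> \<zero>\<^bsub>M\<^esub>}"
        "x = finsum M y {k. y k \<noteq> \<zero>\<^bsub>M\<^esub>}"
        using M unfolding graded_module_def grading_def by blast
      have yc: "y k \<in> carrier M" for k using y(1) Mk by blast
      have "c g (finsum M y F) = c' g (finsum M y F)" if "finite F" for F
        using that
      proof induction
        case empty
        have "\<zero>\<^bsub>M\<^esub> \<in> mgrade M 0"
          using M by (simp add: graded_module_def grading_def additive_subgroup.zero_closed)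
        then show ?case using component[OF d d'] by simp
      next
        case (insert k F)
        have add: "v (y k \<oplus>\<^bsub>M\<^esub> finsum M y F) = v (y k) \<oplus>\<^bsub>N\<^esub> v (finsum M y F)"
          if "v \<in> gr_hom R M (shift N g)" for v
          using that yc by (simp add: gr_hom_def shift_def)
        show ?case using insert add[OF hg(1)] add[OF hg(2)] component[OF d d' y(1)[rule_format]] yc
          by simp
      qed
      then show ?thesis using y by simp
    qed
  qed
  show ?thesis
    unfolding grading_def
    by (intro conjI allI ballI ex_ex1I) (rule hsg, erule exist, erule (1) unique)
qed


lemma ghom_graded_module:
  assumes R: "graded_cring R" and M: "graded_module R M" and N: "graded_module R N"
  shows "graded_module R (ghom R M N)"
proof -
  interpret N: module R N using N by (simp add: graded_module_def)
  interpret M: module R M using M by (simp add: graded_module_def)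
  interpret G: abelian_group "ghom R M N" by (rule ghom_abelian_group[OF M N])
  note sub = ghom_abelian_group(3)[OF M N]
  note cl = ghom_elem_closed[OF N]
  have Rk: "rgrade R k \<subseteq> carrier R" for k
    using R by (auto simp: graded_cring_def grading_def dest: additive_subgroup.a_Hcarr)
  have Mk: "mgrade M k \<subseteq> carrier M" for k
    using M by (auto simp: graded_module_def grading_def dest: additive_subgroup.a_Hcarr)
  have hom: "(\<lambda>x\<in>carrier M. r \<odot>\<^bsub>N\<^esub> u x) \<in> gr_hom R M (shift N (k + g))"
    if r: "r \<in> rgrade R k" and u: "u \<in> gr_hom R M (shift N g)" for r u k g
  proof -
    have rc: "r \<in> carrier R" using r Rk by blast
    have uc: "u x \<in> carrier N" if "x \<in> carrier M" for x
      using that u by (auto simp: gr_hom_def shift_def)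
    have "r \<odot>\<^bsub>N\<^esub> u x \<in> mgrade N (k + g + j)" if "x \<in> mgrade M j" for x j
      using that u r N by (auto simp: gr_hom_def shift_def image_subset_iff graded_module_def add.assoc)
    then show ?thesis
      using rc uc u
      by (auto dest: subsetD[OF Mk] simp: gr_hom_def shift_def N.smult_r_distr N.smult_assoc1[symmetric] N.m_comm)
  qed
  have split: "\<exists>F c. finite F \<and> (\<forall>k. c k \<in> rgrade R k) \<and> r = finsum R c F"
    if "r \<in> carrier R" for r
    using that R unfolding graded_cring_def grading_def by blast
  have hsm: "(\<lambda>x\<in>carrier M. r \<odot>\<^bsub>N\<^esub> u x) \<in> carrier (ghom R M N)"
    if r: "r \<in> carrier R" and u: "u \<in> gr_hom R M (shift N g)" for r u g
  proof -
    obtain F c where F: "finite F" and c: "\<forall>k. c k \<in> rgrade R k" and rs: "r = finsum R c F"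
      using split[OF r] by blast
    have cR: "c k \<in> carrier R" for k using c Rk by blast
    have uc: "u x \<in> carrier N" if "x \<in> carrier M" for x
      using that u by (auto simp: gr_hom_def shift_def)
    have "(\<lambda>x\<in>carrier M. finsum R c F \<odot>\<^bsub>N\<^esub> u x) \<in> carrier (ghom R M N)"
      using F
    proof induction
      case empty
      have "(\<lambda>x\<in>carrier M. finsum R c {} \<odot>\<^bsub>N\<^esub> u x) = \<zero>\<^bsub>ghom R M N\<^esub>"
        using uc by (auto simp: ghom_def restrict_def)
      then show ?case by simp
    next
      case (insert k F)
      have "(\<lambda>x\<in>carrier M. finsum R c (insert k F) \<odot>\<^bsub>N\<^esub> u x) =
        (\<lambda>x\<in>carrier M. c k \<odot>\<^bsub>N\<^esub> u x) \<oplus>\<^bsub>ghom R M N\<^esub> (\<lambda>x\<in>carrier M. finsum R c F \<odot>\<^bsub>N\<^esub> u x)"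
        using insert(1,2) uc cR by (auto simp: ghom_def restrict_def N.smult_l_distr)
      then show ?case
        using G.a_closed[OF subsetD[OF sub hom[OF c[rule_format] u]] insert.IH] by (simp only:)
    qed
    then show ?thesis by (simp add: rs)
  qed
  have sm: "(\<lambda>x\<in>carrier M. r \<odot>\<^bsub>N\<^esub> u x) \<in> carrier (ghom R M N)"
    if r: "r \<in> carrier R" and u: "u \<in> carrier (ghom R M N)" for r u
  proof -
    obtain c where c: "\<forall>g. c g \<in> gr_hom R M (shift N g)" "finite {g. c g \<noteq> \<zero>\<^bsub>ghom R M N\<^esub>}"
      "u = finsum (ghom R M N) c {g. c g \<noteq> \<zero>\<^bsub>ghom R M N\<^esub>}"
      using ghom_grading[OF M N] u unfolding grading_def by blast
    have cc: "c g \<in> carrier (ghom R M N)" for g using c(1) sub by blast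
    have "(\<lambda>x\<in>carrier M. r \<odot>\<^bsub>N\<^esub> finsum (ghom R M N) c F x) \<in> carrier (ghom R M N)"
      if "finite F" for F
      using that
    proof induction
      case empty
      have "(\<lambda>x\<in>carrier M. r \<odot>\<^bsub>N\<^esub> finsum (ghom R M N) c {} x) = \<zero>\<^bsub>ghom R M N\<^esub>"
        using r by simp (auto simp: ghom_def restrict_def)
      then show ?case by simp
    next
      case (insert k F)
      have Fc: "finsum (ghom R M N) c F \<in> carrier (ghom R M N)" using cc by simp
      have "(\<lambda>x\<in>carrier M. r \<odot>\<^bsub>N\<^esub> (c k \<oplus>\<^bsub>ghom R M N\<^esub> finsum (ghom R M N) c F) x) =
        (\<lambda>x\<in>carrier M. r \<odot>\<^bsub>N\<^esub> c k x) \<oplus>\<^bsub>ghom R M N\<^esub>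
        (\<lambda>x\<in>carrier M. r \<odot>\<^bsub>N\<^esub> finsum (ghom R M N) c F x)"
        unfolding ghom_def[THEN arg_cong[of _ _ add]]
        using cl[OF cc] cl[OF Fc] r by (auto simp: restrict_def N.smult_r_distr)
      moreover have "finsum (ghom R M N) c (insert k F) = c k \<oplus>\<^bsub>ghom R M N\<^esub> finsum (ghom R M N) c F"
        using insert(1,2) cc by simp
      ultimately show ?case
        using G.a_closed[OF hsm[OF r c(1)[rule_format]] insert.IH] by (simp only:)
    qed
    then show ?thesis using c(2,3) by simp
  qed
  have smc: "r \<odot>\<^bsub>ghom R M N\<^esub> u = (\<lambda>x\<in>carrier M. r \<odot>\<^bsub>N\<^esub> u x)" for r u by (simp add: ghom_def)
  have adc: "u \<oplus>\<^bsub>ghom R M N\<^esub> v = (\<lambda>x\<in>carrier M. u x \<oplus>\<^bsub>N\<^esub> v x)" for u v by (simp add: ghom_def)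
  have "module R (ghom R M N)"
  proof (rule moduleI)
    show "cring R" using R by (simp add: graded_cring_def)
    show "abelian_group (ghom R M N)" by (rule G.abelian_group_axioms)
    fix r u assume r: "r \<in> carrier R" and u: "u \<in> carrier (ghom R M N)"
    show "r \<odot>\<^bsub>ghom R M N\<^esub> u \<in> carrier (ghom R M N)" using sm[OF r u] by (simp add: smc)
    show "r \<odot>\<^bsub>ghom R M N\<^esub> (u \<oplus>\<^bsub>ghom R M N\<^esub> v) = r \<odot>\<^bsub>ghom R M N\<^esub> u \<oplus>\<^bsub>ghom R M N\<^esub> r \<odot>\<^bsub>ghom R M N\<^esub> v"
      if v: "v \<in> carrier (ghom R M N)" for v
      using r cl[OF u] cl[OF v] by (auto simp: smc adc N.smult_r_distr)
    fix s assume s: "s \<in> carrier R"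
    show "(r \<oplus>\<^bsub>R\<^esub> s) \<odot>\<^bsub>ghom R M N\<^esub> u = r \<odot>\<^bsub>ghom R M N\<^esub> u \<oplus>\<^bsub>ghom R M N\<^esub> s \<odot>\<^bsub>ghom R M N\<^esub> u"
      using r s cl[OF u] by (auto simp: smc adc N.smult_l_distr)
    show "(r \<otimes>\<^bsub>R\<^esub> s) \<odot>\<^bsub>ghom R M N\<^esub> u = r \<odot>\<^bsub>ghom R M N\<^esub> (s \<odot>\<^bsub>ghom R M N\<^esub> u)"
      using r s cl[OF u] by (auto simp: smc N.smult_assoc1)
  next
    fix u assume u: "u \<in> carrier (ghom R M N)"
    then have "u \<in> extensional (carrier M)" by (simp add: ghom_def)
    then show "\<one>\<^bsub>R\<^esub> \<odot>\<^bsub>ghom R M N\<^esub> u = u"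
      using cl[OF u] by (auto simp: smc restrict_def extensional_def)
  qed
  then show ?thesis
    using ghom_grading[OF M N] hom by (simp add: graded_module_def ghom_def)
qed


section \<open>Direct limits over the natural numbers\<close>

text \<open>For a system \<open>t n : A n \<rightarrow> A (n + 1)\<close>, the map \<open>A n \<rightarrow> A m\<close> is \<open>fold t [n..<m]\<close>.\<close>

definition dl_class ::
    "(nat \<Rightarrow> ('r, 'm, 'g) gmod) \<Rightarrow> (nat \<Rightarrow> 'm \<Rightarrow> 'm) \<Rightarrow> nat \<Rightarrow> 'm \<Rightarrow> (nat \<times> 'm) set" where
  "dl_class A t n x = {(m, y). y \<in> carrier (A m) \<and>
     (\<exists>k\<ge>max n m. fold t [n..<k] x = fold t [m..<k] y)}"

definition dirlim ::
    "(nat \<Rightarrow> ('r, 'm, 'g) gmod) \<Rightarrow> (nat \<Rightarrow> 'm \<Rightarrow> 'm) \<Rightarrow> ('r, (nat \<times> 'm) set, 'g) gmod" where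
  "dirlim A t = \<lparr>
     carrier = {dl_class A t n x | n x. x \<in> carrier (A n)},
     mult = undefined, one = undefined,
     zero = dl_class A t 0 \<zero>\<^bsub>A 0\<^esub>,
     add = (\<lambda>X Y. \<Union>(n, x)\<in>X. \<Union>(m, y)\<in>Y. dl_class A t (max n m)
        (fold t [n..<max n m] x \<oplus>\<^bsub>A (max n m)\<^esub> fold t [m..<max n m] y)),
     smult = (\<lambda>r X. \<Union>(n, x)\<in>X. dl_class A t n (r \<odot>\<^bsub>A n\<^esub> x)),
     mgrade = (\<lambda>g. {dl_class A t n x | n x. x \<in> mgrade (A n) g})\<rparr>"

definition dl_map ::
    "(nat \<Rightarrow> ('r, 'm, 'g) gmod) \<Rightarrow> (nat \<Rightarrow> 'm \<Rightarrow> 'm) \<Rightarrow>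
     (nat \<Rightarrow> ('s, 'n, 'h) gmod) \<Rightarrow> (nat \<Rightarrow> 'n \<Rightarrow> 'n) \<Rightarrow>
     (nat \<Rightarrow> 'm \<Rightarrow> 'n) \<Rightarrow> (nat \<times> 'm) set \<Rightarrow> (nat \<times> 'n) set" where
  "dl_map A t B s \<phi> = (\<lambda>X\<in>carrier (dirlim A t). \<Union>(n, x)\<in>X. dl_class B s n (\<phi> n x))"


section \<open>Coarsening\<close>

definition coarse_grade ::
    "('a, 'm) ring_scheme \<Rightarrow> ('g \<Rightarrow> 'h) \<Rightarrow> ('g \<Rightarrow> 'a set) \<Rightarrow> 'h \<Rightarrow> 'a set" where
  "coarse_grade A \<psi> D h = {finsum A c F | c F. finite F \<and> F \<subseteq> \<psi> -` {h} \<and> (\<forall>g\<in>F. c g \<in> D g)}"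

definition coarsen_ring :: "('g \<Rightarrow> 'h) \<Rightarrow> ('r, 'g) gring \<Rightarrow> ('r, 'h) gring" where
  "coarsen_ring \<psi> R = \<lparr>carrier = carrier R, mult = mult R, one = \<one>\<^bsub>R\<^esub>, zero = \<zero>\<^bsub>R\<^esub>, add = add R,
     rgrade = coarse_grade R \<psi> (rgrade R)\<rparr>"

text \<open>On morphisms the coarsening functor does not change the underlying map.\<close>

definition coarsen :: "('g \<Rightarrow> 'h) \<Rightarrow> ('r, 'm, 'g) gmod \<Rightarrow> ('r, 'm, 'h) gmod" where
  "coarsen \<psi> M = \<lparr>carrier = carrier M, mult = mult M, one = \<one>\<^bsub>M\<^esub>, zero = \<zero>\<^bsub>M\<^esub>, add = add M,
     smult = smult M, mgrade = coarse_grade M \<psi> (mgrade M)\<rparr>"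


section \<open>Projective resolutions\<close>

text \<open>
  \<open>GrMod(R)\<close> is the category of the graded modules with elements in a type \<open>'u\<close>, which plays
  the part of a universe. Its epimorphisms are the surjective morphisms.

  The only demand on \<open>'u\<close> is that it be infinite and at least as large as \<open>R\<close>. Then the
  free graded modules on the homogeneous elements of a module in \<open>'u\<close> have copies in \<open>'u\<close>, so
  there are enough projectives. There is no upper bound, so every module lies in such a universe.
\<close>

definition universe_for :: "'u itself \<Rightarrow> ('r, 'g) gring \<Rightarrow> bool" where
  "universe_for U R \<longleftrightarrow> (\<exists>f :: nat \<times> 'r \<Rightarrow> 'u. inj_on f (UNIV \<times> carrier R))"

definition gr_projective ::
    "('r, 'g::ab_group_add) gring \<Rightarrow> ('r, 'u, 'g) gmod \<Rightarrow> bool" where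
  "gr_projective R P \<longleftrightarrow> graded_module R P \<and>
     (\<forall>(A :: ('r, 'u, 'g) gmod) (B :: ('r, 'u, 'g) gmod) p f.
        graded_module R A \<and> graded_module R B \<and> p \<in> gr_hom R A B \<and> p ` carrier A = carrier B \<and>
        f \<in> gr_hom R P B \<longrightarrow> (\<exists>f'\<in>gr_hom R P A. \<forall>x\<in>carrier P. p (f' x) = f x))"

text \<open>
  \<open>\<dots> \<rightarrow> P 2 \<rightarrow> P 1 \<rightarrow> P 0 \<rightarrow> M \<rightarrow> 0\<close> with \<open>d i : P i \<rightarrow> P (i - 1)\<close> and augmentation
  \<open>\<epsilon> : P 0 \<rightarrow> M\<close>. The index \<open>i\<close> runs over all integers and \<open>P i = 0\<close> for \<open>i < 0\<close>. Only the
  modules \<open>P i\<close> have to lie in the universe \<open>'u\<close>.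
\<close>

record ('r, 'u, 'g, 'v) resolution =
  pr :: "int \<Rightarrow> ('r, 'u, 'g) gmod"
  df :: "int \<Rightarrow> 'u \<Rightarrow> 'u"
  aug :: "'u \<Rightarrow> 'v"

definition projective_resolution ::
    "('r, 'g::ab_group_add) gring \<Rightarrow> ('r, 'v, 'g) gmod \<Rightarrow> ('r, 'u, 'g, 'v) resolution \<Rightarrow> bool" where
  "projective_resolution R M P \<longleftrightarrow>
     (\<forall>i. gr_projective R (pr P i)) \<and>
     (\<forall>i<0. carrier (pr P i) = {\<zero>\<^bsub>pr P i\<^esub>}) \<and>
     (\<forall>i. df P i \<in> gr_hom R (pr P i) (pr P (i - 1))) \<and>
     aug P \<in> gr_hom R (pr P 0) M \<and>
     aug P ` carrier (pr P 0) = carrier M \<and>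
     df P 1 ` carrier (pr P 1) = a_kernel (pr P 0) M (aug P) \<and>
     (\<forall>i\<ge>1. df P (i + 1) ` carrier (pr P (i + 1)) = a_kernel (pr P i) (pr P (i - 1)) (df P i))"

definition resolution_of ::
    "('r, 'g::ab_group_add) gring \<Rightarrow> ('r, 'v, 'g) gmod \<Rightarrow> ('r, 'u, 'g, 'v) resolution" where
  "resolution_of R M = (SOME P. projective_resolution R M P)"

definition chain_lift ::
    "('r, 'g::ab_group_add) gring \<Rightarrow> ('r, 'v, 'g) gmod \<Rightarrow> ('r, 'w, 'g) gmod \<Rightarrow>
     ('r, 'u, 'g, 'v) resolution \<Rightarrow> ('r, 'u, 'g, 'w) resolution \<Rightarrow> ('v \<Rightarrow> 'w) \<Rightarrow> int \<Rightarrow> 'u \<Rightarrow> 'u" where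
  "chain_lift R M M' P P' f = (SOME \<phi>.
     (\<forall>i. \<phi> i \<in> gr_hom R (pr P i) (pr P' i)) \<and>
     (\<forall>i. \<forall>x\<in>carrier (pr P i). \<phi> (i - 1) (df P i x) = df P' i (\<phi> i x)) \<and>
     (\<forall>x\<in>carrier (pr P 0). f (aug P x) = aug P' (\<phi> 0 x)))"


section \<open>Graded Ext\<close>

text \<open>
  Cohomology of the complex \<open>i \<mapsto> ghom R (P i) N\<close> with differential \<open>u \<mapsto> u \<circ> d\<close>, without
  signs.
\<close>

definition cocycles ::
    "('r, 'g::ab_group_add) gring \<Rightarrow> ('r, 'u, 'g, 'v) resolution \<Rightarrow> ('r, 'n, 'g) gmod \<Rightarrow> int \<Rightarrow>
     ('u \<Rightarrow> 'n) set" where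
  "cocycles R P N i = {u \<in> carrier (ghom R (pr P i) N).
     \<forall>x\<in>carrier (pr P (i + 1)). u (df P (i + 1) x) = \<zero>\<^bsub>N\<^esub>}"

definition coboundaries ::
    "('r, 'g::ab_group_add) gring \<Rightarrow> ('r, 'u, 'g, 'v) resolution \<Rightarrow> ('r, 'n, 'g) gmod \<Rightarrow> int \<Rightarrow>
     ('u \<Rightarrow> 'n) set" where
  "coboundaries R P N i =
     {compose (carrier (pr P i)) v (df P i) | v. v \<in> carrier (ghom R (pr P (i - 1)) N)}"

definition ext_of ::
    "('r, 'g::ab_group_add) gring \<Rightarrow> ('r, 'u, 'g, 'v) resolution \<Rightarrow> int \<Rightarrow> ('r, 'n, 'g) gmod \<Rightarrow>
     ('r, ('u \<Rightarrow> 'n) set, 'g) gmod" where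
  "ext_of R P i N =
     quotmod (submod (ghom R (pr P i) N) (cocycles R P N i)) (coboundaries R P N i)"

definition ext ::
    "('r, 'g::ab_group_add) gring \<Rightarrow> int \<Rightarrow> ('r, 'v, 'g) gmod \<Rightarrow> ('r, 'u, 'g) gmod \<Rightarrow>
     ('r, ('u \<Rightarrow> 'u) set, 'g) gmod" where
  "ext R i M N = ext_of R (resolution_of R M) i N"

text \<open>\<open>Ext(f, N) : Ext(M', N) \<rightarrow> Ext(M, N)\<close> for \<open>f : M \<rightarrow> M'\<close>.\<close>

definition ext_map1 ::
    "('r, 'g::ab_group_add) gring \<Rightarrow> int \<Rightarrow> ('r, 'v, 'g) gmod \<Rightarrow> ('r, 'w, 'g) gmod \<Rightarrow> ('v \<Rightarrow> 'w) \<Rightarrow>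
     ('r, 'u, 'g) gmod \<Rightarrow> ('u \<Rightarrow> 'u) set \<Rightarrow> ('u \<Rightarrow> 'u) set" where
  "ext_map1 R i M M' f N =
     (let P = (resolution_of R M :: ('r, 'u, 'g, 'v) resolution);
          P' = (resolution_of R M' :: ('r, 'u, 'g, 'w) resolution)
      in induced (ext R i M' N) (ghom R (pr P i) N) (coboundaries R P N i)
           (\<lambda>u. compose (carrier (pr P i)) u (chain_lift R M M' P P' f i)))"

text \<open>\<open>Ext(M, f) : Ext(M, N) \<rightarrow> Ext(M, N')\<close> for \<open>f : N \<rightarrow> N'\<close>.\<close>

definition ext_map2 ::
    "('r, 'g::ab_group_add) gring \<Rightarrow> int \<Rightarrow> ('r, 'v, 'g) gmod \<Rightarrow> ('r, 'u, 'g) gmod \<Rightarrow>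
     ('r, 'u, 'g) gmod \<Rightarrow> ('u \<Rightarrow> 'u) \<Rightarrow> ('u \<Rightarrow> 'u) set \<Rightarrow> ('u \<Rightarrow> 'u) set" where
  "ext_map2 R i M N N' f =
     (let P = (resolution_of R M :: ('r, 'u, 'g, 'v) resolution)
      in induced (ext R i M N) (ghom R (pr P i) N') (coboundaries R P N' i)
           (\<lambda>u. compose (carrier (pr P i)) f u))"

text \<open>
  The connecting map \<open>Ext\<^sup>i(M, C) \<rightarrow> Ext\<^sup>i\<^sup>+\<^sup>1(M, A)\<close> of an exact sequence
  \<open>0 \<rightarrow> A \<rightarrow> B \<rightarrow> C \<rightarrow> 0\<close> with maps \<open>\<alpha>\<close>, \<open>\<beta>\<close>, given by the snake lemma: lift a cocycle
  \<open>w : P i \<rightarrow> C\<close> to \<open>v : P i \<rightarrow> B\<close>, then factor \<open>v \<circ> d\<close> as \<open>\<alpha> \<circ> u\<close>. The class of \<open>u\<close> does not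
  depend on these choices, so the union has just one member.
\<close>

definition ext_conn ::
    "('r, 'g::ab_group_add) gring \<Rightarrow> int \<Rightarrow> ('r, 'v, 'g) gmod \<Rightarrow> ('r, 'u, 'g) gmod \<Rightarrow> ('u \<Rightarrow> 'u) \<Rightarrow>
     ('r, 'u, 'g) gmod \<Rightarrow> ('u \<Rightarrow> 'u) \<Rightarrow> ('r, 'u, 'g) gmod \<Rightarrow> ('u \<Rightarrow> 'u) set \<Rightarrow> ('u \<Rightarrow> 'u) set" where
  "ext_conn R i M A \<alpha> B \<beta> C =
     (let P = (resolution_of R M :: ('r, 'u, 'g, 'v) resolution)
      in (\<lambda>X\<in>carrier (ext R i M C). \<Union> {coboundaries R P A (i + 1) +>\<^bsub>ghom R (pr P (i + 1)) A\<^esub> u | u v w.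
           w \<in> X \<and> v \<in> carrier (ghom R (pr P i) B) \<and> u \<in> carrier (ghom R (pr P (i + 1)) A) \<and>
           (\<forall>x\<in>carrier (pr P i). \<beta> (v x) = w x) \<and>
           (\<forall>x\<in>carrier (pr P (i + 1)). \<alpha> (u x) = v (df P (i + 1) x))}))"


section \<open>Delta-functors\<close>

definition short_exact ::
    "('r, 'g::ab_group_add) gring \<Rightarrow> ('r, 'u, 'g) gmod \<Rightarrow> ('u \<Rightarrow> 'u) \<Rightarrow> ('r, 'u, 'g) gmod \<Rightarrow>
     ('u \<Rightarrow> 'u) \<Rightarrow> ('r, 'u, 'g) gmod \<Rightarrow> bool" where
  "short_exact R A \<alpha> B \<beta> C \<longleftrightarrow>
     graded_module R A \<and> graded_module R B \<and> graded_module R C \<and>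
     \<alpha> \<in> gr_hom R A B \<and> \<beta> \<in> gr_hom R B C \<and> inj_on \<alpha> (carrier A) \<and>
     \<alpha> ` carrier A = a_kernel B C \<beta> \<and> \<beta> ` carrier B = carrier C"

text \<open>
  The data of a \<open>\<delta>\<close>-functor from \<open>'g\<close>-graded modules with elements in \<open>'u\<close> to \<open>'h\<close>-graded
  modules with elements in \<open>'w\<close>. The arguments of \<open>mor\<close> are the degree, the source, the target
  and the morphism; those of \<open>conn\<close> are the degree and a short exact sequence.
\<close>

record ('r, 'u, 'g, 'w, 'h) delta =
  obj :: "int \<Rightarrow> ('r, 'u, 'g) gmod \<Rightarrow> ('r, 'w, 'h) gmod"
  mor :: "int \<Rightarrow> ('r, 'u, 'g) gmod \<Rightarrow> ('r, 'u, 'g) gmod \<Rightarrow> ('u \<Rightarrow> 'u) \<Rightarrow> 'w \<Rightarrow> 'w"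
  conn :: "int \<Rightarrow> ('r, 'u, 'g) gmod \<Rightarrow> ('u \<Rightarrow> 'u) \<Rightarrow> ('r, 'u, 'g) gmod \<Rightarrow> ('u \<Rightarrow> 'u) \<Rightarrow>
     ('r, 'u, 'g) gmod \<Rightarrow> 'w \<Rightarrow> 'w"

text \<open>
  \<open>R\<close> is the ring of the source category and \<open>S\<close> that of the target category. The last clause
  only fixes the value at arguments that are not objects, so that a morphism of
  \<open>\<delta>\<close>-functors is determined by its components.
\<close>

definition delta_morphism ::
    "('r, 'g::ab_group_add) gring \<Rightarrow> ('r, 'h::ab_group_add) gring \<Rightarrow>
     ('r, 'u, 'g, 'w, 'h) delta \<Rightarrow> ('r, 'u, 'g, 'z, 'h) delta \<Rightarrow>
     (int \<Rightarrow> ('r, 'u, 'g) gmod \<Rightarrow> 'w \<Rightarrow> 'z) \<Rightarrow> bool" where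
  "delta_morphism R S T T' \<eta> \<longleftrightarrow>
     (\<forall>i M. graded_module R M \<longrightarrow> \<eta> i M \<in> gr_hom S (obj T i M) (obj T' i M)) \<and>
     (\<forall>i M N f. graded_module R M \<and> graded_module R N \<and> f \<in> gr_hom R M N \<longrightarrow>
        (\<forall>x\<in>carrier (obj T i M). \<eta> i N (mor T i M N f x) = mor T' i M N f (\<eta> i M x))) \<and>
     (\<forall>i A \<alpha> B \<beta> C. short_exact R A \<alpha> B \<beta> C \<longrightarrow>
        (\<forall>x\<in>carrier (obj T i C).
           \<eta> (i + 1) A (conn T i A \<alpha> B \<beta> C x) = conn T' i A \<alpha> B \<beta> C (\<eta> i C x))) \<and>
     (\<forall>i M. \<not> graded_module R M \<longrightarrow> \<eta> i M = undefined)"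

definition delta_isomorphism ::
    "('r, 'g::ab_group_add) gring \<Rightarrow> ('r, 'h::ab_group_add) gring \<Rightarrow>
     ('r, 'u, 'g, 'w, 'h) delta \<Rightarrow> ('r, 'u, 'g, 'z, 'h) delta \<Rightarrow>
     (int \<Rightarrow> ('r, 'u, 'g) gmod \<Rightarrow> 'w \<Rightarrow> 'z) \<Rightarrow> bool" where
  "delta_isomorphism R S T T' \<eta> \<longleftrightarrow> delta_morphism R S T T' \<eta> \<and>
     (\<exists>\<theta>. delta_morphism R S T' T \<theta> \<and>
        (\<forall>i M. graded_module R M \<longrightarrow>
           (\<forall>x\<in>carrier (obj T i M). \<theta> i M (\<eta> i M x) = x) \<and>
           (\<forall>y\<in>carrier (obj T' i M). \<eta> i M (\<theta> i M y) = y)))"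

text \<open>The two composites \<open>T(\<bullet>)\<^sub>[\<^sub>\<psi>\<^sub>]\<close> and \<open>T(\<bullet>\<^sub>[\<^sub>\<psi>\<^sub>])\<close> with the coarsening functor.\<close>

definition coarsen_after ::
    "('g \<Rightarrow> 'h) \<Rightarrow> ('r, 'u, 'g, 'w, 'g) delta \<Rightarrow> ('r, 'u, 'g, 'w, 'h) delta" where
  "coarsen_after \<psi> T = \<lparr>obj = (\<lambda>i M. coarsen \<psi> (obj T i M)), mor = mor T, conn = conn T\<rparr>"

definition coarsen_before ::
    "('g \<Rightarrow> 'h) \<Rightarrow> ('r, 'u, 'h, 'w, 'h) delta \<Rightarrow> ('r, 'u, 'g, 'w, 'h) delta" where
  "coarsen_before \<psi> T = \<lparr>
     obj = (\<lambda>i M. obj T i (coarsen \<psi> M)),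
     mor = (\<lambda>i M N. mor T i (coarsen \<psi> M) (coarsen \<psi> N)),
     conn = (\<lambda>i A \<alpha> B \<beta> C. conn T i (coarsen \<psi> A) \<alpha> (coarsen \<psi> B) \<beta> (coarsen \<psi> C))\<rparr>"


section \<open>Graded local cohomology\<close>

text \<open>The projective system \<open>R/a\<^sup>n\<close>, with \<open>a\<^sup>0 = R\<close>.\<close>

definition quot_pow :: "('r, 'g) gring \<Rightarrow> 'r set \<Rightarrow> nat \<Rightarrow> ('r, 'r set, 'g) gmod" where
  "quot_pow R a n = quotmod (regular R) (a [^]\<^bsub>ideals_set R\<^esub> n)"

definition quot_proj :: "('r, 'g) gring \<Rightarrow> 'r set \<Rightarrow> nat \<Rightarrow> 'r set \<Rightarrow> 'r set" where
  "quot_proj R a n =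
     induced (quot_pow R a (Suc n)) (regular R) (a [^]\<^bsub>ideals_set R\<^esub> n) (\<lambda>x. x)"

definition torsion_system ::
    "('r, 'g::ab_group_add) gring \<Rightarrow> 'r set \<Rightarrow> ('r, 'u, 'g) gmod \<Rightarrow> nat \<Rightarrow> ('r, 'r set \<Rightarrow> 'u, 'g) gmod"
    where
  "torsion_system R a M n = ghom R (quot_pow R a n) M"

definition torsion_trans ::
    "('r, 'g) gring \<Rightarrow> 'r set \<Rightarrow> nat \<Rightarrow> ('r set \<Rightarrow> 'u) \<Rightarrow> ('r set \<Rightarrow> 'u)" where
  "torsion_trans R a n u = compose (carrier (quot_pow R a (Suc n))) u (quot_proj R a n)"

definition torsion ::
    "('r, 'g::ab_group_add) gring \<Rightarrow> 'r set \<Rightarrow> ('r, 'u, 'g) gmod \<Rightarrow>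
     ('r, (nat \<times> ('r set \<Rightarrow> 'u)) set, 'g) gmod" where
  "torsion R a M = dirlim (torsion_system R a M) (torsion_trans R a)"

definition lc_system ::
    "('r, 'g::ab_group_add) gring \<Rightarrow> 'r set \<Rightarrow> int \<Rightarrow> ('r, 'u, 'g) gmod \<Rightarrow> nat \<Rightarrow>
     ('r, ('u \<Rightarrow> 'u) set, 'g) gmod" where
  "lc_system R a i M n = ext R i (quot_pow R a n) M"

definition lc_trans ::
    "('r, 'g::ab_group_add) gring \<Rightarrow> 'r set \<Rightarrow> int \<Rightarrow> ('r, 'u, 'g) gmod \<Rightarrow> nat \<Rightarrow>
     ('u \<Rightarrow> 'u) set \<Rightarrow> ('u \<Rightarrow> 'u) set" where
  "lc_trans R a i M n = ext_map1 R i (quot_pow R a (Suc n)) (quot_pow R a n) (quot_proj R a n) M"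

definition local_cohomology ::
    "('r, 'g::ab_group_add) gring \<Rightarrow> 'r set \<Rightarrow>
     ('r, 'u, 'g, (nat \<times> ('u \<Rightarrow> 'u) set) set, 'g) delta" where
  "local_cohomology R a = \<lparr>
     obj = (\<lambda>i M. dirlim (lc_system R a i M) (lc_trans R a i M)),
     mor = (\<lambda>i M N f. dl_map (lc_system R a i M) (lc_trans R a i M)
        (lc_system R a i N) (lc_trans R a i N) (\<lambda>n. ext_map2 R i (quot_pow R a n) M N f)),
     conn = (\<lambda>i A \<alpha> B \<beta> C. dl_map (lc_system R a i C) (lc_trans R a i C)
        (lc_system R a (i + 1) A) (lc_trans R a (i + 1) A)
        (\<lambda>n. ext_conn R i (quot_pow R a n) A \<alpha> B \<beta> C))\<rparr>"

text \<open>
  The canonical isomorphism from the torsion functor to local cohomology in degree \<open>0\<close>; on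
  \<open>Hom(R/a\<^sup>n, M)\<close> it sends \<open>u\<close> to the class of \<open>u \<circ> \<epsilon>\<close> in \<open>Ext\<^sup>0(R/a\<^sup>n, M)\<close>.
\<close>

definition torsion_iso ::
    "('r, 'g::ab_group_add) gring \<Rightarrow> 'r set \<Rightarrow> ('r, 'u, 'g) gmod \<Rightarrow>
     (nat \<times> ('r set \<Rightarrow> 'u)) set \<Rightarrow> (nat \<times> ('u \<Rightarrow> 'u) set) set" where
  "torsion_iso R a M = dl_map (torsion_system R a M) (torsion_trans R a)
     (lc_system R a 0 M) (lc_trans R a 0 M)
     (\<lambda>n u. let P = (resolution_of R (quot_pow R a n) :: ('r, 'u, 'g, 'r set) resolution)
        in coboundaries R P M 0 +>\<^bsub>ghom R (pr P 0) M\<^esub> compose (carrier (pr P 0)) u (aug P))"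


section \<open>The canonical morphism\<close>

text \<open>
  On \<open>Hom(M, N(g))\<close> the map \<open>h\<^sub>\<psi>(M, N)\<close> is \<open>u \<mapsto> u\<^sub>[\<^sub>\<psi>\<^sub>]\<close>, which keeps the underlying map. With
  both graded Hom modules realised as modules of maps, its additive extension is the inclusion.
\<close>

definition hom_coarsen ::
    "('r, 'g::ab_group_add) gring \<Rightarrow> ('r, 'm, 'g) gmod \<Rightarrow> ('r, 'n, 'g) gmod \<Rightarrow>
     ('m \<Rightarrow> 'n) \<Rightarrow> ('m \<Rightarrow> 'n)" where
  "hom_coarsen R M N = (\<lambda>u\<in>carrier (ghom R M N). u)"

definition torsion_coarsen ::
    "('g::ab_group_add \<Rightarrow> 'h::ab_group_add) \<Rightarrow> ('r, 'g) gring \<Rightarrow> 'r set \<Rightarrow> ('r, 'u, 'g) gmod \<Rightarrow>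
     (nat \<times> ('r set \<Rightarrow> 'u)) set \<Rightarrow> (nat \<times> ('r set \<Rightarrow> 'u)) set" where
  "torsion_coarsen \<psi> R a M = dl_map (torsion_system R a M) (torsion_trans R a)
     (torsion_system (coarsen_ring \<psi> R) a (coarsen \<psi> M)) (torsion_trans (coarsen_ring \<psi> R) a)
     (\<lambda>n. hom_coarsen R (quot_pow R a n) M)"

definition lc_source ::
    "('g::ab_group_add \<Rightarrow> 'h::ab_group_add) \<Rightarrow> ('r, 'g) gring \<Rightarrow> 'r set \<Rightarrow>
     ('r, 'u, 'g, (nat \<times> ('u \<Rightarrow> 'u) set) set, 'h) delta" where
  "lc_source \<psi> R a = coarsen_after \<psi> (local_cohomology R a)"

definition lc_target ::
    "('g::ab_group_add \<Rightarrow> 'h::ab_group_add) \<Rightarrow> ('r, 'g) gring \<Rightarrow> 'r set \<Rightarrow>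
     ('r, 'u, 'g, (nat \<times> ('u \<Rightarrow> 'u) set) set, 'h) delta" where
  "lc_target \<psi> R a = coarsen_before \<psi> (local_cohomology (coarsen_ring \<psi> R) a)"

text \<open>
  A morphism of \<open>\<delta>\<close>-functors whose component in degree \<open>0\<close> is \<open>torsion_coarsen\<close>, up to the
  identification of the torsion functors with local cohomology in degree \<open>0\<close>.
\<close>

definition extends_torsion_coarsen ::
    "('g::ab_group_add \<Rightarrow> 'h::ab_group_add) \<Rightarrow> ('r, 'g) gring \<Rightarrow> 'r set \<Rightarrow>
     (int \<Rightarrow> ('r, 'u, 'g) gmod \<Rightarrow>
       (nat \<times> ('u \<Rightarrow> 'u) set) set \<Rightarrow> (nat \<times> ('u \<Rightarrow> 'u) set) set) \<Rightarrow> bool" where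
  "extends_torsion_coarsen \<psi> R a \<eta> \<longleftrightarrow>
     delta_morphism R (coarsen_ring \<psi> R) (lc_source \<psi> R a) (lc_target \<psi> R a) \<eta> \<and>
     (\<forall>M. graded_module R M \<longrightarrow> (\<forall>x\<in>carrier (torsion R a M).
        \<eta> 0 M (torsion_iso R a M x) =
          torsion_iso (coarsen_ring \<psi> R) a (coarsen \<psi> M) (torsion_coarsen \<psi> R a M x)))"

definition canonical_morphism ::
    "('g::ab_group_add \<Rightarrow> 'h::ab_group_add) \<Rightarrow> ('r, 'g) gring \<Rightarrow> 'r set \<Rightarrow>
     int \<Rightarrow> ('r, 'u, 'g) gmod \<Rightarrow> (nat \<times> ('u \<Rightarrow> 'u) set) set \<Rightarrow> (nat \<times> ('u \<Rightarrow> 'u) set) set" where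
  "canonical_morphism \<psi> R a = (THE \<eta>. extends_torsion_coarsen \<psi> R a \<eta>)"

end

theory Submission
  imports Defs "HOL-Algebra.Free_Abelian_Groups"
begin

text \<open>
  The idea is to recognise both sides as limits of Ext modules over the coarsened ring, computed with
  two families of projective resolutions of the same modules \<open>R/a\<^sup>n\<close>.

  An element of the graded Hom module is an \<open>R\<close>-linear map in which only finitely many degree shifts
  occur (\<open>ghom_iff\<close>). A degree shift in \<open>G\<close> maps to a degree shift in \<open>H\<close>, and since the kernel of
  \<open>\<psi>\<close> is finite, finitely many shifts in \<open>H\<close> come from finitely many shifts in \<open>G\<close>. So coarsening the
  graded Hom module of \<open>M\<close> and \<open>N\<close> gives exactly the graded Hom module of the coarsened modules
  (\<open>ghom_coarsen\<close>). A projective graded module is a retract of a free one, and homomorphisms out of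
  a coarsened free module are still given by their values on a homogeneous basis; hence coarsened
  projectives are projective (\<open>gr_projective_coarsen\<close>), and a coarsened projective resolution is one
  again (\<open>coarsen_resolution\<close>). Coarsening commutes with subquotients and direct limits too, so the
  coarsened local cohomology is the limit of Ext over the coarsened ring, computed with the coarsened
  resolutions \<open>cP n\<close> of \<open>R/a\<^sup>n\<close>. The other side is the same limit for the chosen resolutions over the
  coarsened ring. Lifts of the identity of \<open>R/a\<^sup>n\<close> between the two resolutions, in both directions, are
  compatible with the transition maps and inverse to each other up to homotopy (\<open>lifts_homotopic\<close>).
  On cohomology classes they give mutually inverse morphisms of \<open>\<delta>\<close>-functors
  (\<open>eta_delta_isomorphism\<close>), which in degree 0 extend the map of torsion functors (\<open>eta_extends\<close>).

  This isomorphism is the canonical morphism because nothing else extends the map of torsion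
  functors (\<open>extension_unique\<close>). Effaceability is used one class at a time, and without injective modules.
  A homogeneous cocycle \<open>P (k + 1) \<rightarrow> M\<close> becomes a coboundary in the pushout of \<open>M\<close> and a shift of \<open>P k\<close>,
  so its class is the image under a connecting map of a class of degree \<open>k\<close>
  (\<open>class_is_connected\<close>). By induction a morphism of \<open>\<delta>\<close>-functors is determined by its values in degree
  0, where every class comes from the torsion functor (\<open>torsion_iso_surj\<close>).
\<close>

section \<open>Additive maps and homogeneous components\<close>

definition additive_map :: "('a, 'm) ring_scheme \<Rightarrow> ('b, 'n) ring_scheme \<Rightarrow> ('a \<Rightarrow> 'b) \<Rightarrow> bool" where
  "additive_map A B u \<longleftrightarrow> (\<forall>x\<in>carrier A. u x \<in> carrier B) \<and>
     (\<forall>x\<in>carrier A. \<forall>y\<in>carrier A. u (x \<oplus>\<^bsub>A\<^esub> y) = u x \<oplus>\<^bsub>B\<^esub> u y)"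

lemma additive_map_zero:
  assumes "abelian_group A" "abelian_group B" "additive_map A B u"
  shows "u \<zero>\<^bsub>A\<^esub> = \<zero>\<^bsub>B\<^esub>"
proof -
  interpret A: abelian_group A by fact
  interpret B: abelian_group B by fact
  have "u \<zero>\<^bsub>A\<^esub> \<oplus>\<^bsub>B\<^esub> u \<zero>\<^bsub>A\<^esub> = u \<zero>\<^bsub>A\<^esub>" "u \<zero>\<^bsub>A\<^esub> \<in> carrier B"
    using assms(3) A.zero_closed A.l_zero unfolding additive_map_def by metis+
  then show ?thesis using B.add.r_cancel_one' B.add.r_cancel_one by metis
qed

lemma additive_map_minus:
  assumes "abelian_group A" "abelian_group B" "additive_map A B u" "x \<in> carrier A"
  shows "u (\<ominus>\<^bsub>A\<^esub> x) = \<ominus>\<^bsub>B\<^esub> u x"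
proof -
  interpret A: abelian_group A by fact
  interpret B: abelian_group B by fact
  have "u (\<ominus>\<^bsub>A\<^esub> x) \<oplus>\<^bsub>B\<^esub> u x = u \<zero>\<^bsub>A\<^esub>"
    using assms(3,4) A.a_inv_closed[OF assms(4)] A.l_neg[OF assms(4)]
    unfolding additive_map_def by metis
  then have "u (\<ominus>\<^bsub>A\<^esub> x) \<oplus>\<^bsub>B\<^esub> u x = \<zero>\<^bsub>B\<^esub>" using additive_map_zero[OF assms(1-3)] by simp
  moreover have "u (\<ominus>\<^bsub>A\<^esub> x) \<in> carrier B" "u x \<in> carrier B"
    using assms(3,4) unfolding additive_map_def by auto
  ultimately show ?thesis using B.minus_equality by metis
qed

text \<open>Stated for monoids, with the preservation of zero as a hypothesis, so that it applies to direct limits,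
  of which only the monoid laws are at hand where finite sums of classes are formed.\<close>

lemma additive_map_finsum:
  assumes A: "abelian_monoid A" and B: "abelian_monoid B" and u: "additive_map A B u"
    and z: "u \<zero>\<^bsub>A\<^esub> = \<zero>\<^bsub>B\<^esub>" and F: "finite F" and f: "\<And>i. i \<in> F \<Longrightarrow> f i \<in> carrier A"
  shows "u (finsum A f F) = finsum B (\<lambda>i. u (f i)) F"
proof -
  interpret A: abelian_monoid A by fact
  interpret B: abelian_monoid B by fact
  from F f show ?thesis
  proof (induction F)
    case empty then show ?case by (simp add: z)
  next
    case (insert i F)
    have uf: "u (f j) \<in> carrier B" if "j \<in> insert i F" for j
      using u insert.prems[OF that] by (simp add: additive_map_def)
    have "finsum A f F \<in> carrier A" using insert.prems by (auto intro!: A.finsum_closed)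
    then show ?case using insert uf u by (simp add: additive_map_def Pi_iff)
  qed
qed

lemma additive_map_finsum_group:
  assumes A: "abelian_group A" and B: "abelian_group B" and u: "additive_map A B u"
    and F: "finite F" and f: "\<And>i. i \<in> F \<Longrightarrow> f i \<in> carrier A"
  shows "u (finsum A f F) = finsum B (\<lambda>i. u (f i)) F"
  using additive_map_finsum[OF abelian_group.axioms(1)[OF A] abelian_group.axioms(1)[OF B] u
      additive_map_zero[OF A B u] F f] .

lemma (in abelian_monoid) finsum_single:
  assumes "finite F" "g \<in> F" "x \<in> carrier G" "\<And>k. k \<in> F \<Longrightarrow> k \<noteq> g \<Longrightarrow> c k = \<zero>" "c g = x"
  shows "finsum G c F = x"
proof -
  have "finsum G c F = finsum G (\<lambda>k. if g = k then x else \<zero>) F"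
    using assms by (intro finsum_cong') auto
  then show ?thesis using add.finprod_singleton[OF assms(2,1), of "\<lambda>_. x"] assms(3) by simp
qed

definition component :: "('a, 'm) ring_scheme \<Rightarrow> ('g \<Rightarrow> 'a set) \<Rightarrow> 'g \<Rightarrow> 'a \<Rightarrow> 'a" where
  "component A D g x = (THE c. (\<forall>g. c g \<in> D g) \<and> finite {g. c g \<noteq> \<zero>\<^bsub>A\<^esub>} \<and>
        x = finsum A c {g. c g \<noteq> \<zero>\<^bsub>A\<^esub>}) g"

locale graded_group = abelian_group A for A (structure) +
  fixes D :: "'g \<Rightarrow> 'a set"
  assumes grading: "grading A D"
begin

lemma D_subgroup: "additive_subgroup (D g) A"
  using grading by (simp add: grading_def)

lemma D_carrier [simp]: "x \<in> D g \<Longrightarrow> x \<in> carrier A"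
  using additive_subgroup.a_Hcarr[OF D_subgroup] .

lemma D_zero [simp]: "\<zero> \<in> D g"
  using additive_subgroup.zero_closed[OF D_subgroup] .

lemma D_add: "x \<in> D g \<Longrightarrow> y \<in> D g \<Longrightarrow> x \<oplus> y \<in> D g"
  using additive_subgroup.a_closed[OF D_subgroup] .

lemma D_minus: "x \<in> D g \<Longrightarrow> \<ominus> x \<in> D g"
  using additive_subgroup.a_inv_closed[OF D_subgroup] .

lemma D_finsum: "(\<And>i. i \<in> F \<Longrightarrow> f i \<in> D g) \<Longrightarrow> finsum A f F \<in> D g"
proof (induction F rule: infinite_finite_induct)
  case (insert i F)
  have "f i \<in> D g" "\<And>j. j \<in> F \<Longrightarrow> f j \<in> carrier A" "f i \<in> carrier A"
    using insert.prems D_carrier by blast+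
  with insert show ?case by (simp add: Pi_iff D_add)
qed auto

lemma
  assumes "x \<in> carrier A"
  shows component_in: "component A D g x \<in> D g"
    and component_finite: "finite {g. component A D g x \<noteq> \<zero>}"
    and component_sum': "x = finsum A (\<lambda>g. component A D g x) {g. component A D g x \<noteq> \<zero>}"
proof -
  have "\<exists>!c. (\<forall>g. c g \<in> D g) \<and> finite {g. c g \<noteq> \<zero>} \<and> x = finsum A c {g. c g \<noteq> \<zero>}"
    using grading assms by (simp add: grading_def)
  from theI'[OF this] show "component A D g x \<in> D g" "finite {g. component A D g x \<noteq> \<zero>}"
    "x = finsum A (\<lambda>g. component A D g x) {g. component A D g x \<noteq> \<zero>}"
    unfolding component_def by blast+
qed

lemma component_closed [simp]: "x \<in> carrier A \<Longrightarrow> component A D g x \<in> carrier A"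
  using component_in D_carrier by blast

lemma component_sum:
  assumes "x \<in> carrier A" "finite F" "\<And>g. g \<notin> F \<Longrightarrow> component A D g x = \<zero>"
  shows "finsum A (\<lambda>g. component A D g x) F = x"
proof -
  have "finsum A (\<lambda>g. component A D g x) F =
      finsum A (\<lambda>g. component A D g x) {g. component A D g x \<noteq> \<zero>}"
    using assms by (intro add.finprod_mono_neutral_cong_right) auto
  then show ?thesis using component_sum'[OF assms(1)] by simp
qed

lemma component_unique:
  assumes F: "finite F" and c: "\<And>g. g \<in> F \<Longrightarrow> c g \<in> D g" and x: "x = finsum A c F"
  shows "component A D g x = (if g \<in> F then c g else \<zero>)"
proof -
  let ?c = "\<lambda>g. if g \<in> F then c g else \<zero>"
  let ?P = "\<lambda>x c. (\<forall>g. c g \<in> D g) \<and> finite {g. c g \<noteq> \<zero>} \<and> x = finsum A c {g. c g \<noteq> \<zero>}"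
  have cc: "c g \<in> carrier A" if "g \<in> F" for g using c[OF that] by simp
  have xc: "x \<in> carrier A" using x cc by auto
  have "finsum A ?c {g. ?c g \<noteq> \<zero>} = finsum A c F"
    using F cc by (intro add.finprod_mono_neutral_cong_left) (auto split: if_splits)
  then have "?P x ?c" using F c x by (auto split: if_splits)
  moreover have "?P x (\<lambda>g. component A D g x)"
    using component_in[OF xc] component_finite[OF xc] component_sum'[OF xc] by blast
  moreover have "\<exists>!c. ?P x c" using grading xc by (simp add: grading_def)
  ultimately have "(\<lambda>g. component A D g x) = ?c" by (intro ex1_eq[of "?P x"])
  then show ?thesis by (rule fun_cong)
qed

lemma component_homog:
  assumes "x \<in> D g" shows "component A D k x = (if k = g then x else \<zero>)"
  using component_unique[of "{g}" "\<lambda>_. x" x k] assms by simp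

lemma component_self: "x \<in> D g \<Longrightarrow> component A D g x = x"
  by (simp add: component_homog)

lemma component_zero [simp]: "component A D g \<zero> = \<zero>"
  using component_homog[OF D_zero] by simp

lemma finite_component_support:
  assumes "finite X" "X \<subseteq> carrier A"
  obtains F where "finite F" "\<And>x g. x \<in> X \<Longrightarrow> g \<notin> F \<Longrightarrow> component A D g x = \<zero>"
  using assms component_finite
  by (intro that[of "\<Union>x\<in>X. {g. component A D g x \<noteq> \<zero>}"]) auto

lemma component_add:
  assumes x: "x \<in> carrier A" and y: "y \<in> carrier A"
  shows "component A D g (x \<oplus> y) = component A D g x \<oplus> component A D g y"
proof -
  obtain F where F: "finite F" "\<And>z g. z \<in> {x,y} \<Longrightarrow> g \<notin> F \<Longrightarrow> component A D g z = \<zero>"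
    using finite_component_support[of "{x,y}"] x y by auto
  have "x \<oplus> y = finsum A (\<lambda>g. component A D g x) F \<oplus> finsum A (\<lambda>g. component A D g y) F"
    using component_sum[OF x F(1)] component_sum[OF y F(1)] F(2) by simp
  also have "\<dots> = finsum A (\<lambda>g. component A D g x \<oplus> component A D g y) F"
    using x y by (intro finsum_addf[symmetric]) auto
  finally have "component A D g (x \<oplus> y) =
      (if g \<in> F then component A D g x \<oplus> component A D g y else \<zero>)"
    using F x y by (intro component_unique) (auto intro!: D_add component_in)
  then show ?thesis using F(2) by auto
qed

lemma component_additive: "additive_map A A (component A D g)"
  by (simp add: additive_map_def component_add)

lemma component_eqI:
  assumes "x \<in> carrier A" "y \<in> carrier A" "\<And>g. component A D g x = component A D g y"
  shows "x = y"
  using component_sum'[OF assms(1)] component_sum'[OF assms(2)] assms(3) by simp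

lemma homogI:
  assumes "x \<in> carrier A" "\<And>k. k \<noteq> g \<Longrightarrow> component A D k x = \<zero>" shows "x \<in> D g"
proof -
  have "component A D g x = x"
    using component_sum[OF assms(1), of "{g}"] assms by simp
  then show ?thesis using component_in[OF assms(1)] by metis
qed

end

text \<open>A map that shifts degrees injectively sends the decomposition of \<open>x\<close> to a decomposition of \<open>u x\<close>,
  since different components of \<open>x\<close> still land in different degrees.\<close>

lemma component_additive_map:
  fixes A :: "('a, 'm) ring_scheme" and B :: "('b, 'n) ring_scheme"
  assumes A: "graded_group A D" and B: "graded_group B E" and u: "additive_map A B u"
    and deg: "\<And>k x. x \<in> D k \<Longrightarrow> u x \<in> E (\<sigma> k)" and inj: "inj \<sigma>" and x: "x \<in> carrier A"
  shows "component B E (\<sigma> k) (u x) = u (component A D k x)"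
    and "j \<notin> range \<sigma> \<Longrightarrow> component B E j (u x) = \<zero>\<^bsub>B\<^esub>"
proof -
  interpret A: graded_group A D by fact
  interpret B: graded_group B E by fact
  obtain F where F: "finite F" "\<And>z g. z \<in> {x} \<Longrightarrow> g \<notin> F \<Longrightarrow> component A D g z = \<zero>\<^bsub>A\<^esub>"
    using A.finite_component_support[of "{x}"] x by auto
  have uc: "u (component A D g x) \<in> carrier B" for g
    using u A.component_closed[OF x] by (simp add: additive_map_def)
  have z: "u \<zero>\<^bsub>A\<^esub> = \<zero>\<^bsub>B\<^esub>"
    using additive_map_zero[OF A.abelian_group_axioms B.abelian_group_axioms u] .
  have "u x = u (finsum A (\<lambda>g. component A D g x) F)"
    using A.component_sum[OF x F(1)] F(2) by simp
  also have "\<dots> = finsum B (\<lambda>g. u (component A D g x)) F"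
    using x by (intro additive_map_finsum_group[OF A.abelian_group_axioms B.abelian_group_axioms u F(1)]) auto
  also have "\<dots> = finsum B (\<lambda>j. u (component A D (the_inv \<sigma> j) x)) (\<sigma> ` F)"
    using inj uc by (subst B.add.finprod_reindex) (auto simp: the_inv_f_f intro: inj_on_subset)
  finally have *: "component B E j (u x) =
      (if j \<in> \<sigma> ` F then u (component A D (the_inv \<sigma> j) x) else \<zero>\<^bsub>B\<^esub>)" for j
    using F(1) x inj
    by (intro B.component_unique) (auto simp: the_inv_f_f intro!: deg A.component_in)
  show "component B E (\<sigma> k) (u x) = u (component A D k x)"
    using *[of "\<sigma> k"] F(2)[of x k] inj z by (auto simp: the_inv_f_f inj_image_mem_iff)
  show "component B E j (u x) = \<zero>\<^bsub>B\<^esub>" if "j \<notin> range \<sigma>" using *[of j] that by auto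
qed

text \<open>A family of additive projections suffices for a grading: applying \<open>p g\<close> to any decomposition of \<open>x\<close>
  returns the summand of degree \<open>g\<close>, so decompositions are unique.\<close>

lemma gradingI:
  fixes A :: "('a, 'm) ring_scheme"
  assumes A: "abelian_group A" and D: "\<And>g. additive_subgroup (D g) A"
    and p: "\<And>g x. x \<in> carrier A \<Longrightarrow> p g x \<in> D g"
    and padd: "\<And>g x y. x \<in> carrier A \<Longrightarrow> y \<in> carrier A \<Longrightarrow> p g (x \<oplus>\<^bsub>A\<^esub> y) = p g x \<oplus>\<^bsub>A\<^esub> p g y"
    and pfin: "\<And>x. x \<in> carrier A \<Longrightarrow> finite {g. p g x \<noteq> \<zero>\<^bsub>A\<^esub>}"
    and psum: "\<And>x. x \<in> carrier A \<Longrightarrow> finsum A (\<lambda>g. p g x) {g. p g x \<noteq> \<zero>\<^bsub>A\<^esub>} = x"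
    and p1: "\<And>g x. x \<in> D g \<Longrightarrow> p g x = x"
    and p0: "\<And>g k x. x \<in> D k \<Longrightarrow> g \<noteq> k \<Longrightarrow> p g x = \<zero>\<^bsub>A\<^esub>"
  shows "grading A D" "x \<in> carrier A \<Longrightarrow> component A D g x = p g x"
proof -
  interpret A: abelian_group A by fact
  have Dc: "x \<in> D g \<Longrightarrow> x \<in> carrier A" for x g using additive_subgroup.a_Hcarr[OF D] .
  have pa: "additive_map A A (p g)" for g using p padd Dc unfolding additive_map_def by blast
  have uniq: "c g = p g x" if c: "\<forall>g. c g \<in> D g" "finite {g. c g \<noteq> \<zero>\<^bsub>A\<^esub>}"
    "x = finsum A c {g. c g \<noteq> \<zero>\<^bsub>A\<^esub>}" for c x g
  proof -
    let ?F = "insert g {g. c g \<noteq> \<zero>\<^bsub>A\<^esub>}"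
    have cc: "c g \<in> carrier A" for g using c Dc by blast
    have xF: "x = finsum A c ?F"
      unfolding c(3) using c(2) cc by (intro A.add.finprod_mono_neutral_cong_left) auto
    have "p g x = p g (finsum A c ?F)" by (rule arg_cong[OF xF])
    also have "\<dots> = finsum A (\<lambda>k. p g (c k)) ?F"
      by (rule additive_map_finsum_group[OF A A pa]) (use c(2) cc in auto)
    also have "\<dots> = c g"
      using c cc p0[of "c k" k g for k] by (intro A.finsum_single[of _ g]) (auto simp: p1)
    finally show ?thesis by simp
  qed
  show gr: "grading A D"
    unfolding grading_def
  proof (intro conjI allI ballI D)
    fix x assume x: "x \<in> carrier A"
    show "\<exists>!c. (\<forall>g. c g \<in> D g) \<and> finite {g. c g \<noteq> \<zero>\<^bsub>A\<^esub>} \<and> x = finsum A c {g. c g \<noteq> \<zero>\<^bsub>A\<^esub>}"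
      using uniq p[OF x] pfin[OF x] psum[OF x] by (intro ex1I[of _ "\<lambda>g. p g x"]) auto
  qed
  interpret G: graded_group A D by unfold_locales (rule gr)
  show "component A D g x = p g x" if "x \<in> carrier A"
    using uniq[of "\<lambda>g. component A D g x"] G.component_in[OF that] G.component_finite[OF that]
      G.component_sum'[OF that] by blast
qed

section \<open>Graded modules and their homomorphisms\<close>

abbreviation mcomp :: "('r, 'm, 'g) gmod \<Rightarrow> 'g \<Rightarrow> 'm \<Rightarrow> 'm" where
  "mcomp M \<equiv> component M (mgrade M)"

abbreviation rcomp :: "('r, 'g) gring \<Rightarrow> 'g \<Rightarrow> 'r \<Rightarrow> 'r" where
  "rcomp R \<equiv> component R (rgrade R)"

lemma graded_moduleD:
  assumes "graded_module R M"
  shows "module R M" "graded_group M (mgrade M)" "abelian_group M" "cring R"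
    "\<And>r x k g. r \<in> rgrade R k \<Longrightarrow> x \<in> mgrade M g \<Longrightarrow> r \<odot>\<^bsub>M\<^esub> x \<in> mgrade M (k + g)"
  using assms
  by (auto simp: graded_module_def graded_group_def graded_group_axioms_def module_def)

lemma graded_cringD:
  assumes "graded_cring R"
  shows "cring R" "graded_group R (rgrade R)" "abelian_group R"
    "\<And>r s k g. r \<in> rgrade R k \<Longrightarrow> s \<in> rgrade R g \<Longrightarrow> r \<otimes>\<^bsub>R\<^esub> s \<in> rgrade R (k + g)"
  using assms ring.is_abelian_group[OF cring.axioms(1), of R]
  by (auto simp: graded_cring_def graded_group_def graded_group_axioms_def)

definition linear_map ::
    "('r, 'g) gring \<Rightarrow> ('r, 'm, 'g) gmod \<Rightarrow> ('r, 'n, 'g) gmod \<Rightarrow> ('m \<Rightarrow> 'n) \<Rightarrow> bool" where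
  "linear_map R M N u \<longleftrightarrow> additive_map M N u \<and>
     (\<forall>r\<in>carrier R. \<forall>x\<in>carrier M. u (r \<odot>\<^bsub>M\<^esub> x) = r \<odot>\<^bsub>N\<^esub> u x)"

lemma linear_mapD:
  assumes "linear_map R M N u"
  shows "additive_map M N u" "\<And>x. x \<in> carrier M \<Longrightarrow> u x \<in> carrier N"
    "\<And>x y. x \<in> carrier M \<Longrightarrow> y \<in> carrier M \<Longrightarrow> u (x \<oplus>\<^bsub>M\<^esub> y) = u x \<oplus>\<^bsub>N\<^esub> u y"
    "\<And>r x. r \<in> carrier R \<Longrightarrow> x \<in> carrier M \<Longrightarrow> u (r \<odot>\<^bsub>M\<^esub> x) = r \<odot>\<^bsub>N\<^esub> u x"
  using assms by (auto simp: linear_map_def additive_map_def)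

lemma linear_map_cong:
  assumes "linear_map R M N u" "abelian_group M" "module R M" "\<And>x. x \<in> carrier M \<Longrightarrow> v x = u x"
  shows "linear_map R M N v"
proof -
  interpret module R M by fact
  show ?thesis using assms(1,4) by (simp add: linear_map_def additive_map_def)
qed

lemma linear_map_zero:
  "graded_module R M \<Longrightarrow> graded_module R N \<Longrightarrow> linear_map R M N u \<Longrightarrow> u \<zero>\<^bsub>M\<^esub> = \<zero>\<^bsub>N\<^esub>"
  using additive_map_zero graded_moduleD(3) linear_mapD(1) by metis

lemma linear_map_minus:
  "graded_module R M \<Longrightarrow> graded_module R N \<Longrightarrow> linear_map R M N u \<Longrightarrow> x \<in> carrier M \<Longrightarrow>
    u (\<ominus>\<^bsub>M\<^esub> x) = \<ominus>\<^bsub>N\<^esub> u x"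
  using additive_map_minus graded_moduleD(3) linear_mapD(1) by metis

lemma linear_map_compose:
  assumes "graded_module R M" "linear_map R M N u" "linear_map R N L v"
  shows "linear_map R M L (compose (carrier M) v u)"
proof -
  interpret module R M using assms(1) graded_moduleD by blast
  show ?thesis using assms(2,3) by (auto simp: linear_map_def additive_map_def compose_def)
qed

lemma shift_simps [simp]:
  "carrier (shift N g) = carrier N" "add (shift N g) = add N" "smult (shift N g) = smult N"
  "ring.zero (shift N g) = ring.zero N" "mgrade (shift N g) k = mgrade N (g + k)"
  by (simp_all add: shift_def)

lemma linear_map_shift [simp]: "linear_map R M (shift N g) u \<longleftrightarrow> linear_map R M N u"
  by (simp add: linear_map_def additive_map_def)

lemma linear_map_shift_left [simp]: "linear_map R (shift M g) N u \<longleftrightarrow> linear_map R M N u"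
  by (simp add: linear_map_def additive_map_def)

lemma shift_0 [simp]: "shift N 0 = N"
  by (simp add: shift_def)

lemma gr_hom_iff:
  "u \<in> gr_hom R M N \<longleftrightarrow> u \<in> extensional (carrier M) \<and> linear_map R M N u \<and>
     (\<forall>g. \<forall>x\<in>mgrade M g. u x \<in> mgrade N g)"
  by (auto simp: gr_hom_def linear_map_def additive_map_def PiE_iff image_subset_iff)

lemma gr_homD:
  assumes "u \<in> gr_hom R M N"
  shows "u \<in> extensional (carrier M)" "linear_map R M N u" "\<And>x g. x \<in> mgrade M g \<Longrightarrow> u x \<in> mgrade N g"
    "\<And>x. x \<in> carrier M \<Longrightarrow> u x \<in> carrier N"
  using assms by (auto simp: gr_hom_iff dest: linear_mapD)

lemma gr_hom_restrict:
  assumes M: "graded_module R M" and "linear_map R M N u" "\<And>g x. x \<in> mgrade M g \<Longrightarrow> u x \<in> mgrade N g"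
  shows "(\<lambda>x\<in>carrier M. u x) \<in> gr_hom R M N"
proof -
  interpret M: graded_group M "mgrade M" using M by (rule graded_moduleD)
  show ?thesis using assms graded_moduleD[OF M]
    by (auto simp: gr_hom_iff intro: linear_map_cong)
qed

lemma shift_graded_module:
  fixes M :: "('r, 'm, 'g::ab_group_add) gmod"
  assumes M: "graded_module R M" shows "graded_module R (shift M g)"
proof -
  interpret M: graded_group M "mgrade M" using M by (rule graded_moduleD)
  interpret module R M using M by (rule graded_moduleD)
  have ag: "abelian_group (shift M g)"
    by (rule abelian_groupI) (auto simp: M.a_ac intro: M.l_neg exI[of _ "\<ominus>\<^bsub>M\<^esub> x" for x] bexI[of _ "\<ominus>\<^bsub>M\<^esub> x" for x])
  have fs: "finsum (shift M g) c F = finsum M c F" for c :: "'g \<Rightarrow> _" and F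
    by (simp add: finsum_def finprod_def shift_def)
  have mo: "module R (shift M g)"
    by (rule moduleI) (auto simp: R.is_cring ag smult_l_distr smult_r_distr smult_assoc1)
  have sub: "additive_subgroup (mgrade (shift M g) k) (shift M g)" for k
    using M.D_subgroup[of "g + k"] by (simp add: additive_subgroup_def shift_def)
  have "grading (shift M g) (mgrade (shift M g))"
  proof (rule gradingI[OF ag sub, where p = "\<lambda>k. mcomp M (g + k)"])
    fix x assume x: "x \<in> carrier (shift M g)"
    have *: "{k. mcomp M (g + k) x \<noteq> \<zero>\<^bsub>M\<^esub>} = (\<lambda>j. j - g) ` {k. mcomp M k x \<noteq> \<zero>\<^bsub>M\<^esub>}"
      by (force simp: image_iff intro: exI[of _ "g + k" for k])
    have xc: "x \<in> carrier M" using x by simp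
    show "finite {k. mcomp M (g + k) x \<noteq> \<zero>\<^bsub>shift M g\<^esub>}"
      using M.component_finite[OF xc] by (simp add: *)
    have "finsum M (\<lambda>k. mcomp M (g + k) x) ((\<lambda>j. j - g) ` {k. mcomp M k x \<noteq> \<zero>\<^bsub>M\<^esub>}) = x"
      using M.component_sum'[OF xc] xc by (subst M.add.finprod_reindex) (auto simp: inj_on_def)
    then show "finsum (shift M g) (\<lambda>k. mcomp M (g + k) x) {k. mcomp M (g + k) x \<noteq> \<zero>\<^bsub>shift M g\<^esub>} = x"
      by (simp add: fs *)
  qed (auto simp: M.component_in M.component_add M.component_homog)
  then show ?thesis using mo graded_moduleD(5)[OF M]
    by (auto simp: graded_module_def add.left_commute)
qed

lemma gr_hom_shift_iff:
  "u \<in> gr_hom R M (shift N g) \<longleftrightarrow> u \<in> extensional (carrier M) \<and> linear_map R M N u \<and>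
     (\<forall>k. \<forall>x\<in>mgrade M k. u x \<in> mgrade N (g + k))"
  by (simp add: gr_hom_iff)

lemma gr_hom_shift_both: "u \<in> gr_hom R M N \<Longrightarrow> u \<in> gr_hom R (shift M g) (shift N g)"
  by (auto simp: gr_hom_iff)

lemma gr_hom_compose:
  assumes M: "graded_module R M" and "u \<in> gr_hom R M N" "v \<in> gr_hom R N L"
  shows "compose (carrier M) v u \<in> gr_hom R M L"
proof -
  interpret M: graded_group M "mgrade M" using M by (rule graded_moduleD)
  show ?thesis using assms linear_map_compose[OF M, of N u L v]
    by (auto simp: gr_hom_iff compose_def)
qed

lemma gr_hom_id: "graded_module R M \<Longrightarrow> (\<lambda>x\<in>carrier M. x) \<in> gr_hom R M M"
  by (rule gr_hom_restrict) (auto simp: linear_map_def additive_map_def)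

lemma gr_hom_zero:
  assumes "graded_module R M" "graded_module R N"
  shows "(\<lambda>x\<in>carrier M. \<zero>\<^bsub>N\<^esub>) \<in> gr_hom R M N"
proof -
  interpret N: graded_group N "mgrade N" using assms by (intro graded_moduleD)
  interpret module R N using assms graded_moduleD by blast
  show ?thesis using assms
    by (intro gr_hom_restrict) (auto simp: linear_map_def additive_map_def)
qed

lemma gr_hom_component:
  assumes "graded_module R M" "graded_module R N" "u \<in> gr_hom R M N" "x \<in> carrier M"
  shows "mcomp N g (u x) = u (mcomp M g x)"
  using component_additive_map(1)[of M "mgrade M" N "mgrade N" u "\<lambda>k. k" x g]
    graded_moduleD[OF assms(1)] graded_moduleD[OF assms(2)] gr_homD[OF assms(3)] assms(4)
  by (auto dest: linear_mapD)

lemma smult_component: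
  fixes M :: "('r, 'm, 'g::ab_group_add) gmod"
  assumes R: "graded_cring R" and M: "graded_module R M" and r: "r \<in> rgrade R k" and x: "x \<in> carrier M"
  shows "mcomp M (k + g) (r \<odot>\<^bsub>M\<^esub> x) = r \<odot>\<^bsub>M\<^esub> mcomp M g x"
proof -
  interpret module R M using M by (rule graded_moduleD)
  interpret RR: graded_group R "rgrade R" using R by (rule graded_cringD)
  have rc: "r \<in> carrier R" using r by simp
  have "additive_map M M (\<lambda>x. r \<odot>\<^bsub>M\<^esub> x)" using rc by (simp add: additive_map_def smult_r_distr)
  then show ?thesis
    using component_additive_map(1)[of M "mgrade M" M "mgrade M" "\<lambda>x. r \<odot>\<^bsub>M\<^esub> x" "\<lambda>g. k + g" x g]
      graded_moduleD(2,5)[OF M] r x by (auto)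
qed

text \<open>Of an arbitrary preimage of a homogeneous element, the component of the same degree is again a preimage.\<close>

lemma homog_preimage:
  fixes M :: "('r, 'm, 'g::ab_group_add) gmod"
  assumes M: "graded_module R M" and N: "graded_module R N" and u: "u \<in> gr_hom R M N"
    and y: "y \<in> mgrade N g" "y \<in> u ` carrier M"
  obtains x where "x \<in> mgrade M g" "u x = y"
proof -
  interpret M: graded_group M "mgrade M" using M by (rule graded_moduleD)
  interpret N: graded_group N "mgrade N" using N by (rule graded_moduleD)
  obtain x where x: "x \<in> carrier M" "u x = y" using y by auto
  then have "u (mcomp M g x) = y"
    using gr_hom_component[OF M N u x(1), of g] N.component_self[OF y(1)] by simp
  then show ?thesis using that M.component_in[OF x(1)] by blast
qed

section \<open>Graded submodules, quotients, copies and direct sums\<close>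

text \<open>Stability under taking components replaces the condition that the intersections with the
  homogeneous parts form a grading; it is immediate for kernels and images. Negatives are scalar
  multiples by \<open>-1\<close>.\<close>

definition graded_submodule :: "('r, 'g::ab_group_add) gring \<Rightarrow> ('r, 'm, 'g) gmod \<Rightarrow> 'm set \<Rightarrow> bool" where
  "graded_submodule R M K \<longleftrightarrow> K \<subseteq> carrier M \<and> \<zero>\<^bsub>M\<^esub> \<in> K \<and>
     (\<forall>x\<in>K. \<forall>y\<in>K. x \<oplus>\<^bsub>M\<^esub> y \<in> K) \<and> (\<forall>r\<in>carrier R. \<forall>x\<in>K. r \<odot>\<^bsub>M\<^esub> x \<in> K) \<and>
     (\<forall>g. \<forall>x\<in>K. mcomp M g x \<in> K)"

lemma graded_submoduleD:
  assumes "graded_submodule R M K"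
  shows "K \<subseteq> carrier M" "\<zero>\<^bsub>M\<^esub> \<in> K" "\<And>x y. x \<in> K \<Longrightarrow> y \<in> K \<Longrightarrow> x \<oplus>\<^bsub>M\<^esub> y \<in> K"
    "\<And>r x. r \<in> carrier R \<Longrightarrow> x \<in> K \<Longrightarrow> r \<odot>\<^bsub>M\<^esub> x \<in> K" "\<And>g x. x \<in> K \<Longrightarrow> mcomp M g x \<in> K"
    "\<And>x. x \<in> K \<Longrightarrow> x \<in> carrier M"
  using assms unfolding graded_submodule_def by blast+

lemma additive_subgroupI:
  assumes "abelian_group M" "K \<subseteq> carrier M" "\<zero>\<^bsub>M\<^esub> \<in> K" "\<And>x y. x \<in> K \<Longrightarrow> y \<in> K \<Longrightarrow> x \<oplus>\<^bsub>M\<^esub> y \<in> K"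
    "\<And>x. x \<in> K \<Longrightarrow> \<ominus>\<^bsub>M\<^esub> x \<in> K"
  shows "additive_subgroup K M"
proof -
  interpret abelian_group M by fact
  show ?thesis
    by (rule additive_subgroup.intro, rule add.subgroupI) (use assms in auto)
qed

lemma graded_submodule_minus:
  assumes M: "graded_module R M" and K: "graded_submodule R M K" and x: "x \<in> K"
  shows "\<ominus>\<^bsub>M\<^esub> x \<in> K"
proof -
  interpret module R M using M by (rule graded_moduleD)
  have "\<ominus>\<^bsub>M\<^esub> x = (\<ominus>\<^bsub>R\<^esub> \<one>\<^bsub>R\<^esub>) \<odot>\<^bsub>M\<^esub> x"
    using graded_submoduleD(6)[OF K x] by (simp add: smult_l_minus)
  then show ?thesis using graded_submoduleD(4)[OF K _ x] by simp
qed

lemma graded_submodule_subgroup: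
  assumes M: "graded_module R M" and K: "graded_submodule R M K"
  shows "additive_subgroup K M"
  using graded_submoduleD[OF K] graded_submodule_minus[OF M K] graded_moduleD(3)[OF M]
  by (intro additive_subgroupI) auto

lemma submod_simps [simp]:
  "carrier (submod M Z) = Z" "add (submod M Z) = add M" "smult (submod M Z) = smult M"
  "ring.zero (submod M Z) = ring.zero M" "mgrade (submod M Z) g = mgrade M g \<inter> Z"
  by (simp_all add: submod_def)

lemma finsum_submod:
  assumes "abelian_group M" "abelian_group (submod M Z)" "Z \<subseteq> carrier M" "finite F" "\<And>i. i \<in> F \<Longrightarrow> f i \<in> Z"
  shows "finsum (submod M Z) f F = finsum M f F"
  using additive_map_finsum_group[OF assms(2,1) _ assms(4), of "\<lambda>x. x" f] assms(3,5)
  by (auto simp: additive_map_def)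

lemma
  assumes R: "graded_cring R" and M: "graded_module R M" and Z: "graded_submodule R M Z"
  shows submod_graded_module: "graded_module R (submod M Z)"
    and submod_component: "x \<in> Z \<Longrightarrow> mcomp (submod M Z) g x = mcomp M g x"
proof -
  interpret M: graded_group M "mgrade M" using M by (rule graded_moduleD)
  interpret module R M using M by (rule graded_moduleD)
  note Zs = graded_submoduleD[OF Z]
  note Zm = graded_submodule_minus[OF M Z]
  have ag: "abelian_group (submod M Z)"
  proof (rule abelian_groupI)
    show "\<exists>y\<in>carrier (submod M Z). y \<oplus>\<^bsub>submod M Z\<^esub> x = \<zero>\<^bsub>submod M Z\<^esub>"
      if "x \<in> carrier (submod M Z)" for x
      using that Zm Zs(6) M.l_neg by auto
  qed (auto simp: M.a_ac Zs)
  have mo: "module R (submod M Z)"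
    by (rule moduleI) (auto simp: R.is_cring ag smult_l_distr smult_r_distr smult_assoc1 Zs)
  interpret S: abelian_group "submod M Z" by (rule ag)
  have mi: "\<ominus>\<^bsub>submod M Z\<^esub> x = \<ominus>\<^bsub>M\<^esub> x" if "x \<in> Z" for x
    using that Zm Zs(6) by (intro S.minus_equality) (auto simp: M.l_neg)
  have sub: "additive_subgroup (mgrade (submod M Z) k) (submod M Z)" for k
    by (rule additive_subgroupI[OF ag]) (auto simp: Zs mi Zm M.D_add M.D_minus)
  have inn: "mcomp M g x \<in> mgrade (submod M Z) g" if "x \<in> carrier (submod M Z)" for g x
    using that Zs(5,6) M.component_in by simp
  have padd: "mcomp M g (x \<oplus>\<^bsub>submod M Z\<^esub> y) = mcomp M g x \<oplus>\<^bsub>submod M Z\<^esub> mcomp M g y"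
    if "x \<in> carrier (submod M Z)" "y \<in> carrier (submod M Z)" for g x y
    using that Zs(6) M.component_add by simp
  have fin: "finite {g. mcomp M g x \<noteq> \<zero>\<^bsub>submod M Z\<^esub>}" if "x \<in> carrier (submod M Z)" for x
    using that M.component_finite Zs(6) by auto
  have su: "finsum (submod M Z) (\<lambda>g. mcomp M g x) {g. mcomp M g x \<noteq> \<zero>\<^bsub>submod M Z\<^esub>} = x"
    if "x \<in> carrier (submod M Z)" for x
  proof -
    have xZ: "x \<in> Z" using that by simp
    have "finsum (submod M Z) (\<lambda>g. mcomp M g x) {g. mcomp M g x \<noteq> \<zero>\<^bsub>M\<^esub>} =
        finsum M (\<lambda>g. mcomp M g x) {g. mcomp M g x \<noteq> \<zero>\<^bsub>M\<^esub>}"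
      using fin[OF that] Zs(5)[OF xZ]
      by (intro finsum_submod[OF M.abelian_group_axioms ag Zs(1)]) simp_all
    then show ?thesis using M.component_sum'[OF Zs(6)[OF xZ]] by simp
  qed
  have p1: "mcomp M g x = x" if "x \<in> mgrade (submod M Z) g" for g x
    using that M.component_self[of x g] by simp
  have p0: "mcomp M g x = \<zero>\<^bsub>submod M Z\<^esub>" if "x \<in> mgrade (submod M Z) k" "g \<noteq> k" for g k x
    using that M.component_homog[of x k g] by simp
  have gr: "grading (submod M Z) (mgrade (submod M Z))"
    by (rule gradingI(1)[OF ag sub, where p = "mcomp M"]) (rule inn padd fin su p1 p0; assumption)+
  have "r \<in> carrier R" if "r \<in> rgrade R k" for r k
    using graded_group.D_carrier[OF graded_cringD(2)[OF R] that] .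
  then show "graded_module R (submod M Z)"
    using gr mo graded_moduleD(5)[OF M] Zs(4) by (simp add: graded_module_def)
  show "mcomp (submod M Z) g x = mcomp M g x" if "x \<in> Z"
    by (rule gradingI(2)[OF ag sub, where p = "mcomp M"])
       ((rule inn padd fin su p1 p0; assumption) | simp add: that)+
qed

lemma kernel_graded_submodule:
  assumes M: "graded_module R M" and N: "graded_module R N" and u: "u \<in> gr_hom R M N"
  shows "graded_submodule R M (a_kernel M N u)"
proof -
  interpret M: graded_group M "mgrade M" using M by (rule graded_moduleD)
  interpret MM: module R M using M by (rule graded_moduleD)
  interpret N: graded_group N "mgrade N" using N by (rule graded_moduleD)
  interpret NN: module R N using N by (rule graded_moduleD)
  note ul = gr_homD(2)[OF u]
  have "u (mcomp M g x) = \<zero>\<^bsub>N\<^esub>" if "x \<in> carrier M" "u x = \<zero>\<^bsub>N\<^esub>" for g x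
    using gr_hom_component[OF M N u that(1), of g] that(2) by simp
  then show ?thesis
    using linear_mapD[OF ul] linear_map_zero[OF M N ul]
    by (simp add: graded_submodule_def a_kernel_def')
qed

lemma image_graded_submodule:
  assumes M: "graded_module R M" and N: "graded_module R N" and u: "u \<in> gr_hom R M N"
  shows "graded_submodule R N (u ` carrier M)"
proof -
  interpret M: graded_group M "mgrade M" using M by (rule graded_moduleD)
  interpret MM: module R M using M by (rule graded_moduleD)
  note ul = gr_homD(2)[OF u]
  show ?thesis
    unfolding graded_submodule_def
  proof (intro conjI ballI allI)
    show "\<zero>\<^bsub>N\<^esub> \<in> u ` carrier M"
      using linear_map_zero[OF M N ul, symmetric] M.zero_closed by (rule image_eqI)
    show "u ` carrier M \<subseteq> carrier N" using linear_mapD(2)[OF ul] by (rule image_subsetI)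
  next
    fix x y assume "x \<in> u ` carrier M" "y \<in> u ` carrier M"
    then obtain x' y' where xy: "x = u x'" "y = u y'" "x' \<in> carrier M" "y' \<in> carrier M" by blast
    show "x \<oplus>\<^bsub>N\<^esub> y \<in> u ` carrier M"
      unfolding xy using linear_mapD(3)[OF ul xy(3,4), symmetric] M.a_closed[OF xy(3,4)] by (rule image_eqI)
  next
    fix r x assume r: "r \<in> carrier R" and "x \<in> u ` carrier M"
    then obtain x' where x: "x = u x'" "x' \<in> carrier M" by blast
    show "r \<odot>\<^bsub>N\<^esub> x \<in> u ` carrier M"
      unfolding x using linear_mapD(4)[OF ul r x(2), symmetric] MM.smult_closed[OF r x(2)] by (rule image_eqI)
  next
    fix g x assume "x \<in> u ` carrier M"
    then obtain x' where x: "x = u x'" "x' \<in> carrier M" by blast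
    show "mcomp N g x \<in> u ` carrier M"
      unfolding x using gr_hom_component[OF M N u x(2)] M.component_closed[OF x(2)] by (rule image_eqI)
  qed
qed

lemma gr_hom_into_submod:
  assumes "u \<in> gr_hom R M N" "u ` carrier M \<subseteq> Z" "graded_module R M"
  shows "u \<in> gr_hom R M (submod N Z)"
proof -
  interpret M: graded_group M "mgrade M" using assms(3) by (rule graded_moduleD)
  have "u x \<in> Z" if "x \<in> mgrade M g" for x g using assms(2) M.D_carrier[OF that] by blast
  then show ?thesis using assms(1,2)
    by (simp add: gr_hom_iff linear_map_def additive_map_def image_subset_iff)
qed

subsection \<open>Cosets\<close>

lemma coset_mem: "y \<in> K +>\<^bsub>M\<^esub> x \<longleftrightarrow> (\<exists>k\<in>K. y = k \<oplus>\<^bsub>M\<^esub> x)"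
  by (auto simp: a_r_coset_def')

lemma coset_submod [simp]: "K +>\<^bsub>submod M Z\<^esub> x = K +>\<^bsub>M\<^esub> x"
  by (simp add: a_r_coset_def')

lemma coset_self:
  assumes "abelian_group M" "additive_subgroup K M" "x \<in> carrier M" shows "x \<in> K +>\<^bsub>M\<^esub> x"
proof -
  interpret abelian_group M by fact
  show ?thesis using assms additive_subgroup.zero_closed[OF assms(2)]
    by (auto simp: coset_mem intro!: bexI[of _ "\<zero>\<^bsub>M\<^esub>"])
qed

lemma coset_eqI:
  assumes M: "abelian_group M" and K: "additive_subgroup K M" and x: "x \<in> carrier M" "k \<in> K" "y = k \<oplus>\<^bsub>M\<^esub> x"
  shows "K +>\<^bsub>M\<^esub> y = K +>\<^bsub>M\<^esub> x"
proof -
  interpret abelian_group M by fact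
  have kc: "k \<in> carrier M" "\<And>l. l \<in> K \<Longrightarrow> l \<in> carrier M" using additive_subgroup.a_Hcarr[OF K] x by auto
  have "l \<oplus>\<^bsub>M\<^esub> y \<in> K +>\<^bsub>M\<^esub> x" if "l \<in> K" for l
    using that x kc additive_subgroup.a_closed[OF K that x(2)] a_assoc[of l k x] coset_mem by metis
  moreover have "l \<oplus>\<^bsub>M\<^esub> x \<in> K +>\<^bsub>M\<^esub> y" if "l \<in> K" for l
  proof -
    have "(l \<ominus>\<^bsub>M\<^esub> k) \<oplus>\<^bsub>M\<^esub> y = l \<oplus>\<^bsub>M\<^esub> x"
      using that x kc by (simp add: a_minus_def a_assoc r_neg2 r_neg1)
    moreover have "l \<ominus>\<^bsub>M\<^esub> k \<in> K"
      using that x additive_subgroup.a_closed[OF K] additive_subgroup.a_inv_closed[OF K]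
      by (simp add: a_minus_def)
    ultimately show ?thesis by (metis coset_mem)
  qed
  ultimately show ?thesis by (fastforce simp: coset_mem)
qed

lemma coset_eq_zero:
  assumes M: "abelian_group M" and K: "additive_subgroup K M" and x: "x \<in> carrier M"
  shows "K +>\<^bsub>M\<^esub> x = K \<longleftrightarrow> x \<in> K"
proof -
  interpret abelian_group M by fact
  have K0: "K +>\<^bsub>M\<^esub> \<zero>\<^bsub>M\<^esub> = K"
    using additive_subgroup.a_Hcarr[OF K] by (auto simp: coset_mem set_eq_iff)
  show ?thesis
  proof
    assume "K +>\<^bsub>M\<^esub> x = K" then show "x \<in> K" using coset_self[OF M K x] by simp
  next
    assume "x \<in> K" then show "K +>\<^bsub>M\<^esub> x = K"
      using coset_eqI[OF M K, of "\<zero>\<^bsub>M\<^esub>" x x] x K0 by simp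
  qed
qed

text \<open>Operations on cosets are written as unions over the representatives; when the summands agree
  the union collapses to the value at any representative.\<close>

lemma coset_UN:
  assumes M: "abelian_group M" and K: "additive_subgroup K M" and N: "abelian_group N"
    and L: "additive_subgroup L N" and Z: "additive_subgroup Z M" "K \<subseteq> Z"
    and f: "\<And>x y. x \<in> Z \<Longrightarrow> y \<in> Z \<Longrightarrow> \<phi> (x \<oplus>\<^bsub>M\<^esub> y) = \<phi> x \<oplus>\<^bsub>N\<^esub> \<phi> y" "\<And>x. x \<in> Z \<Longrightarrow> \<phi> x \<in> carrier N"
      "\<And>x. x \<in> K \<Longrightarrow> \<phi> x \<in> L" and x: "x \<in> Z"
  shows "(\<Union>z\<in>K +>\<^bsub>M\<^esub> x. L +>\<^bsub>N\<^esub> \<phi> z) = L +>\<^bsub>N\<^esub> \<phi> x"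
proof -
  have xc: "x \<in> carrier M" using additive_subgroup.a_Hcarr[OF Z(1) x] .
  have "L +>\<^bsub>N\<^esub> \<phi> z = L +>\<^bsub>N\<^esub> \<phi> x" if z: "z \<in> K +>\<^bsub>M\<^esub> x" for z
  proof -
    obtain k where k: "k \<in> K" "z = k \<oplus>\<^bsub>M\<^esub> x" using z by (auto simp: coset_mem)
    then have "\<phi> z = \<phi> k \<oplus>\<^bsub>N\<^esub> \<phi> x" using f(1) x Z(2) by blast
    then show ?thesis using coset_eqI[OF N L f(2)[OF x] f(3)[OF k(1)]] by simp
  qed
  then show ?thesis using coset_self[OF M K xc] by blast
qed

lemma graded_moduleI:
  assumes R: "graded_cring R" and mo: "module R M" and gr: "grading M (mgrade M)"
    and sm: "\<And>g h r x. r \<in> rgrade R g \<Longrightarrow> x \<in> mgrade M h \<Longrightarrow> r \<odot>\<^bsub>M\<^esub> x \<in> mgrade M (g + h)"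
  shows "graded_module R M"
  using assms by (simp add: graded_module_def)

lemma carrier_subgroup: "abelian_group M \<Longrightarrow> additive_subgroup (carrier M) M"
proof -
  assume "abelian_group M"
  then interpret abelian_group M .
  show ?thesis by (rule additive_subgroupI) (simp_all add: abelian_group_axioms)
qed

text \<open>Gradings pass to quotients by homogeneous kernels. This serves both for quotient modules and
  for isomorphic copies.\<close>

lemma grading_image:
  fixes A :: "('a, 'm) ring_scheme" and B :: "('b, 'n) ring_scheme"
  assumes A: "graded_group A D" and B: "abelian_group B" and q: "additive_map A B q"
    and surj: "q ` carrier A = carrier B"
    and ker: "\<And>x g. x \<in> carrier A \<Longrightarrow> q x = \<zero>\<^bsub>B\<^esub> \<Longrightarrow> q (component A D g x) = \<zero>\<^bsub>B\<^esub>"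
  shows "grading B (\<lambda>g. q ` D g)"
proof -
  interpret A: graded_group A D by fact
  interpret B: abelian_group B by fact
  note AA = A.abelian_group_axioms
  have qc: "q x \<in> carrier B" if "x \<in> carrier A" for x using q that by (simp add: additive_map_def)
  have qa: "q (x \<oplus>\<^bsub>A\<^esub> y) = q x \<oplus>\<^bsub>B\<^esub> q y" if "x \<in> carrier A" "y \<in> carrier A" for x y
    using q that by (simp add: additive_map_def)
  note q0 = additive_map_zero[OF AA B q]
  note qm = additive_map_minus[OF AA B q]
  define r where "r y = inv_into (carrier A) q y" for y
  have r: "r y \<in> carrier A" "q (r y) = y" if "y \<in> carrier B" for y
    using that surj unfolding r_def by (auto intro: inv_into_into f_inv_into_f)
  define p where "p g y = q (component A D g (r y))" for g y
  have pq: "p g (q x) = q (component A D g x)" if x: "x \<in> carrier A" for g x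
  proof -
    have rx: "r (q x) \<in> carrier A" "q (r (q x)) = q x" using r qc x by auto
    let ?y = "r (q x)"
    have "q (?y \<oplus>\<^bsub>A\<^esub> \<ominus>\<^bsub>A\<^esub> x) = \<zero>\<^bsub>B\<^esub>" using rx x qc by (simp add: qa qm B.r_neg)
    then have "q (component A D g (?y \<oplus>\<^bsub>A\<^esub> \<ominus>\<^bsub>A\<^esub> x)) = \<zero>\<^bsub>B\<^esub>" using ker rx x by simp
    moreover have "component A D g (\<ominus>\<^bsub>A\<^esub> x) = \<ominus>\<^bsub>A\<^esub> component A D g x"
      using additive_map_minus[OF AA AA A.component_additive x] .
    ultimately have "q (component A D g ?y) \<oplus>\<^bsub>B\<^esub> \<ominus>\<^bsub>B\<^esub> q (component A D g x) = \<zero>\<^bsub>B\<^esub>"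
      using rx x by (simp add: A.component_add qa qm)
    then show ?thesis unfolding p_def using qc[OF A.component_closed[OF rx(1)]] qc[OF A.component_closed[OF x]]
      by (metis B.add.inv_solve_right' B.l_zero B.zero_closed)
  qed
  have ob: "\<exists>x\<in>carrier A. y = q x" if "y \<in> carrier B" for y using that surj by blast
  show ?thesis
  proof (rule gradingI(1)[OF B, where p = p])
    show "additive_subgroup (q ` D g) B" for g
    proof (rule additive_subgroupI[OF B])
      show "q ` D g \<subseteq> carrier B" using qc A.D_carrier by blast
      show "\<zero>\<^bsub>B\<^esub> \<in> q ` D g" using q0[symmetric] A.D_zero by (rule image_eqI)
    next
      fix x y assume "x \<in> q ` D g" "y \<in> q ` D g"
      then obtain x' y' where xy: "x = q x'" "y = q y'" "x' \<in> D g" "y' \<in> D g" by blast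
      show "x \<oplus>\<^bsub>B\<^esub> y \<in> q ` D g"
        unfolding xy using qa[symmetric] xy(3,4) A.D_add by (intro image_eqI[of _ _ "x' \<oplus>\<^bsub>A\<^esub> y'"]) auto
    next
      fix x assume "x \<in> q ` D g"
      then obtain x' where x: "x = q x'" "x' \<in> D g" by blast
      show "\<ominus>\<^bsub>B\<^esub> x \<in> q ` D g"
        unfolding x using qm x(2) A.D_minus by (intro image_eqI[of _ _ "\<ominus>\<^bsub>A\<^esub> x'"]) auto
    qed
  next
    fix y g assume y: "y \<in> carrier B"
    then obtain x where x: "x \<in> carrier A" "y = q x" using ob by blast
    show "p g y \<in> q ` D g" unfolding x(2) pq[OF x(1)] using A.component_in[OF x(1)] by blast
  next
    fix g y z assume "y \<in> carrier B" "z \<in> carrier B"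
    then obtain y' z' where "y' \<in> carrier A" "z' \<in> carrier A" "y = q y'" "z = q z'" using ob by blast
    then show "p g (y \<oplus>\<^bsub>B\<^esub> z) = p g y \<oplus>\<^bsub>B\<^esub> p g z"
      by (simp add: qa[symmetric] pq A.component_add)
  next
    fix y assume "y \<in> carrier B"
    then obtain x where x: "x \<in> carrier A" "y = q x" using ob by blast
    let ?F = "{g. component A D g x \<noteq> \<zero>\<^bsub>A\<^esub>}"
    have sub: "{g. p g y \<noteq> \<zero>\<^bsub>B\<^esub>} \<subseteq> ?F" using pq[OF x(1)] q0 x(2) by auto
    then show "finite {g. p g y \<noteq> \<zero>\<^bsub>B\<^esub>}" using A.component_finite[OF x(1)] finite_subset by blast
    have "y = finsum B (\<lambda>g. q (component A D g x)) ?F"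
      using additive_map_finsum_group[OF AA B q A.component_finite[OF x(1)], of "\<lambda>g. component A D g x"]
        A.component_sum'[OF x(1)] x by simp
    also have "\<dots> = finsum B (\<lambda>g. p g y) {g. p g y \<noteq> \<zero>\<^bsub>B\<^esub>}"
      using sub A.component_finite[OF x(1)] pq[OF x(1)] x qc
      by (intro B.add.finprod_mono_neutral_cong_right) auto
    finally show "finsum B (\<lambda>g. p g y) {g. p g y \<noteq> \<zero>\<^bsub>B\<^esub>} = y" by simp
  next
    fix g y assume "y \<in> q ` D g"
    then obtain x where x: "x \<in> D g" "y = q x" by blast
    show "p g y = y" using pq[OF A.D_carrier[OF x(1)], of g] A.component_self[OF x(1)] x(2) by simp
  next
    fix g k y assume "y \<in> q ` D k" and gk: "g \<noteq> k"
    then obtain x where x: "x \<in> D k" "y = q x" by blast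
    show "p g y = \<zero>\<^bsub>B\<^esub>"
      using pq[OF A.D_carrier[OF x(1)], of g] A.component_homog[OF x(1), of g] x(2) gk q0 by simp
  qed
qed

lemma graded_module_image:
  fixes M :: "('r, 'm, 'g::ab_group_add) gmod" and N :: "('r, 'n, 'g) gmod"
  assumes R: "graded_cring R" and M: "graded_module R M"
    and surj: "carrier N = q ` carrier M" and deg: "\<And>g. mgrade N g = q ` mgrade M g"
    and qa: "\<And>x y. x \<in> carrier M \<Longrightarrow> y \<in> carrier M \<Longrightarrow> q x \<oplus>\<^bsub>N\<^esub> q y = q (x \<oplus>\<^bsub>M\<^esub> y)"
    and qs: "\<And>r x. r \<in> carrier R \<Longrightarrow> x \<in> carrier M \<Longrightarrow> r \<odot>\<^bsub>N\<^esub> q x = q (r \<odot>\<^bsub>M\<^esub> x)"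
    and q0: "\<zero>\<^bsub>N\<^esub> = q \<zero>\<^bsub>M\<^esub>"
    and ker: "\<And>x g. x \<in> carrier M \<Longrightarrow> q x = \<zero>\<^bsub>N\<^esub> \<Longrightarrow> q (mcomp M g x) = \<zero>\<^bsub>N\<^esub>"
  shows "graded_module R N"
proof -
  interpret M: graded_group M "mgrade M" using M by (rule graded_moduleD)
  interpret MM: module R M using M by (rule graded_moduleD)
  have inv: "\<exists>y\<in>carrier N. y \<oplus>\<^bsub>N\<^esub> x = \<zero>\<^bsub>N\<^esub>" if "x \<in> carrier N" for x
  proof -
    from that obtain x' where x': "x' \<in> carrier M" "x = q x'" by (auto simp: surj)
    have "q (\<ominus>\<^bsub>M\<^esub> x') \<oplus>\<^bsub>N\<^esub> x = \<zero>\<^bsub>N\<^esub>" using x' by (simp add: qa q0 M.l_neg)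
    moreover have "q (\<ominus>\<^bsub>M\<^esub> x') \<in> carrier N" unfolding surj using x' by simp
    ultimately show ?thesis by blast
  qed
  have ag: "abelian_group N"
  proof (rule abelian_groupI)
    show "\<exists>y\<in>carrier N. y \<oplus>\<^bsub>N\<^esub> x = \<zero>\<^bsub>N\<^esub>" if "x \<in> carrier N" for x using inv[OF that] .
  qed (auto simp: surj qa q0 M.a_ac)
  have mo: "module R N"
    by (rule moduleI)
      (auto simp: surj qs qa MM.R.is_cring ag MM.smult_l_distr MM.smult_r_distr MM.smult_assoc1)
  have "grading N (\<lambda>g. q ` mgrade M g)"
  proof (rule grading_image[OF _ ag _ surj[symmetric] ker])
    show "graded_group M (mgrade M)" ..
    show "additive_map M N q" by (simp add: additive_map_def surj qa)
  qed
  moreover have "r \<odot>\<^bsub>N\<^esub> y \<in> mgrade N (g + h)" if r: "r \<in> rgrade R g" and y: "y \<in> mgrade N h" for r y g h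
  proof -
    obtain x where x: "x \<in> mgrade M h" "y = q x" using y deg by blast
    have "r \<in> carrier R" using graded_group.D_carrier[OF graded_cringD(2)[OF R] r] .
    then show ?thesis using graded_moduleD(5)[OF M r x(1)] M.D_carrier[OF x(1)] x(2) by (simp add: qs deg)
  qed
  moreover have "mgrade N = (\<lambda>g. q ` mgrade M g)" using deg by auto
  ultimately show ?thesis using mo by (intro graded_moduleI[OF R]) auto
qed

subsection \<open>Quotients\<close>

lemma quotmod_carrier: "carrier (quotmod M K) = (\<lambda>x. K +>\<^bsub>M\<^esub> x) ` carrier M"
  by (auto simp: quotmod_def A_RCOSETS_def')

lemma quotmod_add:
  assumes M: "abelian_group M" and K: "additive_subgroup K M" and xy: "x \<in> carrier M" "y \<in> carrier M"
  shows "(K +>\<^bsub>M\<^esub> x) \<oplus>\<^bsub>quotmod M K\<^esub> (K +>\<^bsub>M\<^esub> y) = K +>\<^bsub>M\<^esub> (x \<oplus>\<^bsub>M\<^esub> y)"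
  using abelian_subgroup.a_rcos_sum[OF abelian_subgroupI3[OF K M] xy] by (simp add: quotmod_def)

lemma quotmod_smult:
  assumes M: "graded_module R M" and K: "graded_submodule R M K" and r: "r \<in> carrier R" "x \<in> carrier M"
  shows "r \<odot>\<^bsub>quotmod M K\<^esub> (K +>\<^bsub>M\<^esub> x) = K +>\<^bsub>M\<^esub> (r \<odot>\<^bsub>M\<^esub> x)"
proof -
  interpret module R M using M by (rule graded_moduleD)
  note ag = graded_moduleD(3)[OF M] and Ks = graded_submodule_subgroup[OF M K]
  show ?thesis
    unfolding quotmod_def
    by simp (rule coset_UN[OF ag Ks ag Ks carrier_subgroup[OF ag]],
        use r graded_submoduleD(1,4)[OF K] in \<open>simp_all add: smult_r_distr\<close>)
qed

lemma
  fixes M :: "('r, 'm, 'g::ab_group_add) gmod"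
  assumes R: "graded_cring R" and M: "graded_module R M" and K: "graded_submodule R M K"
  shows quotmod_graded_module: "graded_module R (quotmod M K)"
    and quotmod_projection: "(\<lambda>x\<in>carrier M. K +>\<^bsub>M\<^esub> x) \<in> gr_hom R M (quotmod M K)"
proof -
  interpret M: graded_group M "mgrade M" using M by (rule graded_moduleD)
  interpret MM: module R M using M by (rule graded_moduleD)
  note ag = graded_moduleD(3)[OF M] and Ks = graded_submodule_subgroup[OF M K]
  note qa = quotmod_add[OF ag Ks] and qs = quotmod_smult[OF M K]
  have z: "\<zero>\<^bsub>quotmod M K\<^esub> = K" by (simp add: quotmod_def)
  have dg: "mgrade (quotmod M K) g = (\<lambda>x. K +>\<^bsub>M\<^esub> x) ` mgrade M g" for g by (auto simp: quotmod_def)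
  show "graded_module R (quotmod M K)"
  proof (rule graded_module_image[OF R M quotmod_carrier dg qa qs])
    show "\<zero>\<^bsub>quotmod M K\<^esub> = K +>\<^bsub>M\<^esub> \<zero>\<^bsub>M\<^esub>"
      using coset_eq_zero[OF ag Ks M.zero_closed] graded_submoduleD(2)[OF K] z by simp
    show "K +>\<^bsub>M\<^esub> mcomp M g x = \<zero>\<^bsub>quotmod M K\<^esub>" if "x \<in> carrier M" "K +>\<^bsub>M\<^esub> x = \<zero>\<^bsub>quotmod M K\<^esub>" for x g
      using that graded_submoduleD(5)[OF K, of x g] coset_eq_zero[OF ag Ks] z by simp
  qed
  show "(\<lambda>x\<in>carrier M. K +>\<^bsub>M\<^esub> x) \<in> gr_hom R M (quotmod M K)"
    by (rule gr_hom_restrict[OF M]) (auto simp: linear_map_def additive_map_def quotmod_carrier qa qs dg)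
qed

subsection \<open>Copies\<close>

text \<open>Transport of structure along an injection. Projective modules and resolutions have their elements
  in one fixed type, so modules constructed in other types are copied into it.\<close>

definition copymod :: "('m \<Rightarrow> 'n) \<Rightarrow> ('r, 'm, 'g) gmod \<Rightarrow> ('r, 'n, 'g) gmod" where
  "copymod f M = (let i = inv_into (carrier M) f in
     \<lparr>carrier = f ` carrier M, mult = undefined, one = undefined, ring.zero = f \<zero>\<^bsub>M\<^esub>,
      add = \<lambda>x y. f (i x \<oplus>\<^bsub>M\<^esub> i y), smult = \<lambda>r x. f (r \<odot>\<^bsub>M\<^esub> i x), mgrade = \<lambda>g. f ` mgrade M g\<rparr>)"

lemma
  fixes M :: "('r, 'm, 'g::ab_group_add) gmod" and f :: "'m \<Rightarrow> 'n"
  assumes R: "graded_cring R" and M: "graded_module R M" and f: "inj_on f (carrier M)"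
  shows copymod_graded_module: "graded_module R (copymod f M)"
    and copymod_to: "(\<lambda>x\<in>carrier M. f x) \<in> gr_hom R M (copymod f M)"
    and copymod_from: "(\<lambda>y\<in>f ` carrier M. inv_into (carrier M) f y) \<in> gr_hom R (copymod f M) M"
    and copymod_carrier: "carrier (copymod f M) = f ` carrier M"
proof -
  interpret M: graded_group M "mgrade M" using M by (rule graded_moduleD)
  interpret MM: module R M using M by (rule graded_moduleD)
  let ?N = "copymod f M"
  have c: "carrier ?N = f ` carrier M" and dg: "mgrade ?N g = f ` mgrade M g" and z: "\<zero>\<^bsub>?N\<^esub> = f \<zero>\<^bsub>M\<^esub>" for g
    by (simp_all add: copymod_def Let_def)
  have a: "f x \<oplus>\<^bsub>?N\<^esub> f y = f (x \<oplus>\<^bsub>M\<^esub> y)" if "x \<in> carrier M" "y \<in> carrier M" for x y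
    using that f by (simp add: copymod_def Let_def)
  have s: "r \<odot>\<^bsub>?N\<^esub> f x = f (r \<odot>\<^bsub>M\<^esub> x)" if "x \<in> carrier M" for x r
    using that f by (simp add: copymod_def Let_def)
  show N: "graded_module R ?N"
  proof (rule graded_module_image[OF R M c dg a s z])
    show "f (mcomp M g x) = \<zero>\<^bsub>?N\<^esub>" if "x \<in> carrier M" "f x = \<zero>\<^bsub>?N\<^esub>" for x g
      using inj_onD[OF f, of x "\<zero>\<^bsub>M\<^esub>"] that z by simp
  qed
  show "carrier ?N = f ` carrier M" by (rule c)
  show "(\<lambda>x\<in>carrier M. f x) \<in> gr_hom R M ?N"
    by (rule gr_hom_restrict[OF M]) (auto simp: linear_map_def additive_map_def c a s dg)
  have "(\<lambda>y\<in>carrier ?N. inv_into (carrier M) f y) \<in> gr_hom R ?N M"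
    by (rule gr_hom_restrict[OF N]) (auto simp: linear_map_def additive_map_def c a s dg f)
  then show "(\<lambda>y\<in>f ` carrier M. inv_into (carrier M) f y) \<in> gr_hom R ?N M" unfolding c .
qed

subsection \<open>Direct sums\<close>

definition direct_sum :: "('r, 'm, 'g) gmod \<Rightarrow> ('r, 'n, 'g) gmod \<Rightarrow> ('r, 'm \<times> 'n, 'g) gmod" where
  "direct_sum M N = \<lparr>carrier = carrier M \<times> carrier N, mult = undefined, one = undefined,
     ring.zero = (\<zero>\<^bsub>M\<^esub>, \<zero>\<^bsub>N\<^esub>), add = (\<lambda>(x, y) (x', y'). (x \<oplus>\<^bsub>M\<^esub> x', y \<oplus>\<^bsub>N\<^esub> y')),
     smult = (\<lambda>r (x, y). (r \<odot>\<^bsub>M\<^esub> x, r \<odot>\<^bsub>N\<^esub> y)), mgrade = (\<lambda>g. mgrade M g \<times> mgrade N g)\<rparr>"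

lemma direct_sum_simps [simp]:
  "carrier (direct_sum M N) = carrier M \<times> carrier N" "ring.zero (direct_sum M N) = (\<zero>\<^bsub>M\<^esub>, \<zero>\<^bsub>N\<^esub>)"
  "(x, y) \<oplus>\<^bsub>direct_sum M N\<^esub> (x', y') = (x \<oplus>\<^bsub>M\<^esub> x', y \<oplus>\<^bsub>N\<^esub> y')"
  "r \<odot>\<^bsub>direct_sum M N\<^esub> (x, y) = (r \<odot>\<^bsub>M\<^esub> x, r \<odot>\<^bsub>N\<^esub> y)" "mgrade (direct_sum M N) g = mgrade M g \<times> mgrade N g"
  by (simp_all add: direct_sum_def)

lemma direct_sum_graded_module:
  fixes M :: "('r, 'm, 'g::ab_group_add) gmod" and N :: "('r, 'n, 'g) gmod"
  assumes R: "graded_cring R" and M: "graded_module R M" and N: "graded_module R N"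
  shows "graded_module R (direct_sum M N)"
proof -
  interpret M: graded_group M "mgrade M" using M by (rule graded_moduleD)
  interpret MM: module R M using M by (rule graded_moduleD)
  interpret N: graded_group N "mgrade N" using N by (rule graded_moduleD)
  interpret NN: module R N using N by (rule graded_moduleD)
  let ?S = "direct_sum M N"
  have "\<exists>y\<in>carrier ?S. y \<oplus>\<^bsub>?S\<^esub> x = \<zero>\<^bsub>?S\<^esub>" if "x \<in> carrier ?S" for x
    using that
    by (cases x) (auto intro!: bexI[of _ "(\<ominus>\<^bsub>M\<^esub> fst x, \<ominus>\<^bsub>N\<^esub> snd x)"] simp: M.l_neg N.l_neg)
  then have ag: "abelian_group ?S"
    by (intro abelian_groupI) (auto simp: M.a_ac N.a_ac)
  interpret S: abelian_group ?S by (rule ag)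
  have mo: "module R ?S"
    by (rule moduleI)
      (auto simp: MM.R.is_cring ag MM.smult_l_distr MM.smult_r_distr MM.smult_assoc1
        NN.smult_l_distr NN.smult_r_distr NN.smult_assoc1)
  have mi: "\<ominus>\<^bsub>?S\<^esub> (x, y) = (\<ominus>\<^bsub>M\<^esub> x, \<ominus>\<^bsub>N\<^esub> y)" if "x \<in> carrier M" "y \<in> carrier N" for x y
    using that by (intro S.minus_equality) (auto simp: M.l_neg N.l_neg)
  have sub: "additive_subgroup (mgrade ?S g) ?S" for g
    by (rule additive_subgroupI[OF ag]) (auto simp: mi M.D_add N.D_add M.D_minus N.D_minus)
  have fs: "finsum ?S f F = (finsum M (\<lambda>i. fst (f i)) F, finsum N (\<lambda>i. snd (f i)) F)"
    if "finite F" "\<And>i. i \<in> F \<Longrightarrow> f i \<in> carrier ?S" for F and f :: "'g \<Rightarrow> _"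
  proof -
    have 1: "fst (finsum ?S f F) = finsum M (\<lambda>i. fst (f i)) F"
      by (rule additive_map_finsum_group[OF ag M.abelian_group_axioms])
        (use that in \<open>auto simp: additive_map_def\<close>)
    have 2: "snd (finsum ?S f F) = finsum N (\<lambda>i. snd (f i)) F"
      by (rule additive_map_finsum_group[OF ag N.abelian_group_axioms])
        (use that in \<open>auto simp: additive_map_def\<close>)
    show ?thesis using 1 2 by (metis prod.collapse)
  qed
  let ?p = "\<lambda>g z. (mcomp M g (fst z), mcomp N g (snd z))"
  have "grading ?S (mgrade ?S)"
  proof (rule gradingI(1)[OF ag sub, where p = ?p])
    fix z assume "z \<in> carrier ?S"
    then obtain x y where z: "z = (x, y)" "x \<in> carrier M" "y \<in> carrier N" by auto
    let ?F = "{g. mcomp M g x \<noteq> \<zero>\<^bsub>M\<^esub>} \<union> {g. mcomp N g y \<noteq> \<zero>\<^bsub>N\<^esub>}"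
    have F: "finite ?F" using M.component_finite[OF z(2)] N.component_finite[OF z(3)] by simp
    have eq: "{g. ?p g z \<noteq> \<zero>\<^bsub>?S\<^esub>} = ?F" using z by auto
    show "finite {g. ?p g z \<noteq> \<zero>\<^bsub>?S\<^esub>}" using F eq by simp
    show "finsum ?S (\<lambda>g. ?p g z) {g. ?p g z \<noteq> \<zero>\<^bsub>?S\<^esub>} = z"
      unfolding eq using F z M.component_sum[OF z(2) F] N.component_sum[OF z(3) F]
      by (subst fs) auto
  qed (auto simp: M.component_in N.component_in M.component_add N.component_add M.component_homog
      N.component_homog)
  then show ?thesis
    using mo graded_moduleD(5)[OF M] graded_moduleD(5)[OF N] by (intro graded_moduleI[OF R]) auto
qed

section \<open>Coarsening\<close>

lemma (in abelian_monoid) finsum_partition: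
  assumes F: "finite F" and f: "\<And>g. g \<in> F \<Longrightarrow> f g \<in> carrier G"
  shows "finsum G (\<lambda>h. finsum G f {g \<in> F. \<psi> g = h}) (\<psi> ` F) = finsum G f F"
proof -
  have "finsum G f (\<Union>h\<in>\<psi> ` F. {g \<in> F. \<psi> g = h}) = finsum G (\<lambda>h. finsum G f {g \<in> F. \<psi> g = h}) (\<psi> ` F)"
    by (rule add.finprod_UN_disjoint) (use F f in \<open>auto simp: pairwise_def disjnt_def\<close>)
  moreover have "(\<Union>h\<in>\<psi> ` F. {g \<in> F. \<psi> g = h}) = F" by auto
  ultimately show ?thesis by simp
qed

context graded_group
begin

text \<open>A vanishing condition on the fine components is easier to use than the existence of a finite
  decomposition, by which \<open>coarse_grade\<close> is defined.\<close>

lemma coarse_grade_iff: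
  "x \<in> coarse_grade A \<psi> D h \<longleftrightarrow> x \<in> carrier A \<and> (\<forall>g. \<psi> g \<noteq> h \<longrightarrow> component A D g x = \<zero>)"
proof
  assume "x \<in> coarse_grade A \<psi> D h"
  then obtain c F where F: "finite F" "F \<subseteq> \<psi> -` {h}" "\<forall>g\<in>F. c g \<in> D g" "x = finsum A c F"
    by (auto simp: coarse_grade_def)
  have "x \<in> carrier A" unfolding F(4) using F(3) by (auto intro!: finsum_closed)
  then show "x \<in> carrier A \<and> (\<forall>g. \<psi> g \<noteq> h \<longrightarrow> component A D g x = \<zero>)"
    using component_unique[of F c x] F by auto
next
  assume x: "x \<in> carrier A \<and> (\<forall>g. \<psi> g \<noteq> h \<longrightarrow> component A D g x = \<zero>)"
  then have "x = finsum A (\<lambda>g. component A D g x) {g. component A D g x \<noteq> \<zero>}"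
    using component_sum' by blast
  then show "x \<in> coarse_grade A \<psi> D h"
    using x component_in[of x] component_finite[of x] unfolding coarse_grade_def
    by (intro CollectI exI[of _ "\<lambda>g. component A D g x"] exI[of _ "{g. component A D g x \<noteq> \<zero>}"]) auto
qed

lemma coarse_gradeI: "x \<in> D g \<Longrightarrow> \<psi> g = h \<Longrightarrow> x \<in> coarse_grade A \<psi> D h"
  by (auto simp: coarse_grade_iff component_homog)

lemma coarse_subgroup: "additive_subgroup (coarse_grade A \<psi> D h) A"
  using additive_map_minus[OF abelian_group_axioms abelian_group_axioms component_additive]
  by (intro additive_subgroupI[OF abelian_group_axioms]) (auto simp: coarse_grade_iff component_add)

lemma coarse_grade_induct [consumes 1, case_names zero homog add]:
  assumes x: "x \<in> coarse_grade A \<psi> D h" and z: "P \<zero>"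
    and h: "\<And>g x. \<psi> g = h \<Longrightarrow> x \<in> D g \<Longrightarrow> P x"
    and a: "\<And>x y. x \<in> carrier A \<Longrightarrow> y \<in> carrier A \<Longrightarrow> P x \<Longrightarrow> P y \<Longrightarrow> P (x \<oplus> y)"
  shows "P x"
proof -
  obtain c F where F: "finite F" "F \<subseteq> \<psi> -` {h}" "\<forall>g\<in>F. c g \<in> D g" "x = finsum A c F"
    using x by (auto simp: coarse_grade_def)
  from F(1-3) have "P (finsum A c F)"
  proof (induction F)
    case empty then show ?case using z by simp
  next
    case (insert g F)
    have cc: "c \<in> F \<rightarrow> carrier A" "c g \<in> carrier A" using insert.prems by auto
    have "P (c g)" using h insert.prems by auto
    moreover have "P (finsum A c F)" using insert by auto
    ultimately show ?case using a insert(1,2) cc by simp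
  qed
  then show ?thesis using F(4) by simp
qed

lemma carrier_induct [consumes 1, case_names zero homog add]:
  assumes x: "x \<in> carrier A" and "P \<zero>" "\<And>g x. x \<in> D g \<Longrightarrow> P x"
    and "\<And>x y. x \<in> carrier A \<Longrightarrow> y \<in> carrier A \<Longrightarrow> P x \<Longrightarrow> P y \<Longrightarrow> P (x \<oplus> y)"
  shows "P x"
  by (rule coarse_grade_induct[of x "\<lambda>_. ()" "()" P]) (use assms in \<open>auto simp: coarse_grade_iff\<close>)

text \<open>The projection to the coarse degree \<open>h\<close> is the sum of the projections to the degrees over \<open>h\<close>.\<close>

lemma coarse_grading: "grading A (coarse_grade A \<psi> D)"
  and coarse_component_sum: "x \<in> carrier A \<Longrightarrow> component A (coarse_grade A \<psi> D) h x =
    finsum A (\<lambda>g. component A D g x) {g. component A D g x \<noteq> \<zero> \<and> \<psi> g = h}"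
proof -
  define p where "p h x = finsum A (\<lambda>g. component A D g x) {g. component A D g x \<noteq> \<zero> \<and> \<psi> g = h}" for h x
  have pF: "p h x = finsum A (\<lambda>g. component A D g x) {g \<in> F. \<psi> g = h}"
    if "x \<in> carrier A" "finite F" "\<And>g. g \<notin> F \<Longrightarrow> component A D g x = \<zero>" for x F h
    unfolding p_def using that by (intro add.finprod_mono_neutral_cong_left) auto
  have pin: "p h x \<in> coarse_grade A \<psi> D h" if x: "x \<in> carrier A" for h x
    unfolding p_def coarse_grade_def using component_in[OF x] component_finite[OF x]
    by (intro CollectI exI[of _ "\<lambda>g. component A D g x"] exI[of _ "{g. component A D g x \<noteq> \<zero> \<and> \<psi> g = h}"]) auto
  have padd: "p h (x \<oplus> y) = p h x \<oplus> p h y" if xy: "x \<in> carrier A" "y \<in> carrier A" for h x y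
  proof -
    obtain F where F: "finite F" "\<And>z g. z \<in> {x, y, x \<oplus> y} \<Longrightarrow> g \<notin> F \<Longrightarrow> component A D g z = \<zero>"
      using finite_component_support[of "{x, y, x \<oplus> y}"] xy by auto
    show ?thesis
      using xy F by (simp add: pF[of _ F] component_add finsum_addf)
  qed
  have psupp: "finite {h. p h x \<noteq> \<zero>}" "{h. p h x \<noteq> \<zero>} \<subseteq> \<psi> ` {g. component A D g x \<noteq> \<zero>}"
    if x: "x \<in> carrier A" for x
  proof -
    have "p h x = \<zero>" if "h \<notin> \<psi> ` {g. component A D g x \<noteq> \<zero>}" for h
    proof -
      have *: "{g. component A D g x \<noteq> \<zero> \<and> \<psi> g = h} = {}" using that by auto
      show ?thesis unfolding p_def * by simp
    qed
    then show "{h. p h x \<noteq> \<zero>} \<subseteq> \<psi> ` {g. component A D g x \<noteq> \<zero>}" by blast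
    then show "finite {h. p h x \<noteq> \<zero>}" using component_finite[OF x] finite_subset by blast
  qed
  have psum: "finsum A (\<lambda>h. p h x) {h. p h x \<noteq> \<zero>} = x" if x: "x \<in> carrier A" for x
  proof -
    let ?F = "{g. component A D g x \<noteq> \<zero>}"
    have pc: "p h x \<in> carrier A" for h using pin[OF x] by (simp add: coarse_grade_iff)
    have "finsum A (\<lambda>h. p h x) {h. p h x \<noteq> \<zero>} = finsum A (\<lambda>h. p h x) (\<psi> ` ?F)"
      using psupp[OF x] pc component_finite[OF x] by (intro add.finprod_mono_neutral_cong_left) auto
    also have "\<dots> = finsum A (\<lambda>h. finsum A (\<lambda>g. component A D g x) {g \<in> ?F. \<psi> g = h}) (\<psi> ` ?F)"
      by (simp add: p_def)
    also have "\<dots> = finsum A (\<lambda>g. component A D g x) ?F"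
      using component_finite[OF x] x by (intro finsum_partition) auto
    also have "\<dots> = x" using component_sum'[OF x] by simp
    finally show ?thesis .
  qed
  have p1: "p h x = x" if x: "x \<in> coarse_grade A \<psi> D h" for h x
  proof -
    have "{g. component A D g x \<noteq> \<zero> \<and> \<psi> g = h} = {g. component A D g x \<noteq> \<zero>}"
      using x by (auto simp: coarse_grade_iff)
    then show ?thesis using x component_sum'[of x] by (simp add: p_def coarse_grade_iff)
  qed
  have p0: "p h x = \<zero>" if x: "x \<in> coarse_grade A \<psi> D k" and hk: "h \<noteq> k" for h k x
  proof -
    have *: "{g. component A D g x \<noteq> \<zero> \<and> \<psi> g = h} = {}" using x hk by (auto simp: coarse_grade_iff)
    show ?thesis unfolding p_def * by simp
  qed
  show "grading A (coarse_grade A \<psi> D)"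
    by (rule gradingI(1)[OF abelian_group_axioms coarse_subgroup, where p = p])
       (rule pin padd psupp(1) psum p1 p0; assumption)+
  show "component A (coarse_grade A \<psi> D) h x =
      finsum A (\<lambda>g. component A D g x) {g. component A D g x \<noteq> \<zero> \<and> \<psi> g = h}" if "x \<in> carrier A"
    unfolding p_def[symmetric]
    by (rule gradingI(2)[OF abelian_group_axioms, where p = p and D = "coarse_grade A \<psi> D"])
       ((rule coarse_subgroup pin padd psupp(1) psum p1 p0; assumption?) | simp add: that)+
qed

lemma coarse_graded_group: "graded_group A (coarse_grade A \<psi> D)"
  using coarse_grading by unfold_locales

lemma component_coarse_component:
  assumes x: "x \<in> carrier A"
  shows "component A D g (component A (coarse_grade A \<psi> D) h x) = (if \<psi> g = h then component A D g x else \<zero>)"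
  using component_unique[of "{g. component A D g x \<noteq> \<zero> \<and> \<psi> g = h}" "\<lambda>g. component A D g x"]
    coarse_component_sum[OF x, of \<psi> h] component_finite[OF x] component_in[OF x] by auto

end

lemma coarse_grade_cong:
  assumes "carrier A = carrier B" "add A = add B" "ring.zero A = ring.zero B"
  shows "coarse_grade A \<psi> D h = coarse_grade B \<psi> D h"
  using assms by (simp add: coarse_grade_def finsum_def finprod_def)

lemma coarsen_simps [simp]:
  "carrier (coarsen \<psi> M) = carrier M" "add (coarsen \<psi> M) = add M" "smult (coarsen \<psi> M) = smult M"
  "ring.zero (coarsen \<psi> M) = ring.zero M" "mgrade (coarsen \<psi> M) = coarse_grade M \<psi> (mgrade M)"
  "mult (coarsen \<psi> M) = mult M" "one (coarsen \<psi> M) = one M"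
  by (simp_all add: coarsen_def)

lemma coarsen_ring_simps [simp]:
  "carrier (coarsen_ring \<psi> R) = carrier R" "add (coarsen_ring \<psi> R) = add R"
  "mult (coarsen_ring \<psi> R) = mult R" "one (coarsen_ring \<psi> R) = one R"
  "ring.zero (coarsen_ring \<psi> R) = ring.zero R" "rgrade (coarsen_ring \<psi> R) = coarse_grade R \<psi> (rgrade R)"
  by (simp_all add: coarsen_ring_def)

lemma finsum_ops_cong:
  assumes "carrier A = carrier B" "add A = add B" "ring.zero A = ring.zero B"
  shows "finsum A = finsum B"
  using assms by (intro ext) (simp add: finsum_def finprod_def)

lemma ring_ops_cong:
  assumes "carrier A = carrier B" "add A = add B" "ring.zero A = ring.zero B"
  shows "finsum A c F = finsum B c F" "abelian_group A = abelian_group B" "additive_subgroup K A = additive_subgroup K B"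
    "a_r_coset A = a_r_coset B" "grading A D = grading B D" "component A D = component B D"
    "graded_group A D = graded_group B D"
proof -
  show "finsum A c F = finsum B c F" using assms by (simp add: finsum_def finprod_def)
  have "abelian_group B'" if "abelian_group A'" "carrier A' = carrier B'" "add A' = add B'" "ring.zero A' = ring.zero B'"
    for A' :: "('x, 'y) ring_scheme" and B' :: "('x, 'z) ring_scheme"
  proof -
    interpret abelian_group A' by fact
    show ?thesis
    proof (rule abelian_groupI)
      show "\<exists>y\<in>carrier B'. y \<oplus>\<^bsub>B'\<^esub> x = \<zero>\<^bsub>B'\<^esub>" if "x \<in> carrier B'" for x
        using l_neg[of x] a_inv_closed[of x] that unfolding \<open>carrier A' = _\<close> \<open>add A' = _\<close> \<open>ring.zero A' = _\<close> by blast
    qed (simp_all flip: that(2-) add: a_ac)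
  qed
  from this[of A B] this[of B A] assms show a: "abelian_group A = abelian_group B" by metis
  show s: "additive_subgroup K A = additive_subgroup K B" for K
    using assms by (simp add: additive_subgroup_def subgroup_def m_inv_def)
  show "a_r_coset A = a_r_coset B" using assms by (intro ext) (simp add: a_r_coset_def')
  note f' = finsum_ops_cong[OF assms]
  show g: "grading A D = grading B D" unfolding grading_def s assms f' ..
  show "component A D = component B D" unfolding component_def assms f' ..
  show "graded_group A D = graded_group B D" unfolding graded_group_def graded_group_axioms_def a g ..
qed

context
  fixes \<psi> :: "'g::ab_group_add \<Rightarrow> 'h::ab_group_add" and R :: "('r, 'g) gring"
  assumes hom: "\<And>x y. \<psi> (x + y) = \<psi> x + \<psi> y" and R: "graded_cring R"
begin

interpretation R: graded_group R "rgrade R" using R by (rule graded_cringD)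
interpretation RR: cring R using R by (rule graded_cringD)

lemma cring_coarsen: "cring (coarsen_ring \<psi> R)"
proof (rule cringI)
  show "abelian_group (coarsen_ring \<psi> R)"
    using ring_ops_cong(2)[of "coarsen_ring \<psi> R" R] R.abelian_group_axioms by simp
  show "comm_monoid (coarsen_ring \<psi> R)"
    by (rule comm_monoidI) (simp_all add: RR.m_assoc RR.m_comm RR.m_lcomm)
qed (simp add: RR.l_distr)

lemma coarsen_ring_graded: "graded_cring (coarsen_ring \<psi> R)"
proof -
  have g: "grading (coarsen_ring \<psi> R) (rgrade (coarsen_ring \<psi> R))"
    using ring_ops_cong(5)[of "coarsen_ring \<psi> R" R "rgrade (coarsen_ring \<psi> R)"] R.coarse_grading by simp
  have "r \<otimes>\<^bsub>R\<^esub> s \<in> coarse_grade R \<psi> (rgrade R) (h + k)"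
    if r: "r \<in> coarse_grade R \<psi> (rgrade R) h" and s: "s \<in> coarse_grade R \<psi> (rgrade R) k" for r s h k
  proof -
    interpret C: graded_group R "coarse_grade R \<psi> (rgrade R)" by (rule R.coarse_graded_group)
    have sc: "s \<in> carrier R" using s by simp
    from r show ?thesis
    proof (induction rule: R.coarse_grade_induct)
      case zero then show ?case using sc by simp
    next
      case (add x y) then show ?case using sc by (simp add: RR.l_distr C.D_add)
    next
      case (homog g x)
      have xc: "x \<in> carrier R" using homog by simp
      from s show ?case
      proof (induction rule: R.coarse_grade_induct)
        case zero then show ?case using xc by simp
      next
        case (add y z) then show ?case using xc by (simp add: RR.r_distr C.D_add)
      next
        case (homog j y)
        then show ?case using graded_cringD(4)[OF R \<open>x \<in> rgrade R g\<close> homog(2)] \<open>\<psi> g = h\<close> hom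
          by (intro R.coarse_gradeI[of _ "g + j"]) auto
      qed
    qed
  qed
  then show ?thesis using g cring_coarsen by (simp add: graded_cring_def)
qed

lemma coarsen_graded_module:
  assumes M: "graded_module R M"
  shows "graded_module (coarsen_ring \<psi> R) (coarsen \<psi> M)"
proof -
  interpret M: graded_group M "mgrade M" using M by (rule graded_moduleD)
  interpret MM: module R M using M by (rule graded_moduleD)
  interpret C: graded_group M "coarse_grade M \<psi> (mgrade M)" by (rule M.coarse_graded_group)
  have "module (coarsen_ring \<psi> R) (coarsen \<psi> M)"
    by (rule moduleI)
      (use ring_ops_cong(2)[of "coarsen \<psi> M" M] M.abelian_group_axioms in \<open>simp_all add: cring_coarsen
        MM.smult_l_distr MM.smult_r_distr MM.smult_assoc1\<close>)
  moreover have "grading (coarsen \<psi> M) (mgrade (coarsen \<psi> M))"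
    using ring_ops_cong(5)[of "coarsen \<psi> M" M "mgrade (coarsen \<psi> M)"] M.coarse_grading by simp
  moreover have "r \<odot>\<^bsub>M\<^esub> s \<in> coarse_grade M \<psi> (mgrade M) (h + k)"
    if r: "r \<in> coarse_grade R \<psi> (rgrade R) h" and s: "s \<in> coarse_grade M \<psi> (mgrade M) k" for r s h k
  proof -
    have sc: "s \<in> carrier M" using s by simp
    from r show ?thesis
    proof (induction rule: R.coarse_grade_induct)
      case zero then show ?case using sc by simp
    next
      case (add x y) then show ?case using sc by (simp add: MM.smult_l_distr C.D_add)
    next
      case (homog g x)
      have xc: "x \<in> carrier R" using homog by simp
      from s show ?case
      proof (induction rule: M.coarse_grade_induct)
        case zero then show ?case using xc by simp
      next
        case (add y z) then show ?case using xc by (simp add: MM.smult_r_distr C.D_add)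
      next
        case (homog j y)
        then show ?case using graded_moduleD(5)[OF M \<open>x \<in> rgrade R g\<close> homog(2)] \<open>\<psi> g = h\<close> hom
          by (intro M.coarse_gradeI[of _ "g + j"]) auto
      qed
    qed
  qed
  ultimately show ?thesis by (intro graded_moduleI[OF coarsen_ring_graded]) auto
qed

lemma linear_map_coarsen [simp]:
  "linear_map (coarsen_ring \<psi> R) (coarsen \<psi> M) (coarsen \<psi> N) u \<longleftrightarrow> linear_map R M N u"
  by (simp add: linear_map_def additive_map_def)

lemma coarsen_gr_hom:
  assumes M: "graded_module R M" and N: "graded_module R N" and u: "u \<in> gr_hom R M N"
  shows "u \<in> gr_hom (coarsen_ring \<psi> R) (coarsen \<psi> M) (coarsen \<psi> N)"
proof -
  interpret M: graded_group M "mgrade M" using M by (rule graded_moduleD)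
  interpret N: graded_group N "mgrade N" using N by (rule graded_moduleD)
  have "u x \<in> coarse_grade N \<psi> (mgrade N) h" if "x \<in> coarse_grade M \<psi> (mgrade M) h" for x h
    using that gr_hom_component[OF M N u] gr_homD(4)[OF u]
      linear_map_zero[OF M N gr_homD(2)[OF u]]
    by (simp add: M.coarse_grade_iff N.coarse_grade_iff)
  then show ?thesis using u by (simp add: gr_hom_iff)
qed

end

section \<open>The graded Hom module\<close>

text \<open>The set \<open>F\<close> contains all differences between the degree of a homogeneous element and the degrees
  in which its image has a component.\<close>

definition degrees_in :: "('r, 'm, 'g::ab_group_add) gmod \<Rightarrow> ('r, 'n, 'g) gmod \<Rightarrow> 'g set \<Rightarrow> ('m \<Rightarrow> 'n) \<Rightarrow> bool" where
  "degrees_in M N F u \<longleftrightarrow> (\<forall>k j. \<forall>x\<in>mgrade M k. j - k \<notin> F \<longrightarrow> mcomp N j (u x) = \<zero>\<^bsub>N\<^esub>)"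

text \<open>The part of degree \<open>g\<close> sends \<open>x\<close> to the sum over \<open>k\<close> of the components of degree \<open>g + k\<close> of the image
  of the component of degree \<open>k\<close>. It is linear because scalars can be decomposed as well.\<close>

lemma homogeneous_part:
  fixes R :: "('r, 'g::ab_group_add) gring" and M :: "('r, 'm, 'g) gmod" and N :: "('r, 'n, 'g) gmod"
  assumes R: "graded_cring R" and M: "graded_module R M" and N: "graded_module R N"
    and u: "linear_map R M N u"
  obtains c where "c \<in> gr_hom R M (shift N g)" "\<And>k x. x \<in> mgrade M k \<Longrightarrow> c x = mcomp N (g + k) (u x)"
proof -
  interpret R: graded_group R "rgrade R" using R by (rule graded_cringD)
  interpret M: graded_group M "mgrade M" using M by (rule graded_moduleD)
  interpret MM: module R M using M by (rule graded_moduleD)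
  interpret N: graded_group N "mgrade N" using N by (rule graded_moduleD)
  interpret NN: module R N using N by (rule graded_moduleD)
  note ul = linear_mapD[OF u]
  define e where "e x = finsum N (\<lambda>k. mcomp N (g + k) (u (mcomp M k x))) {k. mcomp M k x \<noteq> \<zero>\<^bsub>M\<^esub>}" for x
  have tc: "mcomp N (g + k) (u (mcomp M k x)) \<in> carrier N" if "x \<in> carrier M" for x k
    using that ul(2) by simp
  have eF: "e x = finsum N (\<lambda>k. mcomp N (g + k) (u (mcomp M k x))) F"
    if x: "x \<in> carrier M" and F: "finite F" "\<And>k. k \<notin> F \<Longrightarrow> mcomp M k x = \<zero>\<^bsub>M\<^esub>" for x F
    unfolding e_def using F tc[OF x] linear_map_zero[OF M N u]
    by (intro N.add.finprod_mono_neutral_cong_left) auto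
  have ec: "e x \<in> carrier N" if "x \<in> carrier M" for x
    unfolding e_def using tc[OF that] by (intro N.finsum_closed) auto
  have eh: "e x = mcomp N (g + k) (u x)" if x: "x \<in> mgrade M k" for x k
  proof -
    have "e x = finsum N (\<lambda>k. mcomp N (g + k) (u (mcomp M k x))) {k}"
      using x by (intro eF) (auto simp: M.component_homog)
    then show ?thesis using x tc[of x k] by (simp add: M.component_self)
  qed
  have ea: "e (x \<oplus>\<^bsub>M\<^esub> y) = e x \<oplus>\<^bsub>N\<^esub> e y" if xy: "x \<in> carrier M" "y \<in> carrier M" for x y
  proof -
    obtain F where F: "finite F" "\<And>z g. z \<in> {x, y, x \<oplus>\<^bsub>M\<^esub> y} \<Longrightarrow> g \<notin> F \<Longrightarrow> mcomp M g z = \<zero>\<^bsub>M\<^esub>"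
      using M.finite_component_support[of "{x, y, x \<oplus>\<^bsub>M\<^esub> y}"] xy by auto
    show ?thesis
      using xy F tc ul(2,3) by (simp add: eF[of _ F] M.component_add N.component_add N.finsum_addf Pi_iff)
  qed
  have e0: "e \<zero>\<^bsub>M\<^esub> = \<zero>\<^bsub>N\<^esub>" by (simp add: e_def)
  have es: "e (r \<odot>\<^bsub>M\<^esub> x) = r \<odot>\<^bsub>N\<^esub> e x" if r: "r \<in> carrier R" and x: "x \<in> carrier M" for r x
    using r
  proof (induction rule: R.carrier_induct)
    case zero then show ?case using x ec[OF x] e0 by simp
  next
    case (add r s) then show ?case using x ec[OF x] ea by (simp add: MM.smult_l_distr NN.smult_l_distr)
  next
    case (homog l r)
    have rc: "r \<in> carrier R" using homog by simp
    from x show ?case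
    proof (induction rule: M.carrier_induct)
      case zero then show ?case using rc e0 by simp
    next
      case (add x y) then show ?case using rc ea ec by (simp add: MM.smult_r_distr NN.smult_r_distr)
    next
      case (homog k x)
      have "e (r \<odot>\<^bsub>M\<^esub> x) = mcomp N (g + (l + k)) (u (r \<odot>\<^bsub>M\<^esub> x))"
        using eh[OF graded_moduleD(5)[OF M \<open>r \<in> rgrade R l\<close> homog]] .
      also have "\<dots> = mcomp N (l + (g + k)) (r \<odot>\<^bsub>N\<^esub> u x)"
        using rc homog ul(4) by (simp add: add.left_commute)
      also have "\<dots> = r \<odot>\<^bsub>N\<^esub> mcomp N (g + k) (u x)"
        using smult_component[OF R N \<open>r \<in> rgrade R l\<close>] ul(2) homog by simp
      finally show ?case using eh[OF homog] by simp
    qed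
  qed
  have "(\<lambda>x\<in>carrier M. e x) \<in> gr_hom R M (shift N g)"
  proof (rule gr_hom_restrict[OF M])
    show "linear_map R M (shift N g) e" using ec ea es by (simp add: linear_map_def additive_map_def)
    show "e x \<in> mgrade (shift N g) k" if "x \<in> mgrade M k" for x k
      using N.component_in[OF ul(2)[OF M.D_carrier[OF that]]] eh[OF that] by simp
  qed
  then show ?thesis using eh by (intro that[of "\<lambda>x\<in>carrier M. e x"]) auto
qed

text \<open>An element of the graded Hom module is a linear map for which only finitely many degree shifts
  occur. In this form the condition does not mention a decomposition, which makes it easy to check
  for composites, and to compare for two gradings.\<close>

lemma ghom_iff:
  fixes R :: "('r, 'g::ab_group_add) gring" and M :: "('r, 'm, 'g) gmod" and N :: "('r, 'n, 'g) gmod"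
  assumes R: "graded_cring R" and M: "graded_module R M" and N: "graded_module R N"
  shows "u \<in> carrier (ghom R M N) \<longleftrightarrow>
    u \<in> extensional (carrier M) \<and> linear_map R M N u \<and> (\<exists>F. finite F \<and> degrees_in M N F u)"
proof -
  interpret R: graded_group R "rgrade R" using R by (rule graded_cringD)
  interpret M: graded_group M "mgrade M" using M by (rule graded_moduleD)
  interpret MM: module R M using M by (rule graded_moduleD)
  interpret N: graded_group N "mgrade N" using N by (rule graded_moduleD)
  interpret NN: module R N using N by (rule graded_moduleD)
  note NA = N.abelian_group_axioms
  show ?thesis
  proof
    assume "u \<in> carrier (ghom R M N)"
    then obtain F c where ue: "u \<in> extensional (carrier M)" and F: "finite F"
      and c: "\<And>g. g \<in> F \<Longrightarrow> c g \<in> gr_hom R M (shift N g)"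
      and u: "\<And>x. x \<in> carrier M \<Longrightarrow> u x = finsum N (\<lambda>g. c g x) F"
      by (auto simp: ghom_def)
    have cl: "linear_map R M N (c g)" if "g \<in> F" for g using gr_homD(2)[OF c[OF that]] by simp
    have cc: "c g x \<in> carrier N" if "g \<in> F" "x \<in> carrier M" for g x using linear_mapD(2)[OF cl] that by blast
    have lin: "linear_map R M N u"
      unfolding linear_map_def additive_map_def
    proof (intro conjI ballI)
      fix x y assume xy: "x \<in> carrier M" "y \<in> carrier M"
      have "u (x \<oplus>\<^bsub>M\<^esub> y) = finsum N (\<lambda>g. c g (x \<oplus>\<^bsub>M\<^esub> y)) F" using xy by (intro u) simp
      also have "\<dots> = finsum N (\<lambda>g. c g x \<oplus>\<^bsub>N\<^esub> c g y) F"
        by (rule N.finsum_cong') (use xy cc linear_mapD(3)[OF cl] in auto)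
      finally have "u (x \<oplus>\<^bsub>M\<^esub> y) = finsum N (\<lambda>g. c g x \<oplus>\<^bsub>N\<^esub> c g y) F" .
      then show "u (x \<oplus>\<^bsub>M\<^esub> y) = u x \<oplus>\<^bsub>N\<^esub> u y"
        using xy u cc by (simp add: N.finsum_addf Pi_iff)
    next
      fix r x assume r: "r \<in> carrier R" and x: "x \<in> carrier M"
      have "u (r \<odot>\<^bsub>M\<^esub> x) = finsum N (\<lambda>g. c g (r \<odot>\<^bsub>M\<^esub> x)) F" using r x by (intro u) simp
      also have "\<dots> = finsum N (\<lambda>g. r \<odot>\<^bsub>N\<^esub> c g x) F"
        by (rule N.finsum_cong') (use r x cc linear_mapD(4)[OF cl] in auto)
      also have "\<dots> = r \<odot>\<^bsub>N\<^esub> finsum N (\<lambda>g. c g x) F"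
        by (rule additive_map_finsum_group[OF NA NA, symmetric])
          (use r x F cc in \<open>auto simp: additive_map_def NN.smult_r_distr\<close>)
      finally show "u (r \<odot>\<^bsub>M\<^esub> x) = r \<odot>\<^bsub>N\<^esub> u x" using u x by simp
    next
      fix x assume x: "x \<in> carrier M" then show "u x \<in> carrier N" using u[OF x] cc by (auto intro!: N.finsum_closed)
    qed
    have "mcomp N j (u x) = \<zero>\<^bsub>N\<^esub>" if x: "x \<in> mgrade M k" and j: "j - k \<notin> F" for j k x
    proof -
      have "mcomp N j (u x) = finsum N (\<lambda>g. mcomp N j (c g x)) F"
        using u[of x] x additive_map_finsum_group[OF NA NA N.component_additive F] cc by auto
      also have "\<dots> = finsum N (\<lambda>g. \<zero>\<^bsub>N\<^esub>) F"
      proof (rule N.finsum_cong')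
        fix g assume g: "g \<in> F"
        have "c g x \<in> mgrade N (g + k)" using c[OF g] x by (auto simp: gr_hom_shift_iff)
        moreover have "j \<noteq> g + k" using g j by auto
        ultimately show "mcomp N j (c g x) = \<zero>\<^bsub>N\<^esub>" by (simp add: N.component_homog)
      qed auto
      finally show ?thesis by simp
    qed
    then show "u \<in> extensional (carrier M) \<and> linear_map R M N u \<and> (\<exists>F. finite F \<and> degrees_in M N F u)"
      using ue lin F unfolding degrees_in_def by blast
  next
    assume "u \<in> extensional (carrier M) \<and> linear_map R M N u \<and> (\<exists>F. finite F \<and> degrees_in M N F u)"
    then obtain F where ue: "u \<in> extensional (carrier M)" and u: "linear_map R M N u" and F: "finite F"
      and d: "\<And>k j x. x \<in> mgrade M k \<Longrightarrow> j - k \<notin> F \<Longrightarrow> mcomp N j (u x) = \<zero>\<^bsub>N\<^esub>"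
      unfolding degrees_in_def by blast
    note ul = linear_mapD[OF u]
    have "\<exists>c. c \<in> gr_hom R M (shift N g) \<and> (\<forall>k. \<forall>x\<in>mgrade M k. c x = mcomp N (g + k) (u x))" for g
      using homogeneous_part[OF R M N u, of g] by metis
    then obtain c where c: "\<And>g. c g \<in> gr_hom R M (shift N g)"
      and ch: "\<And>g k x. x \<in> mgrade M k \<Longrightarrow> c g x = mcomp N (g + k) (u x)"
      by metis
    have cl: "linear_map R M N (c g)" for g using gr_homD(2)[OF c] by simp
    have "u x = finsum N (\<lambda>g. c g x) F" if "x \<in> carrier M" for x
      using that
    proof (induction rule: M.carrier_induct)
      case zero then show ?case using linear_map_zero[OF M N u] linear_map_zero[OF M N cl] by simp
    next
      case (add x y)
      then show ?case using ul(3) linear_mapD(2,3)[OF cl] by (simp add: N.finsum_addf Pi_iff)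
    next
      case (homog k x)
      have ux: "u x \<in> carrier N" using ul(2) homog by simp
      have "finsum N (\<lambda>j. mcomp N j (u x)) ((\<lambda>g. g + k) ` F) = u x"
      proof (rule N.component_sum[OF ux])
        fix j assume j: "j \<notin> (\<lambda>g. g + k) ` F"
        have "j - k \<notin> F"
        proof
          assume "j - k \<in> F" then have "(j - k) + k \<in> (\<lambda>g. g + k) ` F" by (rule imageI)
          then show False using j by simp
        qed
        then show "mcomp N j (u x) = \<zero>\<^bsub>N\<^esub>" using d homog by blast
      qed (use F in auto)
      then show ?case using ux ch[OF homog] by (subst (asm) N.add.finprod_reindex) (auto simp: inj_on_def)
    qed
    then show "u \<in> carrier (ghom R M N)" using ue F c by (auto simp: ghom_def)
  qed
qed

lemma ghom_simps:
  "\<zero>\<^bsub>ghom R M N\<^esub> = (\<lambda>x\<in>carrier M. \<zero>\<^bsub>N\<^esub>)" "u \<oplus>\<^bsub>ghom R M N\<^esub> v = (\<lambda>x\<in>carrier M. u x \<oplus>\<^bsub>N\<^esub> v x)"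
  "r \<odot>\<^bsub>ghom R M N\<^esub> u = (\<lambda>x\<in>carrier M. r \<odot>\<^bsub>N\<^esub> u x)" "mgrade (ghom R M N) g = gr_hom R M (shift N g)"
  by (simp_all add: ghom_def)

lemma ghomD:
  assumes "graded_cring R" "graded_module R M" "graded_module R N" "u \<in> carrier (ghom R M N)"
  shows "u \<in> extensional (carrier M)" "linear_map R M N u" "\<And>x. x \<in> carrier M \<Longrightarrow> u x \<in> carrier N"
  using assms ghom_iff[OF assms(1-3)] by (auto dest: linear_mapD)

lemma gr_hom_ghom:
  assumes "graded_module R M" "graded_module R N" "u \<in> gr_hom R M (shift N g)"
  shows "u \<in> carrier (ghom R M N)"
  using ghom_abelian_group(3)[OF assms(1,2)] assms(3) by blast

lemma ghom_eqI:
  assumes "u \<in> extensional (carrier M)" "v \<in> extensional (carrier M)" "\<And>x. x \<in> carrier M \<Longrightarrow> u x = v x"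
  shows "u = v"
  using extensionalityI assms by blast

lemma eval_additive:
  assumes "graded_cring R" "graded_module R M" "graded_module R N" "x \<in> carrier M"
  shows "additive_map (ghom R M N) N (\<lambda>u. u x)"
  using assms ghomD(3)[OF assms(1-3)] by (simp add: additive_map_def ghom_simps)

lemma ghom_minus:
  assumes "graded_cring R" "graded_module R M" "graded_module R N" "u \<in> carrier (ghom R M N)" "x \<in> carrier M"
  shows "(\<ominus>\<^bsub>ghom R M N\<^esub> u) x = \<ominus>\<^bsub>N\<^esub> u x"
  using additive_map_minus[OF ghom_abelian_group(1)[OF assms(2,3)] graded_moduleD(3)[OF assms(3)]
      eval_additive[OF assms(1-3,5)] assms(4)] .

lemma ghom_graded_group:
  "graded_cring R \<Longrightarrow> graded_module R M \<Longrightarrow> graded_module R N \<Longrightarrow>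
    graded_group (ghom R M N) (\<lambda>g. gr_hom R M (shift N g))"
  using graded_moduleD(2)[OF ghom_graded_module[of R M N]] by (simp add: ghom_def)

lemma ghom_component:
  fixes R :: "('r, 'g::ab_group_add) gring" and M :: "('r, 'm, 'g) gmod" and N :: "('r, 'n, 'g) gmod"
  assumes R: "graded_cring R" and M: "graded_module R M" and N: "graded_module R N"
    and u: "u \<in> carrier (ghom R M N)" and x: "x \<in> mgrade M k"
  shows "component (ghom R M N) (\<lambda>g. gr_hom R M (shift N g)) g u x = mcomp N (g + k) (u x)"
proof -
  interpret G: graded_group "ghom R M N" "\<lambda>g. gr_hom R M (shift N g)" by (rule ghom_graded_group[OF R M N])
  interpret M: graded_group M "mgrade M" using M by (rule graded_moduleD)
  interpret N: graded_group N "mgrade N" using N by (rule graded_moduleD)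
  have xc: "x \<in> carrier M" using x by simp
  let ?c = "\<lambda>g. component (ghom R M N) (\<lambda>g. gr_hom R M (shift N g)) g u"
  have deg: "?c g x \<in> mgrade N (g + k)" for g using G.component_in[OF u, of g] x by (auto simp: gr_hom_shift_iff)
  obtain F where F: "finite F" "g \<in> F" "\<And>j. j \<notin> F \<Longrightarrow> ?c j = \<zero>\<^bsub>ghom R M N\<^esub>"
    using G.component_finite[OF u] by (intro that[of "insert g {g. ?c g \<noteq> \<zero>\<^bsub>ghom R M N\<^esub>}"]) auto
  have "u = finsum (ghom R M N) ?c F" using G.component_sum[OF u F(1,3)] by simp
  then have "u x = finsum (ghom R M N) ?c F x" by simp
  also have "\<dots> = finsum N (\<lambda>g. ?c g x) F" using finsum_ghom[OF M N _ xc F(1)] u by simp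
  finally have "mcomp N (g + k) (u x) = mcomp N (g + k) (finsum N (\<lambda>g. ?c g x) F)" by simp
  also have "\<dots> = finsum N (\<lambda>j. mcomp N (g + k) (?c j x)) F"
    by (rule additive_map_finsum_group[OF N.abelian_group_axioms N.abelian_group_axioms N.component_additive F(1)])
      (rule N.D_carrier[OF deg])
  also have "\<dots> = ?c g x"
    using F deg[of g] N.component_homog[OF deg, of "g + k"] by (intro N.finsum_single[of _ g]) auto
  finally show ?thesis by simp
qed

lemma ghom_compose_right:
  fixes R :: "('r, 'g::ab_group_add) gring"
  assumes R: "graded_cring R" and L: "graded_module R L" and M: "graded_module R M" and N: "graded_module R N"
    and f: "f \<in> gr_hom R L M" and u: "u \<in> carrier (ghom R M N)"
  shows "compose (carrier L) u f \<in> carrier (ghom R L N)"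
proof -
  interpret L: graded_group L "mgrade L" using L by (rule graded_moduleD)
  obtain F where F: "finite F" "degrees_in M N F u" using u ghom_iff[OF R M N] by blast
  have "degrees_in L N F (compose (carrier L) u f)"
    using F(2) gr_homD(3)[OF f] by (simp add: degrees_in_def compose_def)
  then show ?thesis
    using F(1) linear_map_compose[OF L gr_homD(2)[OF f] ghomD(2)[OF R M N u]]
    by (auto simp: ghom_iff[OF R L N] compose_def)
qed

lemma ghom_compose_left:
  fixes R :: "('r, 'g::ab_group_add) gring"
  assumes R: "graded_cring R" and L: "graded_module R L" and M: "graded_module R M" and N: "graded_module R N"
    and u: "u \<in> carrier (ghom R L M)" and f: "f \<in> gr_hom R M N"
  shows "compose (carrier L) f u \<in> carrier (ghom R L N)"
proof -
  interpret L: graded_group L "mgrade L" using L by (rule graded_moduleD)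
  obtain F where F: "finite F" "degrees_in L M F u" using u ghom_iff[OF R L M] by blast
  have "degrees_in L N F (compose (carrier L) f u)"
    using F(2) gr_hom_component[OF M N f] ghomD(3)[OF R L M u] linear_map_zero[OF M N gr_homD(2)[OF f]]
    by (simp add: degrees_in_def compose_def)
  then show ?thesis
    using F(1) linear_map_compose[OF L ghomD(2)[OF R L M u] gr_homD(2)[OF f]]
    by (auto simp: ghom_iff[OF R L N] compose_def)
qed

text \<open>An injective homomorphism of graded modules reflects the vanishing of components, so the factor
  has no degree shifts other than those of the composite.\<close>

lemma ghom_factor_inj:
  fixes R :: "('r, 'g::ab_group_add) gring"
  assumes R: "graded_cring R" and L: "graded_module R L" and M: "graded_module R M" and N: "graded_module R N"
    and f: "f \<in> gr_hom R M N" "inj_on f (carrier M)" and u: "u \<in> carrier (ghom R L N)"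
    and im: "u ` carrier L \<subseteq> f ` carrier M"
  obtains v where "v \<in> carrier (ghom R L M)" "\<And>x. x \<in> carrier L \<Longrightarrow> f (v x) = u x"
proof -
  interpret L: graded_group L "mgrade L" using L by (rule graded_moduleD)
  interpret LL: module R L using L by (rule graded_moduleD)
  interpret M: graded_group M "mgrade M" using M by (rule graded_moduleD)
  interpret MM: module R M using M by (rule graded_moduleD)
  note fl = linear_mapD[OF gr_homD(2)[OF f(1)]] and ul = linear_mapD[OF ghomD(2)[OF R L N u]]
  define v where "v = (\<lambda>x\<in>carrier L. inv_into (carrier M) f (u x))"
  have v: "v x \<in> carrier M" "f (v x) = u x" if "x \<in> carrier L" for x
    using that im unfolding v_def by (auto intro!: inv_into_into f_inv_into_f)
  have eqI: "y = z" if "y \<in> carrier M" "z \<in> carrier M" "f y = f z" for y z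
    using inj_onD[OF f(2)] that by blast
  have "linear_map R L M v"
    unfolding linear_map_def additive_map_def
    by (intro conjI ballI eqI) (simp_all add: v fl ul)
  moreover obtain F where F: "finite F" "degrees_in L N F u" using u ghom_iff[OF R L N] by blast
  have "mcomp M j (v x) = \<zero>\<^bsub>M\<^esub>" if "x \<in> mgrade L k" "j - k \<notin> F" for x j k
  proof (rule eqI)
    have xc: "x \<in> carrier L" using that by simp
    have "f (mcomp M j (v x)) = mcomp N j (u x)" using gr_hom_component[OF M N f(1) v(1)[OF xc]] v[OF xc] by simp
    then show "f (mcomp M j (v x)) = f \<zero>\<^bsub>M\<^esub>"
      using that F(2) linear_map_zero[OF M N gr_homD(2)[OF f(1)]] by (simp add: degrees_in_def)
    show "mcomp M j (v x) \<in> carrier M" using v[OF xc] by simp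
  qed simp
  then have "degrees_in L M F v" by (simp add: degrees_in_def)
  ultimately have "v \<in> carrier (ghom R L M)" using F(1) ghom_iff[OF R L M] v_def by auto
  then show ?thesis using that v by blast
qed

lemma ghom_factor_surj:
  fixes R :: "('r, 'g::ab_group_add) gring"
  assumes R: "graded_cring R" and L: "graded_module R L" and M: "graded_module R M" and N: "graded_module R N"
    and f: "f \<in> gr_hom R L M" "f ` carrier L = carrier M" and u: "u \<in> carrier (ghom R L N)"
    and ker: "\<And>x. x \<in> carrier L \<Longrightarrow> f x = \<zero>\<^bsub>M\<^esub> \<Longrightarrow> u x = \<zero>\<^bsub>N\<^esub>"
  obtains v where "v \<in> carrier (ghom R M N)" "\<And>x. x \<in> carrier L \<Longrightarrow> v (f x) = u x"
proof -
  interpret L: graded_group L "mgrade L" using L by (rule graded_moduleD)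
  interpret LL: module R L using L by (rule graded_moduleD)
  interpret M: graded_group M "mgrade M" using M by (rule graded_moduleD)
  interpret MM: module R M using M by (rule graded_moduleD)
  interpret N: graded_group N "mgrade N" using N by (rule graded_moduleD)
  note fl = linear_mapD[OF gr_homD(2)[OF f(1)]] and ul = linear_mapD[OF ghomD(2)[OF R L N u]]
  define v where "v = (\<lambda>y\<in>carrier M. u (inv_into (carrier L) f y))"
  have v: "v (f x) = u x" if x: "x \<in> carrier L" for x
  proof -
    let ?y = "inv_into (carrier L) f (f x)"
    have y: "?y \<in> carrier L" "f ?y = f x" using x by (auto intro!: inv_into_into f_inv_into_f)
    have "f (?y \<oplus>\<^bsub>L\<^esub> \<ominus>\<^bsub>L\<^esub> x) = \<zero>\<^bsub>M\<^esub>"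
      using x y fl linear_map_minus[OF L M gr_homD(2)[OF f(1)]] by (simp add: M.r_neg)
    then have "u ?y \<oplus>\<^bsub>N\<^esub> \<ominus>\<^bsub>N\<^esub> u x = \<zero>\<^bsub>N\<^esub>"
      using ker[of "?y \<oplus>\<^bsub>L\<^esub> \<ominus>\<^bsub>L\<^esub> x"] x y ul linear_map_minus[OF L N ghomD(2)[OF R L N u]] by simp
    then have "u ?y = u x" using ul(2)[OF x] ul(2)[OF y(1)]
      by (metis N.add.inv_solve_right' N.l_zero N.zero_closed)
    then show ?thesis using fl(2)[OF x] by (simp add: v_def)
  qed
  have ob: "\<exists>x\<in>carrier L. y = f x" if "y \<in> carrier M" for y using that f(2) by blast
  have "linear_map R M N v"
    unfolding linear_map_def additive_map_def
  proof (intro conjI ballI)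
    fix x assume "x \<in> carrier M"
    then obtain x' where x': "x' \<in> carrier L" "x = f x'" using ob by blast
    show "v x \<in> carrier N" using x' v ul by simp
    show "v (r \<odot>\<^bsub>M\<^esub> x) = r \<odot>\<^bsub>N\<^esub> v x" if "r \<in> carrier R" for r
      using x' that by (simp add: fl(4)[symmetric] v ul)
    fix y assume "y \<in> carrier M"
    then obtain y' where y': "y' \<in> carrier L" "y = f y'" using ob by blast
    show "v (x \<oplus>\<^bsub>M\<^esub> y) = v x \<oplus>\<^bsub>N\<^esub> v y" using x' y' by (simp add: fl(3)[symmetric] v ul)
  qed
  moreover obtain F where F: "finite F" "degrees_in L N F u" using u ghom_iff[OF R L N] by blast
  have "mcomp N j (v y) = \<zero>\<^bsub>N\<^esub>" if y: "y \<in> mgrade M k" "j - k \<notin> F" for y j k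
  proof -
    have "y \<in> f ` carrier L" using f(2) y(1) by simp
    then obtain x where x: "x \<in> mgrade L k" "f x = y" using homog_preimage[OF L M f(1) y(1)] by metis
    then show ?thesis using F(2) y(2) v[of x] by (auto simp: degrees_in_def)
  qed
  then have "degrees_in M N F v" by (simp add: degrees_in_def)
  ultimately have "v \<in> carrier (ghom R M N)" using F(1) ghom_iff[OF R M N] v_def by auto
  then show ?thesis using that v by blast
qed

text \<open>This is the only use of the finiteness of the kernel: a linear map with finitely many degree
  shifts in \<open>H\<close> then has finitely many degree shifts in \<open>G\<close>.\<close>

lemma finite_preimage:
  fixes \<psi> :: "'g::ab_group_add \<Rightarrow> 'h::ab_group_add"
  assumes hom: "\<And>x y. \<psi> (x + y) = \<psi> x + \<psi> y" and ker: "finite {g. \<psi> g = 0}" and F: "finite F"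
  shows "finite (\<psi> -` F)"
proof -
  have diff: "\<psi> (x - y) = \<psi> x - \<psi> y" for x y using hom[of "x - y" y] by simp
  have "finite (\<psi> -` {h})" for h
  proof (cases "\<exists>g. \<psi> g = h")
    case True
    then obtain g where g: "\<psi> g = h" by blast
    have "\<psi> -` {h} \<subseteq> (\<lambda>k. k + g) ` {k. \<psi> k = 0}"
    proof
      fix x assume "x \<in> \<psi> -` {h}"
      then show "x \<in> (\<lambda>k. k + g) ` {k. \<psi> k = 0}" using g by (intro image_eqI[of _ _ "x - g"]) (auto simp: diff)
    qed
    then show ?thesis using ker finite_surj by blast
  next
    case False
    then have "\<psi> -` {h} = {}" by auto
    then show ?thesis by simp
  qed
  moreover have "\<psi> -` F = (\<Union>h\<in>F. \<psi> -` {h})" by auto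
  ultimately show ?thesis using F by simp
qed

context
  fixes \<psi> :: "'g::ab_group_add \<Rightarrow> 'h::ab_group_add" and R :: "('r, 'g) gring"
    and M :: "('r, 'm, 'g) gmod" and N :: "('r, 'n, 'g) gmod"
  assumes hom: "\<And>x y. \<psi> (x + y) = \<psi> x + \<psi> y" and R: "graded_cring R"
    and M: "graded_module R M" and N: "graded_module R N" and ker: "finite {g. \<psi> g = 0}"
begin

interpretation M: graded_group M "mgrade M" using M by (rule graded_moduleD)
interpretation N: graded_group N "mgrade N" using N by (rule graded_moduleD)
interpretation CN: graded_group N "coarse_grade N \<psi> (mgrade N)" by (rule N.coarse_graded_group)

lemma psi_diff: "\<psi> (x - y) = \<psi> x - \<psi> y"
  using hom[of "x - y" y] by simp

lemma mcomp_coarsen: "component (coarsen \<psi> L) D = component L D"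
  using ring_ops_cong(6)[of "coarsen \<psi> L" L] by simp

text \<open>The linear maps are the same on both sides. If the differences of coarse degrees that occur for \<open>u\<close>
  lie in \<open>F\<close>, then those of fine degrees lie in the preimage of \<open>F\<close>.\<close>

lemma ghom_coarsen_carrier:
  "carrier (ghom (coarsen_ring \<psi> R) (coarsen \<psi> M) (coarsen \<psi> N)) = carrier (ghom R M N)"
proof (intro equalityI subsetI)
  note cS = coarsen_ring_graded[OF hom R] and cM = coarsen_graded_module[OF hom R M]
    and cN = coarsen_graded_module[OF hom R N]
  fix u assume "u \<in> carrier (ghom R M N)"
  then obtain F where u: "u \<in> extensional (carrier M)" "linear_map R M N u" and F: "finite F" "degrees_in M N F u"
    using ghom_iff[OF R M N] by blast
  note ul = linear_mapD[OF u(2)]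
  have "component N (coarse_grade N \<psi> (mgrade N)) j (u x) = \<zero>\<^bsub>N\<^esub>"
    if x: "x \<in> coarse_grade M \<psi> (mgrade M) h" and j: "j - h \<notin> \<psi> ` F" for x h j
    using x
  proof (induction rule: M.coarse_grade_induct)
    case zero then show ?case using linear_map_zero[OF M N u(2)] by simp
  next
    case (add x y) then show ?case using ul by (simp add: CN.component_add)
  next
    case (homog g x)
    have ux: "u x \<in> carrier N" using ul homog by simp
    have "mcomp N i (u x) = \<zero>\<^bsub>N\<^esub>" if "\<psi> i = j" for i
    proof -
      have "i - g \<notin> F" using j homog that psi_diff by (metis imageI)
      then show ?thesis using F(2) homog by (simp add: degrees_in_def)
    qed
    then have "mcomp N i (component N (coarse_grade N \<psi> (mgrade N)) j (u x)) = mcomp N i \<zero>\<^bsub>N\<^esub>" for i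
      using N.component_coarse_component[OF ux, of i \<psi> j] by simp
    then show ?case using N.component_eqI[OF CN.component_closed[OF ux] N.zero_closed] by simp
  qed
  then have "degrees_in (coarsen \<psi> M) (coarsen \<psi> N) (\<psi> ` F) u"
    by (simp add: degrees_in_def mcomp_coarsen)
  then show "u \<in> carrier (ghom (coarsen_ring \<psi> R) (coarsen \<psi> M) (coarsen \<psi> N))"
    using u F by (auto simp: ghom_iff[OF cS cM cN] linear_map_coarsen[OF hom R])
next
  note cS = coarsen_ring_graded[OF hom R] and cM = coarsen_graded_module[OF hom R M]
    and cN = coarsen_graded_module[OF hom R N]
  fix u assume "u \<in> carrier (ghom (coarsen_ring \<psi> R) (coarsen \<psi> M) (coarsen \<psi> N))"
  then obtain F where u: "u \<in> extensional (carrier M)" "linear_map R M N u" and F: "finite F"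
    "degrees_in (coarsen \<psi> M) (coarsen \<psi> N) F u"
    by (auto simp: ghom_iff[OF cS cM cN] linear_map_coarsen[OF hom R])
  note ul = linear_mapD[OF u(2)]
  have "mcomp N j (u x) = \<zero>\<^bsub>N\<^esub>" if x: "x \<in> mgrade M k" and j: "j - k \<notin> \<psi> -` F" for x k j
  proof -
    have "x \<in> coarse_grade M \<psi> (mgrade M) (\<psi> k)" using x by (rule M.coarse_gradeI) simp
    moreover have "\<psi> j - \<psi> k \<notin> F" using j by (simp add: psi_diff)
    ultimately have "component N (coarse_grade N \<psi> (mgrade N)) (\<psi> j) (u x) = \<zero>\<^bsub>N\<^esub>"
      using F(2) by (simp add: degrees_in_def mcomp_coarsen)
    then show ?thesis using N.component_coarse_component[of "u x" j \<psi> "\<psi> j"] ul(2)[of x] x by simp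
  qed
  then have "degrees_in M N (\<psi> -` F) u" by (simp add: degrees_in_def)
  then show "u \<in> carrier (ghom R M N)"
    using u finite_preimage[OF hom ker F(1)] ghom_iff[OF R M N] by blast
qed

lemma ghom_coarsen: "coarsen \<psi> (ghom R M N) = ghom (coarsen_ring \<psi> R) (coarsen \<psi> M) (coarsen \<psi> N)"
proof -
  note cS = coarsen_ring_graded[OF hom R] and cM = coarsen_graded_module[OF hom R M]
    and cN = coarsen_graded_module[OF hom R N]
  interpret G: graded_group "ghom R M N" "\<lambda>g. gr_hom R M (shift N g)" by (rule ghom_graded_group[OF R M N])
  let ?c = "\<lambda>g u. component (ghom R M N) (\<lambda>g. gr_hom R M (shift N g)) g u"
  have "coarse_grade (ghom R M N) \<psi> (\<lambda>g. gr_hom R M (shift N g)) h =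
      gr_hom (coarsen_ring \<psi> R) (coarsen \<psi> M) (shift (coarsen \<psi> N) h)" for h
  proof (intro equalityI subsetI)
    fix u assume "u \<in> coarse_grade (ghom R M N) \<psi> (\<lambda>g. gr_hom R M (shift N g)) h"
    then have uc: "u \<in> carrier (ghom R M N)" and z: "\<And>g. \<psi> g \<noteq> h \<Longrightarrow> ?c g u = \<zero>\<^bsub>ghom R M N\<^esub>"
      by (auto simp: G.coarse_grade_iff)
    note ul = linear_mapD[OF ghomD(2)[OF R M N uc]]
    have "u x \<in> coarse_grade N \<psi> (mgrade N) (h + l)" if "x \<in> coarse_grade M \<psi> (mgrade M) l" for x l
      using that
    proof (induction rule: M.coarse_grade_induct)
      case zero then show ?case using linear_map_zero[OF M N ghomD(2)[OF R M N uc]] by simp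
    next
      case (add x y) then show ?case using ul by (simp add: CN.D_add)
    next
      case (homog k x)
      have "mcomp N j (u x) = \<zero>\<^bsub>N\<^esub>" if "\<psi> j \<noteq> h + l" for j
      proof -
        have "\<psi> (j - k) \<noteq> h" using that homog psi_diff by auto
        then have "?c (j - k) u x = \<zero>\<^bsub>N\<^esub>" using z homog by (simp add: ghom_simps)
        then show ?thesis using ghom_component[OF R M N uc homog(2), of "j - k"] by simp
      qed
      then show ?case using ul homog by (simp add: N.coarse_grade_iff)
    qed
    then show "u \<in> gr_hom (coarsen_ring \<psi> R) (coarsen \<psi> M) (shift (coarsen \<psi> N) h)"
      using ghomD[OF R M N uc] by (simp add: gr_hom_shift_iff linear_map_coarsen[OF hom R])
  next
    fix u assume u: "u \<in> gr_hom (coarsen_ring \<psi> R) (coarsen \<psi> M) (shift (coarsen \<psi> N) h)"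
    then have uc: "u \<in> carrier (ghom R M N)"
      using gr_hom_ghom[OF cM cN u] ghom_coarsen_carrier by simp
    have "?c g u = \<zero>\<^bsub>ghom R M N\<^esub>" if g: "\<psi> g \<noteq> h" for g
    proof -
      have cc: "?c g u \<in> carrier (ghom R M N)" using uc by simp
      note cl = linear_mapD[OF ghomD(2)[OF R M N cc]]
      have "?c g u x = \<zero>\<^bsub>N\<^esub>" if "x \<in> carrier M" for x
        using that
      proof (induction rule: M.carrier_induct)
        case zero then show ?case using linear_map_zero[OF M N ghomD(2)[OF R M N cc]] by simp
      next
        case (add x y) then show ?case using cl by simp
      next
        case (homog k x)
        have "u x \<in> coarse_grade N \<psi> (mgrade N) (h + \<psi> k)"
          using u M.coarse_gradeI[OF homog, of \<psi>] by (auto simp: gr_hom_shift_iff)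
        then show ?case using ghom_component[OF R M N uc homog, of g] g hom
          by (simp add: N.coarse_grade_iff)
      qed
      then show ?thesis using ghomD(1)[OF R M N cc]
        by (intro ghom_eqI[of _ M]) (auto simp: ghom_simps)
    qed
    then show "u \<in> coarse_grade (ghom R M N) \<psi> (\<lambda>g. gr_hom R M (shift N g)) h"
      using uc by (simp add: G.coarse_grade_iff)
  qed
  then have "mgrade (coarsen \<psi> (ghom R M N)) = mgrade (ghom (coarsen_ring \<psi> R) (coarsen \<psi> M) (coarsen \<psi> N))"
    by (intro ext) (simp add: ghom_def)
  then show ?thesis using ghom_coarsen_carrier
    by (intro gmod.equality) (simp_all add: ghom_def)
qed

end

section \<open>Free modules\<close>

text \<open>The component of degree 0 of the unit acts as the identity on homogeneous elements, hence on the unit.\<close>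

lemma one_homogeneous:
  assumes R: "graded_cring R" shows "\<one>\<^bsub>R\<^esub> \<in> rgrade R 0"
proof -
  interpret R: graded_group R "rgrade R" using R by (rule graded_cringD)
  interpret RR: cring R using R by (rule graded_cringD)
  let ?e = "rcomp R 0 \<one>\<^bsub>R\<^esub>"
  have ec: "?e \<in> carrier R" by simp
  have "?e \<otimes>\<^bsub>R\<^esub> r = r" if "r \<in> carrier R" for r
    using that
  proof (induction rule: R.carrier_induct)
    case zero then show ?case by simp
  next
    case (add x y) then show ?case using ec by (simp add: RR.r_distr)
  next
    case (homog h r)
    have rc: "r \<in> carrier R" using homog by simp
    have "rcomp R (0 + h) (\<one>\<^bsub>R\<^esub> \<otimes>\<^bsub>R\<^esub> r) = ?e \<otimes>\<^bsub>R\<^esub> r"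
      using component_additive_map(1)[of R "rgrade R" R "rgrade R" "\<lambda>x. x \<otimes>\<^bsub>R\<^esub> r" "\<lambda>k. k + h" "\<one>\<^bsub>R\<^esub>" 0]
        R.graded_group_axioms graded_cringD(4)[OF R _ homog] rc
      by (simp add: additive_map_def RR.l_distr)
    then show ?case using rc homog by (simp add: R.component_self)
  qed
  from this[of "\<one>\<^bsub>R\<^esub>"] have "?e = \<one>\<^bsub>R\<^esub>" by simp
  then show ?thesis using R.component_in[of "\<one>\<^bsub>R\<^esub>" 0] by simp
qed

text \<open>The basis element of \<open>x\<close> has degree \<open>wt x\<close>, so in an element of degree \<open>g\<close> its coefficient has
  degree \<open>g - wt x\<close>.\<close>

definition free_mod :: "('r, 'g::ab_group_add) gring \<Rightarrow> 'x set \<Rightarrow> ('x \<Rightarrow> 'g) \<Rightarrow> ('r, 'x \<Rightarrow> 'r, 'g) gmod" where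
  "free_mod R X wt =
     (let C = {c. (\<forall>x. c x \<in> carrier R) \<and> (\<forall>x. x \<notin> X \<longrightarrow> c x = \<zero>\<^bsub>R\<^esub>) \<and> finite {x. c x \<noteq> \<zero>\<^bsub>R\<^esub>}}
      in \<lparr>carrier = C, mult = undefined, one = undefined, ring.zero = (\<lambda>_. \<zero>\<^bsub>R\<^esub>),
        add = (\<lambda>c d x. c x \<oplus>\<^bsub>R\<^esub> d x), smult = (\<lambda>r c x. r \<otimes>\<^bsub>R\<^esub> c x),
        mgrade = (\<lambda>g. {c\<in>C. \<forall>x. c x \<in> rgrade R (g - wt x)})\<rparr>)"

definition basis_elt :: "('r, 'g) gring \<Rightarrow> 'x \<Rightarrow> 'x \<Rightarrow> 'r" where
  "basis_elt R x = (\<lambda>y. if y = x then \<one>\<^bsub>R\<^esub> else \<zero>\<^bsub>R\<^esub>)"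

lemma free_mod_carrier:
  "c \<in> carrier (free_mod R X wt) \<longleftrightarrow>
    (\<forall>x. c x \<in> carrier R) \<and> (\<forall>x. x \<notin> X \<longrightarrow> c x = \<zero>\<^bsub>R\<^esub>) \<and> finite {x. c x \<noteq> \<zero>\<^bsub>R\<^esub>}"
  by (simp add: free_mod_def Let_def)

lemma free_mod_simps:
  "\<zero>\<^bsub>free_mod R X wt\<^esub> = (\<lambda>_. \<zero>\<^bsub>R\<^esub>)" "c \<oplus>\<^bsub>free_mod R X wt\<^esub> d = (\<lambda>x. c x \<oplus>\<^bsub>R\<^esub> d x)"
  "r \<odot>\<^bsub>free_mod R X wt\<^esub> c = (\<lambda>x. r \<otimes>\<^bsub>R\<^esub> c x)"
  "c \<in> mgrade (free_mod R X wt) g \<longleftrightarrow> c \<in> carrier (free_mod R X wt) \<and> (\<forall>x. c x \<in> rgrade R (g - wt x))"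
  by (auto simp: free_mod_def Let_def)

context
  fixes R :: "('r, 'g::ab_group_add) gring" and X :: "'x set" and wt :: "'x \<Rightarrow> 'g"
  assumes R: "graded_cring R"
begin

interpretation R: graded_group R "rgrade R" using R by (rule graded_cringD)
interpretation RR: cring R using R by (rule graded_cringD)

abbreviation (input) FM where "FM \<equiv> free_mod R X wt"

lemma free_mod_closed:
  shows "(\<lambda>_. \<zero>\<^bsub>R\<^esub>) \<in> carrier FM"
    and "c \<in> carrier FM \<Longrightarrow> d \<in> carrier FM \<Longrightarrow> (\<lambda>x. c x \<oplus>\<^bsub>R\<^esub> d x) \<in> carrier FM"
    and "c \<in> carrier FM \<Longrightarrow> (\<lambda>x. \<ominus>\<^bsub>R\<^esub> c x) \<in> carrier FM"
    and "r \<in> carrier R \<Longrightarrow> c \<in> carrier FM \<Longrightarrow> (\<lambda>x. r \<otimes>\<^bsub>R\<^esub> c x) \<in> carrier FM"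
proof -
  show "(\<lambda>_. \<zero>\<^bsub>R\<^esub>) \<in> carrier FM" by (simp add: free_mod_carrier)
  show "(\<lambda>x. c x \<oplus>\<^bsub>R\<^esub> d x) \<in> carrier FM" if c: "c \<in> carrier FM" and d: "d \<in> carrier FM"
  proof -
    have "finite ({x. c x \<noteq> \<zero>\<^bsub>R\<^esub>} \<union> {x. d x \<noteq> \<zero>\<^bsub>R\<^esub>})" using c d by (simp add: free_mod_carrier)
    moreover have "{x. c x \<oplus>\<^bsub>R\<^esub> d x \<noteq> \<zero>\<^bsub>R\<^esub>} \<subseteq> {x. c x \<noteq> \<zero>\<^bsub>R\<^esub>} \<union> {x. d x \<noteq> \<zero>\<^bsub>R\<^esub>}"
      using c d by (auto simp: free_mod_carrier)
    ultimately show ?thesis using c d finite_subset by (auto simp: free_mod_carrier)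
  qed
  show "(\<lambda>x. \<ominus>\<^bsub>R\<^esub> c x) \<in> carrier FM" if c: "c \<in> carrier FM"
  proof -
    have "{x. \<ominus>\<^bsub>R\<^esub> c x \<noteq> \<zero>\<^bsub>R\<^esub>} \<subseteq> {x. c x \<noteq> \<zero>\<^bsub>R\<^esub>}" by auto
    then show ?thesis using c finite_subset by (auto simp: free_mod_carrier)
  qed
  show "(\<lambda>x. r \<otimes>\<^bsub>R\<^esub> c x) \<in> carrier FM" if r: "r \<in> carrier R" and c: "c \<in> carrier FM"
  proof -
    have "{x. r \<otimes>\<^bsub>R\<^esub> c x \<noteq> \<zero>\<^bsub>R\<^esub>} \<subseteq> {x. c x \<noteq> \<zero>\<^bsub>R\<^esub>}" using r by auto
    then show ?thesis using c r finite_subset by (auto simp: free_mod_carrier)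
  qed
qed

lemma free_mod_abelian_group: "abelian_group FM"
proof (rule abelian_groupI)
  fix c assume c: "c \<in> carrier FM"
  then have "(\<lambda>x. \<ominus>\<^bsub>R\<^esub> c x) \<oplus>\<^bsub>FM\<^esub> c = \<zero>\<^bsub>FM\<^esub>" by (simp add: free_mod_simps free_mod_carrier R.l_neg)
  then show "\<exists>d\<in>carrier FM. d \<oplus>\<^bsub>FM\<^esub> c = \<zero>\<^bsub>FM\<^esub>" using free_mod_closed(3)[OF c] by blast
qed (simp_all add: free_mod_closed free_mod_simps, simp_all add: free_mod_carrier R.a_ac)

lemma free_mod_finsum:
  assumes "finite F" "\<And>i. i \<in> F \<Longrightarrow> f i \<in> carrier FM"
  shows "finsum FM f F y = finsum R (\<lambda>i. f i y) F"
  by (rule additive_map_finsum_group[OF free_mod_abelian_group R.abelian_group_axioms _ assms])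
     (simp_all add: additive_map_def free_mod_carrier free_mod_simps)

lemma free_mod_graded_module: "graded_module R FM"
proof -
  interpret F: abelian_group FM by (rule free_mod_abelian_group)
  have mo: "module R FM"
    by (rule moduleI) (simp_all add: free_mod_closed free_mod_simps RR.is_cring free_mod_abelian_group,
        simp_all add: free_mod_carrier RR.l_distr RR.r_distr RR.m_assoc)
  have mi: "\<ominus>\<^bsub>FM\<^esub> c = (\<lambda>x. \<ominus>\<^bsub>R\<^esub> c x)" if c: "c \<in> carrier FM" for c
    using c free_mod_closed(3)[OF c]
    by (intro F.minus_equality) (simp_all add: free_mod_simps free_mod_carrier R.l_neg)
  have sub: "additive_subgroup (mgrade FM g) FM" for g
    by (rule additive_subgroupI[OF free_mod_abelian_group])
       (auto simp: free_mod_simps mi free_mod_closed R.D_add R.D_minus)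
  define p where "p g c = (\<lambda>x. rcomp R (g - wt x) (c x))" for g and c :: "'x \<Rightarrow> 'r"
  have pc: "p g c \<in> carrier FM" if c: "c \<in> carrier FM" for g c
  proof -
    have "{x. p g c x \<noteq> \<zero>\<^bsub>R\<^esub>} \<subseteq> {x. c x \<noteq> \<zero>\<^bsub>R\<^esub>}" by (auto simp: p_def)
    then show ?thesis using c finite_subset by (auto simp: free_mod_carrier p_def)
  qed
  have p_in: "p g c \<in> mgrade FM g" if c: "c \<in> carrier FM" for g c
    using pc[OF c] c by (simp add: free_mod_simps) (simp add: p_def free_mod_carrier R.component_in)
  have p_add: "p g (c \<oplus>\<^bsub>FM\<^esub> d) = p g c \<oplus>\<^bsub>FM\<^esub> p g d" if "c \<in> carrier FM" "d \<in> carrier FM" for g c d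
    using that by (simp add: free_mod_simps p_def) (simp add: free_mod_carrier R.component_add)
  have p_fin: "finite {g. p g c \<noteq> \<zero>\<^bsub>FM\<^esub>}" if c: "c \<in> carrier FM" for c
  proof -
    let ?B = "\<Union>x\<in>{x. c x \<noteq> \<zero>\<^bsub>R\<^esub>}. (\<lambda>k. k + wt x) ` {k. rcomp R k (c x) \<noteq> \<zero>\<^bsub>R\<^esub>}"
    have "finite ?B" using c R.component_finite by (simp add: free_mod_carrier)
    moreover have "{g. p g c \<noteq> \<zero>\<^bsub>FM\<^esub>} \<subseteq> ?B"
    proof
      fix g assume "g \<in> {g. p g c \<noteq> \<zero>\<^bsub>FM\<^esub>}"
      then obtain x where x: "rcomp R (g - wt x) (c x) \<noteq> \<zero>\<^bsub>R\<^esub>" by (auto simp: p_def free_mod_simps)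
      then have "c x \<noteq> \<zero>\<^bsub>R\<^esub>" by auto
      moreover have "g \<in> (\<lambda>k. k + wt x) ` {k. rcomp R k (c x) \<noteq> \<zero>\<^bsub>R\<^esub>}"
        using x by (intro image_eqI[of _ _ "g - wt x"]) auto
      ultimately show "g \<in> ?B" by blast
    qed
    ultimately show ?thesis using finite_subset by blast
  qed
  have p_sum: "finsum FM (\<lambda>g. p g c) {g. p g c \<noteq> \<zero>\<^bsub>FM\<^esub>} = c" if c: "c \<in> carrier FM" for c
  proof
    fix y
    have yc: "c y \<in> carrier R" using c by (simp add: free_mod_carrier)
    let ?F = "{g. p g c \<noteq> \<zero>\<^bsub>FM\<^esub>}"
    have "finsum FM (\<lambda>g. p g c) ?F y = finsum R (\<lambda>g. rcomp R (g - wt y) (c y)) ?F"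
      using free_mod_finsum[OF p_fin[OF c], of "\<lambda>g. p g c" y] pc[OF c] by (simp add: p_def)
    also have "\<dots> = finsum R (\<lambda>k. rcomp R k (c y)) ((\<lambda>g. g - wt y) ` ?F)"
      using yc by (subst R.add.finprod_reindex) (auto simp: inj_on_def)
    also have "\<dots> = c y"
    proof (rule R.component_sum[OF yc])
      show "finite ((\<lambda>g. g - wt y) ` ?F)" using p_fin[OF c] by simp
      fix k assume k: "k \<notin> (\<lambda>g. g - wt y) ` ?F"
      have "k + wt y \<notin> ?F"
      proof
        assume "k + wt y \<in> ?F"
        then have "(k + wt y) - wt y \<in> (\<lambda>g. g - wt y) ` ?F" by (rule imageI)
        then show False using k by simp
      qed
      then have "p (k + wt y) c y = \<zero>\<^bsub>R\<^esub>" by (simp add: free_mod_simps)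
      then show "rcomp R k (c y) = \<zero>\<^bsub>R\<^esub>" by (simp add: p_def)
    qed
    finally show "finsum FM (\<lambda>g. p g c) ?F y = c y" .
  qed
  have p1: "p g c = c" if "c \<in> mgrade FM g" for g c
    using that by (simp add: free_mod_simps p_def R.component_self)
  have p0: "p g c = \<zero>\<^bsub>FM\<^esub>" if "c \<in> mgrade FM k" "g \<noteq> k" for g k c
    using that R.component_homog[of "c x" "k - wt x" "g - wt x" for x] by (simp add: free_mod_simps p_def)
  have "grading FM (mgrade FM)"
    by (rule gradingI(1)[OF free_mod_abelian_group sub, where p = p])
       (rule p_in p_add p_fin p_sum p1 p0; assumption)+
  moreover have "r \<odot>\<^bsub>FM\<^esub> c \<in> mgrade FM (g + h)" if r: "r \<in> rgrade R g" and c: "c \<in> mgrade FM h" for r c g h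
  proof -
    have "r \<otimes>\<^bsub>R\<^esub> c x \<in> rgrade R (g + (h - wt x))" for x
      using graded_cringD(4)[OF R r] c by (simp add: free_mod_simps)
    then show ?thesis using r c free_mod_closed(4) by (simp add: free_mod_simps add_diff_eq)
  qed
  ultimately show ?thesis using mo by (intro graded_moduleI[OF R]) auto
qed

lemma basis_elt_homog: "x \<in> X \<Longrightarrow> basis_elt R x \<in> mgrade FM (wt x)"
  using one_homogeneous[OF R] by (auto simp: free_mod_simps free_mod_carrier basis_elt_def)

lemma basis_elt_carrier: "x \<in> X \<Longrightarrow> basis_elt R x \<in> carrier FM"
  using basis_elt_homog by (simp add: free_mod_simps)

lemma free_mod_expand:
  assumes c: "c \<in> carrier FM"
  shows "finsum FM (\<lambda>x. c x \<odot>\<^bsub>FM\<^esub> basis_elt R x) {x. c x \<noteq> \<zero>\<^bsub>R\<^esub>} = c"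
proof
  fix y
  let ?F = "{x. c x \<noteq> \<zero>\<^bsub>R\<^esub>}"
  have F: "finite ?F" "?F \<subseteq> X" and cR: "\<And>x. c x \<in> carrier R" using c by (auto simp: free_mod_carrier)
  have cl: "c x \<odot>\<^bsub>FM\<^esub> basis_elt R x \<in> carrier FM" if "x \<in> ?F" for x
    using free_mod_closed(4)[OF cR basis_elt_carrier, of x x] that F(2) by (auto simp: free_mod_simps)
  have "finsum FM (\<lambda>x. c x \<odot>\<^bsub>FM\<^esub> basis_elt R x) ?F y = finsum R (\<lambda>x. c x \<otimes>\<^bsub>R\<^esub> basis_elt R x y) ?F"
    using free_mod_finsum[OF F(1) cl] by (simp add: free_mod_simps)
  also have "\<dots> = c y"
  proof (cases "y \<in> ?F")
    case True
    then show ?thesis using F cR by (intro R.finsum_single[of _ y]) (auto simp: basis_elt_def)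
  next
    case False
    have "finsum R (\<lambda>x. c x \<otimes>\<^bsub>R\<^esub> basis_elt R x y) ?F = finsum R (\<lambda>x. \<zero>\<^bsub>R\<^esub>) ?F"
      using False cR by (intro R.finsum_cong') (auto simp: basis_elt_def)
    then show ?thesis using False by simp
  qed
  finally show "finsum FM (\<lambda>x. c x \<odot>\<^bsub>FM\<^esub> basis_elt R x) ?F y = c y" .
qed

text \<open>The universal property is needed for homomorphisms that respect a coarser grading, since this
  is what makes coarsened projectives projective.\<close>

context
  fixes \<psi> :: "'g \<Rightarrow> 'h::ab_group_add" and N :: "('r, 'n, 'h) gmod"
  assumes hom: "\<And>x y. \<psi> (x + y) = \<psi> x + \<psi> y" and N: "graded_module (coarsen_ring \<psi> R) N"
begin

interpretation N: graded_group N "mgrade N" using N by (rule graded_moduleD)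
interpretation NN: module "coarsen_ring \<psi> R" N using N by (rule graded_moduleD)

lemma free_mod_eval:
  assumes u: "linear_map (coarsen_ring \<psi> R) (coarsen \<psi> FM) N u" and c: "c \<in> carrier FM"
  shows "u c = finsum N (\<lambda>x. c x \<odot>\<^bsub>N\<^esub> u (basis_elt R x)) {x. c x \<noteq> \<zero>\<^bsub>R\<^esub>}"
proof -
  let ?F = "{x. c x \<noteq> \<zero>\<^bsub>R\<^esub>}"
  have F: "finite ?F" "?F \<subseteq> X" and cR: "\<And>x. c x \<in> carrier R" using c by (auto simp: free_mod_carrier)
  have be: "basis_elt R x \<in> carrier FM" if "x \<in> ?F" for x using basis_elt_carrier that F(2) by blast
  note ul = linear_mapD[OF u]
  have cl: "c x \<odot>\<^bsub>FM\<^esub> basis_elt R x \<in> carrier FM" if "x \<in> ?F" for x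
    using free_mod_closed(4)[OF cR be[OF that]] by (simp add: free_mod_simps)
  have am: "additive_map FM N u" using ul(2,3) by (simp add: additive_map_def)
  have "u c = u (finsum FM (\<lambda>x. c x \<odot>\<^bsub>FM\<^esub> basis_elt R x) ?F)" using free_mod_expand[OF c] by simp
  also have "\<dots> = finsum N (\<lambda>x. u (c x \<odot>\<^bsub>FM\<^esub> basis_elt R x)) ?F"
    by (rule additive_map_finsum_group[OF free_mod_abelian_group N.abelian_group_axioms am F(1) cl])
  also have "\<dots> = finsum N (\<lambda>x. c x \<odot>\<^bsub>N\<^esub> u (basis_elt R x)) ?F"
    using ul(2,4) cR be by (intro N.finsum_cong') auto
  finally show ?thesis .
qed

lemma free_mod_extend:
  assumes a: "\<And>x. x \<in> X \<Longrightarrow> a x \<in> mgrade N (\<psi> (wt x))"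
  obtains L where "L \<in> gr_hom (coarsen_ring \<psi> R) (coarsen \<psi> FM) N" "\<And>x. x \<in> X \<Longrightarrow> L (basis_elt R x) = a x"
proof -
  note cF = coarsen_graded_module[OF hom R free_mod_graded_module]
  interpret F: graded_group FM "mgrade FM" using free_mod_graded_module by (rule graded_moduleD)
  have ac: "a x \<in> carrier N" if "x \<in> X" for x using a[OF that] by simp
  define L where "L c = finsum N (\<lambda>x. c x \<odot>\<^bsub>N\<^esub> a x) {x. c x \<noteq> \<zero>\<^bsub>R\<^esub>}" for c
  have sm: "r \<in> carrier R \<Longrightarrow> y \<in> carrier N \<Longrightarrow> r \<odot>\<^bsub>N\<^esub> y \<in> carrier N" for r y using NN.smult_closed by simp
  have sz: "y \<in> carrier N \<Longrightarrow> \<zero>\<^bsub>R\<^esub> \<odot>\<^bsub>N\<^esub> y = \<zero>\<^bsub>N\<^esub>" for y using NN.smult_l_null by simp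
  have LF: "L c = finsum N (\<lambda>x. c x \<odot>\<^bsub>N\<^esub> a x) F"
    if "c \<in> carrier FM" "finite F" "F \<subseteq> X" "\<And>x. x \<notin> F \<Longrightarrow> c x = \<zero>\<^bsub>R\<^esub>" for c F
    unfolding L_def using that ac sm sz
    by (intro N.add.finprod_mono_neutral_cong_left) (auto simp: free_mod_carrier subset_eq)
  have Lc: "L c \<in> carrier N" if c: "c \<in> carrier FM" for c
    unfolding L_def
  proof (intro N.finsum_closed Pi_I)
    fix x assume "x \<in> {x. c x \<noteq> \<zero>\<^bsub>R\<^esub>}"
    then have "x \<in> X" "c x \<in> carrier R" using c by (auto simp: free_mod_carrier)
    then show "c x \<odot>\<^bsub>N\<^esub> a x \<in> carrier N" using ac sm by simp
  qed
  have La: "L (c \<oplus>\<^bsub>FM\<^esub> d) = L c \<oplus>\<^bsub>N\<^esub> L d" if c: "c \<in> carrier FM" and d: "d \<in> carrier FM" for c d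
  proof -
    let ?F = "{x. c x \<noteq> \<zero>\<^bsub>R\<^esub>} \<union> {x. d x \<noteq> \<zero>\<^bsub>R\<^esub>}"
    have F: "finite ?F" "?F \<subseteq> X" and cR: "\<And>x. c x \<in> carrier R" "\<And>x. d x \<in> carrier R"
      using c d by (auto simp: free_mod_carrier)
    have "L (c \<oplus>\<^bsub>FM\<^esub> d) = finsum N (\<lambda>x. (c x \<oplus>\<^bsub>R\<^esub> d x) \<odot>\<^bsub>N\<^esub> a x) ?F"
      using LF[of "c \<oplus>\<^bsub>FM\<^esub> d" ?F] c d F free_mod_closed(2) by (auto simp: free_mod_simps)
    also have "\<dots> = finsum N (\<lambda>x. c x \<odot>\<^bsub>N\<^esub> a x \<oplus>\<^bsub>N\<^esub> d x \<odot>\<^bsub>N\<^esub> a x) ?F"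
      using NN.smult_l_distr cR ac F(2) sm by (intro N.finsum_cong') (auto simp: subset_eq)
    also have "\<dots> = finsum N (\<lambda>x. c x \<odot>\<^bsub>N\<^esub> a x) ?F \<oplus>\<^bsub>N\<^esub> finsum N (\<lambda>x. d x \<odot>\<^bsub>N\<^esub> a x) ?F"
      using cR ac F(2) sm by (intro N.finsum_addf) (auto simp: subset_eq)
    also have "\<dots> = L c \<oplus>\<^bsub>N\<^esub> L d"
      using LF[OF c F] LF[OF d F] by simp
    finally show ?thesis .
  qed
  have Ls: "L (r \<odot>\<^bsub>FM\<^esub> c) = r \<odot>\<^bsub>N\<^esub> L c" if r: "r \<in> carrier R" and c: "c \<in> carrier FM" for r c
  proof -
    let ?F = "{x. c x \<noteq> \<zero>\<^bsub>R\<^esub>}"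
    have F: "finite ?F" "?F \<subseteq> X" and cR: "\<And>x. c x \<in> carrier R" using c by (auto simp: free_mod_carrier)
    have "L (r \<odot>\<^bsub>FM\<^esub> c) = finsum N (\<lambda>x. (r \<otimes>\<^bsub>R\<^esub> c x) \<odot>\<^bsub>N\<^esub> a x) ?F"
      using LF[of "r \<odot>\<^bsub>FM\<^esub> c" ?F] r c F free_mod_closed(4) by (auto simp: free_mod_simps)
    also have "\<dots> = finsum N (\<lambda>x. r \<odot>\<^bsub>N\<^esub> (c x \<odot>\<^bsub>N\<^esub> a x)) ?F"
      using NN.smult_assoc1 r cR ac F(2) sm by (intro N.finsum_cong') (auto simp: subset_eq)
    also have "\<dots> = r \<odot>\<^bsub>N\<^esub> finsum N (\<lambda>x. c x \<odot>\<^bsub>N\<^esub> a x) ?F"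
    proof (rule additive_map_finsum_group[OF N.abelian_group_axioms N.abelian_group_axioms _ F(1), symmetric])
      show "additive_map N N (\<lambda>x. r \<odot>\<^bsub>N\<^esub> x)" using r NN.smult_r_distr sm by (simp add: additive_map_def)
      show "c x \<odot>\<^bsub>N\<^esub> a x \<in> carrier N" if "x \<in> ?F" for x using that cR ac F(2) sm by blast
    qed
    finally show ?thesis by (simp add: L_def)
  qed
  have Lh: "L c \<in> mgrade N (\<psi> g)" if c: "c \<in> mgrade FM g" for c g
    unfolding L_def
  proof (rule N.D_finsum)
    fix x assume "x \<in> {x. c x \<noteq> \<zero>\<^bsub>R\<^esub>}"
    then have x: "x \<in> X" using c by (auto simp: free_mod_simps free_mod_carrier)
    have "c x \<in> coarse_grade R \<psi> (rgrade R) (\<psi> (g - wt x))"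
      using c by (intro R.coarse_gradeI[of _ "g - wt x"]) (auto simp: free_mod_simps)
    then have "c x \<odot>\<^bsub>N\<^esub> a x \<in> mgrade N (\<psi> (g - wt x) + \<psi> (wt x))"
      using graded_moduleD(5)[OF N _ a[OF x]] by simp
    then show "c x \<odot>\<^bsub>N\<^esub> a x \<in> mgrade N (\<psi> g)" by (simp flip: hom)
  qed
  have L0: "L \<zero>\<^bsub>FM\<^esub> = \<zero>\<^bsub>N\<^esub>" by (simp add: L_def free_mod_simps)
  have "(\<lambda>c\<in>carrier (coarsen \<psi> FM). L c) \<in> gr_hom (coarsen_ring \<psi> R) (coarsen \<psi> FM) N"
  proof (rule gr_hom_restrict[OF cF])
    show "linear_map (coarsen_ring \<psi> R) (coarsen \<psi> FM) N L"
      using La Ls Lc by (simp add: linear_map_def additive_map_def)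
    fix h c assume "c \<in> mgrade (coarsen \<psi> FM) h"
    then have "c \<in> coarse_grade FM \<psi> (mgrade FM) h" by simp
    then show "L c \<in> mgrade N h"
    proof (induction rule: F.coarse_grade_induct)
      case zero then show ?case by (simp add: L0)
    next
      case (homog g c) then show ?case using Lh by auto
    next
      case (add c d) then show ?case by (simp add: La N.D_add)
    qed
  qed
  moreover have "L (basis_elt R x) = a x" if x: "x \<in> X" for x
  proof -
    have "L (basis_elt R x) = finsum N (\<lambda>y. basis_elt R x y \<odot>\<^bsub>N\<^esub> a y) {x}"
      using x basis_elt_carrier[OF x] by (intro LF) (auto simp: basis_elt_def)
    then show ?thesis using ac[OF x] NN.smult_one by (simp add: basis_elt_def)
  qed
  ultimately show ?thesis using basis_elt_carrier by (intro that[of "\<lambda>c\<in>carrier (coarsen \<psi> FM). L c"]) auto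
qed

end

end

text \<open>Coarsening along the identity changes nothing. Hence what is proved for modules over a coarsened
  ring contains the case of the ring itself.\<close>

lemma coarse_grade_id:
  assumes "graded_group A D" shows "coarse_grade A (\<lambda>g. g) D = D"
proof -
  interpret graded_group A D by fact
  have "x \<in> coarse_grade A (\<lambda>g. g) D h \<longleftrightarrow> x \<in> D h" for x h
    using homogI[of x h] by (auto simp: coarse_grade_iff component_homog)
  then show ?thesis by (simp add: fun_eq_iff set_eq_iff)
qed

lemma coarsen_ring_id: "graded_cring R \<Longrightarrow> coarsen_ring (\<lambda>g. g) R = R"
  using coarse_grade_id[OF graded_cringD(2), of R] by (intro gring.equality) auto

lemma coarsen_id: "graded_module R M \<Longrightarrow> coarsen (\<lambda>g. g) M = M"
  using coarse_grade_id[OF graded_moduleD(2), of R M] by (intro gmod.equality) auto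

section \<open>Projective modules\<close>

text \<open>A basis element has a homogeneous image in the coarsened grading, hence a homogeneous preimage under
  a surjection. Choosing these extends to the free module, and the section restricts the lift to \<open>P\<close>.\<close>

lemma free_retract_projective:
  fixes R :: "('r, 'g::ab_group_add) gring" and P :: "('r, 'u, 'g) gmod" and \<psi> :: "'g \<Rightarrow> 'h::ab_group_add"
  assumes hom: "\<And>x y. \<psi> (x + y) = \<psi> x + \<psi> y" and R: "graded_cring R" and P: "graded_module R P"
    and p: "p \<in> gr_hom R (free_mod R X wt) P" and s: "s \<in> gr_hom R P (free_mod R X wt)"
    and ps: "\<And>x. x \<in> carrier P \<Longrightarrow> p (s x) = x"
  shows "gr_projective (coarsen_ring \<psi> R) (coarsen \<psi> P)"
  unfolding gr_projective_def
proof (intro conjI allI impI)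
  let ?S = "coarsen_ring \<psi> R" and ?F = "free_mod R X wt"
  note F = free_mod_graded_module[OF R, of X wt]
  note cF = coarsen_graded_module[OF hom R F]
  show cP: "graded_module ?S (coarsen \<psi> P)" by (rule coarsen_graded_module[OF hom R P])
  note cp = coarsen_gr_hom[OF hom R F P p] and cs = coarsen_gr_hom[OF hom R P F s]
  interpret P: graded_group P "mgrade P" using P by (rule graded_moduleD)
  fix A B :: "('r, 'u, 'h) gmod" and q f
  assume "graded_module ?S A \<and> graded_module ?S B \<and> q \<in> gr_hom ?S A B \<and>
    q ` carrier A = carrier B \<and> f \<in> gr_hom ?S (coarsen \<psi> P) B"
  then have A: "graded_module ?S A" and B: "graded_module ?S B" and q: "q \<in> gr_hom ?S A B"
    and qs: "q ` carrier A = carrier B" and f: "f \<in> gr_hom ?S (coarsen \<psi> P) B" by auto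
  interpret B: graded_group B "mgrade B" using B by (rule graded_moduleD)
  note be = basis_elt_homog[OF R, of _ X wt]
  have "\<exists>a. a \<in> mgrade A (\<psi> (wt x)) \<and> q a = f (p (basis_elt R x))" if x: "x \<in> X" for x
  proof -
    have "p (basis_elt R x) \<in> coarse_grade P \<psi> (mgrade P) (\<psi> (wt x))"
      using gr_homD(3)[OF p be[OF x]] by (rule P.coarse_gradeI) simp
    then have "f (p (basis_elt R x)) \<in> mgrade B (\<psi> (wt x))" using gr_homD(3)[OF f] by simp
    then show ?thesis using homog_preimage[OF A B q, of _ "\<psi> (wt x)"] qs B.D_carrier by metis
  qed
  then obtain a where a: "\<And>x. x \<in> X \<Longrightarrow> a x \<in> mgrade A (\<psi> (wt x))"
    and qa: "\<And>x. x \<in> X \<Longrightarrow> q (a x) = f (p (basis_elt R x))" by metis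
  have "\<exists>L. L \<in> gr_hom ?S (coarsen \<psi> ?F) A \<and> (\<forall>x\<in>X. L (basis_elt R x) = a x)"
    by (rule free_mod_extend[OF R hom A a]) blast+
  then obtain L where L: "L \<in> gr_hom ?S (coarsen \<psi> ?F) A" and Lb: "\<And>x. x \<in> X \<Longrightarrow> L (basis_elt R x) = a x"
    by blast
  have eq: "q (L c) = f (p c)" if c: "c \<in> carrier ?F" for c
  proof -
    have 1: "linear_map ?S (coarsen \<psi> ?F) B (compose (carrier (coarsen \<psi> ?F)) q L)"
      by (rule linear_map_compose[OF cF gr_homD(2)[OF L] gr_homD(2)[OF q]])
    have 2: "linear_map ?S (coarsen \<psi> ?F) B (compose (carrier (coarsen \<psi> ?F)) f p)"
      by (rule linear_map_compose[OF cF gr_homD(2)[OF cp] gr_homD(2)[OF f]])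
    have same: "compose (carrier (coarsen \<psi> ?F)) q L (basis_elt R x) = compose (carrier (coarsen \<psi> ?F)) f p (basis_elt R x)"
      if "c x \<noteq> \<zero>\<^bsub>R\<^esub>" for x
    proof -
      have x: "x \<in> X" using c that by (auto simp: free_mod_carrier)
      then show ?thesis using basis_elt_carrier[OF R x, of wt] Lb[OF x] qa[OF x] by (simp add: compose_def)
    qed
    have cR: "c x \<in> carrier R" for x using c by (simp add: free_mod_carrier)
    have fc: "f (p (basis_elt R x)) \<in> carrier B" if "c x \<noteq> \<zero>\<^bsub>R\<^esub>" for x
    proof -
      have x: "x \<in> X" using c that by (auto simp: free_mod_carrier)
      show ?thesis using gr_homD(4)[OF f] gr_homD(4)[OF p] basis_elt_carrier[OF R x, of wt] by simp
    qed
    have "compose (carrier (coarsen \<psi> ?F)) q L c = compose (carrier (coarsen \<psi> ?F)) f p c"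
      unfolding free_mod_eval[OF R hom B 1 c] free_mod_eval[OF R hom B 2 c]
    proof (rule B.finsum_cong', rule refl)
      show "(\<lambda>x. c x \<odot>\<^bsub>B\<^esub> compose (carrier (coarsen \<psi> ?F)) f p (basis_elt R x)) \<in> {x. c x \<noteq> \<zero>\<^bsub>R\<^esub>} \<rightarrow> carrier B"
      proof
        fix x assume "x \<in> {x. c x \<noteq> \<zero>\<^bsub>R\<^esub>}"
        then have x: "c x \<noteq> \<zero>\<^bsub>R\<^esub>" "x \<in> X" using c by (auto simp: free_mod_carrier)
        show "c x \<odot>\<^bsub>B\<^esub> compose (carrier (coarsen \<psi> ?F)) f p (basis_elt R x) \<in> carrier B"
          using module.smult_closed[OF graded_moduleD(1)[OF B], of "c x"] fc[OF x(1)] cR[of x]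
            basis_elt_carrier[OF R x(2), of wt] by (simp add: compose_def)
      qed
    qed (use same in simp)
    then show ?thesis using c by (simp add: compose_def)
  qed
  have "compose (carrier (coarsen \<psi> P)) L s \<in> gr_hom ?S (coarsen \<psi> P) A"
    by (rule gr_hom_compose[OF cP cs L])
  moreover have "q (compose (carrier (coarsen \<psi> P)) L s x) = f x" if "x \<in> carrier (coarsen \<psi> P)" for x
    using that eq[of "s x"] gr_homD(4)[OF s, of x] ps[of x] by (simp add: compose_def)
  ultimately show "\<exists>f'\<in>gr_hom ?S (coarsen \<psi> P) A. \<forall>x\<in>carrier (coarsen \<psi> P). q (f' x) = f x" by blast
qed

text \<open>The basis consists of all homogeneous elements, each with one of its degrees; only the element 0
  has more than one.\<close>

lemma free_cover:
  fixes R :: "('r, 'g::ab_group_add) gring" and M :: "('r, 'v, 'g) gmod"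
  assumes R: "graded_cring R" and M: "graded_module R M"
  obtains X :: "'v set" and wt :: "'v \<Rightarrow> 'g" and L
  where "X \<subseteq> carrier M" "L \<in> gr_hom R (free_mod R X wt) M" "L ` carrier (free_mod R X wt) = carrier M"
proof -
  interpret M: graded_group M "mgrade M" using M by (rule graded_moduleD)
  define X where "X = {x. \<exists>g. x \<in> mgrade M g}"
  define wt where "wt x = (SOME g. x \<in> mgrade M g)" for x
  have wt: "x \<in> mgrade M (wt x)" if "x \<in> X" for x
    using that unfolding X_def wt_def by (auto intro: someI)
  let ?F = "free_mod R X wt"
  note F = free_mod_graded_module[OF R, of X wt]
  interpret F: graded_group ?F "mgrade ?F" using F by (rule graded_moduleD)
  obtain L where L: "L \<in> gr_hom R ?F M" and Lb: "\<And>x. x \<in> X \<Longrightarrow> L (basis_elt R x) = x"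
    using free_mod_extend[OF R, of "\<lambda>g. g" M X "\<lambda>x. x" wt] wt M
    unfolding coarsen_ring_id[OF R] coarsen_id[OF F] by auto
  have "y \<in> L ` carrier ?F" if "y \<in> carrier M" for y
    using that
  proof (induction rule: M.carrier_induct)
    case zero then show ?case using linear_map_zero[OF F M gr_homD(2)[OF L], symmetric] F.zero_closed by (rule image_eqI)
  next
    case (homog g x)
    then have x: "x \<in> X" by (auto simp: X_def)
    show ?case using Lb[OF x, symmetric] basis_elt_carrier[OF R x] by (rule image_eqI)
  next
    case (add x y)
    then show ?case using graded_submoduleD(3)[OF image_graded_submodule[OF F M L]] by blast
  qed
  then have "L ` carrier ?F = carrier M" using gr_homD(4)[OF L] by blast
  moreover have "X \<subseteq> carrier M" unfolding X_def using M.D_carrier by blast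
  ultimately show ?thesis using L that by blast
qed

lemma universe_infinite:
  assumes R: "graded_cring R" and U: "universe_for TYPE('u) R"
  shows "infinite (UNIV :: 'u set)" "\<exists>j :: 'r \<Rightarrow> 'u. inj_on j (carrier (R :: ('r, 'g::ab_group_add) gring))"
proof -
  obtain f :: "nat \<times> 'r \<Rightarrow> 'u" where f: "inj_on f (UNIV \<times> carrier R)" using U by (auto simp: universe_for_def)
  have z: "\<zero>\<^bsub>R\<^esub> \<in> carrier R"
    using abelian_monoid.zero_closed[OF abelian_group.axioms(1)[OF graded_cringD(3)[OF R]]] .
  have "inj (\<lambda>n. f (n, \<zero>\<^bsub>R\<^esub>))" using f z by (auto simp: inj_on_def)
  then show "infinite (UNIV :: 'u set)" using finite_imageD infinite_UNIV_nat finite_subset subset_UNIV by metis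
  have "inj_on (\<lambda>r. f (0, r)) (carrier R)" using f by (auto simp: inj_on_def)
  then show "\<exists>j :: 'r \<Rightarrow> 'u. inj_on j (carrier R)" by blast
qed

text \<open>The finitely supported functions are encoded by their graphs, which are finite subsets of
  \<open>'u \<times> 'u\<close>.\<close>

lemma free_mod_embedding:
  fixes R :: "('r, 'g::ab_group_add) gring" and i :: "'v \<Rightarrow> 'u"
  assumes R: "graded_cring R" and U: "universe_for TYPE('u) R" and i: "inj_on i X"
  shows "\<exists>\<kappa> :: ('v \<Rightarrow> 'r) \<Rightarrow> 'u. inj_on \<kappa> (carrier (free_mod R X wt))"
proof -
  have inf: "infinite (UNIV :: 'u set)" by (rule universe_infinite(1)[OF R U])
  obtain j :: "'r \<Rightarrow> 'u" where j: "inj_on j (carrier R)" using universe_infinite(2)[OF R U] by blast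
  obtain b where b: "bij_betw b ((UNIV :: 'u set) \<times> (UNIV :: 'u set)) (UNIV :: 'u set)"
    using Times_same_infinite_bij_betw[OF inf] by blast
  obtain a where a: "bij_betw a (Fpow (UNIV :: 'u set)) (UNIV :: 'u set)"
    using Fpow_infinite_bij_betw[OF inf] by blast
  have binj: "inj b" using b by (simp add: bij_betw_def)
  define \<gamma> where "\<gamma> c = (\<lambda>x. b (i x, j (c x))) ` {x. c x \<noteq> \<zero>\<^bsub>R\<^esub>}" for c :: "'v \<Rightarrow> 'r"
  have "c x = d x" if c: "c \<in> carrier (free_mod R X wt)" and d: "d \<in> carrier (free_mod R X wt)"
    and eq: "\<gamma> c \<subseteq> \<gamma> d" and x: "c x \<noteq> \<zero>\<^bsub>R\<^esub>" for c d x
  proof -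
    have "b (i x, j (c x)) \<in> \<gamma> d" using eq x by (auto simp: \<gamma>_def)
    then obtain y where y: "d y \<noteq> \<zero>\<^bsub>R\<^esub>" "b (i x, j (c x)) = b (i y, j (d y))" by (auto simp: \<gamma>_def)
    have ij: "i x = i y" "j (c x) = j (d y)" using injD[OF binj y(2)] by auto
    have "x \<in> X" "y \<in> X" using c d x y by (auto simp: free_mod_carrier)
    then have "x = y" using ij(1) inj_onD[OF i] by blast
    then show ?thesis using ij(2) inj_onD[OF j] c d by (auto simp: free_mod_carrier)
  qed
  then have "inj_on \<gamma> (carrier (free_mod R X wt))"
    by (intro inj_onI ext) (metis equalityD1 equalityD2)
  moreover have "\<gamma> ` carrier (free_mod R X wt) \<subseteq> Fpow UNIV"
    by (auto simp: Fpow_def \<gamma>_def free_mod_carrier)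
  ultimately have "inj_on (a \<circ> \<gamma>) (carrier (free_mod R X wt))"
    using a by (intro comp_inj_on) (auto simp: bij_betw_def intro: inj_on_subset)
  then show ?thesis by blast
qed

lemma enough_projectives:
  fixes R :: "('r, 'g::ab_group_add) gring" and M :: "('r, 'v, 'g) gmod" and i :: "'v \<Rightarrow> 'u"
  assumes R: "graded_cring R" and U: "universe_for TYPE('u) R" and M: "graded_module R M"
    and i: "inj_on i (carrier M)"
  obtains P :: "('r, 'u, 'g) gmod" and p
  where "gr_projective R P" "p \<in> gr_hom R P M" "p ` carrier P = carrier M"
proof -
  obtain X wt L where X: "X \<subseteq> carrier M" and L: "L \<in> gr_hom R (free_mod R X wt) M"
    and Ls: "L ` carrier (free_mod R X wt) = carrier M"
    by (rule free_cover[OF R M])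
  let ?F = "free_mod R X wt"
  note F = free_mod_graded_module[OF R, of X wt]
  obtain \<kappa> :: "('v \<Rightarrow> 'r) \<Rightarrow> 'u" where k: "inj_on \<kappa> (carrier ?F)"
    using free_mod_embedding[OF R U inj_on_subset[OF i X]] by blast
  let ?P = "copymod \<kappa> ?F"
  note P = copymod_graded_module[OF R F k] and to = copymod_to[OF R F k] and from' = copymod_from[OF R F k]
    and car = copymod_carrier[OF R F k]
  let ?from = "\<lambda>y\<in>\<kappa> ` carrier ?F. inv_into (carrier ?F) \<kappa> y"
  have "gr_projective (coarsen_ring (\<lambda>g. g) R) (coarsen (\<lambda>g. g) ?P)"
  proof (rule free_retract_projective[OF _ R P to from'])
    show "(\<lambda>x\<in>carrier ?F. \<kappa> x) (?from x) = x" if "x \<in> carrier ?P" for x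
      using that k unfolding car by auto
  qed simp
  then have proj: "gr_projective R ?P" unfolding coarsen_ring_id[OF R] coarsen_id[OF P] .
  have "compose (carrier ?P) L ?from \<in> gr_hom R ?P M" by (rule gr_hom_compose[OF P from' L])
  moreover have "compose (carrier ?P) L ?from ` carrier ?P = carrier M"
  proof -
    have "compose (carrier ?P) L ?from ` carrier ?P = L ` carrier ?F"
      unfolding car using k by (auto simp: compose_def image_image image_iff)
    then show ?thesis using Ls by simp
  qed
  ultimately show ?thesis using that proj by blast
qed

lemma gr_projectiveD: "gr_projective R P \<Longrightarrow> graded_module R P"
  by (simp add: gr_projective_def)

lemma gr_projective_property:
  fixes P A B :: "('r, 'u, 'g::ab_group_add) gmod"
  assumes "gr_projective R P" "graded_module R A" "graded_module R B" "p \<in> gr_hom R A B"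
    "p ` carrier A = carrier B" "f \<in> gr_hom R P B"
  shows "\<exists>f'\<in>gr_hom R P A. \<forall>x\<in>carrier P. p (f' x) = f x"
  using conjunct2[OF assms(1)[unfolded gr_projective_def], rule_format, of A B p f] assms(2-) by blast

text \<open>The defining property of a projective speaks of modules in the universe, but the image of a
  module in the universe has a copy there, so the target of the surjection may have any type.\<close>

lemma gr_projective_lift:
  fixes R :: "('r, 'g::ab_group_add) gring" and P A :: "('r, 'u, 'g) gmod" and B :: "('r, 'w, 'g) gmod"
  assumes R: "graded_cring R" and P: "gr_projective R P" and A: "graded_module R A" and B: "graded_module R B"
    and p: "p \<in> gr_hom R A B" and f: "f \<in> gr_hom R P B" and im: "f ` carrier P \<subseteq> p ` carrier A"
  obtains f' where "f' \<in> gr_hom R P A" "\<And>x. x \<in> carrier P \<Longrightarrow> p (f' x) = f x"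
proof -
  note Pm = gr_projectiveD[OF P]
  let ?Z = "p ` carrier A"
  note Zs = image_graded_submodule[OF A B p]
  let ?B = "submod B ?Z"
  note B' = submod_graded_module[OF R B Zs]
  let ?r = "inv_into (carrier A) p"
  have r: "inj_on ?r (carrier ?B)" using inj_on_inv_into[of ?Z p "carrier A"] by simp
  note C = copymod_graded_module[OF R B' r] and to = copymod_to[OF R B' r] and car = copymod_carrier[OF R B' r]
  let ?to = "\<lambda>x\<in>carrier ?B. ?r x"
  have p': "p \<in> gr_hom R A ?B" by (rule gr_hom_into_submod[OF p _ A]) simp
  have f': "f \<in> gr_hom R P ?B" by (rule gr_hom_into_submod[OF f im Pm])
  let ?q = "compose (carrier A) ?to p" and ?h = "compose (carrier P) ?to f"
  have q: "?q \<in> gr_hom R A (copymod ?r ?B)" by (rule gr_hom_compose[OF A p' to])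
  have h: "?h \<in> gr_hom R P (copymod ?r ?B)" by (rule gr_hom_compose[OF Pm f' to])
  have surj: "?q ` carrier A = carrier (copymod ?r ?B)"
    unfolding car by (auto simp: compose_def image_image)
  obtain f' where f1: "f' \<in> gr_hom R P A" and eq: "\<forall>x\<in>carrier P. ?q (f' x) = ?h x"
    using gr_projective_property[OF P A C q surj h] by blast
  have "p (f' x) = f x" if x: "x \<in> carrier P" for x
  proof -
    have fx: "f' x \<in> carrier A" "f x \<in> ?Z" using gr_homD(4)[OF f1 x] im x by auto
    then have "?r (p (f' x)) = ?r (f x)" using eq x by (auto simp: compose_def)
    then show ?thesis using inj_onD[OF r, of "p (f' x)" "f x"] fx by simp
  qed
  then show ?thesis using that f1 by blast
qed

text \<open>A free cover of a projective module splits. The splitting remains one after coarsening, so the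
  criterion for retracts of free modules applies.\<close>

lemma gr_projective_coarsen:
  fixes R :: "('r, 'g::ab_group_add) gring" and P :: "('r, 'u, 'g) gmod" and \<psi> :: "'g \<Rightarrow> 'h::ab_group_add"
  assumes hom: "\<And>x y. \<psi> (x + y) = \<psi> x + \<psi> y" and R: "graded_cring R" and U: "universe_for TYPE('u) R"
    and P: "gr_projective R P"
  shows "gr_projective (coarsen_ring \<psi> R) (coarsen \<psi> P)"
proof -
  note Pm = gr_projectiveD[OF P]
  obtain X wt L where L: "L \<in> gr_hom R (free_mod R X wt) P" and X: "X \<subseteq> carrier P"
    and Ls: "L ` carrier (free_mod R X wt) = carrier P"
    by (rule free_cover[OF R Pm])
  let ?F = "free_mod R X wt"
  note F = free_mod_graded_module[OF R, of X wt]
  obtain \<kappa> :: "('u \<Rightarrow> 'r) \<Rightarrow> 'u" where k: "inj_on \<kappa> (carrier ?F)"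
    using free_mod_embedding[OF R U, of "\<lambda>x. x" X] by auto
  let ?K = "copymod \<kappa> ?F"
  note K = copymod_graded_module[OF R F k] and from' = copymod_from[OF R F k] and car = copymod_carrier[OF R F k]
  let ?from = "\<lambda>y\<in>\<kappa> ` carrier ?F. inv_into (carrier ?F) \<kappa> y"
  let ?q = "compose (carrier ?K) L ?from"
  have q: "?q \<in> gr_hom R ?K P" by (rule gr_hom_compose[OF K from' L])
  have "?q ` carrier ?K = L ` carrier ?F"
    unfolding car using k by (auto simp: compose_def image_image image_iff)
  then have "(\<lambda>x\<in>carrier P. x) ` carrier P \<subseteq> ?q ` carrier ?K" using Ls by auto
  then obtain s where s: "s \<in> gr_hom R P ?K" and qs: "\<And>x. x \<in> carrier P \<Longrightarrow> ?q (s x) = (\<lambda>x\<in>carrier P. x) x"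
    using gr_projective_lift[OF R P K Pm q gr_hom_id[OF Pm]] by blast
  show ?thesis
  proof (rule free_retract_projective[OF hom R Pm L])
    show "compose (carrier P) ?from s \<in> gr_hom R P ?F" by (rule gr_hom_compose[OF Pm s from'])
    show "L (compose (carrier P) ?from s x) = x" if "x \<in> carrier P" for x
      using qs[OF that] that gr_homD(4)[OF s that] by (simp add: compose_def)
  qed
qed

text \<open>An element of the graded Hom module is a finite sum of homomorphisms into shifts, which lift one by one.\<close>

lemma ghom_lift:
  fixes R :: "('r, 'g::ab_group_add) gring" and P B :: "('r, 'u, 'g) gmod" and C :: "('r, 'w, 'g) gmod"
  assumes R: "graded_cring R" and P: "gr_projective R P" and B: "graded_module R B" and C: "graded_module R C"
    and b: "b \<in> gr_hom R B C" "b ` carrier B = carrier C" and w: "w \<in> carrier (ghom R P C)"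
  obtains v where "v \<in> carrier (ghom R P B)" "\<And>x. x \<in> carrier P \<Longrightarrow> b (v x) = w x"
proof -
  note Pm = gr_projectiveD[OF P]
  interpret G: graded_group "ghom R P C" "\<lambda>g. gr_hom R P (shift C g)" by (rule ghom_graded_group[OF R Pm C])
  interpret H: graded_group "ghom R P B" "\<lambda>g. gr_hom R P (shift B g)" by (rule ghom_graded_group[OF R Pm B])
  note bl = linear_mapD[OF gr_homD(2)[OF b(1)]]
  from w have "\<exists>v\<in>carrier (ghom R P B). \<forall>x\<in>carrier P. b (v x) = w x"
  proof (induction rule: G.carrier_induct)
    case zero
    then show ?case
      using H.zero_closed linear_map_zero[OF B C gr_homD(2)[OF b(1)]]
      by (intro bexI[of _ "\<zero>\<^bsub>ghom R P B\<^esub>"]) (auto simp: ghom_simps)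
  next
    case (homog g w)
    have wc: "w ` carrier P \<subseteq> b ` carrier (shift B g)" using homog gr_homD(4)[OF homog] b(2) by auto
    obtain v where "v \<in> gr_hom R P (shift B g)" "\<And>x. x \<in> carrier P \<Longrightarrow> b (v x) = w x"
      using gr_projective_lift[OF R P shift_graded_module[OF B] shift_graded_module[OF C]
          gr_hom_shift_both[OF b(1)] homog wc] by blast
    then show ?case using gr_hom_ghom[OF Pm B] by blast
  next
    case (add w w')
    then obtain v v' where v: "v \<in> carrier (ghom R P B)" "\<forall>x\<in>carrier P. b (v x) = w x"
      and v': "v' \<in> carrier (ghom R P B)" "\<forall>x\<in>carrier P. b (v' x) = w' x" by blast
    have "b ((v \<oplus>\<^bsub>ghom R P B\<^esub> v') x) = (w \<oplus>\<^bsub>ghom R P C\<^esub> w') x" if "x \<in> carrier P" for x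
      using that v v' bl(3) ghomD(3)[OF R Pm B v(1) that] ghomD(3)[OF R Pm B v'(1) that]
      by (simp add: ghom_simps)
    then show ?case using H.a_closed[OF v(1) v'(1)] by blast
  qed
  then show ?thesis using that by blast
qed

section \<open>Projective resolutions and chain maps\<close>

lemma resolutionD:
  assumes "projective_resolution R M P"
  shows "gr_projective R (pr P i)" "graded_module R (pr P i)" "i < 0 \<Longrightarrow> carrier (pr P i) = {\<zero>\<^bsub>pr P i\<^esub>}"
    "df P i \<in> gr_hom R (pr P i) (pr P (i - 1))" "aug P \<in> gr_hom R (pr P 0) M"
    "aug P ` carrier (pr P 0) = carrier M" "df P 1 ` carrier (pr P 1) = a_kernel (pr P 0) M (aug P)"
    "i \<ge> 1 \<Longrightarrow> df P (i + 1) ` carrier (pr P (i + 1)) = a_kernel (pr P i) (pr P (i - 1)) (df P i)"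
proof -
  note a = assms[unfolded projective_resolution_def]
  show "gr_projective R (pr P i)" using a by simp
  then show "graded_module R (pr P i)" by (rule gr_projectiveD)
  show "i < 0 \<Longrightarrow> carrier (pr P i) = {\<zero>\<^bsub>pr P i\<^esub>}" "df P i \<in> gr_hom R (pr P i) (pr P (i - 1))"
    "aug P \<in> gr_hom R (pr P 0) M" "aug P ` carrier (pr P 0) = carrier M"
    "df P 1 ` carrier (pr P 1) = a_kernel (pr P 0) M (aug P)"
    "i \<ge> 1 \<Longrightarrow> df P (i + 1) ` carrier (pr P (i + 1)) = a_kernel (pr P i) (pr P (i - 1)) (df P i)"
    using a by simp_all
qed

lemma resolution_df:
  assumes "projective_resolution R M P"
  shows "df P (i + 1) \<in> gr_hom R (pr P (i + 1)) (pr P i)"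
  using resolutionD(4)[OF assms, of "i + 1"] by simp

lemma resolution_dd:
  assumes P: "projective_resolution R M P" and x: "x \<in> carrier (pr P (i + 1))"
  shows "df P i (df P (i + 1) x) = \<zero>\<^bsub>pr P (i - 1)\<^esub>"
proof (cases "i \<ge> 1")
  case True
  then have "df P (i + 1) x \<in> a_kernel (pr P i) (pr P (i - 1)) (df P i)"
    using resolutionD(8)[OF P True] x by blast
  then show ?thesis by (simp add: a_kernel_def')
next
  case False
  then have "carrier (pr P (i - 1)) = {\<zero>\<^bsub>pr P (i - 1)\<^esub>}" using resolutionD(3)[OF P, of "i - 1"] by simp
  moreover have "df P i (df P (i + 1) x) \<in> carrier (pr P (i - 1))"
    using gr_homD(4)[OF resolutionD(4)[OF P]] gr_homD(4)[OF resolution_df[OF P] x] by blast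
  ultimately show ?thesis by blast
qed

text \<open>Each step covers the kernel of the last map. That kernel is a submodule of a module in the universe,
  so one embedding of \<open>M\<close> is enough to start.\<close>

lemma resolution_exists:
  fixes R :: "('r, 'g::ab_group_add) gring" and M :: "('r, 'v, 'g) gmod" and j :: "'v \<Rightarrow> 'u"
  assumes R: "graded_cring R" and U: "universe_for TYPE('u) R" and M: "graded_module R M"
    and j: "inj_on j (carrier M)"
  shows "\<exists>P :: ('r, 'u, 'g, 'v) resolution. projective_resolution R M P"
proof -
  obtain P0 :: "('r, 'u, 'g) gmod" and e where P0: "gr_projective R P0" and e: "e \<in> gr_hom R P0 M"
    and es: "e ` carrier P0 = carrier M"
    by (rule enough_projectives[OF R U M j])
  note P0m = gr_projectiveD[OF P0]
  interpret P0: graded_group P0 "mgrade P0" using P0m by (rule graded_moduleD)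
  interpret P0M: module R P0 using P0m by (rule graded_moduleD)
  \<comment> \<open>A state consists of the last module, the map out of it, and the kernel of that map.\<close>
  define I where "I n = (\<lambda>(A :: ('r, 'u, 'g) gmod, d :: 'u \<Rightarrow> 'u, K). gr_projective R A \<and> graded_submodule R A K \<and>
     (n = (0::nat) \<longrightarrow> A = P0 \<and> K = a_kernel P0 M e))" for n
  define Q where "Q n = (\<lambda>(A :: ('r, 'u, 'g) gmod, d :: 'u \<Rightarrow> 'u, K :: 'u set) (A' :: ('r, 'u, 'g) gmod, d' :: 'u \<Rightarrow> 'u, K').
     d' \<in> gr_hom R A' A \<and> d' ` carrier A' = K \<and> K' = a_kernel A' A d')" for n :: nat
  have "\<exists>f. \<forall>n. I n (f n) \<and> Q n (f n) (f (Suc n))"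
  proof (rule dependent_nat_choice)
    show "\<exists>x. I 0 x"
      using P0 kernel_graded_submodule[OF P0m M e]
      by (intro exI[of _ "(P0, \<lambda>x. x, a_kernel P0 M e)"]) (simp add: I_def)
  next
    fix x :: "('r, 'u, 'g) gmod \<times> ('u \<Rightarrow> 'u) \<times> 'u set" and n
    assume "I n x"
    then obtain A d K where x: "x = (A, d, K)" and A: "gr_projective R A" and K: "graded_submodule R A K"
      by (auto simp: I_def)
    note Am = gr_projectiveD[OF A]
    have inj: "inj_on (\<lambda>x. x) (carrier (submod A K))" by simp
    obtain A' :: "('r, 'u, 'g) gmod" and p where A': "gr_projective R A'"
      and p: "p \<in> gr_hom R A' (submod A K)" and ps: "p ` carrier A' = carrier (submod A K)"
      by (rule enough_projectives[OF R U submod_graded_module[OF R Am K] inj])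
    note A'm = gr_projectiveD[OF A']
    have pA: "p \<in> gr_hom R A' A"
      using p graded_submoduleD(1)[OF K] by (auto simp: gr_hom_iff linear_map_def additive_map_def)
    have "graded_submodule R A' (a_kernel A' A p)" by (rule kernel_graded_submodule[OF A'm Am pA])
    then show "\<exists>y. I (Suc n) y \<and> Q n x y"
      using A' pA ps x by (intro exI[of _ "(A', p, a_kernel A' A p)"]) (simp add: I_def Q_def)
  qed
  then obtain f where f: "\<And>n. I n (f n)" "\<And>n. Q n (f n) (f (Suc n))" by blast
  define A where "A n = fst (f n)" for n
  define d where "d n = fst (snd (f n))" for n
  define K where "K n = snd (snd (f n))" for n
  have fn: "f n = (A n, d n, K n)" for n by (simp add: A_def d_def K_def)
  have A: "gr_projective R (A n)" for n using f(1)[of n] by (simp add: fn I_def)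
  note Am = gr_projectiveD[OF A]
  have A0: "A 0 = P0" "K 0 = a_kernel P0 M e" using f(1)[of 0] by (simp_all add: fn I_def)
  have d: "d (Suc n) \<in> gr_hom R (A (Suc n)) (A n)" "d (Suc n) ` carrier (A (Suc n)) = K n"
    "K (Suc n) = a_kernel (A (Suc n)) (A n) (d (Suc n))" for n
    using f(2)[of n] by (simp_all add: fn Q_def)
  have zs: "graded_submodule R P0 {\<zero>\<^bsub>P0\<^esub>}" by (simp add: graded_submodule_def)
  define O' where "O' = submod P0 {\<zero>\<^bsub>P0\<^esub>}"
  have Oc: "carrier O' = {\<zero>\<^bsub>O'\<^esub>}" by (simp add: O'_def)
  have Om: "graded_module R O'" unfolding O'_def by (rule submod_graded_module[OF R P0m zs])
  have Op: "gr_projective R O'"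
    unfolding gr_projective_def
  proof (intro conjI allI impI Om)
    fix X Y :: "('r, 'u, 'g) gmod" and p h
    assume "graded_module R X \<and> graded_module R Y \<and> p \<in> gr_hom R X Y \<and> p ` carrier X = carrier Y \<and> h \<in> gr_hom R O' Y"
    then have X: "graded_module R X" and Y: "graded_module R Y" and p: "p \<in> gr_hom R X Y" and h: "h \<in> gr_hom R O' Y"
      by auto
    have "p ((\<lambda>x\<in>carrier O'. \<zero>\<^bsub>X\<^esub>) x) = h x" if "x \<in> carrier O'" for x
      using that Oc linear_map_zero[OF X Y gr_homD(2)[OF p]] linear_map_zero[OF Om Y gr_homD(2)[OF h]] by auto
    then show "\<exists>f'\<in>gr_hom R O' X. \<forall>x\<in>carrier O'. p (f' x) = h x" using gr_hom_zero[OF Om X] by blast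
  qed
  define PP :: "int \<Rightarrow> ('r, 'u, 'g) gmod" where "PP i = (if i < 0 then O' else A (nat i))" for i
  define dd :: "int \<Rightarrow> 'u \<Rightarrow> 'u" where
    "dd i = (if i \<ge> 1 then d (nat i) else (\<lambda>x\<in>carrier (PP i). \<zero>\<^bsub>PP (i - 1)\<^esub>))" for i
  have PPm: "graded_module R (PP i)" for i using Am Om by (simp add: PP_def)
  have nS: "nat i = Suc (nat (i - 1))" "nat (i + 1) = Suc (nat i)" if "i \<ge> 1" for i using that by simp_all
  have ddh: "dd i \<in> gr_hom R (PP i) (PP (i - 1))" for i
  proof (cases "i \<ge> 1")
    case True
    then show ?thesis using d(1)[of "nat (i - 1)"] nS(1)[OF True] by (simp add: dd_def PP_def)
  next
    case False
    then show ?thesis using gr_hom_zero[OF PPm PPm] by (simp add: dd_def)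
  qed
  have "projective_resolution R M \<lparr>pr = PP, df = dd, aug = e\<rparr>"
    unfolding projective_resolution_def
  proof (intro conjI allI impI, goal_cases)
    case (1 i) then show ?case using A Op by (simp add: PP_def)
  next
    case (2 i) then show ?case using Oc by (simp add: PP_def)
  next
    case (3 i) then show ?case using ddh by simp
  next
    case 4 then show ?case using e A0 by (simp add: PP_def)
  next
    case 5 then show ?case using es A0 by (simp add: PP_def)
  next
    case 6 then show ?case using d(2)[of 0] A0 by (simp add: PP_def dd_def)
  next
    case (7 i)
    then have "i \<ge> 1" by simp
    then show ?case using d(2)[of "nat i"] d(3)[of "nat (i - 1)"] nS[OF \<open>i \<ge> 1\<close>] by (simp add: PP_def dd_def)
  qed
  then show ?thesis by blast
qed

definition chain_map ::
    "('r, 'g::ab_group_add) gring \<Rightarrow> ('r, 'u, 'g, 'v) resolution \<Rightarrow> ('r, 'u, 'g, 'w) resolution \<Rightarrow>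
      (int \<Rightarrow> 'u \<Rightarrow> 'u) \<Rightarrow> bool" where
  "chain_map R P P' \<phi> \<longleftrightarrow> (\<forall>i. \<phi> i \<in> gr_hom R (pr P i) (pr P' i)) \<and>
     (\<forall>i. \<forall>x\<in>carrier (pr P i). \<phi> (i - 1) (df P i x) = df P' i (\<phi> i x))"

definition lifts ::
    "('r, 'g::ab_group_add) gring \<Rightarrow> ('r, 'u, 'g, 'v) resolution \<Rightarrow> ('r, 'u, 'g, 'w) resolution \<Rightarrow>
      ('v \<Rightarrow> 'w) \<Rightarrow> (int \<Rightarrow> 'u \<Rightarrow> 'u) \<Rightarrow> bool" where
  "lifts R P P' f \<phi> \<longleftrightarrow> chain_map R P P' \<phi> \<and> (\<forall>x\<in>carrier (pr P 0). f (aug P x) = aug P' (\<phi> 0 x))"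

lemma chain_mapD:
  assumes "chain_map R P P' \<phi>"
  shows "\<phi> i \<in> gr_hom R (pr P i) (pr P' i)"
    "x \<in> carrier (pr P (i + 1)) \<Longrightarrow> \<phi> i (df P (i + 1) x) = df P' (i + 1) (\<phi> (i + 1) x)"
    "x \<in> carrier (pr P i) \<Longrightarrow> \<phi> (i - 1) (df P i x) = df P' i (\<phi> i x)"
proof -
  show "\<phi> i \<in> gr_hom R (pr P i) (pr P' i)" using assms by (simp add: chain_map_def)
  show 1: "x \<in> carrier (pr P i) \<Longrightarrow> \<phi> (i - 1) (df P i x) = df P' i (\<phi> i x)" for i
    using assms by (simp add: chain_map_def)
  show "x \<in> carrier (pr P (i + 1)) \<Longrightarrow> \<phi> i (df P (i + 1) x) = df P' (i + 1) (\<phi> (i + 1) x)"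
    using 1[of "i + 1"] by simp
qed

lemma lifts_exist:
  fixes R :: "('r, 'g::ab_group_add) gring"
    and P :: "('r, 'u, 'g, 'v) resolution" and P' :: "('r, 'u, 'g, 'w) resolution"
  assumes R: "graded_cring R" and M: "graded_module R M" and M': "graded_module R M'"
    and P: "projective_resolution R M P" and P': "projective_resolution R M' P'" and f: "f \<in> gr_hom R M M'"
  shows "\<exists>\<phi>. lifts R P P' f \<phi>"
proof -
  note Pm = resolutionD(2)[OF P] and P'm = resolutionD(2)[OF P']
  note Pd = resolutionD(4)[OF P] and P'd = resolutionD(4)[OF P']
  note Pd1 = resolution_df[OF P] and P'd1 = resolution_df[OF P']
  define I where "I n \<phi> \<longleftrightarrow> \<phi> \<in> gr_hom R (pr P (int n)) (pr P' (int n)) \<and>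
    (\<forall>x\<in>carrier (pr P (int n + 1)). \<phi> (df P (int n + 1) x) \<in> df P' (int n + 1) ` carrier (pr P' (int n + 1))) \<and>
    (n = 0 \<longrightarrow> (\<forall>x\<in>carrier (pr P 0). f (aug P x) = aug P' (\<phi> x)))" for n \<phi>
  define Q where "Q n \<phi> \<phi>' \<longleftrightarrow>
    (\<forall>x\<in>carrier (pr P (int n + 1)). \<phi> (df P (int n + 1) x) = df P' (int n + 1) (\<phi>' x))" for n :: nat and \<phi> \<phi>' :: "'u \<Rightarrow> 'u"
  have "\<exists>\<phi>. \<forall>n. I n (\<phi> n) \<and> Q n (\<phi> n) (\<phi> (Suc n))"
  proof (rule dependent_nat_choice)
    let ?fe = "compose (carrier (pr P 0)) f (aug P)"
    have fe: "?fe \<in> gr_hom R (pr P 0) M'" by (rule gr_hom_compose[OF Pm resolutionD(5)[OF P] f])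
    have "?fe ` carrier (pr P 0) \<subseteq> aug P' ` carrier (pr P' 0)"
      using gr_homD(4)[OF fe] resolutionD(6)[OF P'] by auto
    then obtain \<phi> where \<phi>: "\<phi> \<in> gr_hom R (pr P 0) (pr P' 0)"
      and eq: "\<And>x. x \<in> carrier (pr P 0) \<Longrightarrow> aug P' (\<phi> x) = ?fe x"
      using gr_projective_lift[OF R resolutionD(1)[OF P] P'm M' resolutionD(5)[OF P'] fe] by blast
    have "\<phi> (df P 1 x) \<in> df P' 1 ` carrier (pr P' 1)" if x: "x \<in> carrier (pr P 1)" for x
    proof -
      have dx: "df P 1 x \<in> carrier (pr P 0)" "aug P (df P 1 x) = \<zero>\<^bsub>M\<^esub>"
        using resolutionD(7)[OF P] x by (auto simp: a_kernel_def')
      then have "aug P' (\<phi> (df P 1 x)) = \<zero>\<^bsub>M'\<^esub>"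
        using eq[OF dx(1)] linear_map_zero[OF M M' gr_homD(2)[OF f]] by (simp add: compose_def)
      then show ?thesis unfolding resolutionD(7)[OF P'] using gr_homD(4)[OF \<phi> dx(1)] by (simp add: a_kernel_def')
    qed
    then show "\<exists>\<phi>. I 0 \<phi>" using \<phi> eq by (intro exI[of _ \<phi>]) (simp add: I_def compose_def)
  next
    fix \<phi> n assume "I n \<phi>"
    then have \<phi>: "\<phi> \<in> gr_hom R (pr P (int n)) (pr P' (int n))"
      and im: "\<And>x. x \<in> carrier (pr P (int n + 1)) \<Longrightarrow> \<phi> (df P (int n + 1) x) \<in> df P' (int n + 1) ` carrier (pr P' (int n + 1))"
      by (auto simp: I_def)
    let ?h = "compose (carrier (pr P (int n + 1))) \<phi> (df P (int n + 1))"
    have h: "?h \<in> gr_hom R (pr P (int n + 1)) (pr P' (int n))" by (rule gr_hom_compose[OF Pm Pd1 \<phi>])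
    have "?h ` carrier (pr P (int n + 1)) \<subseteq> df P' (int n + 1) ` carrier (pr P' (int n + 1))"
      using im by (auto simp: compose_def)
    then obtain \<phi>' where \<phi>': "\<phi>' \<in> gr_hom R (pr P (int n + 1)) (pr P' (int n + 1))"
      and eq: "\<And>x. x \<in> carrier (pr P (int n + 1)) \<Longrightarrow> df P' (int n + 1) (\<phi>' x) = ?h x"
      using gr_projective_lift[OF R resolutionD(1)[OF P] P'm P'm P'd1 h] by blast
    have "\<phi>' (df P (int n + 2) x) \<in> df P' (int n + 2) ` carrier (pr P' (int n + 2))"
      if x: "x \<in> carrier (pr P (int n + 2))" for x
    proof -
      have x': "x \<in> carrier (pr P (int n + 1 + 1))" using x by (simp add: add.assoc)
      have dx: "df P (int n + 2) x \<in> carrier (pr P (int n + 1))"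
        using gr_homD(4)[OF Pd1 x'] by (simp add: add.assoc)
      have "df P' (int n + 1) (\<phi>' (df P (int n + 2) x)) = \<phi> (df P (int n + 1) (df P (int n + 2) x))"
        using eq[OF dx] dx by (simp add: compose_def)
      also have "df P (int n + 1) (df P (int n + 2) x) = \<zero>\<^bsub>pr P (int n)\<^esub>"
        using resolution_dd[OF P x'] by (simp add: add.assoc)
      finally have "df P' (int n + 1) (\<phi>' (df P (int n + 2) x)) = \<zero>\<^bsub>pr P' (int n)\<^esub>"
        using linear_map_zero[OF Pm P'm gr_homD(2)[OF \<phi>]] by simp
      then show ?thesis
        using resolutionD(8)[OF P', of "int n + 1"] gr_homD(4)[OF \<phi>' dx] by (simp add: a_kernel_def' add.assoc)
    qed
    then show "\<exists>\<phi>'. I (Suc n) \<phi>' \<and> Q n \<phi> \<phi>'"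
      using \<phi>' eq by (intro exI[of _ \<phi>']) (simp add: I_def Q_def compose_def add.commute add.left_commute)
  qed
  then obtain \<phi> where \<phi>: "\<And>n. I n (\<phi> n)" "\<And>n. Q n (\<phi> n) (\<phi> (Suc n))" by blast
  define \<Phi> where "\<Phi> i = (if i < 0 then (\<lambda>x\<in>carrier (pr P i). \<zero>\<^bsub>pr P' i\<^esub>) else \<phi> (nat i))" for i :: int
  have \<Phi>h: "\<Phi> i \<in> gr_hom R (pr P i) (pr P' i)" for i
  proof (cases "i < 0")
    case True then show ?thesis using gr_hom_zero[OF Pm P'm] by (simp add: \<Phi>_def)
  next
    case False
    then have "int (nat i) = i" by simp
    then show ?thesis using \<phi>(1)[of "nat i"] False by (simp add: \<Phi>_def I_def)
  qed
  have "\<Phi> (i - 1) (df P i x) = df P' i (\<Phi> i x)" if x: "x \<in> carrier (pr P i)" for i x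
  proof (cases "i \<ge> 1")
    case True
    then obtain n where n: "i = int n + 1" by (metis add.commute zle_iff_zadd)
    then have "nat i = Suc n" "nat (i - 1) = n" by auto
    then show ?thesis using \<phi>(2)[of n] x n True by (simp add: \<Phi>_def Q_def)
  next
    case False
    have "df P' i (\<Phi> i x) \<in> carrier (pr P' (i - 1))" using gr_homD(4)[OF P'd] gr_homD(4)[OF \<Phi>h x] by blast
    then show ?thesis
      using False resolutionD(3)[OF P', of "i - 1"] gr_homD(4)[OF Pd x] by (simp add: \<Phi>_def)
  qed
  then have "lifts R P P' f \<Phi>"
    using \<Phi>h \<phi>(1)[of 0] by (simp add: lifts_def chain_map_def I_def) (simp add: \<Phi>_def)
  then show ?thesis by blast
qed

lemma gr_hom_diff:
  fixes R :: "('r, 'g::ab_group_add) gring" and N :: "('r, 'n, 'g) gmod"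
  assumes M: "graded_module R M" and N: "graded_module R N" and u: "u \<in> gr_hom R M N" and v: "v \<in> gr_hom R M N"
  shows "(\<lambda>x\<in>carrier M. u x \<ominus>\<^bsub>N\<^esub> v x) \<in> gr_hom R M N"
proof -
  interpret N: graded_group N "mgrade N" using N by (rule graded_moduleD)
  interpret NN: module R N using N by (rule graded_moduleD)
  note ul = linear_mapD[OF gr_homD(2)[OF u]] and vl = linear_mapD[OF gr_homD(2)[OF v]]
  show ?thesis
  proof (rule gr_hom_restrict[OF M])
    show "linear_map R M N (\<lambda>x. u x \<ominus>\<^bsub>N\<^esub> v x)"
      using ul(2-) vl(2-)
      by (simp add: linear_map_def additive_map_def a_minus_def NN.smult_r_distr NN.smult_r_minus
          N.minus_add N.a_ac)
    show "u x \<ominus>\<^bsub>N\<^esub> v x \<in> mgrade N g" if "x \<in> mgrade M g" for x g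
      using gr_homD(3)[OF u that] gr_homD(3)[OF v that] by (simp add: a_minus_def N.D_add N.D_minus)
  qed
qed

lemma (in abelian_group) minus_eq_zero: "x \<in> carrier G \<Longrightarrow> y \<in> carrier G \<Longrightarrow> x \<ominus> y = \<zero> \<Longrightarrow> x = y"
  by (metis a_minus_def add.inv_solve_right' l_zero zero_closed)

lemma (in abelian_group) eq_add_minus: "x \<in> carrier G \<Longrightarrow> y \<in> carrier G \<Longrightarrow> x = y \<oplus> (x \<ominus> y)"
  by (simp add: a_minus_def a_lcomm r_neg)

lemma linear_map_diff:
  assumes "graded_module R M" "graded_module R N" "linear_map R M N u" "x \<in> carrier M" "y \<in> carrier M"
  shows "u (x \<ominus>\<^bsub>M\<^esub> y) = u x \<ominus>\<^bsub>N\<^esub> u y"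
proof -
  interpret abelian_group M using assms(1) by (rule graded_moduleD)
  show ?thesis using assms linear_mapD(3)[OF assms(3)] linear_map_minus[OF assms(1-3)] by (simp add: a_minus_def)
qed

text \<open>Two lifts of the same map differ by \<open>d \<circ> s + s \<circ> d\<close> for a chain homotopy \<open>s\<close>. A cocycle kills the first
  summand, so \<open>v\<close> is the composite of \<open>u\<close> and \<open>s\<close>.\<close>

lemma lifts_homotopic:
  fixes R :: "('r, 'g::ab_group_add) gring"
    and P :: "('r, 'u, 'g, 'v) resolution" and P' :: "('r, 'u, 'g, 'w) resolution"
  assumes R: "graded_cring R" and M: "graded_module R M" and M': "graded_module R M'"
    and P: "projective_resolution R M P" and P': "projective_resolution R M' P'"
    and \<phi>: "lifts R P P' f \<phi>" and \<phi>': "lifts R P P' f \<phi>'"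
    and N: "graded_module R N" and u: "u \<in> cocycles R P' N i"
  shows "\<exists>v\<in>carrier (ghom R (pr P (i - 1)) N). \<forall>x\<in>carrier (pr P i). u (\<phi> i x) = v (df P i x) \<oplus>\<^bsub>N\<^esub> u (\<phi>' i x)"
proof -
  note Pm = resolutionD(2)[OF P] and P'm = resolutionD(2)[OF P']
  note Pd = resolutionD(4)[OF P] and P'd = resolutionD(4)[OF P']
  note Pd1 = resolution_df[OF P] and P'd1 = resolution_df[OF P']
  have cm: "chain_map R P P' \<phi>" "chain_map R P P' \<phi>'" using \<phi> \<phi>' by (auto simp: lifts_def)
  note \<phi>h = chain_mapD(1)[OF cm(1)] and \<phi>'h = chain_mapD(1)[OF cm(2)]
  interpret N: abelian_group N using N by (rule graded_moduleD)
  have P'a: "abelian_group (pr P' i)" for i using graded_moduleD(3)[OF P'm] .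
  define \<delta> where "\<delta> i = (\<lambda>x\<in>carrier (pr P i). \<phi> i x \<ominus>\<^bsub>pr P' i\<^esub> \<phi>' i x)" for i
  have \<delta>h: "\<delta> i \<in> gr_hom R (pr P i) (pr P' i)" for i unfolding \<delta>_def by (rule gr_hom_diff[OF Pm P'm \<phi>h \<phi>'h])
  have \<delta>d: "df P' (i + 1) (\<delta> (i + 1) x) = \<delta> i (df P (i + 1) x)" if x: "x \<in> carrier (pr P (i + 1))" for i x
    using x gr_homD(4)[OF Pd1 x] linear_map_diff[OF P'm P'm gr_homD(2)[OF P'd1] gr_homD(4)[OF \<phi>h x] gr_homD(4)[OF \<phi>'h x]]
      chain_mapD(2)[OF cm(1) x] chain_mapD(2)[OF cm(2) x] by (simp add: \<delta>_def)
  let ?r = "\<lambda>n s x. \<delta> (int n + 1) x \<ominus>\<^bsub>pr P' (int n + 1)\<^esub> s (df P (int n + 1) x)"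
  define I where "I n s \<longleftrightarrow> s \<in> gr_hom R (pr P (int n)) (pr P' (int n + 1)) \<and>
    (\<forall>x\<in>carrier (pr P (int n + 1)). df P' (int n + 1) (?r n s x) = \<zero>\<^bsub>pr P' (int n)\<^esub>) \<and>
    (n = 0 \<longrightarrow> (\<forall>x\<in>carrier (pr P 0). df P' 1 (s x) = \<delta> 0 x))" for n and s :: "'u \<Rightarrow> 'u"
  define Q where "Q n s t \<longleftrightarrow>
    (\<forall>x\<in>carrier (pr P (int n + 1)). df P' (int n + 2) (t x) = ?r n s x)" for n :: nat and s t :: "'u \<Rightarrow> 'u"
  have "\<exists>s. \<forall>n. I n (s n) \<and> Q n (s n) (s (Suc n))"
  proof (rule dependent_nat_choice)
    have "\<delta> 0 ` carrier (pr P 0) \<subseteq> df P' 1 ` carrier (pr P' 1)"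
    proof (rule image_subsetI)
      fix x assume x: "x \<in> carrier (pr P 0)"
      have "aug P' (\<delta> 0 x) = aug P' (\<phi> 0 x) \<ominus>\<^bsub>M'\<^esub> aug P' (\<phi>' 0 x)"
        using x linear_map_diff[OF P'm M' gr_homD(2)[OF resolutionD(5)[OF P']] gr_homD(4)[OF \<phi>h x] gr_homD(4)[OF \<phi>'h x]]
        by (simp add: \<delta>_def)
      also have "\<dots> = aug P' (\<phi> 0 x) \<ominus>\<^bsub>M'\<^esub> aug P' (\<phi> 0 x)" using \<phi> \<phi>' x by (simp add: lifts_def)
      also have "\<dots> = \<zero>\<^bsub>M'\<^esub>"
        using abelian_group.r_neg[OF graded_moduleD(3)[OF M']] gr_homD(4)[OF resolutionD(5)[OF P'] gr_homD(4)[OF \<phi>h x]]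
        by (simp add: a_minus_def)
      finally show "\<delta> 0 x \<in> df P' 1 ` carrier (pr P' 1)"
        unfolding resolutionD(7)[OF P'] using gr_homD(4)[OF \<delta>h x] by (simp add: a_kernel_def')
    qed
    then obtain s where s: "s \<in> gr_hom R (pr P 0) (pr P' 1)"
      and eq: "\<And>x. x \<in> carrier (pr P 0) \<Longrightarrow> df P' 1 (s x) = \<delta> 0 x"
      using gr_projective_lift[OF R resolutionD(1)[OF P] P'm P'm P'd1[of 0, simplified] \<delta>h] by auto
    have "df P' 1 (\<delta> 1 x \<ominus>\<^bsub>pr P' 1\<^esub> s (df P 1 x)) = \<zero>\<^bsub>pr P' 0\<^esub>" if x: "x \<in> carrier (pr P 1)" for x
    proof -
      have dx: "df P 1 x \<in> carrier (pr P 0)" using gr_homD(4)[OF Pd1[of 0]] x by simp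
      have "df P' 1 (\<delta> 1 x \<ominus>\<^bsub>pr P' 1\<^esub> s (df P 1 x)) = df P' 1 (\<delta> 1 x) \<ominus>\<^bsub>pr P' 0\<^esub> df P' 1 (s (df P 1 x))"
        using linear_map_diff[OF P'm P'm gr_homD(2)[OF P'd1[of 0]], of "\<delta> 1 x" "s (df P 1 x)"]
          gr_homD(4)[OF \<delta>h x] gr_homD(4)[OF s dx] by simp
      also have "\<dots> = \<delta> 0 (df P 1 x) \<ominus>\<^bsub>pr P' 0\<^esub> \<delta> 0 (df P 1 x)"
        using \<delta>d[of x 0] x eq[OF dx] by simp
      finally show ?thesis
        using abelian_group.r_neg[OF P'a gr_homD(4)[OF \<delta>h dx]] by (simp add: a_minus_def)
    qed
    then show "\<exists>s. I 0 s" using s eq by (intro exI[of _ s]) (simp add: I_def)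
  next
    fix s n assume "I n s"
    then have s: "s \<in> gr_hom R (pr P (int n)) (pr P' (int n + 1))"
      and res: "\<And>x. x \<in> carrier (pr P (int n + 1)) \<Longrightarrow> df P' (int n + 1) (?r n s x) = \<zero>\<^bsub>pr P' (int n)\<^esub>"
      by (auto simp: I_def)
    let ?sd = "compose (carrier (pr P (int n + 1))) s (df P (int n + 1))"
    let ?h = "\<lambda>x\<in>carrier (pr P (int n + 1)). \<delta> (int n + 1) x \<ominus>\<^bsub>pr P' (int n + 1)\<^esub> ?sd x"
    have sd: "?sd \<in> gr_hom R (pr P (int n + 1)) (pr P' (int n + 1))" by (rule gr_hom_compose[OF Pm Pd1 s])
    have h: "?h \<in> gr_hom R (pr P (int n + 1)) (pr P' (int n + 1))" by (rule gr_hom_diff[OF Pm P'm \<delta>h sd])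
    have hr: "?h x = ?r n s x" if "x \<in> carrier (pr P (int n + 1))" for x using that by (simp add: compose_def)
    have im: "?h ` carrier (pr P (int n + 1)) \<subseteq> df P' (int n + 1 + 1) ` carrier (pr P' (int n + 1 + 1))"
    proof (rule image_subsetI)
      fix x assume x: "x \<in> carrier (pr P (int n + 1))"
      show "?h x \<in> df P' (int n + 1 + 1) ` carrier (pr P' (int n + 1 + 1))"
        using resolutionD(8)[OF P', of "int n + 1"] gr_homD(4)[OF h x] res[OF x] hr[OF x] by (simp add: a_kernel_def')
    qed
    obtain t where t: "t \<in> gr_hom R (pr P (int n + 1)) (pr P' (int n + 1 + 1))"
      and eq: "\<And>x. x \<in> carrier (pr P (int n + 1)) \<Longrightarrow> df P' (int n + 1 + 1) (t x) = ?r n s x"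
      using gr_projective_lift[OF R resolutionD(1)[OF P] P'm P'm P'd1 h im] hr by auto
    have "df P' (int n + 1 + 1) (\<delta> (int n + 1 + 1) x \<ominus>\<^bsub>pr P' (int n + 1 + 1)\<^esub> t (df P (int n + 1 + 1) x)) = \<zero>\<^bsub>pr P' (int n + 1)\<^esub>"
      if x: "x \<in> carrier (pr P (int n + 1 + 1))" for x
    proof -
      let ?y = "df P (int n + 1 + 1) x"
      have y: "?y \<in> carrier (pr P (int n + 1))" using gr_homD(4)[OF Pd1 x] .
      have dy: "df P (int n + 1) ?y = \<zero>\<^bsub>pr P (int n)\<^esub>" using resolution_dd[OF P x] by simp
      interpret X: abelian_group "pr P' (int n + 1)" by (rule P'a)
      have \<delta>y: "\<delta> (int n + 1) ?y \<in> carrier (pr P' (int n + 1))" using gr_homD(4)[OF \<delta>h y] .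
      have "df P' (int n + 1 + 1) (\<delta> (int n + 1 + 1) x \<ominus>\<^bsub>pr P' (int n + 1 + 1)\<^esub> t ?y)
          = df P' (int n + 1 + 1) (\<delta> (int n + 1 + 1) x) \<ominus>\<^bsub>pr P' (int n + 1)\<^esub> df P' (int n + 1 + 1) (t ?y)"
        by (rule linear_map_diff[OF P'm P'm gr_homD(2)[OF P'd1] gr_homD(4)[OF \<delta>h x] gr_homD(4)[OF t y]])
      also have "\<dots> = \<delta> (int n + 1) ?y \<ominus>\<^bsub>pr P' (int n + 1)\<^esub> (\<delta> (int n + 1) ?y \<ominus>\<^bsub>pr P' (int n + 1)\<^esub> s \<zero>\<^bsub>pr P (int n)\<^esub>)"
        using \<delta>d[OF x] eq[OF y] dy by simp
      also have "\<dots> = \<zero>\<^bsub>pr P' (int n + 1)\<^esub>"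
      proof -
        have m0: "\<ominus>\<^bsub>pr P' (int n + 1)\<^esub> \<zero>\<^bsub>pr P' (int n + 1)\<^esub> = \<zero>\<^bsub>pr P' (int n + 1)\<^esub>"
          by (rule X.minus_equality) (rule X.l_zero X.zero_closed)+
        have s0: "s \<zero>\<^bsub>pr P (int n)\<^esub> = \<zero>\<^bsub>pr P' (int n + 1)\<^esub>"
          using linear_map_zero[OF Pm P'm gr_homD(2)[OF s]] .
        show ?thesis unfolding a_minus_def s0 m0 X.r_zero[OF \<delta>y] X.r_neg[OF \<delta>y] ..
      qed
      finally show ?thesis .
    qed
    then show "\<exists>t. I (Suc n) t \<and> Q n s t"
      using t eq by (intro exI[of _ t]) (simp add: I_def Q_def add.commute add.left_commute)
  qed
  then obtain s where s: "\<And>n. I n (s n)" "\<And>n. Q n (s n) (s (Suc n))" by blast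
  have uc: "u \<in> carrier (ghom R (pr P' i) N)"
    and ud: "\<And>x. x \<in> carrier (pr P' (i + 1)) \<Longrightarrow> u (df P' (i + 1) x) = \<zero>\<^bsub>N\<^esub>" using u by (auto simp: cocycles_def)
  note ul = linear_mapD[OF ghomD(2)[OF R P'm N uc]]
  have zg: "\<zero>\<^bsub>ghom R (pr P (i - 1)) N\<^esub> \<in> carrier (ghom R (pr P (i - 1)) N)"
    using abelian_monoid.zero_closed[OF abelian_group.axioms(1)[OF ghom_abelian_group(1)[OF Pm N]]] .
  have split: "\<phi> i x = \<phi>' i x \<oplus>\<^bsub>pr P' i\<^esub> \<delta> i x" if "x \<in> carrier (pr P i)" for x
    using abelian_group.eq_add_minus[OF P'a gr_homD(4)[OF \<phi>h that] gr_homD(4)[OF \<phi>'h that]] that by (simp add: \<delta>_def)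
  have usplit: "u (\<phi> i x) = u (\<phi>' i x) \<oplus>\<^bsub>N\<^esub> u (\<delta> i x)" if "x \<in> carrier (pr P i)" for x
    using split[OF that] ul(3)[OF gr_homD(4)[OF \<phi>'h that] gr_homD(4)[OF \<delta>h that]] by simp
  have u\<phi>: "u (\<phi>' i x) \<in> carrier N" if "x \<in> carrier (pr P i)" for x using ul(2) gr_homD(4)[OF \<phi>'h that] by blast
  consider "i < 0" | "i = 0" | n where "i = int n + 1"
    using that(3)[of "nat (i - 1)"] that(1,2) by linarith
  then show ?thesis
  proof cases
    case 1
    have "u (\<delta> i x) = \<zero>\<^bsub>N\<^esub>" if "x \<in> carrier (pr P i)" for x
      using gr_homD(4)[OF \<delta>h that] resolutionD(3)[OF P' 1] linear_map_zero[OF P'm N ghomD(2)[OF R P'm N uc]] by simp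
    then show ?thesis using zg usplit u\<phi> gr_homD(4)[OF Pd]
      by (intro bexI[OF _ zg]) (simp add: ghom_simps)
  next
    case 2
    have "u (\<delta> i x) = \<zero>\<^bsub>N\<^esub>" if x: "x \<in> carrier (pr P i)" for x
    proof -
      have "\<delta> i x = df P' 1 (s 0 x)" "s 0 x \<in> carrier (pr P' 1)"
        using s(1)[of 0] x 2 gr_homD(4)[of "s 0" R "pr P 0" "pr P' 1" x] by (auto simp: I_def)
      then show ?thesis using ud[of "s 0 x"] 2 by simp
    qed
    then show ?thesis using zg usplit u\<phi> gr_homD(4)[OF Pd]
      by (intro bexI[OF _ zg]) (simp add: ghom_simps)
  next
    case (3 n)
    have sh: "s n \<in> gr_hom R (pr P (int n)) (pr P' (int n + 1))" using s(1)[of n] by (simp add: I_def)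
    have th: "s (Suc n) \<in> gr_hom R (pr P (int n + 1)) (pr P' (int n + 2))"
      using s(1)[of "Suc n"] by (simp add: I_def add.commute add.left_commute)
    let ?v = "compose (carrier (pr P (int n))) u (s n)"
    have v: "?v \<in> carrier (ghom R (pr P (i - 1)) N)"
      using ghom_compose_right[OF R Pm P'm N sh] uc 3 by simp
    have "u (\<delta> i x) = ?v (df P i x)" if x: "x \<in> carrier (pr P i)" for x
    proof -
      have x1: "x \<in> carrier (pr P (int n + 1))" using x 3 by simp
      have dx: "df P (int n + 1) x \<in> carrier (pr P (int n))" using gr_homD(4)[OF Pd1 x1] .
      let ?t = "s (Suc n) x"
      have tc: "?t \<in> carrier (pr P' (i + 1))" using gr_homD(4)[OF th x1] 3 by (simp add: add.assoc)
      have t1: "df P' (i + 1) ?t = \<delta> i x \<ominus>\<^bsub>pr P' i\<^esub> s n (df P i x)"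
        using s(2)[of n] x1 3 by (simp add: Q_def add.assoc)
      have "u (\<delta> i x) \<ominus>\<^bsub>N\<^esub> u (s n (df P i x)) = \<zero>\<^bsub>N\<^esub>"
        using linear_map_diff[OF P'm N ghomD(2)[OF R P'm N uc] gr_homD(4)[OF \<delta>h x], of "s n (df P i x)"]
          gr_homD(4)[OF sh dx] 3 ud[OF tc] t1 by simp
      then have "u (\<delta> i x) = u (s n (df P i x))"
        using N.minus_eq_zero ul(2) gr_homD(4)[OF \<delta>h x] gr_homD(4)[OF sh dx] 3 by simp
      then show ?thesis using dx 3 by (simp add: compose_def)
    qed
    moreover have "?v (df P i x) \<in> carrier N" if "x \<in> carrier (pr P i)" for x
      using ghomD(3)[OF R Pm N v gr_homD(4)[OF Pd that]] .
    ultimately show ?thesis using v usplit u\<phi> N.a_comm by (intro bexI[OF _ v]) auto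
  qed
qed

section \<open>Graded Ext\<close>

lemma precompose_gr_hom:
  fixes R :: "('r, 'g::ab_group_add) gring"
  assumes R: "graded_cring R" and L: "graded_module R L" and M: "graded_module R M" and N: "graded_module R N"
    and f: "f \<in> gr_hom R L M"
  shows "(\<lambda>u\<in>carrier (ghom R M N). compose (carrier L) u f) \<in> gr_hom R (ghom R M N) (ghom R L N)"
proof (rule gr_hom_restrict[OF ghom_graded_module[OF R M N]])
  interpret L: graded_group L "mgrade L" using L by (rule graded_moduleD)
  have fc: "f x \<in> carrier M" if "x \<in> carrier L" for x using gr_homD(4)[OF f that] .
  show "linear_map R (ghom R M N) (ghom R L N) (\<lambda>u. compose (carrier L) u f)"
    using ghom_compose_right[OF R L M N f] fc
    by (simp add: linear_map_def additive_map_def ghom_simps compose_def restrict_def fun_eq_iff)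
  show "compose (carrier L) u f \<in> mgrade (ghom R L N) g" if u: "u \<in> mgrade (ghom R M N) g" for u g
    using gr_hom_compose[OF L f, of u "shift N g"] u by (simp add: ghom_simps)
qed

lemma postcompose_linear:
  fixes R :: "('r, 'g::ab_group_add) gring"
  assumes R: "graded_cring R" and L: "graded_module R L" and M: "graded_module R M" and N: "graded_module R N"
    and f: "f \<in> gr_hom R M N"
  shows "linear_map R (ghom R L M) (ghom R L N) (\<lambda>u. compose (carrier L) f u)"
    and "u \<in> mgrade (ghom R L M) g \<Longrightarrow> compose (carrier L) f u \<in> mgrade (ghom R L N) g"
proof -
  note fl = linear_mapD[OF gr_homD(2)[OF f]]
  show "linear_map R (ghom R L M) (ghom R L N) (\<lambda>u. compose (carrier L) f u)"
    using ghom_compose_left[OF R L M N _ f] ghomD(3)[OF R L M] fl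
    by (simp add: linear_map_def additive_map_def ghom_simps compose_def restrict_def fun_eq_iff)
  show "u \<in> mgrade (ghom R L M) g \<Longrightarrow> compose (carrier L) f u \<in> mgrade (ghom R L N) g"
    using gr_hom_compose[OF L, of u "shift M g" f "shift N g"] gr_hom_shift_both[OF f] by (simp add: ghom_simps)
qed

lemma graded_submodule_within:
  assumes R: "graded_cring R" and M: "graded_module R M" and Z: "graded_submodule R M Z"
    and B: "graded_submodule R M B" "B \<subseteq> Z"
  shows "graded_submodule R (submod M Z) B"
  using graded_submoduleD[OF B(1)] B(2) submod_component[OF R M Z]
  by (auto simp: graded_submodule_def subset_eq)

text \<open>Homomorphisms and chain maps act on Ext in this form, since Ext is the quotient of a submodule of
  cocycles by the coboundaries.\<close>

lemma induced_subquotient: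
  fixes R :: "('r, 'g::ab_group_add) gring" and M :: "('r, 'm, 'g) gmod" and N :: "('r, 'n, 'g) gmod"
  assumes R: "graded_cring R" and M: "graded_module R M" and N: "graded_module R N"
    and Z: "graded_submodule R M Z" and B: "graded_submodule R M B" "B \<subseteq> Z"
    and Z': "graded_submodule R N Z'" and B': "graded_submodule R N B'" "B' \<subseteq> Z'"
    and \<phi>Z: "\<And>u. u \<in> Z \<Longrightarrow> \<phi> u \<in> Z'" and \<phi>B: "\<And>u. u \<in> B \<Longrightarrow> \<phi> u \<in> B'"
    and \<phi>a: "\<And>u v. u \<in> Z \<Longrightarrow> v \<in> Z \<Longrightarrow> \<phi> (u \<oplus>\<^bsub>M\<^esub> v) = \<phi> u \<oplus>\<^bsub>N\<^esub> \<phi> v"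
    and \<phi>s: "\<And>r u. r \<in> carrier R \<Longrightarrow> u \<in> Z \<Longrightarrow> \<phi> (r \<odot>\<^bsub>M\<^esub> u) = r \<odot>\<^bsub>N\<^esub> \<phi> u"
    and \<phi>d: "\<And>u g. u \<in> Z \<Longrightarrow> u \<in> mgrade M g \<Longrightarrow> \<phi> u \<in> mgrade N g"
  shows "u \<in> Z \<Longrightarrow> induced (quotmod (submod M Z) B) N B' \<phi> (B +>\<^bsub>M\<^esub> u) = B' +>\<^bsub>N\<^esub> \<phi> u"
    and "induced (quotmod (submod M Z) B) N B' \<phi> \<in> gr_hom R (quotmod (submod M Z) B) (quotmod (submod N Z') B')"
proof -
  note MA = graded_moduleD(3)[OF M] and NA = graded_moduleD(3)[OF N]
  note Bs = graded_submodule_subgroup[OF M B(1)] and Zs = graded_submodule_subgroup[OF M Z]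
    and B's = graded_submodule_subgroup[OF N B'(1)]
  have Z'c: "\<phi> u \<in> carrier N" if "u \<in> Z" for u using \<phi>Z[OF that] graded_submoduleD(6)[OF Z'] by blast
  have car: "carrier (quotmod (submod M Z) B) = (\<lambda>u. B +>\<^bsub>M\<^esub> u) ` Z" by (simp add: quotmod_carrier)
  show eq: "induced (quotmod (submod M Z) B) N B' \<phi> (B +>\<^bsub>M\<^esub> u) = B' +>\<^bsub>N\<^esub> \<phi> u" if u: "u \<in> Z" for u
  proof -
    have "(\<Union>z\<in>B +>\<^bsub>M\<^esub> u. B' +>\<^bsub>N\<^esub> \<phi> z) = B' +>\<^bsub>N\<^esub> \<phi> u"
      by (rule coset_UN[OF MA Bs NA B's Zs B(2) \<phi>a Z'c \<phi>B u])
    moreover have "B +>\<^bsub>M\<^esub> u \<in> carrier (quotmod (submod M Z) B)" unfolding car using u by (rule imageI)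
    ultimately show ?thesis by (simp add: induced_def)
  qed
  note MZ = submod_graded_module[OF R M Z] and NZ = submod_graded_module[OF R N Z']
  note BZ = graded_submodule_within[OF R M Z B] and BZ' = graded_submodule_within[OF R N Z' B']
  let ?Q = "quotmod (submod M Z) B" and ?Q' = "quotmod (submod N Z') B'"
  note Q = quotmod_graded_module[OF R MZ BZ]
  have qa: "(B +>\<^bsub>M\<^esub> u) \<oplus>\<^bsub>?Q\<^esub> (B +>\<^bsub>M\<^esub> v) = B +>\<^bsub>M\<^esub> (u \<oplus>\<^bsub>M\<^esub> v)" if "u \<in> Z" "v \<in> Z" for u v
    using quotmod_add[OF graded_moduleD(3)[OF MZ] graded_submodule_subgroup[OF MZ BZ]] that by simp
  have qa': "(B' +>\<^bsub>N\<^esub> u) \<oplus>\<^bsub>?Q'\<^esub> (B' +>\<^bsub>N\<^esub> v) = B' +>\<^bsub>N\<^esub> (u \<oplus>\<^bsub>N\<^esub> v)" if "u \<in> Z'" "v \<in> Z'" for u v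
    using quotmod_add[OF graded_moduleD(3)[OF NZ] graded_submodule_subgroup[OF NZ BZ']] that by simp
  have qs: "r \<odot>\<^bsub>?Q\<^esub> (B +>\<^bsub>M\<^esub> u) = B +>\<^bsub>M\<^esub> (r \<odot>\<^bsub>M\<^esub> u)" if "r \<in> carrier R" "u \<in> Z" for r u
    using quotmod_smult[OF MZ BZ] that by simp
  have qs': "r \<odot>\<^bsub>?Q'\<^esub> (B' +>\<^bsub>N\<^esub> u) = B' +>\<^bsub>N\<^esub> (r \<odot>\<^bsub>N\<^esub> u)" if "r \<in> carrier R" "u \<in> Z'" for r u
    using quotmod_smult[OF NZ BZ'] that by simp
  show "induced ?Q N B' \<phi> \<in> gr_hom R ?Q ?Q'"
    unfolding gr_hom_iff linear_map_def additive_map_def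
  proof (intro conjI ballI allI)
    show "induced ?Q N B' \<phi> \<in> extensional (carrier ?Q)" by (simp add: induced_def)
  next
    fix X assume "X \<in> carrier ?Q"
    then obtain u where u: "u \<in> Z" "X = B +>\<^bsub>M\<^esub> u" unfolding car by blast
    show "induced ?Q N B' \<phi> X \<in> carrier ?Q'" using \<phi>Z[OF u(1)] by (simp add: u eq quotmod_carrier)
    show "induced ?Q N B' \<phi> (r \<odot>\<^bsub>?Q\<^esub> X) = r \<odot>\<^bsub>?Q'\<^esub> induced ?Q N B' \<phi> X" if r: "r \<in> carrier R" for r
      using u r by (simp add: qs qs' eq \<phi>Z \<phi>s graded_submoduleD(4)[OF Z])
    fix Y assume "Y \<in> carrier ?Q"
    then obtain v where v: "v \<in> Z" "Y = B +>\<^bsub>M\<^esub> v" unfolding car by blast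
    show "induced ?Q N B' \<phi> (X \<oplus>\<^bsub>?Q\<^esub> Y) = induced ?Q N B' \<phi> X \<oplus>\<^bsub>?Q'\<^esub> induced ?Q N B' \<phi> Y"
      using u v by (simp add: qa qa' eq \<phi>Z \<phi>a graded_submoduleD(3)[OF Z])
  next
    fix g X assume "X \<in> mgrade ?Q g"
    then obtain u where u: "u \<in> Z" "u \<in> mgrade M g" "X = B +>\<^bsub>M\<^esub> u" by (auto simp: quotmod_def)
    have "induced ?Q N B' \<phi> X = B' +>\<^bsub>N\<^esub> \<phi> u" using u by (simp add: eq)
    then show "induced ?Q N B' \<phi> X \<in> mgrade ?Q' g"
      using \<phi>Z[OF u(1)] \<phi>d[OF u(1,2)] by (auto simp: quotmod_def)
  qed
qed

abbreviation ext_class ::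
    "('r, 'g::ab_group_add) gring \<Rightarrow> ('r, 'u, 'g, 'v) resolution \<Rightarrow> ('r, 'n, 'g) gmod \<Rightarrow> int \<Rightarrow>
      ('u \<Rightarrow> 'n) \<Rightarrow> ('u \<Rightarrow> 'n) set" where
  "ext_class R P N i u \<equiv> coboundaries R P N i +>\<^bsub>ghom R (pr P i) N\<^esub> u"

definition pull ::
    "('r, 'g::ab_group_add) gring \<Rightarrow> ('r, 'u, 'g, 'v) resolution \<Rightarrow> ('r, 'u, 'g, 'w) resolution \<Rightarrow> int \<Rightarrow>
      ('r, 'n, 'g) gmod \<Rightarrow> (int \<Rightarrow> 'u \<Rightarrow> 'u) \<Rightarrow> ('u \<Rightarrow> 'n) set \<Rightarrow> ('u \<Rightarrow> 'n) set" where
  "pull R P P' i N \<phi> = induced (ext_of R P' i N) (ghom R (pr P i) N) (coboundaries R P N i)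
     (\<lambda>u. compose (carrier (pr P i)) u (\<phi> i))"

definition push ::
    "('r, 'g::ab_group_add) gring \<Rightarrow> ('r, 'u, 'g, 'v) resolution \<Rightarrow> int \<Rightarrow>
      ('r, 'n, 'g) gmod \<Rightarrow> ('r, 'n, 'g) gmod \<Rightarrow> ('n \<Rightarrow> 'n) \<Rightarrow> ('u \<Rightarrow> 'n) set \<Rightarrow> ('u \<Rightarrow> 'n) set" where
  "push R P i N N' f = induced (ext_of R P i N) (ghom R (pr P i) N') (coboundaries R P N' i)
     (\<lambda>u. compose (carrier (pr P i)) f u)"

text \<open>The union ranges over all choices in the snake lemma. By the lemma \<open>connect_class\<close> below they lead to
  a single class, so it has one member.\<close>

definition connect ::
    "('r, 'g::ab_group_add) gring \<Rightarrow> ('r, 'u, 'g, 'v) resolution \<Rightarrow> int \<Rightarrow> ('r, 'n, 'g) gmod \<Rightarrow> ('n \<Rightarrow> 'n) \<Rightarrow>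
     ('r, 'n, 'g) gmod \<Rightarrow> ('n \<Rightarrow> 'n) \<Rightarrow> ('r, 'n, 'g) gmod \<Rightarrow> ('u \<Rightarrow> 'n) set \<Rightarrow> ('u \<Rightarrow> 'n) set" where
  "connect R P i A \<alpha> B \<beta> C =
     (\<lambda>X\<in>carrier (ext_of R P i C). \<Union> {coboundaries R P A (i + 1) +>\<^bsub>ghom R (pr P (i + 1)) A\<^esub> u | u v w.
           w \<in> X \<and> v \<in> carrier (ghom R (pr P i) B) \<and> u \<in> carrier (ghom R (pr P (i + 1)) A) \<and>
           (\<forall>x\<in>carrier (pr P i). \<beta> (v x) = w x) \<and>
           (\<forall>x\<in>carrier (pr P (i + 1)). \<alpha> (u x) = v (df P (i + 1) x))})"

context
  fixes R :: "('r, 'g::ab_group_add) gring" and M :: "('r, 'v, 'g) gmod" and P :: "('r, 'u, 'g, 'v) resolution"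
  assumes R: "graded_cring R" and P: "projective_resolution R M P"
begin

lemma cocyclesD:
  assumes N: "graded_module R N" and u: "u \<in> cocycles R P N i"
  shows "u \<in> carrier (ghom R (pr P i) N)" "u \<in> extensional (carrier (pr P i))" "linear_map R (pr P i) N u"
    "\<And>x. x \<in> carrier (pr P i) \<Longrightarrow> u x \<in> carrier N"
    "\<And>x. x \<in> carrier (pr P (i + 1)) \<Longrightarrow> u (df P (i + 1) x) = \<zero>\<^bsub>N\<^esub>"
proof -
  show 1: "u \<in> carrier (ghom R (pr P i) N)" using u by (simp add: cocycles_def)
  show "u \<in> extensional (carrier (pr P i))" "linear_map R (pr P i) N u" "\<And>x. x \<in> carrier (pr P i) \<Longrightarrow> u x \<in> carrier N"
    using ghomD[OF R resolutionD(2)[OF P] N 1] by auto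
  show "\<And>x. x \<in> carrier (pr P (i + 1)) \<Longrightarrow> u (df P (i + 1) x) = \<zero>\<^bsub>N\<^esub>" using u by (simp add: cocycles_def)
qed

lemma cocycles_submodule:
  assumes N: "graded_module R N" shows "graded_submodule R (ghom R (pr P i) N) (cocycles R P N i)"
proof -
  note Pm = resolutionD(2)[OF P]
  let ?d = "\<lambda>u\<in>carrier (ghom R (pr P i) N). compose (carrier (pr P (i + 1))) u (df P (i + 1))"
  have "graded_submodule R (ghom R (pr P i) N) (a_kernel (ghom R (pr P i) N) (ghom R (pr P (i + 1)) N) ?d)"
    by (rule kernel_graded_submodule[OF ghom_graded_module[OF R Pm N] ghom_graded_module[OF R Pm N]
          precompose_gr_hom[OF R Pm Pm N resolution_df[OF P]]])
  moreover have "a_kernel (ghom R (pr P i) N) (ghom R (pr P (i + 1)) N) ?d = cocycles R P N i"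
    by (auto simp: a_kernel_def' cocycles_def ghom_simps compose_def restrict_def fun_eq_iff)
  ultimately show ?thesis by simp
qed

lemma coboundaries_submodule:
  assumes N: "graded_module R N"
  shows "graded_submodule R (ghom R (pr P i) N) (coboundaries R P N i)"
proof -
  note Pm = resolutionD(2)[OF P]
  let ?d = "\<lambda>u\<in>carrier (ghom R (pr P (i - 1)) N). compose (carrier (pr P i)) u (df P i)"
  have "graded_submodule R (ghom R (pr P i) N) (?d ` carrier (ghom R (pr P (i - 1)) N))"
    by (rule image_graded_submodule[OF ghom_graded_module[OF R Pm N] ghom_graded_module[OF R Pm N]
          precompose_gr_hom[OF R Pm Pm N resolutionD(4)[OF P]]])
  moreover have "?d ` carrier (ghom R (pr P (i - 1)) N) = coboundaries R P N i"
    by (auto simp: coboundaries_def)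
  ultimately show ?thesis by simp
qed

lemma coboundaries_cocycles:
  assumes N: "graded_module R N"
  shows "coboundaries R P N i \<subseteq> cocycles R P N i"
proof
  fix u assume u: "u \<in> coboundaries R P N i"
  then obtain v where v: "v \<in> carrier (ghom R (pr P (i - 1)) N)" "u = compose (carrier (pr P i)) v (df P i)"
    by (auto simp: coboundaries_def)
  have "u (df P (i + 1) x) = \<zero>\<^bsub>N\<^esub>" if x: "x \<in> carrier (pr P (i + 1))" for x
    using resolution_dd[OF P x] gr_homD(4)[OF resolution_df[OF P] x] v(2)
      linear_map_zero[OF resolutionD(2)[OF P] N ghomD(2)[OF R resolutionD(2)[OF P] N v(1)]]
    by (simp add: compose_def)
  then show "u \<in> cocycles R P N i"
    using graded_submoduleD(1)[OF coboundaries_submodule[OF N]] u by (auto simp: cocycles_def)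
qed

lemma ext_carrier:
  "carrier (ext_of R P i N) = (\<lambda>u. ext_class R P N i u) ` cocycles R P N i"
  by (simp add: ext_of_def quotmod_carrier)

lemma ext_graded_module:
  assumes N: "graded_module R N" shows "graded_module R (ext_of R P i N)"
proof -
  note G = ghom_graded_module[OF R resolutionD(2)[OF P, of i] N]
  note Z = cocycles_submodule[OF N, of i]
  show ?thesis unfolding ext_of_def
    by (rule quotmod_graded_module[OF R submod_graded_module[OF R G Z]
          graded_submodule_within[OF R G Z coboundaries_submodule[OF N] coboundaries_cocycles[OF N]]])
qed

lemma ext_add:
  assumes N: "graded_module R N" and u: "u \<in> cocycles R P N i" and v: "v \<in> cocycles R P N i"
  shows "ext_class R P N i u \<oplus>\<^bsub>ext_of R P i N\<^esub> ext_class R P N i v = ext_class R P N i (u \<oplus>\<^bsub>ghom R (pr P i) N\<^esub> v)"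
proof -
  note G = ghom_graded_module[OF R resolutionD(2)[OF P, of i] N]
  note Z = cocycles_submodule[OF N, of i]
  note GZ = submod_graded_module[OF R G Z]
    and BZ = graded_submodule_within[OF R G Z coboundaries_submodule[OF N] coboundaries_cocycles[OF N]]
  show ?thesis unfolding ext_of_def
    using quotmod_add[OF graded_moduleD(3)[OF GZ] graded_submodule_subgroup[OF GZ BZ]] u v by simp
qed

lemma ext_class_eqI:
  assumes N: "graded_module R N" and w: "w \<in> cocycles R P N i" and b: "b \<in> carrier (ghom R (pr P (i - 1)) N)"
    and u: "u \<in> extensional (carrier (pr P i))" "\<And>x. x \<in> carrier (pr P i) \<Longrightarrow> u x = b (df P i x) \<oplus>\<^bsub>N\<^esub> w x"
  shows "ext_class R P N i u = ext_class R P N i w"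
proof -
  note Pm = resolutionD(2)[OF P]
  show ?thesis
  proof (rule coset_eqI[OF ghom_abelian_group(1)[OF Pm N] graded_submodule_subgroup[OF ghom_graded_module[OF R Pm N] coboundaries_submodule[OF N]]])
    show "w \<in> carrier (ghom R (pr P i) N)" by (rule cocyclesD(1)[OF N w])
    show "compose (carrier (pr P i)) b (df P i) \<in> coboundaries R P N i" using b by (auto simp: coboundaries_def)
    show "u = compose (carrier (pr P i)) b (df P i) \<oplus>\<^bsub>ghom R (pr P i) N\<^esub> w"
      using u by (intro ghom_eqI[of _ "pr P i"]) (simp_all add: ghom_simps compose_def)
  qed
qed

lemma
  assumes N: "graded_module R N" and N': "graded_module R N'" and f: "f \<in> gr_hom R N N'"
  shows push_cocycle: "u \<in> cocycles R P N i \<Longrightarrow> compose (carrier (pr P i)) f u \<in> cocycles R P N' i"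
    and push_class: "u \<in> cocycles R P N i \<Longrightarrow> push R P i N N' f (ext_class R P N i u) = ext_class R P N' i (compose (carrier (pr P i)) f u)"
    and push_gr_hom: "push R P i N N' f \<in> gr_hom R (ext_of R P i N) (ext_of R P i N')"
proof -
  note Pm = resolutionD(2)[OF P]
  note G = ghom_graded_module[OF R Pm N, of i] and G' = ghom_graded_module[OF R Pm N', of i]
  note Z = cocycles_submodule[OF N, of i] and Z' = cocycles_submodule[OF N', of i]
  note B = coboundaries_submodule[OF N, of i] coboundaries_cocycles[OF N, of i]
    and B' = coboundaries_submodule[OF N', of i] coboundaries_cocycles[OF N', of i]
  have z: "compose (carrier (pr P i)) f u \<in> cocycles R P N' i" if "u \<in> cocycles R P N i" for u
    using ghom_compose_left[OF R Pm N N' cocyclesD(1)[OF N that] f] cocyclesD(5)[OF N that]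
      gr_homD(4)[OF resolution_df[OF P]] linear_map_zero[OF N N' gr_homD(2)[OF f]]
    by (simp add: cocycles_def compose_def)
  then show "u \<in> cocycles R P N i \<Longrightarrow> compose (carrier (pr P i)) f u \<in> cocycles R P N' i" .
  have b: "compose (carrier (pr P i)) f u \<in> coboundaries R P N' i" if "u \<in> coboundaries R P N i" for u
  proof -
    from that obtain v where v: "v \<in> carrier (ghom R (pr P (i - 1)) N)" "u = compose (carrier (pr P i)) v (df P i)"
      by (auto simp: coboundaries_def)
    have "compose (carrier (pr P i)) f u = compose (carrier (pr P i)) (compose (carrier (pr P (i - 1))) f v) (df P i)"
      using v(2) gr_homD(4)[OF resolutionD(4)[OF P]] by (simp add: compose_def restrict_def fun_eq_iff)
    then show ?thesis using ghom_compose_left[OF R Pm N N' v(1) f] by (auto simp: coboundaries_def)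
  qed
  note pl = postcompose_linear[OF R Pm N N' f]
  have ll: "compose (carrier (pr P i)) f (u \<oplus>\<^bsub>ghom R (pr P i) N\<^esub> v) = compose (carrier (pr P i)) f u \<oplus>\<^bsub>ghom R (pr P i) N'\<^esub> compose (carrier (pr P i)) f v"
    if "u \<in> cocycles R P N i" "v \<in> cocycles R P N i" for u v
    using linear_mapD(3)[OF pl(1) cocyclesD(1)[OF N that(1)] cocyclesD(1)[OF N that(2)]] .
  have ls: "compose (carrier (pr P i)) f (r \<odot>\<^bsub>ghom R (pr P i) N\<^esub> u) = r \<odot>\<^bsub>ghom R (pr P i) N'\<^esub> compose (carrier (pr P i)) f u"
    if "r \<in> carrier R" "u \<in> cocycles R P N i" for r u
    using linear_mapD(4)[OF pl(1) that(1) cocyclesD(1)[OF N that(2)]] .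
  note I = induced_subquotient[OF R G G' Z B Z' B', where \<phi> = "\<lambda>u. compose (carrier (pr P i)) f u", OF z b ll ls pl(2)]
  show "u \<in> cocycles R P N i \<Longrightarrow> push R P i N N' f (ext_class R P N i u) = ext_class R P N' i (compose (carrier (pr P i)) f u)"
    unfolding push_def ext_of_def by (rule I(1))
  show "push R P i N N' f \<in> gr_hom R (ext_of R P i N) (ext_of R P i N')"
    unfolding push_def ext_of_def by (rule I(2))
qed

lemma connect_data:
  fixes A B C :: "('r, 'u, 'g) gmod"
  assumes ex: "short_exact R A \<alpha> B \<beta> C" and w: "w \<in> cocycles R P C i"
  obtains v u where "v \<in> carrier (ghom R (pr P i) B)" "u \<in> cocycles R P A (i + 1)"
    "\<And>x. x \<in> carrier (pr P i) \<Longrightarrow> \<beta> (v x) = w x"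
    "\<And>x. x \<in> carrier (pr P (i + 1)) \<Longrightarrow> \<alpha> (u x) = v (df P (i + 1) x)"
proof -
  have A: "graded_module R A" and B: "graded_module R B" and C: "graded_module R C"
    and a: "\<alpha> \<in> gr_hom R A B" "inj_on \<alpha> (carrier A)" and b: "\<beta> \<in> gr_hom R B C" "\<beta> ` carrier B = carrier C"
    and ab: "\<alpha> ` carrier A = a_kernel B C \<beta>" using ex by (auto simp: short_exact_def)
  note Pm = resolutionD(2)[OF P] and d = resolution_df[OF P]
  obtain v where v: "v \<in> carrier (ghom R (pr P i) B)" "\<And>x. x \<in> carrier (pr P i) \<Longrightarrow> \<beta> (v x) = w x"
    using ghom_lift[OF R resolutionD(1)[OF P] B C b cocyclesD(1)[OF C w]] by blast
  let ?vd = "compose (carrier (pr P (i + 1))) v (df P (i + 1))"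
  have vd: "?vd \<in> carrier (ghom R (pr P (i + 1)) B)" by (rule ghom_compose_right[OF R Pm Pm B d v(1)])
  have "?vd ` carrier (pr P (i + 1)) \<subseteq> \<alpha> ` carrier A"
    unfolding ab
  proof (rule image_subsetI)
    fix x assume x: "x \<in> carrier (pr P (i + 1))"
    note dx = gr_homD(4)[OF d x]
    show "?vd x \<in> a_kernel B C \<beta>"
      using x ghomD(3)[OF R Pm B v(1) dx] v(2)[OF dx] cocyclesD(5)[OF C w x] by (simp add: a_kernel_def' compose_def)
  qed
  then obtain u where u: "u \<in> carrier (ghom R (pr P (i + 1)) A)" "\<And>x. x \<in> carrier (pr P (i + 1)) \<Longrightarrow> \<alpha> (u x) = ?vd x"
    using ghom_factor_inj[OF R Pm A B a vd] by blast
  have "u (df P (i + 1 + 1) x) = \<zero>\<^bsub>A\<^esub>" if x: "x \<in> carrier (pr P (i + 1 + 1))" for x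
  proof -
    note dx = gr_homD(4)[OF d x]
    have "\<alpha> (u (df P (i + 1 + 1) x)) = v (df P (i + 1) (df P (i + 1 + 1) x))" using u(2)[OF dx] dx by (simp add: compose_def)
    also have "\<dots> = v \<zero>\<^bsub>pr P i\<^esub>" using resolution_dd[OF P x] by simp
    also have "\<dots> = \<alpha> \<zero>\<^bsub>A\<^esub>"
      using linear_map_zero[OF Pm B ghomD(2)[OF R Pm B v(1)]] linear_map_zero[OF A B gr_homD(2)[OF a(1)]] by simp
    finally have e: "\<alpha> (u (df P (i + 1 + 1) x)) = \<alpha> \<zero>\<^bsub>A\<^esub>" .
    have "\<zero>\<^bsub>A\<^esub> \<in> carrier A"
      using abelian_monoid.zero_closed[OF abelian_group.axioms(1)[OF graded_moduleD(3)[OF A]]] .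
    then show ?thesis using inj_onD[OF a(2) e] ghomD(3)[OF R Pm A u(1) dx] by simp
  qed
  then have "u \<in> cocycles R P A (i + 1)" using u(1) by (simp add: cocycles_def)
  then show ?thesis using that v u by (simp add: compose_def)
qed

lemma connect_class:
  fixes A B C :: "('r, 'u, 'g) gmod"
  assumes ex: "short_exact R A \<alpha> B \<beta> C" and w: "w \<in> cocycles R P C i"
    and v: "v \<in> carrier (ghom R (pr P i) B)" and u: "u \<in> cocycles R P A (i + 1)"
    and vw: "\<And>x. x \<in> carrier (pr P i) \<Longrightarrow> \<beta> (v x) = w x"
    and uv: "\<And>x. x \<in> carrier (pr P (i + 1)) \<Longrightarrow> \<alpha> (u x) = v (df P (i + 1) x)"
  shows "connect R P i A \<alpha> B \<beta> C (ext_class R P C i w) = ext_class R P A (i + 1) u"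
proof -
  have A: "graded_module R A" and B: "graded_module R B" and C: "graded_module R C"
    and a: "\<alpha> \<in> gr_hom R A B" "inj_on \<alpha> (carrier A)" and b: "\<beta> \<in> gr_hom R B C" "\<beta> ` carrier B = carrier C"
    and ab: "\<alpha> ` carrier A = a_kernel B C \<beta>" using ex by (auto simp: short_exact_def)
  note Pm = resolutionD(2)[OF P] and d = resolution_df[OF P] and d' = resolutionD(4)[OF P]
  interpret A: abelian_group A using A by (rule graded_moduleD)
  interpret B: abelian_group B using B by (rule graded_moduleD)
  interpret C: abelian_group C using C by (rule graded_moduleD)
  note al = linear_mapD[OF gr_homD(2)[OF a(1)]] and bl = linear_mapD[OF gr_homD(2)[OF b(1)]]
  have key: "ext_class R P A (i + 1) u' = ext_class R P A (i + 1) u"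
    if w': "w' \<in> ext_class R P C i w" and v': "v' \<in> carrier (ghom R (pr P i) B)"
      and u': "u' \<in> carrier (ghom R (pr P (i + 1)) A)" and vw': "\<forall>x\<in>carrier (pr P i). \<beta> (v' x) = w' x"
      and uv': "\<forall>x\<in>carrier (pr P (i + 1)). \<alpha> (u' x) = v' (df P (i + 1) x)" for w' v' u'
  proof -
    obtain c where c: "c \<in> coboundaries R P C i" "w' = c \<oplus>\<^bsub>ghom R (pr P i) C\<^esub> w" using w' by (auto simp: coset_mem)
    obtain e where e: "e \<in> carrier (ghom R (pr P (i - 1)) C)" "c = compose (carrier (pr P i)) e (df P i)"
      using c(1) by (auto simp: coboundaries_def)
    obtain l where l: "l \<in> carrier (ghom R (pr P (i - 1)) B)" "\<And>x. x \<in> carrier (pr P (i - 1)) \<Longrightarrow> \<beta> (l x) = e x"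
      using ghom_lift[OF R resolutionD(1)[OF P] B C b e(1)] by blast
    let ?G = "ghom R (pr P i) B"
    interpret G: abelian_group ?G by (rule ghom_abelian_group(1)[OF Pm B])
    let ?ld = "compose (carrier (pr P i)) l (df P i)"
    have ld: "?ld \<in> carrier ?G" by (rule ghom_compose_right[OF R Pm Pm B d' l(1)])
    \<comment> \<open>the difference of the two lifts, corrected by a lift of the coboundary\<close>
    let ?q = "v' \<oplus>\<^bsub>?G\<^esub> \<ominus>\<^bsub>?G\<^esub> (v \<oplus>\<^bsub>?G\<^esub> ?ld)"
    have q: "?q \<in> carrier ?G" using v v' ld by simp
    have qx: "?q x = v' x \<ominus>\<^bsub>B\<^esub> (v x \<oplus>\<^bsub>B\<^esub> l (df P i x))" if x: "x \<in> carrier (pr P i)" for x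
      using x ghom_minus[OF R Pm B G.a_closed[OF v ld] x] by (simp add: ghom_simps compose_def a_minus_def)
    have vx: "v x \<in> carrier B" "v' x \<in> carrier B" "l (df P i x) \<in> carrier B" "w x \<in> carrier C" "e (df P i x) \<in> carrier C"
      if x: "x \<in> carrier (pr P i)" for x
      using ghomD(3)[OF R Pm B v x] ghomD(3)[OF R Pm B v' x] ghomD(3)[OF R Pm B l(1) gr_homD(4)[OF d' x]]
        cocyclesD(4)[OF C w x] ghomD(3)[OF R Pm C e(1) gr_homD(4)[OF d' x]] by auto
    have "?q ` carrier (pr P i) \<subseteq> \<alpha> ` carrier A"
      unfolding ab
    proof (rule image_subsetI)
      fix x assume x: "x \<in> carrier (pr P i)"
      note vx = vx[OF x]
      have "\<beta> (?q x) = \<beta> (v' x) \<ominus>\<^bsub>C\<^esub> (\<beta> (v x) \<oplus>\<^bsub>C\<^esub> \<beta> (l (df P i x)))"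
        unfolding qx[OF x] using linear_map_diff[OF B C gr_homD(2)[OF b(1)] vx(2) B.a_closed[OF vx(1,3)]] bl(3)[OF vx(1,3)] by simp
      also have "\<dots> = (e (df P i x) \<oplus>\<^bsub>C\<^esub> w x) \<ominus>\<^bsub>C\<^esub> (w x \<oplus>\<^bsub>C\<^esub> e (df P i x))"
        using vw[OF x] vw' x c(2) e(2) l(2) gr_homD(4)[OF d' x] by (simp add: ghom_simps compose_def)
      also have "\<dots> = \<zero>\<^bsub>C\<^esub>" using vx C.r_neg[of "w x \<oplus>\<^bsub>C\<^esub> e (df P i x)"] by (simp add: a_minus_def C.a_comm)
      finally show "?q x \<in> a_kernel B C \<beta>" using ghomD(3)[OF R Pm B q x] by (simp add: a_kernel_def')
    qed
    then obtain k where k: "k \<in> carrier (ghom R (pr P i) A)" "\<And>x. x \<in> carrier (pr P i) \<Longrightarrow> \<alpha> (k x) = ?q x"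
      using ghom_factor_inj[OF R Pm A B a q] by blast
    have "u' x = k (df P (i + 1) x) \<oplus>\<^bsub>A\<^esub> u x" if x: "x \<in> carrier (pr P (i + 1))" for x
    proof -
      note dx = gr_homD(4)[OF d x]
      let ?y = "df P (i + 1) x"
      note vy = vx[OF dx]
      have ly: "l (df P i ?y) = \<zero>\<^bsub>B\<^esub>"
        using resolution_dd[OF P x] linear_map_zero[OF Pm B ghomD(2)[OF R Pm B l(1)]] by simp
      have cl: "k ?y \<in> carrier A" "u x \<in> carrier A" "u' x \<in> carrier A"
        using ghomD(3)[OF R Pm A k(1) dx] cocyclesD(4)[OF A u x] ghomD(3)[OF R Pm A u' x] by auto
      have "\<alpha> (k ?y \<oplus>\<^bsub>A\<^esub> u x) = (v' ?y \<ominus>\<^bsub>B\<^esub> v ?y) \<oplus>\<^bsub>B\<^esub> v ?y"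
        using al(3)[OF cl(1,2)] k(2)[OF dx] qx[OF dx] uv[OF x] ly vy by simp
      also have "\<dots> = \<alpha> (u' x)" using vy uv' x by (simp add: a_minus_def B.a_assoc B.l_neg)
      finally show ?thesis using inj_onD[OF a(2)] cl by (metis A.a_closed)
    qed
    then show ?thesis
      using ext_class_eqI[OF A u, of k u'] k(1) ghomD(1)[OF R Pm A u'] by simp
  qed
  have wX: "w \<in> ext_class R P C i w"
    by (rule coset_self[OF ghom_abelian_group(1)[OF Pm C] graded_submodule_subgroup[OF ghom_graded_module[OF R Pm C]
          coboundaries_submodule[OF C]] cocyclesD(1)[OF C w]])
  let ?S = "{ext_class R P A (i + 1) u' | u' v' w'.
           w' \<in> ext_class R P C i w \<and> v' \<in> carrier (ghom R (pr P i) B) \<and> u' \<in> carrier (ghom R (pr P (i + 1)) A) \<and>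
           (\<forall>x\<in>carrier (pr P i). \<beta> (v' x) = w' x) \<and>
           (\<forall>x\<in>carrier (pr P (i + 1)). \<alpha> (u' x) = v' (df P (i + 1) x))}"
  have "?S \<subseteq> {ext_class R P A (i + 1) u}" using key by blast
  moreover have "ext_class R P A (i + 1) u \<in> ?S"
    using wX v cocyclesD(1)[OF A u] vw uv by blast
  ultimately have "?S = {ext_class R P A (i + 1) u}" by blast
  moreover have "ext_class R P C i w \<in> carrier (ext_of R P i C)" unfolding ext_carrier using w by (rule imageI)
  ultimately show ?thesis by (simp add: connect_def)
qed

end

context
  fixes R :: "('r, 'g::ab_group_add) gring" and M :: "('r, 'v, 'g) gmod" and P :: "('r, 'u, 'g, 'v) resolution"
    and M' :: "('r, 'w, 'g) gmod" and P' :: "('r, 'u, 'g, 'w) resolution" and \<phi>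
  assumes R: "graded_cring R" and P: "projective_resolution R M P" and P': "projective_resolution R M' P'"
    and \<phi>: "chain_map R P P' \<phi>"
begin

lemma pull_cocycle:
  assumes N: "graded_module R N" and u: "u \<in> cocycles R P' N i"
  shows "compose (carrier (pr P i)) u (\<phi> i) \<in> cocycles R P N i"
  using ghom_compose_right[OF R resolutionD(2)[OF P] resolutionD(2)[OF P'] N chain_mapD(1)[OF \<phi>] cocyclesD(1)[OF R P' N u]]
    cocyclesD(5)[OF R P' N u] gr_homD(4)[OF chain_mapD(1)[OF \<phi>]] gr_homD(4)[OF resolution_df[OF P]]
  by (simp add: cocycles_def compose_def chain_mapD(2)[OF \<phi>])

lemma
  assumes N: "graded_module R N"
  shows pull_class: "u \<in> cocycles R P' N i \<Longrightarrow>
      pull R P P' i N \<phi> (ext_class R P' N i u) = ext_class R P N i (compose (carrier (pr P i)) u (\<phi> i))"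
    and pull_gr_hom: "pull R P P' i N \<phi> \<in> gr_hom R (ext_of R P' i N) (ext_of R P i N)"
proof -
  note Pm = resolutionD(2)[OF P] and P'm = resolutionD(2)[OF P']
  note G = ghom_graded_module[OF R P'm N, of i] and G' = ghom_graded_module[OF R Pm N, of i]
  note Z = cocycles_submodule[OF R P' N, of i] and Z' = cocycles_submodule[OF R P N, of i]
  note B = coboundaries_submodule[OF R P' N, of i] coboundaries_cocycles[OF R P' N, of i]
    and B' = coboundaries_submodule[OF R P N, of i] coboundaries_cocycles[OF R P N, of i]
  note h = chain_mapD(1)[OF \<phi>]
  have b: "compose (carrier (pr P i)) u (\<phi> i) \<in> coboundaries R P N i" if "u \<in> coboundaries R P' N i" for u
  proof -
    from that obtain v where v: "v \<in> carrier (ghom R (pr P' (i - 1)) N)" "u = compose (carrier (pr P' i)) v (df P' i)"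
      by (auto simp: coboundaries_def)
    have "compose (carrier (pr P i)) u (\<phi> i) = compose (carrier (pr P i)) (compose (carrier (pr P (i - 1))) v (\<phi> (i - 1))) (df P i)"
      using v(2) gr_homD(4)[OF h] gr_homD(4)[OF resolutionD(4)[OF P]]
      by (simp add: compose_def restrict_def fun_eq_iff chain_mapD(3)[OF \<phi>])
    then show ?thesis using ghom_compose_right[OF R Pm P'm N h v(1)] by (auto simp: coboundaries_def)
  qed
  note pc = precompose_gr_hom[OF R Pm P'm N h, of i]
  have pl: "compose (carrier (pr P i)) (u \<oplus>\<^bsub>ghom R (pr P' i) N\<^esub> v) (\<phi> i) =
      compose (carrier (pr P i)) u (\<phi> i) \<oplus>\<^bsub>ghom R (pr P i) N\<^esub> compose (carrier (pr P i)) v (\<phi> i)"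
    if "u \<in> cocycles R P' N i" "v \<in> cocycles R P' N i" for u v
    using gr_homD(4)[OF h] by (simp add: ghom_simps compose_def restrict_def fun_eq_iff)
  have ps: "compose (carrier (pr P i)) (r \<odot>\<^bsub>ghom R (pr P' i) N\<^esub> u) (\<phi> i) =
      r \<odot>\<^bsub>ghom R (pr P i) N\<^esub> compose (carrier (pr P i)) u (\<phi> i)"
    if "r \<in> carrier R" "u \<in> cocycles R P' N i" for r u
    using gr_homD(4)[OF h] by (simp add: ghom_simps compose_def restrict_def fun_eq_iff)
  have pd: "compose (carrier (pr P i)) u (\<phi> i) \<in> mgrade (ghom R (pr P i) N) g"
    if "u \<in> cocycles R P' N i" "u \<in> mgrade (ghom R (pr P' i) N) g" for u g
    using gr_homD(3)[OF pc that(2)] cocyclesD(1)[OF R P' N that(1)] by simp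
  note I = induced_subquotient[OF R G G' Z B Z' B', where \<phi> = "\<lambda>u. compose (carrier (pr P i)) u (\<phi> i)",
      OF pull_cocycle[OF N] b pl ps pd]
  show "u \<in> cocycles R P' N i \<Longrightarrow>
      pull R P P' i N \<phi> (ext_class R P' N i u) = ext_class R P N i (compose (carrier (pr P i)) u (\<phi> i))"
    unfolding pull_def ext_of_def by (rule I(1))
  show "pull R P P' i N \<phi> \<in> gr_hom R (ext_of R P' i N) (ext_of R P i N)"
    unfolding pull_def ext_of_def by (rule I(2))
qed

lemma pull_push:
  assumes N: "graded_module R N" and N': "graded_module R N'" and f: "f \<in> gr_hom R N N'"
    and X: "X \<in> carrier (ext_of R P' i N)"
  shows "pull R P P' i N' \<phi> (push R P' i N N' f X) = push R P i N N' f (pull R P P' i N \<phi> X)"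
proof -
  obtain u where u: "u \<in> cocycles R P' N i" "X = ext_class R P' N i u" using X unfolding ext_carrier[OF R P'] by blast
  have "compose (carrier (pr P i)) (compose (carrier (pr P' i)) f u) (\<phi> i) =
      compose (carrier (pr P i)) f (compose (carrier (pr P i)) u (\<phi> i))"
    using gr_homD(4)[OF chain_mapD(1)[OF \<phi>]] by (simp add: compose_def restrict_def fun_eq_iff)
  then show ?thesis
    using u push_class[OF R P' N N' f u(1)] push_cocycle[OF R P' N N' f u(1)] push_class[OF R P N N' f pull_cocycle[OF N u(1)]]
      pull_class[OF N u(1)] pull_class[OF N' push_cocycle[OF R P' N N' f u(1)]] by simp
qed

lemma pull_connect:
  fixes A B C :: "('r, 'u, 'g) gmod"
  assumes ex: "short_exact R A \<alpha> B \<beta> C" and X: "X \<in> carrier (ext_of R P' i C)"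
  shows "pull R P P' (i + 1) A \<phi> (connect R P' i A \<alpha> B \<beta> C X) = connect R P i A \<alpha> B \<beta> C (pull R P P' i C \<phi> X)"
    and "connect R P' i A \<alpha> B \<beta> C X \<in> carrier (ext_of R P' (i + 1) A)"
proof -
  have A: "graded_module R A" and B: "graded_module R B" and C: "graded_module R C" using ex by (auto simp: short_exact_def)
  note h = chain_mapD(1)[OF \<phi>] and Pm = resolutionD(2)[OF P] and P'm = resolutionD(2)[OF P']
  obtain w where w: "w \<in> cocycles R P' C i" "X = ext_class R P' C i w" using X unfolding ext_carrier[OF R P'] by blast
  obtain v u where v: "v \<in> carrier (ghom R (pr P' i) B)" and u: "u \<in> cocycles R P' A (i + 1)"
    and vw: "\<And>x. x \<in> carrier (pr P' i) \<Longrightarrow> \<beta> (v x) = w x"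
    and uv: "\<And>x. x \<in> carrier (pr P' (i + 1)) \<Longrightarrow> \<alpha> (u x) = v (df P' (i + 1) x)"
    using connect_data[OF R P' ex w(1)] by blast
  have 1: "connect R P' i A \<alpha> B \<beta> C X = ext_class R P' A (i + 1) u"
    unfolding w(2) by (rule connect_class[OF R P' ex w(1) v u vw uv])
  show "connect R P' i A \<alpha> B \<beta> C X \<in> carrier (ext_of R P' (i + 1) A)" unfolding 1 ext_carrier[OF R P'] using u by (rule imageI)
  have "connect R P i A \<alpha> B \<beta> C (ext_class R P C i (compose (carrier (pr P i)) w (\<phi> i))) =
      ext_class R P A (i + 1) (compose (carrier (pr P (i + 1))) u (\<phi> (i + 1)))"
  proof (rule connect_class[OF R P ex pull_cocycle[OF C w(1)] ghom_compose_right[OF R Pm P'm B h v] pull_cocycle[OF A u]])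
    show "\<beta> (compose (carrier (pr P i)) v (\<phi> i) x) = compose (carrier (pr P i)) w (\<phi> i) x" if x: "x \<in> carrier (pr P i)" for x
      using x vw[OF gr_homD(4)[OF h x]] by (simp add: compose_def)
    show "\<alpha> (compose (carrier (pr P (i + 1))) u (\<phi> (i + 1)) x) = compose (carrier (pr P i)) v (\<phi> i) (df P (i + 1) x)"
      if x: "x \<in> carrier (pr P (i + 1))" for x
      using x uv[OF gr_homD(4)[OF h x]] gr_homD(4)[OF resolution_df[OF P] x] chain_mapD(2)[OF \<phi> x] by (simp add: compose_def)
  qed
  then show "pull R P P' (i + 1) A \<phi> (connect R P' i A \<alpha> B \<beta> C X) = connect R P i A \<alpha> B \<beta> C (pull R P P' i C \<phi> X)"
    unfolding 1 unfolding w(2) using pull_class[OF C w(1)] pull_class[OF A u] by simp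
qed

end

text \<open>Homotopic chain maps agree on cohomology, so the map on Ext depends on the lifted map alone.\<close>

lemma pull_unique:
  fixes R :: "('r, 'g::ab_group_add) gring" and P :: "('r, 'u, 'g, 'v) resolution" and P' :: "('r, 'u, 'g, 'w) resolution"
  assumes R: "graded_cring R" and M: "graded_module R M" and M': "graded_module R M'"
    and P: "projective_resolution R M P" and P': "projective_resolution R M' P'"
    and \<phi>: "lifts R P P' f \<phi>" and \<phi>': "lifts R P P' f \<phi>'" and N: "graded_module R N"
    and u: "u \<in> cocycles R P' N i"
  shows "ext_class R P N i (compose (carrier (pr P i)) u (\<phi> i)) = ext_class R P N i (compose (carrier (pr P i)) u (\<phi>' i))"
proof -
  have cm: "chain_map R P P' \<phi>" "chain_map R P P' \<phi>'" using \<phi> \<phi>' by (auto simp: lifts_def)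
  obtain v where v: "v \<in> carrier (ghom R (pr P (i - 1)) N)"
    "\<And>x. x \<in> carrier (pr P i) \<Longrightarrow> u (\<phi> i x) = v (df P i x) \<oplus>\<^bsub>N\<^esub> u (\<phi>' i x)"
    using lifts_homotopic[OF R M M' P P' \<phi> \<phi>' N u] by blast
  show ?thesis
    by (rule ext_class_eqI[OF R P N pull_cocycle[OF R P P' cm(2) N u] v(1)]) (simp_all add: compose_def v(2))
qed

section \<open>Direct limits\<close>

locale direct_system =
  fixes R :: "('r, 'g::ab_group_add) gring" and A :: "nat \<Rightarrow> ('r, 'm, 'g) gmod" and t :: "nat \<Rightarrow> 'm \<Rightarrow> 'm"
  assumes A: "graded_module R (A n)" and t: "linear_map R (A n) (A (Suc n)) (t n)"
    and t_degree: "x \<in> mgrade (A n) g \<Longrightarrow> t n x \<in> mgrade (A (Suc n)) g"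
begin

lemma fold_upt_comp:
  assumes "n \<le> m" "m \<le> k"
  shows "fold t [n..<k] x = fold t [m..<k] (fold t [n..<m] x)"
proof -
  have "[n..<k] = [n..<m] @ [m..<k]" using upt_add_eq_append[of n m "k - m"] assms by simp
  then show ?thesis by simp
qed

lemma trans_closed: "n \<le> m \<Longrightarrow> x \<in> carrier (A n) \<Longrightarrow> fold t [n..<m] x \<in> carrier (A m)"
proof (induction m rule: dec_induct)
  case (step m) then show ?case using linear_mapD(2)[OF t] by simp
qed simp

lemma trans_degree: "n \<le> m \<Longrightarrow> x \<in> mgrade (A n) g \<Longrightarrow> fold t [n..<m] x \<in> mgrade (A m) g"
proof (induction m rule: dec_induct)
  case (step m) then show ?case using t_degree by simp
qed simp

lemma trans_add:
  "n \<le> m \<Longrightarrow> x \<in> carrier (A n) \<Longrightarrow> y \<in> carrier (A n) \<Longrightarrow>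
    fold t [n..<m] (x \<oplus>\<^bsub>A n\<^esub> y) = fold t [n..<m] x \<oplus>\<^bsub>A m\<^esub> fold t [n..<m] y"
proof (induction m rule: dec_induct)
  case (step m) then show ?case using linear_mapD(3)[OF t] trans_closed by simp
qed simp

lemma trans_smult:
  "n \<le> m \<Longrightarrow> r \<in> carrier R \<Longrightarrow> x \<in> carrier (A n) \<Longrightarrow>
    fold t [n..<m] (r \<odot>\<^bsub>A n\<^esub> x) = r \<odot>\<^bsub>A m\<^esub> fold t [n..<m] x"
proof (induction m rule: dec_induct)
  case (step m) then show ?case using linear_mapD(4)[OF t] trans_closed by simp
qed simp

lemma trans_zero: "n \<le> m \<Longrightarrow> fold t [n..<m] \<zero>\<^bsub>A n\<^esub> = \<zero>\<^bsub>A m\<^esub>"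
proof (induction m rule: dec_induct)
  case (step m) then show ?case using linear_map_zero[OF A A t] by simp
qed simp

lemma dl_mem: "(m, y) \<in> dl_class A t n x \<longleftrightarrow>
    y \<in> carrier (A m) \<and> (\<exists>k. n \<le> k \<and> m \<le> k \<and> fold t [n..<k] x = fold t [m..<k] y)"
  by (auto simp: dl_class_def)

lemma dl_self: "x \<in> carrier (A n) \<Longrightarrow> (n, x) \<in> dl_class A t n x"
  by (auto simp: dl_mem)

lemma dl_eqI:
  assumes "n \<le> k" "m \<le> k" "fold t [n..<k] x = fold t [m..<k] y"
  shows "dl_class A t n x = dl_class A t m y"
proof -
  have *: "dl_class A t n x \<subseteq> dl_class A t m y"
    if "n \<le> k" "m \<le> k" "fold t [n..<k] x = fold t [m..<k] y" for n x m y
  proof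
    fix p assume p: "p \<in> dl_class A t n x"
    obtain l z where pz: "p = (l, z)" by (cases p)
    then obtain k' where z: "z \<in> carrier (A l)" and k': "n \<le> k'" "l \<le> k'" "fold t [n..<k'] x = fold t [l..<k'] z"
      using p by (auto simp: dl_mem)
    let ?K = "max k k'"
    have "fold t [m..<?K] y = fold t [k..<?K] (fold t [m..<k] y)" using that by (intro fold_upt_comp) auto
    also have "\<dots> = fold t [n..<?K] x" unfolding that(3)[symmetric] using that by (intro fold_upt_comp[symmetric]) auto
    also have "\<dots> = fold t [k'..<?K] (fold t [n..<k'] x)" using k' by (intro fold_upt_comp) auto
    also have "\<dots> = fold t [l..<?K] z" unfolding k'(3) using k' by (intro fold_upt_comp[symmetric]) auto
    finally show "p \<in> dl_class A t m y" using z that k' unfolding pz dl_mem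
      by (intro conjI exI[of _ ?K]) auto
  qed
  show ?thesis using *[OF assms] *[OF assms(2,1) assms(3)[symmetric]] by blast
qed

lemma dl_shift: "n \<le> m \<Longrightarrow> dl_class A t n x = dl_class A t m (fold t [n..<m] x)"
  by (rule dl_eqI[of n m m]) auto

lemma dirlim_carrier: "X \<in> carrier (dirlim A t) \<longleftrightarrow> (\<exists>n x. x \<in> carrier (A n) \<and> X = dl_class A t n x)"
  by (auto simp: dirlim_def)

lemma dl_class_carrier: "x \<in> carrier (A n) \<Longrightarrow> dl_class A t n x \<in> carrier (dirlim A t)"
  by (auto simp: dirlim_carrier)

lemma A_closed: "x \<in> carrier (A n) \<Longrightarrow> y \<in> carrier (A n) \<Longrightarrow> x \<oplus>\<^bsub>A n\<^esub> y \<in> carrier (A n)"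
  "r \<in> carrier R \<Longrightarrow> x \<in> carrier (A n) \<Longrightarrow> r \<odot>\<^bsub>A n\<^esub> x \<in> carrier (A n)"
  "\<zero>\<^bsub>A n\<^esub> \<in> carrier (A n)"
  using abelian_monoid.a_closed[OF abelian_group.axioms(1)[OF graded_moduleD(3)[OF A]]]
    abelian_monoid.zero_closed[OF abelian_group.axioms(1)[OF graded_moduleD(3)[OF A]]]
    module.smult_closed[OF graded_moduleD(1)[OF A]] by blast+

lemma dirlim_add:
  assumes x: "x \<in> carrier (A n)" and y: "y \<in> carrier (A n)"
  shows "dl_class A t n x \<oplus>\<^bsub>dirlim A t\<^esub> dl_class A t n y = dl_class A t n (x \<oplus>\<^bsub>A n\<^esub> y)"
proof -
  have *: "dl_class A t (max m l) (fold t [m..<max m l] x' \<oplus>\<^bsub>A (max m l)\<^esub> fold t [l..<max m l] y') = dl_class A t n (x \<oplus>\<^bsub>A n\<^esub> y)"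
    if x': "(m, x') \<in> dl_class A t n x" and y': "(l, y') \<in> dl_class A t n y" for m x' l y'
  proof -
    obtain j where x'c: "x' \<in> carrier (A m)" and j: "n \<le> j" "m \<le> j" "fold t [n..<j] x = fold t [m..<j] x'"
      using x' by (auto simp: dl_mem)
    obtain k where y'c: "y' \<in> carrier (A l)" and k: "n \<le> k" "l \<le> k" "fold t [n..<k] y = fold t [l..<k] y'"
      using y' by (auto simp: dl_mem)
    let ?K = "max j k" and ?M = "max m l"
    have K: "?M \<le> ?K" "n \<le> ?K" using j k by auto
    have c: "fold t [m..<?M] x' \<in> carrier (A ?M)" "fold t [l..<?M] y' \<in> carrier (A ?M)"
      using trans_closed x'c y'c by auto
    have "fold t [?M..<?K] (fold t [m..<?M] x' \<oplus>\<^bsub>A ?M\<^esub> fold t [l..<?M] y')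
        = fold t [?M..<?K] (fold t [m..<?M] x') \<oplus>\<^bsub>A ?K\<^esub> fold t [?M..<?K] (fold t [l..<?M] y')"
      by (rule trans_add[OF K(1) c])
    also have "fold t [?M..<?K] (fold t [m..<?M] x') = fold t [m..<?K] x'" using K by (intro fold_upt_comp[symmetric]) auto
    also have "\<dots> = fold t [j..<?K] (fold t [m..<j] x')" using j by (intro fold_upt_comp) auto
    also have "\<dots> = fold t [n..<?K] x" unfolding j(3)[symmetric] using j by (intro fold_upt_comp[symmetric]) auto
    also have "fold t [?M..<?K] (fold t [l..<?M] y') = fold t [l..<?K] y'" using K by (intro fold_upt_comp[symmetric]) auto
    also have "\<dots> = fold t [k..<?K] (fold t [l..<k] y')" using k by (intro fold_upt_comp) auto
    also have "\<dots> = fold t [n..<?K] y" unfolding k(3)[symmetric] using k by (intro fold_upt_comp[symmetric]) auto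
    also have "fold t [n..<?K] x \<oplus>\<^bsub>A ?K\<^esub> fold t [n..<?K] y = fold t [n..<?K] (x \<oplus>\<^bsub>A n\<^esub> y)"
      by (rule trans_add[OF K(2) x y, symmetric])
    finally show ?thesis using K by (intro dl_eqI[of _ ?K]) auto
  qed
  have "(\<Union>(m, x')\<in>dl_class A t n x. \<Union>(l, y')\<in>dl_class A t n y. dl_class A t (max m l)
        (fold t [m..<max m l] x' \<oplus>\<^bsub>A (max m l)\<^esub> fold t [l..<max m l] y')) = dl_class A t n (x \<oplus>\<^bsub>A n\<^esub> y)" (is "?U = ?D")
  proof
    show "?U \<subseteq> ?D" using * by fast
    show "?D \<subseteq> ?U" using *[OF dl_self[OF x] dl_self[OF y]] dl_self[OF x] dl_self[OF y] by fast
  qed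
  then show ?thesis by (simp add: dirlim_def)
qed

lemma dirlim_smult:
  assumes r: "r \<in> carrier R" and x: "x \<in> carrier (A n)"
  shows "r \<odot>\<^bsub>dirlim A t\<^esub> dl_class A t n x = dl_class A t n (r \<odot>\<^bsub>A n\<^esub> x)"
proof -
  have *: "dl_class A t m (r \<odot>\<^bsub>A m\<^esub> x') = dl_class A t n (r \<odot>\<^bsub>A n\<^esub> x)" if x': "(m, x') \<in> dl_class A t n x" for m x'
  proof -
    obtain j where x'c: "x' \<in> carrier (A m)" and j: "n \<le> j" "m \<le> j" "fold t [n..<j] x = fold t [m..<j] x'"
      using x' by (auto simp: dl_mem)
    then show ?thesis using trans_smult[OF j(2) r x'c] trans_smult[OF j(1) r x] by (intro dl_eqI[of _ j]) auto
  qed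
  have "(\<Union>(m, x')\<in>dl_class A t n x. dl_class A t m (r \<odot>\<^bsub>A m\<^esub> x')) = dl_class A t n (r \<odot>\<^bsub>A n\<^esub> x)" (is "?U = ?D")
  proof
    show "?U \<subseteq> ?D" using * by fast
    show "?D \<subseteq> ?U" using *[OF dl_self[OF x]] dl_self[OF x] by fast
  qed
  then show ?thesis by (simp add: dirlim_def)
qed

lemma dirlim_zero: "\<zero>\<^bsub>dirlim A t\<^esub> = dl_class A t n \<zero>\<^bsub>A n\<^esub>"
  using dl_shift[of 0 n "\<zero>\<^bsub>A 0\<^esub>"] trans_zero[of 0 n] by (simp add: dirlim_def)

lemma dl_common_level:
  assumes F: "finite F" and f: "\<And>i. i \<in> F \<Longrightarrow> f i \<in> carrier (dirlim A t)"
  shows "\<exists>n x. \<forall>i\<in>F. x i \<in> carrier (A n) \<and> f i = dl_class A t n (x i)"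
proof -
  have "\<exists>n x. x \<in> carrier (A n) \<and> f i = dl_class A t n x" if "i \<in> F" for i
    using f[OF that] by (simp add: dirlim_carrier)
  then obtain l y where y: "\<And>i. i \<in> F \<Longrightarrow> y i \<in> carrier (A (l i))" "\<And>i. i \<in> F \<Longrightarrow> f i = dl_class A t (l i) (y i)"
    by metis
  let ?n = "Max (insert 0 (l ` F))"
  have le: "l i \<le> ?n" if "i \<in> F" for i using F that by (intro Max_ge) auto
  have "fold t [l i..<?n] (y i) \<in> carrier (A ?n) \<and> f i = dl_class A t ?n (fold t [l i..<?n] (y i))" if "i \<in> F" for i
    using trans_closed[OF le[OF that] y(1)[OF that]] y(2)[OF that] dl_shift[OF le[OF that]] by simp
  then show ?thesis by (intro exI[of _ ?n] exI[of _ "\<lambda>i. fold t [l i..<?n] (y i)"] ballI)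
qed

lemma dirlim_abelian_monoid: "abelian_monoid (dirlim A t)"
proof (rule abelian_monoidI)
  have one: "\<exists>n x. x \<in> carrier (A n) \<and> X = dl_class A t n x" if "X \<in> carrier (dirlim A t)" for X
    using that by (simp add: dirlim_carrier)
  have three: "\<exists>n x y z. x \<in> carrier (A n) \<and> y \<in> carrier (A n) \<and> z \<in> carrier (A n) \<and>
      X = dl_class A t n x \<and> Y = dl_class A t n y \<and> Z = dl_class A t n z"
    if "X \<in> carrier (dirlim A t)" "Y \<in> carrier (dirlim A t)" "Z \<in> carrier (dirlim A t)" for X Y Z
  proof -
    have "\<exists>n x. \<forall>i\<in>{0, 1, 2::nat}. x i \<in> carrier (A n) \<and> (if i = 0 then X else if i = 1 then Y else Z) = dl_class A t n (x i)"
      by (rule dl_common_level) (use that in auto)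
    then obtain n x where x: "\<forall>i\<in>{0, 1, 2::nat}. x i \<in> carrier (A n) \<and> (if i = 0 then X else if i = 1 then Y else Z) = dl_class A t n (x i)"
      by (elim exE)
    show ?thesis by (rule exI[of _ n], rule exI[of _ "x 0"], rule exI[of _ "x 1"], rule exI[of _ "x 2"]) (use x in simp)
  qed
  show "\<zero>\<^bsub>dirlim A t\<^esub> \<in> carrier (dirlim A t)" using dirlim_zero[of 0] dl_class_carrier A_closed by simp
  fix X Y Z assume XYZ: "X \<in> carrier (dirlim A t)" "Y \<in> carrier (dirlim A t)"
  from three[OF XYZ XYZ(1)] obtain n x y where xy: "x \<in> carrier (A n)" "y \<in> carrier (A n)"
    "X = dl_class A t n x" "Y = dl_class A t n y" by blast
  show "X \<oplus>\<^bsub>dirlim A t\<^esub> Y \<in> carrier (dirlim A t)" using xy dirlim_add dl_class_carrier A_closed by simp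
  show "X \<oplus>\<^bsub>dirlim A t\<^esub> Y = Y \<oplus>\<^bsub>dirlim A t\<^esub> X"
    using xy dirlim_add abelian_monoid.a_comm[OF abelian_group.axioms(1)[OF graded_moduleD(3)[OF A]]] by simp
  show "\<zero>\<^bsub>dirlim A t\<^esub> \<oplus>\<^bsub>dirlim A t\<^esub> X = X"
    using xy(1,3) dirlim_add[OF A_closed(3) xy(1)] dirlim_zero[of n]
      abelian_monoid.l_zero[OF abelian_group.axioms(1)[OF graded_moduleD(3)[OF A]]] by simp
  assume Z: "Z \<in> carrier (dirlim A t)"
  from three[OF XYZ Z] obtain n x y z where xyz: "x \<in> carrier (A n)" "y \<in> carrier (A n)" "z \<in> carrier (A n)"
    "X = dl_class A t n x" "Y = dl_class A t n y" "Z = dl_class A t n z" by blast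
  then show "X \<oplus>\<^bsub>dirlim A t\<^esub> Y \<oplus>\<^bsub>dirlim A t\<^esub> Z = X \<oplus>\<^bsub>dirlim A t\<^esub> (Y \<oplus>\<^bsub>dirlim A t\<^esub> Z)"
    using dirlim_add A_closed abelian_monoid.a_assoc[OF abelian_group.axioms(1)[OF graded_moduleD(3)[OF A]]] by simp
qed

lemma dl_class_finsum:
  assumes "finite F" "\<And>i. i \<in> F \<Longrightarrow> f i \<in> carrier (A n)"
  shows "dl_class A t n (finsum (A n) f F) = finsum (dirlim A t) (\<lambda>i. dl_class A t n (f i)) F"
  by (rule additive_map_finsum[where u = "dl_class A t n",
        OF abelian_group.axioms(1)[OF graded_moduleD(3)[OF A[of n]]] dirlim_abelian_monoid _
        dirlim_zero[of n, symmetric] assms])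
     (simp_all add: additive_map_def dl_class_carrier dirlim_add)

text \<open>The finitely many homogeneous summands of an element of coarse degree \<open>h\<close> in the limit can be
  represented at a common level, where their sum already has degree \<open>h\<close>.\<close>

lemma dirlim_coarsen: "dirlim (\<lambda>n. coarsen \<psi> (A n)) t = coarsen \<psi> (dirlim A t)"
proof -
  have cl: "dl_class (\<lambda>n. coarsen \<psi> (A n)) t = dl_class A t" by (intro HOL.ext) (simp add: dl_class_def)
  have Dc: "x \<in> mgrade (A n) g \<Longrightarrow> x \<in> carrier (A n)" for x n g
    using graded_group.D_carrier[OF graded_moduleD(2)[OF A]] .
  have "{dl_class A t n x | n x. x \<in> coarse_grade (A n) \<psi> (mgrade (A n)) h} =
      coarse_grade (dirlim A t) \<psi> (mgrade (dirlim A t)) h" for h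
  proof (intro equalityI subsetI)
    fix X assume "X \<in> {dl_class A t n x | n x. x \<in> coarse_grade (A n) \<psi> (mgrade (A n)) h}"
    then obtain n c F where X: "X = dl_class A t n (finsum (A n) c F)" and F: "finite F" "F \<subseteq> \<psi> -` {h}"
      "\<forall>g\<in>F. c g \<in> mgrade (A n) g" by (auto simp: coarse_grade_def)
    have "X = finsum (dirlim A t) (\<lambda>g. dl_class A t n (c g)) F"
      unfolding X using F Dc by (intro dl_class_finsum) auto
    moreover have "\<forall>g\<in>F. dl_class A t n (c g) \<in> mgrade (dirlim A t) g" using F by (auto simp: dirlim_def)
    ultimately show "X \<in> coarse_grade (dirlim A t) \<psi> (mgrade (dirlim A t)) h"
      using F unfolding coarse_grade_def by (intro CollectI exI[of _ "\<lambda>g. dl_class A t n (c g)"] exI[of _ F]) simp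
  next
    fix X assume "X \<in> coarse_grade (dirlim A t) \<psi> (mgrade (dirlim A t)) h"
    then obtain C F where X: "X = finsum (dirlim A t) C F" and F: "finite F" "F \<subseteq> \<psi> -` {h}"
      and C: "\<And>g. g \<in> F \<Longrightarrow> C g \<in> mgrade (dirlim A t) g" by (auto simp: coarse_grade_def)
    have "\<exists>l y. y \<in> mgrade (A l) g \<and> C g = dl_class A t l y" if "g \<in> F" for g using C[OF that] by (auto simp: dirlim_def)
    then obtain l y where y: "\<And>g. g \<in> F \<Longrightarrow> y g \<in> mgrade (A (l g)) g" "\<And>g. g \<in> F \<Longrightarrow> C g = dl_class A t (l g) (y g)"
      by metis
    let ?n = "Max (insert 0 (l ` F))"
    have le: "l g \<le> ?n" if "g \<in> F" for g using F that by (intro Max_ge) auto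
    let ?x = "\<lambda>g. fold t [l g..<?n] (y g)"
    have x: "?x g \<in> mgrade (A ?n) g" "C g = dl_class A t ?n (?x g)" if "g \<in> F" for g
      using trans_degree[OF le[OF that] y(1)[OF that]] y(2)[OF that] dl_shift[OF le[OF that]] by simp_all
    have xc: "?x g \<in> carrier (A ?n)" if "g \<in> F" for g using Dc[OF x(1)[OF that]] .
    have "X = finsum (dirlim A t) (\<lambda>g. dl_class A t ?n (?x g)) F"
      unfolding X
      by (rule abelian_monoid.finsum_cong'[OF dirlim_abelian_monoid refl _ x(2)]) (use dl_class_carrier[OF xc] in auto)
    also have "\<dots> = dl_class A t ?n (finsum (A ?n) ?x F)"
      by (rule dl_class_finsum[OF F(1) xc, symmetric])
    finally have "X = dl_class A t ?n (finsum (A ?n) ?x F)" .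
    moreover have "finsum (A ?n) ?x F \<in> coarse_grade (A ?n) \<psi> (mgrade (A ?n)) h"
      using F x(1) unfolding coarse_grade_def by (intro CollectI exI[of _ ?x] exI[of _ F]) simp
    ultimately show "X \<in> {dl_class A t n x | n x. x \<in> coarse_grade (A n) \<psi> (mgrade (A n)) h}"
      by (intro CollectI exI[of _ ?n] exI[of _ "finsum (A ?n) ?x F"] conjI)
  qed
  note grades = this
  have mg: "mgrade (dirlim (\<lambda>n. coarsen \<psi> (A n)) t) h = mgrade (coarsen \<psi> (dirlim A t)) h" for h
    unfolding coarsen_simps grades[of h, symmetric] by (simp add: dirlim_def cl)
  show ?thesis
  proof (rule gmod.equality)
    show "mgrade (dirlim (\<lambda>n. coarsen \<psi> (A n)) t) = mgrade (coarsen \<psi> (dirlim A t))" by (rule HOL.ext) (rule mg)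
  qed (simp_all add: dirlim_def cl)
qed

end

lemma dl_map_class:
  fixes R :: "('r, 'g::ab_group_add) gring"
  assumes D: "direct_system R A t" and E: "direct_system R B s"
    and \<phi>: "\<And>n x. x \<in> carrier (A n) \<Longrightarrow> \<phi> n x \<in> carrier (B n)"
    and comm: "\<And>n x. x \<in> carrier (A n) \<Longrightarrow> s n (\<phi> n x) = \<phi> (Suc n) (t n x)"
    and x: "x \<in> carrier (A n)"
  shows "dl_map A t B s \<phi> (dl_class A t n x) = dl_class B s n (\<phi> n x)"
proof -
  interpret D: direct_system R A t by (rule D)
  interpret E: direct_system R B s by (rule E)
  have tr: "fold s [n..<m] (\<phi> n x) = \<phi> m (fold t [n..<m] x)" if "n \<le> m" "x \<in> carrier (A n)" for n m x
    using that
  proof (induction m rule: dec_induct)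
    case (step m) then show ?case using comm[OF D.trans_closed[OF step(1)]] by simp
  qed simp
  have *: "dl_class B s m (\<phi> m x') = dl_class B s n (\<phi> n x)" if x': "(m, x') \<in> dl_class A t n x" for m x'
  proof -
    obtain j where x'c: "x' \<in> carrier (A m)" and j: "n \<le> j" "m \<le> j" "fold t [n..<j] x = fold t [m..<j] x'"
      using x' D.dl_mem by blast
    then show ?thesis using tr[OF j(2) x'c] tr[OF j(1) x] by (intro E.dl_eqI[of _ j]) auto
  qed
  have "(\<Union>(m, x')\<in>dl_class A t n x. dl_class B s m (\<phi> m x')) = dl_class B s n (\<phi> n x)" (is "?U = ?D")
  proof
    show "?U \<subseteq> ?D" using * by fast
    show "?D \<subseteq> ?U" using *[OF D.dl_self[OF x]] D.dl_self[OF x] by fast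
  qed
  then show ?thesis using D.dl_class_carrier[OF x] by (simp add: dl_map_def)
qed

lemma dl_map_gr_hom:
  fixes R :: "('r, 'g::ab_group_add) gring"
  assumes D: "direct_system R A t" and E: "direct_system R B s"
    and \<phi>: "\<And>n. \<phi> n \<in> gr_hom R (A n) (B n)"
    and comm: "\<And>n x. x \<in> carrier (A n) \<Longrightarrow> s n (\<phi> n x) = \<phi> (Suc n) (t n x)"
  shows "dl_map A t B s \<phi> \<in> gr_hom R (dirlim A t) (dirlim B s)"
proof -
  interpret D: direct_system R A t by (rule D)
  interpret E: direct_system R B s by (rule E)
  show ?thesis
  unfolding gr_hom_iff linear_map_def additive_map_def
proof (intro conjI ballI allI)
  have eq: "dl_map A t B s \<phi> (dl_class A t n x) = dl_class B s n (\<phi> n x)" if "x \<in> carrier (A n)" for n x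
    by (rule dl_map_class[OF D E gr_homD(4)[OF \<phi>] comm that])
  note \<phi>l = linear_mapD[OF gr_homD(2)[OF \<phi>]]
  show "dl_map A t B s \<phi> \<in> extensional (carrier (dirlim A t))" by (simp add: dl_map_def)
  fix X assume X: "X \<in> carrier (dirlim A t)"
  then obtain n x where x: "x \<in> carrier (A n)" "X = dl_class A t n x" using D.dirlim_carrier by blast
  show "dl_map A t B s \<phi> X \<in> carrier (dirlim B s)"
    unfolding x(2) eq[OF x(1)] by (rule E.dl_class_carrier[OF \<phi>l(2)[OF x(1)]])
  show "dl_map A t B s \<phi> (r \<odot>\<^bsub>dirlim A t\<^esub> X) = r \<odot>\<^bsub>dirlim B s\<^esub> dl_map A t B s \<phi> X" if r: "r \<in> carrier R" for r
    using x r by (simp add: D.dirlim_smult E.dirlim_smult eq \<phi>l D.A_closed(2))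
  fix Y assume Y: "Y \<in> carrier (dirlim A t)"
  have "\<exists>n x y. x \<in> carrier (A n) \<and> y \<in> carrier (A n) \<and> X = dl_class A t n x \<and> Y = dl_class A t n y"
  proof -
    have "\<exists>n x. \<forall>i\<in>{0, 1::nat}. x i \<in> carrier (A n) \<and> (if i = 0 then X else Y) = dl_class A t n (x i)"
      by (rule D.dl_common_level) (use X Y in auto)
    then obtain n x where x: "\<forall>i\<in>{0, 1::nat}. x i \<in> carrier (A n) \<and> (if i = 0 then X else Y) = dl_class A t n (x i)"
      by (elim exE)
    show ?thesis by (rule exI[of _ n], rule exI[of _ "x 0"], rule exI[of _ "x 1"]) (use x in simp)
  qed
  then obtain n x y where xy: "x \<in> carrier (A n)" "y \<in> carrier (A n)" "X = dl_class A t n x" "Y = dl_class A t n y" by blast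
  then show "dl_map A t B s \<phi> (X \<oplus>\<^bsub>dirlim A t\<^esub> Y) = dl_map A t B s \<phi> X \<oplus>\<^bsub>dirlim B s\<^esub> dl_map A t B s \<phi> Y"
    by (simp add: D.dirlim_add E.dirlim_add eq \<phi>l D.A_closed(1))
next
  fix g X assume "X \<in> mgrade (dirlim A t) g"
  then obtain n x where x: "x \<in> mgrade (A n) g" "X = dl_class A t n x" by (auto simp: dirlim_def)
  have xc: "x \<in> carrier (A n)" using graded_group.D_carrier[OF graded_moduleD(2)[OF D.A] x(1)] .
  have "dl_map A t B s \<phi> X = dl_class B s n (\<phi> n x)"
    unfolding x(2) by (rule dl_map_class[OF D E gr_homD(4)[OF \<phi>] comm xc])
  then show "dl_map A t B s \<phi> X \<in> mgrade (dirlim B s) g" using gr_homD(3)[OF \<phi> x(1)] by (auto simp: dirlim_def)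
qed
qed

section \<open>Limits of Ext along towers of resolutions\<close>

text \<open>Local cohomology with the chosen resolutions and lifts replaced by arbitrary ones. This freedom is
  needed because the coarsening of the chosen resolution is not the one chosen for the coarsened module.\<close>

definition lc_delta ::
    "('r, 'g::ab_group_add) gring \<Rightarrow> (nat \<Rightarrow> ('r, 'u, 'g, 'v) resolution) \<Rightarrow> (nat \<Rightarrow> int \<Rightarrow> 'u \<Rightarrow> 'u) \<Rightarrow>
     ('r, 'u, 'g, (nat \<times> ('u \<Rightarrow> 'u) set) set, 'g) delta" where
  "lc_delta R P \<tau> = \<lparr>
     obj = (\<lambda>i N. dirlim (\<lambda>n. ext_of R (P n) i N) (\<lambda>n. pull R (P (Suc n)) (P n) i N (\<tau> n))),
     mor = (\<lambda>i N N' f. dl_map (\<lambda>n. ext_of R (P n) i N) (\<lambda>n. pull R (P (Suc n)) (P n) i N (\<tau> n))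
        (\<lambda>n. ext_of R (P n) i N') (\<lambda>n. pull R (P (Suc n)) (P n) i N' (\<tau> n)) (\<lambda>n. push R (P n) i N N' f)),
     conn = (\<lambda>i A \<alpha> B \<beta> C. dl_map (\<lambda>n. ext_of R (P n) i C) (\<lambda>n. pull R (P (Suc n)) (P n) i C (\<tau> n))
        (\<lambda>n. ext_of R (P n) (i + 1) A) (\<lambda>n. pull R (P (Suc n)) (P n) (i + 1) A (\<tau> n))
        (\<lambda>n. connect R (P n) i A \<alpha> B \<beta> C))\<rparr>"

lemma local_cohomology_lc_delta:
  "local_cohomology R a = lc_delta R (\<lambda>n. resolution_of R (quot_pow R a n))
     (\<lambda>n. chain_lift R (quot_pow R a (Suc n)) (quot_pow R a n) (resolution_of R (quot_pow R a (Suc n)))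
        (resolution_of R (quot_pow R a n)) (quot_proj R a n))"
  unfolding local_cohomology_def lc_delta_def lc_system_def lc_trans_def ext_def ext_map1_def ext_map2_def ext_conn_def
    pull_def push_def connect_def Let_def ..

definition tower ::
    "('r, 'g::ab_group_add) gring \<Rightarrow> (nat \<Rightarrow> ('r, 'v, 'g) gmod) \<Rightarrow> (nat \<Rightarrow> 'v \<Rightarrow> 'v) \<Rightarrow>
     (nat \<Rightarrow> ('r, 'u, 'g, 'v) resolution) \<Rightarrow> (nat \<Rightarrow> int \<Rightarrow> 'u \<Rightarrow> 'u) \<Rightarrow> bool" where
  "tower R X p P \<tau> \<longleftrightarrow> graded_cring R \<and> (\<forall>n. graded_module R (X n)) \<and> (\<forall>n. projective_resolution R (X n) (P n)) \<and>
     (\<forall>n. lifts R (P (Suc n)) (P n) (p n) (\<tau> n))"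

lemma towerD:
  assumes "tower R X p P \<tau>"
  shows "graded_cring R" "graded_module R (X n)" "projective_resolution R (X n) (P n)"
    "lifts R (P (Suc n)) (P n) (p n) (\<tau> n)" "chain_map R (P (Suc n)) (P n) (\<tau> n)"
  using assms by (simp_all add: tower_def lifts_def)

lemma lifts_compose:
  assumes P: "projective_resolution R M P" and P': "projective_resolution R M' P'"
    and f: "lifts R P P' f \<phi>" and g: "lifts R P' P'' g \<phi>'"
  shows "lifts R P P'' (\<lambda>x. g (f x)) (\<lambda>i. compose (carrier (pr P i)) (\<phi>' i) (\<phi> i))"
proof -
  have cm: "chain_map R P P' \<phi>" "chain_map R P' P'' \<phi>'" using f g by (auto simp: lifts_def)
  note h = chain_mapD(1)[OF cm(1)] and h' = chain_mapD(1)[OF cm(2)]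
  have "chain_map R P P'' (\<lambda>i. compose (carrier (pr P i)) (\<phi>' i) (\<phi> i))"
    unfolding chain_map_def
  proof (intro conjI allI ballI)
    show "compose (carrier (pr P i)) (\<phi>' i) (\<phi> i) \<in> gr_hom R (pr P i) (pr P'' i)" for i
      by (rule gr_hom_compose[OF resolutionD(2)[OF P] h h'])
    fix i x assume x: "x \<in> carrier (pr P i)"
    show "compose (carrier (pr P (i - 1))) (\<phi>' (i - 1)) (\<phi> (i - 1)) (df P i x) = df P'' i (compose (carrier (pr P i)) (\<phi>' i) (\<phi> i) x)"
      using x gr_homD(4)[OF resolutionD(4)[OF P] x] chain_mapD(3)[OF cm(1) x] chain_mapD(3)[OF cm(2) gr_homD(4)[OF h x]]
      by (simp add: compose_def)
  qed
  moreover have "g (f (aug P x)) = aug P'' (compose (carrier (pr P 0)) (\<phi>' 0) (\<phi> 0) x)" if x: "x \<in> carrier (pr P 0)" for x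
    using x f g gr_homD(4)[OF h[of 0] x] by (simp add: lifts_def compose_def)
  ultimately show ?thesis by (simp add: lifts_def)
qed

lemma lifts_id:
  assumes P: "projective_resolution R M P"
  shows "lifts R P P (\<lambda>x. x) (\<lambda>i. \<lambda>x\<in>carrier (pr P i). x)"
  using gr_hom_id[OF resolutionD(2)[OF P]] gr_homD(4)[OF resolutionD(4)[OF P]]
  by (simp add: lifts_def chain_map_def)

context
  fixes R :: "('r, 'g::ab_group_add) gring" and X :: "nat \<Rightarrow> ('r, 'v, 'g) gmod" and p
    and P :: "nat \<Rightarrow> ('r, 'u, 'g, 'v) resolution" and \<tau>
  assumes T: "tower R X p P \<tau>"
begin

abbreviation (input) "lsys i N n \<equiv> ext_of R (P n) i N"
abbreviation (input) "ltrans i N n \<equiv> pull R (P (Suc n)) (P n) i N (\<tau> n)"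

lemma sys_graded: "graded_module R N \<Longrightarrow> graded_module R (lsys i N n)"
  by (rule ext_graded_module[OF towerD(1)[OF T] towerD(3)[OF T]])

lemma trans_gr_hom: "graded_module R N \<Longrightarrow> ltrans i N n \<in> gr_hom R (lsys i N n) (lsys i N (Suc n))"
  by (rule pull_gr_hom[OF towerD(1)[OF T] towerD(3)[OF T] towerD(3)[OF T] towerD(5)[OF T]])

lemma lsystem: "graded_module R N \<Longrightarrow> direct_system R (lsys i N) (ltrans i N)"
  by unfold_locales (rule sys_graded gr_homD(2,3)[OF trans_gr_hom]; assumption)+

lemma lc_obj: "obj (lc_delta R P \<tau>) i N = dirlim (lsys i N) (ltrans i N)"
  by (simp add: lc_delta_def)

lemma lc_obj_cases:
  assumes N: "graded_module R N" and z: "z \<in> carrier (obj (lc_delta R P \<tau>) i N)"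
  obtains n u where "u \<in> cocycles R (P n) N i" "z = dl_class (lsys i N) (ltrans i N) n (ext_class R (P n) N i u)"
proof -
  have "z \<in> carrier (dirlim (lsys i N) (ltrans i N))" using z unfolding lc_obj .
  then have "\<exists>n x. x \<in> carrier (lsys i N n) \<and> z = dl_class (lsys i N) (ltrans i N) n x"
    by (rule iffD1[OF direct_system.dirlim_carrier[OF lsystem[OF N]]])
  then obtain n x where x: "x \<in> carrier (lsys i N n)" "z = dl_class (lsys i N) (ltrans i N) n x" by (elim exE conjE)
  have "x \<in> (\<lambda>u. ext_class R (P n) N i u) ` cocycles R (P n) N i"
    using x(1) unfolding ext_carrier[OF towerD(1)[OF T] towerD(3)[OF T]] .
  then obtain u where "u \<in> cocycles R (P n) N i" "x = ext_class R (P n) N i u" by (elim imageE)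
  then show ?thesis using that x(2) by simp
qed

lemma ext_class_carrier: "u \<in> cocycles R (P n) N i \<Longrightarrow> ext_class R (P n) N i u \<in> carrier (lsys i N n)"
  unfolding ext_carrier[OF towerD(1)[OF T] towerD(3)[OF T]] by (rule imageI)

lemma lc_mor_class:
  assumes N: "graded_module R N" and N': "graded_module R N'" and f: "f \<in> gr_hom R N N'"
    and x: "x \<in> carrier (lsys i N n)"
  shows "mor (lc_delta R P \<tau>) i N N' f (dl_class (lsys i N) (ltrans i N) n x) =
    dl_class (lsys i N') (ltrans i N') n (push R (P n) i N N' f x)"
proof -
  note RT = towerD(1)[OF T]
  have "dl_map (lsys i N) (ltrans i N) (lsys i N') (ltrans i N') (\<lambda>n. push R (P n) i N N' f) (dl_class (lsys i N) (ltrans i N) n x) =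
    dl_class (lsys i N') (ltrans i N') n (push R (P n) i N N' f x)"
  proof (rule dl_map_class[OF lsystem[OF N] lsystem[OF N']])
    show "push R (P n) i N N' f x \<in> carrier (lsys i N' n)" if "x \<in> carrier (lsys i N n)" for n x
      using gr_homD(4)[OF push_gr_hom[OF RT towerD(3)[OF T] N N' f] that] .
    show "ltrans i N' n (push R (P n) i N N' f x) = push R (P (Suc n)) i N N' f (ltrans i N n x)"
      if "x \<in> carrier (lsys i N n)" for n x
      by (rule pull_push[OF RT towerD(3)[OF T] towerD(3)[OF T] towerD(5)[OF T] N N' f that])
  qed (rule x)
  then show ?thesis by (simp add: lc_delta_def)
qed

lemma lc_conn_class:
  fixes A B C :: "('r, 'u, 'g) gmod"
  assumes ex: "short_exact R A \<alpha> B \<beta> C" and x: "x \<in> carrier (lsys i C n)"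
  shows "conn (lc_delta R P \<tau>) i A \<alpha> B \<beta> C (dl_class (lsys i C) (ltrans i C) n x) =
    dl_class (lsys (i + 1) A) (ltrans (i + 1) A) n (connect R (P n) i A \<alpha> B \<beta> C x)"
proof -
  note RT = towerD(1)[OF T]
  have A: "graded_module R A" and C: "graded_module R C" using ex by (auto simp: short_exact_def)
  have "dl_map (lsys i C) (ltrans i C) (lsys (i + 1) A) (ltrans (i + 1) A) (\<lambda>n. connect R (P n) i A \<alpha> B \<beta> C) (dl_class (lsys i C) (ltrans i C) n x) =
    dl_class (lsys (i + 1) A) (ltrans (i + 1) A) n (connect R (P n) i A \<alpha> B \<beta> C x)"
  proof (rule dl_map_class[OF lsystem[OF C] lsystem[OF A]])
    show "connect R (P n) i A \<alpha> B \<beta> C x \<in> carrier (lsys (i + 1) A n)" if "x \<in> carrier (lsys i C n)" for n x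
      by (rule pull_connect(2)[OF RT towerD(3)[OF T] towerD(3)[OF T] towerD(5)[OF T] ex that])
    show "ltrans (i + 1) A n (connect R (P n) i A \<alpha> B \<beta> C x) = connect R (P (Suc n)) i A \<alpha> B \<beta> C (ltrans i C n x)"
      if "x \<in> carrier (lsys i C n)" for n x
      by (rule pull_connect(1)[OF RT towerD(3)[OF T] towerD(3)[OF T] towerD(5)[OF T] ex that])
  qed (rule x)
  then show ?thesis by (simp add: lc_delta_def)
qed

end

text \<open>The maps \<open>\<chi> n\<close> go from the second family of resolutions to the first, as Ext is contravariant in them.\<close>

definition compare ::
    "('r, 'g::ab_group_add) gring \<Rightarrow> (nat \<Rightarrow> ('r, 'u, 'g, 'v) resolution) \<Rightarrow> (nat \<Rightarrow> int \<Rightarrow> 'u \<Rightarrow> 'u) \<Rightarrow>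
      (nat \<Rightarrow> ('r, 'u, 'g, 'v) resolution) \<Rightarrow> (nat \<Rightarrow> int \<Rightarrow> 'u \<Rightarrow> 'u) \<Rightarrow> (nat \<Rightarrow> int \<Rightarrow> 'u \<Rightarrow> 'u) \<Rightarrow>
      int \<Rightarrow> ('r, 'u, 'g) gmod \<Rightarrow> (nat \<times> ('u \<Rightarrow> 'u) set) set \<Rightarrow> (nat \<times> ('u \<Rightarrow> 'u) set) set" where
  "compare R P \<tau> Q \<sigma> \<chi> i N =
     dl_map (\<lambda>n. ext_of R (P n) i N) (\<lambda>n. pull R (P (Suc n)) (P n) i N (\<tau> n))
        (\<lambda>n. ext_of R (Q n) i N) (\<lambda>n. pull R (Q (Suc n)) (Q n) i N (\<sigma> n)) (\<lambda>n. pull R (Q n) (P n) i N (\<chi> n))"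

context
  fixes R :: "('r, 'g::ab_group_add) gring" and X :: "nat \<Rightarrow> ('r, 'v, 'g) gmod" and p
    and P Q :: "nat \<Rightarrow> ('r, 'u, 'g, 'v) resolution" and \<tau> \<sigma> \<chi>
  assumes T: "tower R X p P \<tau>" and T': "tower R X p Q \<sigma>" and \<chi>: "\<And>n. lifts R (Q n) (P n) (\<lambda>x. x) (\<chi> n)"
begin

lemma chi_chain_map: "chain_map R (Q n) (P n) (\<chi> n)"
  using \<chi> by (simp add: lifts_def)

text \<open>The two ways around the square are lifts of the same projection, so they are homotopic.\<close>

lemma compare_square:
  assumes N: "graded_module R N" and x: "x \<in> carrier (ext_of R (P n) i N)"
  shows "pull R (Q (Suc n)) (Q n) i N (\<sigma> n) (pull R (Q n) (P n) i N (\<chi> n) x) =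
    pull R (Q (Suc n)) (P (Suc n)) i N (\<chi> (Suc n)) (pull R (P (Suc n)) (P n) i N (\<tau> n) x)"
proof -
  note R = towerD(1)[OF T] and PR = towerD(3)[OF T] and QR = towerD(3)[OF T']
  obtain u where u: "u \<in> cocycles R (P n) N i" "x = ext_class R (P n) N i u" using x unfolding ext_carrier[OF R PR] by blast
  have l1: "lifts R (Q (Suc n)) (P n) (p n) (\<lambda>i. compose (carrier (pr (Q (Suc n)) i)) (\<chi> n i) (\<sigma> n i))"
    using lifts_compose[OF QR QR towerD(4)[OF T'] \<chi>] .
  have l2: "lifts R (Q (Suc n)) (P n) (p n) (\<lambda>i. compose (carrier (pr (Q (Suc n)) i)) (\<tau> n i) (\<chi> (Suc n) i))"
    using lifts_compose[OF QR PR \<chi> towerD(4)[OF T]] .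
  note e = pull_unique[OF R towerD(2)[OF T] towerD(2)[OF T] QR PR l1 l2 N u(1)]
  note s1 = gr_homD(4)[OF chain_mapD(1)[OF towerD(5)[OF T']]] and s2 = gr_homD(4)[OF chain_mapD(1)[OF chi_chain_map]]
  have "compose (carrier (pr (Q (Suc n)) i)) (compose (carrier (pr (Q n) i)) u (\<chi> n i)) (\<sigma> n i) =
      compose (carrier (pr (Q (Suc n)) i)) u (compose (carrier (pr (Q (Suc n)) i)) (\<chi> n i) (\<sigma> n i))"
    using s1 by (simp add: compose_def restrict_def fun_eq_iff)
  moreover have "compose (carrier (pr (Q (Suc n)) i)) (compose (carrier (pr (P (Suc n)) i)) u (\<tau> n i)) (\<chi> (Suc n) i) =
      compose (carrier (pr (Q (Suc n)) i)) u (compose (carrier (pr (Q (Suc n)) i)) (\<tau> n i) (\<chi> (Suc n) i))"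
    using s2 by (simp add: compose_def restrict_def fun_eq_iff)
  ultimately show ?thesis
    unfolding u(2) using e
      pull_class[OF R QR PR chi_chain_map N u(1)] pull_class[OF R QR QR towerD(5)[OF T'] N pull_cocycle[OF R QR PR chi_chain_map N u(1)]]
      pull_class[OF R PR PR towerD(5)[OF T] N u(1)] pull_class[OF R QR PR chi_chain_map N pull_cocycle[OF R PR PR towerD(5)[OF T] N u(1)]]
    by simp
qed

lemma compare_class:
  assumes N: "graded_module R N" and x: "x \<in> carrier (ext_of R (P n) i N)"
  shows "compare R P \<tau> Q \<sigma> \<chi> i N (dl_class (\<lambda>n. ext_of R (P n) i N) (\<lambda>n. pull R (P (Suc n)) (P n) i N (\<tau> n)) n x) =
    dl_class (\<lambda>n. ext_of R (Q n) i N) (\<lambda>n. pull R (Q (Suc n)) (Q n) i N (\<sigma> n)) n (pull R (Q n) (P n) i N (\<chi> n) x)"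
  unfolding compare_def
proof (rule dl_map_class[OF lsystem[OF T N] lsystem[OF T' N]])
  show "pull R (Q n) (P n) i N (\<chi> n) x \<in> carrier (ext_of R (Q n) i N)" if "x \<in> carrier (ext_of R (P n) i N)" for n x
    using gr_homD(4)[OF pull_gr_hom[OF towerD(1)[OF T] towerD(3)[OF T'] towerD(3)[OF T] chi_chain_map N] that] .
qed (rule compare_square[OF N] x, assumption?)+

lemma compare_gr_hom:
  assumes N: "graded_module R N"
  shows "compare R P \<tau> Q \<sigma> \<chi> i N \<in> gr_hom R (obj (lc_delta R P \<tau>) i N) (obj (lc_delta R Q \<sigma>) i N)"
  unfolding compare_def lc_obj[OF T] lc_obj[OF T']
proof (rule dl_map_gr_hom[OF lsystem[OF T N] lsystem[OF T' N]])
  show "pull R (Q n) (P n) i N (\<chi> n) \<in> gr_hom R (ext_of R (P n) i N) (ext_of R (Q n) i N)" for n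
    by (rule pull_gr_hom[OF towerD(1)[OF T] towerD(3)[OF T'] towerD(3)[OF T] chi_chain_map N])
qed (rule compare_square[OF N], assumption)

lemma compare_mor:
  assumes N: "graded_module R N" and N': "graded_module R N'" and f: "f \<in> gr_hom R N N'"
    and z: "z \<in> carrier (obj (lc_delta R P \<tau>) i N)"
  shows "compare R P \<tau> Q \<sigma> \<chi> i N' (mor (lc_delta R P \<tau>) i N N' f z) =
    mor (lc_delta R Q \<sigma>) i N N' f (compare R P \<tau> Q \<sigma> \<chi> i N z)"
proof -
  note R = towerD(1)[OF T] and PR = towerD(3)[OF T] and QR = towerD(3)[OF T']
  obtain n u where u: "u \<in> cocycles R (P n) N i"
    "z = dl_class (\<lambda>n. ext_of R (P n) i N) (\<lambda>n. pull R (P (Suc n)) (P n) i N (\<tau> n)) n (ext_class R (P n) N i u)"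
    by (rule lc_obj_cases[OF T N z])
  let ?x = "ext_class R (P n) N i u"
  have x: "?x \<in> carrier (ext_of R (P n) i N)" by (rule ext_class_carrier[OF T u(1)])
  have px: "push R (P n) i N N' f ?x \<in> carrier (ext_of R (P n) i N')" using gr_homD(4)[OF push_gr_hom[OF R PR N N' f] x] .
  have qx: "pull R (Q n) (P n) i N (\<chi> n) ?x \<in> carrier (ext_of R (Q n) i N)"
    using gr_homD(4)[OF pull_gr_hom[OF R QR PR chi_chain_map N] x] .
  show ?thesis
    unfolding u(2) lc_mor_class[OF T N N' f x] compare_class[OF N x] compare_class[OF N' px] lc_mor_class[OF T' N N' f qx]
    using pull_push[OF R QR PR chi_chain_map N N' f x] by simp
qed

lemma compare_conn:
  assumes ex: "short_exact R A \<alpha> B \<beta> C" and z: "z \<in> carrier (obj (lc_delta R P \<tau>) i C)"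
  shows "compare R P \<tau> Q \<sigma> \<chi> (i + 1) A (conn (lc_delta R P \<tau>) i A \<alpha> B \<beta> C z) =
    conn (lc_delta R Q \<sigma>) i A \<alpha> B \<beta> C (compare R P \<tau> Q \<sigma> \<chi> i C z)"
proof -
  have A: "graded_module R A" and C: "graded_module R C" using ex by (auto simp: short_exact_def)
  note R = towerD(1)[OF T] and PR = towerD(3)[OF T] and QR = towerD(3)[OF T']
  obtain n u where u: "u \<in> cocycles R (P n) C i"
    "z = dl_class (\<lambda>n. ext_of R (P n) i C) (\<lambda>n. pull R (P (Suc n)) (P n) i C (\<tau> n)) n (ext_class R (P n) C i u)"
    by (rule lc_obj_cases[OF T C z])
  let ?x = "ext_class R (P n) C i u"
  have x: "?x \<in> carrier (ext_of R (P n) i C)" by (rule ext_class_carrier[OF T u(1)])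
  note pc = pull_connect[OF R QR PR chi_chain_map ex x]
  have qx: "pull R (Q n) (P n) i C (\<chi> n) ?x \<in> carrier (ext_of R (Q n) i C)"
    using gr_homD(4)[OF pull_gr_hom[OF R QR PR chi_chain_map C] x] .
  show ?thesis
    unfolding u(2) lc_conn_class[OF T ex x] compare_class[OF C x] compare_class[OF A pc(2)] lc_conn_class[OF T' ex qx]
    using pc(1) by simp
qed

end

text \<open>Both composites of the two comparison maps lift the identity, as the identity does itself, so they
  are homotopic to it.\<close>

lemma compare_inverse:
  fixes R :: "('r, 'g::ab_group_add) gring" and P Q :: "nat \<Rightarrow> ('r, 'u, 'g, 'v) resolution"
  assumes T: "tower R X p P \<tau>" and T': "tower R X p Q \<sigma>" and \<chi>: "\<And>n. lifts R (Q n) (P n) (\<lambda>x. x) (\<chi> n)"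
    and \<chi>': "\<And>n. lifts R (P n) (Q n) (\<lambda>x. x) (\<chi>' n)"
    and N: "graded_module R N" and z: "z \<in> carrier (obj (lc_delta R P \<tau>) i N)"
  shows "compare R Q \<sigma> P \<tau> \<chi>' i N (compare R P \<tau> Q \<sigma> \<chi> i N z) = z"
proof -
  note R = towerD(1)[OF T] and PR = towerD(3)[OF T] and QR = towerD(3)[OF T']
  have cm: "chain_map R (Q n) (P n) (\<chi> n)" "chain_map R (P n) (Q n) (\<chi>' n)" for n using \<chi> \<chi>' by (simp_all add: lifts_def)
  obtain n u where u: "u \<in> cocycles R (P n) N i"
    "z = dl_class (\<lambda>n. ext_of R (P n) i N) (\<lambda>n. pull R (P (Suc n)) (P n) i N (\<tau> n)) n (ext_class R (P n) N i u)"
    by (rule lc_obj_cases[OF T N z])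
  let ?x = "ext_class R (P n) N i u"
  have x: "?x \<in> carrier (ext_of R (P n) i N)" by (rule ext_class_carrier[OF T u(1)])
  have qx: "pull R (Q n) (P n) i N (\<chi> n) ?x \<in> carrier (ext_of R (Q n) i N)"
    using gr_homD(4)[OF pull_gr_hom[OF R QR PR cm(1) N] x] .
  have "lifts R (P n) (P n) (\<lambda>x. x) (\<lambda>i. compose (carrier (pr (P n) i)) (\<chi> n i) (\<chi>' n i))"
    using lifts_compose[OF PR QR \<chi>' \<chi>] .
  note e = pull_unique[OF R towerD(2)[OF T] towerD(2)[OF T] PR PR this lifts_id[OF PR] N u(1)]
  have "compose (carrier (pr (P n) i)) (compose (carrier (pr (Q n) i)) u (\<chi> n i)) (\<chi>' n i) =
      compose (carrier (pr (P n) i)) u (compose (carrier (pr (P n) i)) (\<chi> n i) (\<chi>' n i))"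
    using gr_homD(4)[OF chain_mapD(1)[OF cm(2)]] by (simp add: compose_def restrict_def fun_eq_iff)
  moreover have "compose (carrier (pr (P n) i)) u (\<lambda>x\<in>carrier (pr (P n) i). x) = u"
    using cocyclesD(2)[OF R PR N u(1)] by (auto simp: compose_def restrict_def extensional_def fun_eq_iff)
  ultimately have "pull R (P n) (Q n) i N (\<chi>' n) (pull R (Q n) (P n) i N (\<chi> n) ?x) = ?x"
    using e pull_class[OF R QR PR cm(1) N u(1)] pull_class[OF R PR QR cm(2) N pull_cocycle[OF R QR PR cm(1) N u(1)]] by simp
  then show ?thesis
    unfolding u(2) compare_class[OF T T' \<chi> N x] compare_class[OF T' T \<chi>' N qx] by simp
qed

section \<open>The quotients by the powers of a graded ideal\<close>

lemma regular_simps [simp]: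
  "carrier (regular R) = carrier R" "add (regular R) = add R" "ring.zero (regular R) = ring.zero R"
  "smult (regular R) = mult R" "mgrade (regular R) = rgrade R"
  by (simp_all add: regular_def)

lemma regular_graded_module:
  assumes R: "graded_cring R" shows "graded_module R (regular R)"
proof -
  interpret RR: cring R using R by (rule graded_cringD)
  have ag: "abelian_group (regular R)" using ring_ops_cong(2)[of "regular R" R] graded_cringD(3)[OF R] by simp
  have "module R (regular R)"
    by (rule moduleI) (simp_all add: RR.is_cring ag RR.l_distr RR.r_distr RR.m_assoc)
  moreover have "grading (regular R) (mgrade (regular R))"
    using ring_ops_cong(5)[of "regular R" R "rgrade R"] R by (simp add: graded_cring_def)
  ultimately show ?thesis using graded_cringD(4)[OF R] by (intro graded_moduleI[OF R]) auto
qed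

lemma regular_component: "component (regular R) D = component R D"
  using ring_ops_cong(6)[of "regular R" R] by simp

lemma graded_ideal_component:
  assumes R: "graded_cring R" and a: "graded_ideal a R" and x: "x \<in> a"
  shows "rcomp R g x \<in> a"
proof -
  interpret R: graded_group R "rgrade R" using R by (rule graded_cringD)
  interpret I: ideal a R using a by (simp add: graded_ideal_def)
  let ?A = "R\<lparr>carrier := a\<rparr>"
  have ag: "abelian_group ?A"
  proof (rule abelian_groupI)
    show "\<exists>y\<in>carrier ?A. y \<oplus>\<^bsub>?A\<^esub> x = \<zero>\<^bsub>?A\<^esub>" if "x \<in> carrier ?A" for x
      using that I.a_inv_closed[of x] R.l_neg[of x] I.a_Hcarr[of x] by auto
  qed (use I.a_Hcarr I.a_closed I.zero_closed in \<open>simp_all add: R.a_ac\<close>)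
  have "grading ?A (\<lambda>g. a \<inter> rgrade R g)" using a by (simp add: graded_ideal_def)
  then interpret A: graded_group ?A "\<lambda>g. a \<inter> rgrade R g" using ag by (simp add: graded_group_def graded_group_axioms_def)
  let ?c = "\<lambda>g. component ?A (\<lambda>g. a \<inter> rgrade R g) g x" and ?F = "{g. component ?A (\<lambda>g. a \<inter> rgrade R g) g x \<noteq> \<zero>\<^bsub>?A\<^esub>}"
  have xA: "x \<in> carrier ?A" using x by simp
  have F: "finite ?F" using A.component_finite[OF xA] .
  have cin: "?c g \<in> a \<inter> rgrade R g" for g using A.component_in[OF xA] .
  have "x = finsum ?A ?c ?F" using A.component_sum'[OF xA] .
  also have "\<dots> = finsum R ?c ?F"
    using additive_map_finsum_group[OF ag R.abelian_group_axioms _ F, of "\<lambda>x. x" ?c] I.a_Hcarr cin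
    by (simp add: additive_map_def)
  finally have "rcomp R g x = (if g \<in> ?F then ?c g else \<zero>\<^bsub>R\<^esub>)"
    using F cin by (intro R.component_unique) auto
  then show ?thesis using cin I.zero_closed by auto
qed

text \<open>Products of homogeneous elements generate the product of graded ideals.\<close>

lemma ideal_prod_component:
  assumes R: "graded_cring R" and I: "ideal I R" and J: "ideal J R"
    and Ic: "\<And>x g. x \<in> I \<Longrightarrow> rcomp R g x \<in> I" and Jc: "\<And>x g. x \<in> J \<Longrightarrow> rcomp R g x \<in> J"
    and x: "x \<in> ideal_prod R I J"
  shows "rcomp R g x \<in> ideal_prod R I J"
proof -
  interpret R: graded_group R "rgrade R" using R by (rule graded_cringD)
  interpret RR: cring R using R by (rule graded_cringD)
  interpret K: ideal "ideal_prod R I J" R by (rule RR.ideal_prod_is_ideal[OF I J])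
  interpret I: ideal I R by (rule I)
  interpret J: ideal J R by (rule J)
  have fin: "rcomp R g (finsum R f F) \<in> ideal_prod R I J"
    if "finite F" "\<And>i. i \<in> F \<Longrightarrow> f i \<in> carrier R" "\<And>i. i \<in> F \<Longrightarrow> rcomp R g (f i) \<in> ideal_prod R I J" for f :: "'b \<Rightarrow> 'a" and F g
    using that
  proof (induction F)
    case empty then show ?case using K.zero_closed by simp
  next
    case (insert i F)
    then have "finsum R f F \<in> carrier R" by (auto intro!: R.finsum_closed)
    then show ?case using insert K.a_closed by (simp add: R.component_add Pi_iff)
  qed
  from x show ?thesis
  proof (induction x)
    case (sum s1 s2) then show ?case using K.a_Hcarr K.a_closed by (simp add: R.component_add)
  next
    case (prod i j)
    have ij: "i \<in> carrier R" "j \<in> carrier R" using prod I.a_Hcarr J.a_Hcarr by auto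
    let ?E = "{k. rcomp R k i \<noteq> \<zero>\<^bsub>R\<^esub>}" and ?F = "{k. rcomp R k j \<noteq> \<zero>\<^bsub>R\<^esub>}"
    have hom: "rcomp R g (rcomp R k i \<otimes>\<^bsub>R\<^esub> rcomp R l j) \<in> ideal_prod R I J" for k l
    proof -
      have "rcomp R k i \<otimes>\<^bsub>R\<^esub> rcomp R l j \<in> rgrade R (k + l)"
        using graded_cringD(4)[OF R R.component_in[OF ij(1)] R.component_in[OF ij(2)]] .
      then show ?thesis
        using ideal_prod.prod[of "rcomp R k i" I "rcomp R l j" J R, OF Ic[OF prod(1)] Jc[OF prod(2)]] K.zero_closed by (simp add: R.component_homog)
    qed
    have am: "additive_map R R (\<lambda>x. x \<otimes>\<^bsub>R\<^esub> y)" "additive_map R R (\<lambda>x. y \<otimes>\<^bsub>R\<^esub> x)" if "y \<in> carrier R" for y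
      using that by (simp_all add: additive_map_def RR.l_distr RR.r_distr)
    note RA = R.abelian_group_axioms
    have "i \<otimes>\<^bsub>R\<^esub> j = finsum R (\<lambda>k. rcomp R k i) ?E \<otimes>\<^bsub>R\<^esub> j" using R.component_sum'[OF ij(1)] by simp
    also have "\<dots> = finsum R (\<lambda>k. rcomp R k i \<otimes>\<^bsub>R\<^esub> j) ?E"
      by (rule additive_map_finsum_group[OF RA RA am(1)[OF ij(2)] R.component_finite[OF ij(1)] R.component_closed[OF ij(1)]])
    finally have 1: "i \<otimes>\<^bsub>R\<^esub> j = finsum R (\<lambda>k. rcomp R k i \<otimes>\<^bsub>R\<^esub> j) ?E" .
    have 2: "rcomp R k i \<otimes>\<^bsub>R\<^esub> j = finsum R (\<lambda>l. rcomp R k i \<otimes>\<^bsub>R\<^esub> rcomp R l j) ?F" for k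
    proof -
      have "rcomp R k i \<otimes>\<^bsub>R\<^esub> j = rcomp R k i \<otimes>\<^bsub>R\<^esub> finsum R (\<lambda>l. rcomp R l j) ?F" using R.component_sum'[OF ij(2)] by simp
      also have "\<dots> = finsum R (\<lambda>l. rcomp R k i \<otimes>\<^bsub>R\<^esub> rcomp R l j) ?F"
        by (rule additive_map_finsum_group[OF RA RA am(2)[OF R.component_closed[OF ij(1)]] R.component_finite[OF ij(2)] R.component_closed[OF ij(2)]])
      finally show ?thesis .
    qed
    have "rcomp R g (rcomp R k i \<otimes>\<^bsub>R\<^esub> j) \<in> ideal_prod R I J" for k
      unfolding 2[of k] using ij hom by (intro fin[OF R.component_finite[OF ij(2)]]) simp_all
    then show ?case
      unfolding 1 using ij by (intro fin[OF R.component_finite[OF ij(1)]]) simp_all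
  qed
qed

abbreviation ideal_pow :: "('r, 'g) gring \<Rightarrow> 'r set \<Rightarrow> nat \<Rightarrow> 'r set" where
  "ideal_pow R a n \<equiv> a [^]\<^bsub>ideals_set R\<^esub> n"

lemma ideal_pow_simps: "ideal_pow R a 0 = carrier R" "ideal_pow R a (Suc n) = ideal_prod R (ideal_pow R a n) a"
  by (simp_all add: ideals_set_def nat_pow_def)

lemma
  assumes R: "graded_cring R" and a: "graded_ideal a R"
  shows ideal_pow_ideal: "ideal (ideal_pow R a n) R"
    and ideal_pow_component: "x \<in> ideal_pow R a n \<Longrightarrow> rcomp R g x \<in> ideal_pow R a n"
    and ideal_pow_Suc: "ideal_pow R a (Suc n) \<subseteq> ideal_pow R a n"
proof -
  interpret R: graded_group R "rgrade R" using R by (rule graded_cringD)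
  interpret RR: cring R using R by (rule graded_cringD)
  have aI: "ideal a R" using a by (simp add: graded_ideal_def)
  show 1: "ideal (ideal_pow R a n) R" for n
  proof (induction n)
    case 0 then show ?case unfolding ideal_pow_simps by (rule RR.oneideal)
  next
    case (Suc n) then show ?case unfolding ideal_pow_simps by (rule RR.ideal_prod_is_ideal[OF _ aI])
  qed
  show "x \<in> ideal_pow R a n \<Longrightarrow> rcomp R g x \<in> ideal_pow R a n"
  proof (induction n arbitrary: x g)
    case 0 then show ?case unfolding ideal_pow_simps by simp
  next
    case (Suc n)
    show ?case unfolding ideal_pow_simps
      by (rule ideal_prod_component[OF R 1 aI Suc.IH graded_ideal_component[OF R a] Suc.prems[unfolded ideal_pow_simps]])
  qed
  show "ideal_pow R a (Suc n) \<subseteq> ideal_pow R a n"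
    unfolding ideal_pow_simps using RR.ideal_prod_inter[OF 1 aI] by blast
qed

lemma ideal_pow_submodule:
  assumes R: "graded_cring R" and a: "graded_ideal a R"
  shows "graded_submodule R (regular R) (ideal_pow R a n)"
proof -
  interpret I: ideal "ideal_pow R a n" R by (rule ideal_pow_ideal[OF R a])
  show ?thesis
    unfolding graded_submodule_def regular_component
    using I.a_Hcarr I.zero_closed I.a_closed I.I_l_closed ideal_pow_component[OF R a] by (simp add: subset_iff)
qed

lemma quot_pow_graded_module:
  "graded_cring R \<Longrightarrow> graded_ideal a R \<Longrightarrow> graded_module R (quot_pow R a n)"
  unfolding quot_pow_def by (rule quotmod_graded_module[OF _ regular_graded_module ideal_pow_submodule])

lemma submod_carrier:
  assumes "graded_module R M" shows "submod M (carrier M) = M"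
proof -
  interpret graded_group M "mgrade M" using assms by (rule graded_moduleD)
  have "mgrade M g \<inter> carrier M = mgrade M g" for g using D_carrier by blast
  then show ?thesis by (intro gmod.equality) (simp_all add: submod_def)
qed

lemma carrier_submodule:
  assumes "graded_module R M" shows "graded_submodule R M (carrier M)"
proof -
  interpret graded_group M "mgrade M" using assms by (rule graded_moduleD)
  interpret module R M using assms by (rule graded_moduleD)
  show ?thesis by (simp add: graded_submodule_def)
qed

lemma quot_proj_gr_hom:
  assumes R: "graded_cring R" and a: "graded_ideal a R"
  shows "quot_proj R a n \<in> gr_hom R (quot_pow R a (Suc n)) (quot_pow R a n)"
proof -
  note M = regular_graded_module[OF R]
  note K = ideal_pow_submodule[OF R a]
  note Ks = graded_submoduleD(1)[OF K]
  have "induced (quotmod (submod (regular R) (carrier (regular R))) (ideal_pow R a (Suc n))) (regular R) (ideal_pow R a n) (\<lambda>x. x)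
    \<in> gr_hom R (quotmod (submod (regular R) (carrier (regular R))) (ideal_pow R a (Suc n)))
        (quotmod (submod (regular R) (carrier (regular R))) (ideal_pow R a n))"
    by (rule induced_subquotient(2)[OF R M M carrier_submodule[OF M] K Ks carrier_submodule[OF M] K Ks])
       (use ideal_pow_Suc[OF R a] in auto)
  then show ?thesis unfolding submod_carrier[OF M] quot_proj_def quot_pow_def .
qed

text \<open>Choosing representatives embeds the quotient into \<open>R\<close>, and \<open>R\<close> embeds into the universe.\<close>

lemma quot_pow_embed:
  fixes R :: "('r, 'g::ab_group_add) gring"
  assumes R: "graded_cring R" and U: "universe_for TYPE('u) R"
  shows "\<exists>j :: 'r set \<Rightarrow> 'u. inj_on j (carrier (quot_pow R a n))"
proof -
  obtain j :: "'r \<Rightarrow> 'u" where j: "inj_on j (carrier R)" using universe_infinite(2)[OF R U] by blast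
  let ?q = "\<lambda>x. ideal_pow R a n +>\<^bsub>regular R\<^esub> x"
  have "inj_on (inv_into (carrier R) ?q) (carrier (quot_pow R a n))"
    by (rule inj_on_inv_into) (simp add: quot_pow_def quotmod_carrier)
  moreover have "inv_into (carrier R) ?q ` carrier (quot_pow R a n) \<subseteq> carrier R"
    by (auto simp: quot_pow_def quotmod_carrier intro: inv_into_into)
  ultimately have "inj_on (j \<circ> inv_into (carrier R) ?q) (carrier (quot_pow R a n))"
    using j by (intro comp_inj_on) (auto intro: inj_on_subset)
  then show ?thesis by blast
qed

lemma chain_lift_lifts:
  fixes P :: "('r, 'u, 'g::ab_group_add, 'v) resolution" and P' :: "('r, 'u, 'g, 'w) resolution"
  assumes "\<exists>\<phi>. lifts R P P' f \<phi>"
  shows "lifts R P P' f (chain_lift R M M' P P' f)"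
proof -
  have "chain_lift R M M' P P' f = (SOME \<phi>. lifts R P P' f \<phi>)"
    by (simp add: chain_lift_def lifts_def chain_map_def conj_assoc)
  then show ?thesis using someI_ex[OF assms] by simp
qed

lemma standard_tower:
  fixes R :: "('r, 'g::ab_group_add) gring" and P :: "nat \<Rightarrow> ('r, 'u, 'g, 'r set) resolution"
  assumes R: "graded_cring R" and U: "universe_for TYPE('u) R"
    and X: "\<And>n. graded_module R (quot_pow R a n)"
    and p: "\<And>n. quot_proj R a n \<in> gr_hom R (quot_pow R a (Suc n)) (quot_pow R a n)"
  defines "P \<equiv> \<lambda>n. resolution_of R (quot_pow R a n)"
  shows "tower R (quot_pow R a) (quot_proj R a) P
    (\<lambda>n. chain_lift R (quot_pow R a (Suc n)) (quot_pow R a n) (P (Suc n)) (P n) (quot_proj R a n))"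
proof -
  have P: "projective_resolution R (quot_pow R a n) (P n)" for n
  proof -
    obtain j :: "'r set \<Rightarrow> 'u" where "inj_on j (carrier (quot_pow R a n))" using quot_pow_embed[OF R U] by blast
    from resolution_exists[OF R U X this]
    have "\<exists>P :: ('r, 'u, 'g, 'r set) resolution. projective_resolution R (quot_pow R a n) P" .
    from someI_ex[OF this] show ?thesis unfolding P_def resolution_of_def .
  qed
  then show ?thesis
    using R X chain_lift_lifts[OF lifts_exist[OF R X X P P p]] by (simp add: tower_def)
qed

section \<open>Coarsening subquotients, resolutions and Ext\<close>

lemma coset_coarsen [simp]: "K +>\<^bsub>coarsen \<psi> M\<^esub> x = K +>\<^bsub>M\<^esub> x"
  by (simp add: a_r_coset_def')

lemma coset_regular_coarsen [simp]: "K +>\<^bsub>regular (coarsen_ring \<psi> R)\<^esub> x = K +>\<^bsub>regular R\<^esub> x"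
  by (simp add: a_r_coset_def')

lemma quotmod_coarsen:
  assumes R: "graded_cring R" and M: "graded_module R M" and K: "graded_submodule R M K"
  shows "quotmod (coarsen \<psi> M) K = coarsen \<psi> (quotmod M K)"
proof -
  let ?q = "\<lambda>x. K +>\<^bsub>M\<^esub> x"
  note MA = graded_moduleD(3)[OF M] and Q = quotmod_graded_module[OF R M K]
  note q = quotmod_projection[OF R M K]
  interpret M: graded_group M "mgrade M" using M by (rule graded_moduleD)
  note fs = additive_map_finsum_group[OF MA graded_moduleD(3)[OF Q] linear_mapD(1)[OF gr_homD(2)[OF q]]]
  have qsum: "?q (finsum M c F) = finsum (quotmod M K) (\<lambda>g. ?q (c g)) F"
    if F: "finite F" "\<And>g. g \<in> F \<Longrightarrow> c g \<in> carrier M" for c :: "'b \<Rightarrow> 'c" and F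
  proof -
    have "finsum M c F \<in> carrier M" using F(2) by (intro M.finsum_closed) auto
    then have "?q (finsum M c F) = (\<lambda>x\<in>carrier M. ?q x) (finsum M c F)" by simp
    also have "\<dots> = finsum (quotmod M K) (\<lambda>g. (\<lambda>x\<in>carrier M. ?q x) (c g)) F" by (rule fs[OF F])
    also have "\<dots> = finsum (quotmod M K) (\<lambda>g. ?q (c g)) F"
      using F(2)
      by (intro abelian_monoid.finsum_cong'[OF abelian_group.axioms(1)[OF graded_moduleD(3)[OF Q]]])
        (auto simp: quotmod_carrier)
    finally show ?thesis .
  qed
  have "{?q x | x. x \<in> coarse_grade M \<psi> (mgrade M) h} = coarse_grade (quotmod M K) \<psi> (mgrade (quotmod M K)) h" for h
  proof (intro equalityI subsetI)
    fix X assume "X \<in> {?q x | x. x \<in> coarse_grade M \<psi> (mgrade M) h}"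
    then obtain c F where X: "X = ?q (finsum M c F)" and F: "finite F" "F \<subseteq> \<psi> -` {h}" "\<forall>g\<in>F. c g \<in> mgrade M g"
      by (auto simp: coarse_grade_def)
    have "X = finsum (quotmod M K) (\<lambda>g. ?q (c g)) F" unfolding X by (rule qsum[OF F(1)]) (use F(3) in auto)
    moreover have "\<forall>g\<in>F. ?q (c g) \<in> mgrade (quotmod M K) g" using F(3) by (auto simp: quotmod_def)
    ultimately show "X \<in> coarse_grade (quotmod M K) \<psi> (mgrade (quotmod M K)) h"
      using F unfolding coarse_grade_def by (intro CollectI exI[of _ "\<lambda>g. ?q (c g)"] exI[of _ F]) simp
  next
    fix X assume "X \<in> coarse_grade (quotmod M K) \<psi> (mgrade (quotmod M K)) h"
    then obtain C F where X: "X = finsum (quotmod M K) C F" and F: "finite F" "F \<subseteq> \<psi> -` {h}"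
      and C: "\<And>g. g \<in> F \<Longrightarrow> C g \<in> mgrade (quotmod M K) g" by (auto simp: coarse_grade_def)
    have "\<exists>x. x \<in> mgrade M g \<and> C g = ?q x" if "g \<in> F" for g using C[OF that] by (auto simp: quotmod_def)
    then obtain c where c: "\<And>g. g \<in> F \<Longrightarrow> c g \<in> mgrade M g" "\<And>g. g \<in> F \<Longrightarrow> C g = ?q (c g)" by metis
    have cc: "c g \<in> carrier M" if "g \<in> F" for g using c(1)[OF that] by simp
    have "X = finsum (quotmod M K) (\<lambda>g. ?q (c g)) F"
      unfolding X
      by (rule abelian_monoid.finsum_cong'[OF abelian_group.axioms(1)[OF graded_moduleD(3)[OF Q]] refl _ c(2)])
        (use cc in \<open>auto simp: quotmod_carrier\<close>)
    also have "\<dots> = ?q (finsum M c F)" by (rule qsum[OF F(1) cc, symmetric])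
    finally have "X = ?q (finsum M c F)" .
    moreover have "finsum M c F \<in> coarse_grade M \<psi> (mgrade M) h"
      using F c(1) unfolding coarse_grade_def by (intro CollectI exI[of _ c] exI[of _ F]) simp
    ultimately show "X \<in> {?q x | x. x \<in> coarse_grade M \<psi> (mgrade M) h}" by blast
  qed
  note grades = this
  have mg: "mgrade (quotmod (coarsen \<psi> M) K) h = mgrade (coarsen \<psi> (quotmod M K)) h" for h
    unfolding coarsen_simps grades[of h, symmetric] by (simp add: quotmod_def)
  show ?thesis
  proof (rule gmod.equality)
    show "mgrade (quotmod (coarsen \<psi> M) K) = mgrade (coarsen \<psi> (quotmod M K))" by (rule HOL.ext) (rule mg)
    show "carrier (quotmod (coarsen \<psi> M) K) = carrier (coarsen \<psi> (quotmod M K))" by (simp add: quotmod_carrier)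
    show "add (quotmod (coarsen \<psi> M) K) = add (coarsen \<psi> (quotmod M K))"
      by (intro HOL.ext) (simp add: quotmod_def set_add_def')
  qed (simp_all add: quotmod_def)
qed

lemma submod_coarsen:
  assumes R: "graded_cring R" and M: "graded_module R M" and Z: "graded_submodule R M Z"
  shows "submod (coarsen \<psi> M) Z = coarsen \<psi> (submod M Z)"
proof -
  interpret M: graded_group M "mgrade M" using M by (rule graded_moduleD)
  interpret Z: graded_group "submod M Z" "mgrade (submod M Z)" using submod_graded_module[OF R M Z] by (rule graded_moduleD)
  have "coarse_grade M \<psi> (mgrade M) h \<inter> Z = coarse_grade (submod M Z) \<psi> (mgrade (submod M Z)) h" for h
    unfolding set_eq_iff Int_iff M.coarse_grade_iff Z.coarse_grade_iff
    using graded_submoduleD(6)[OF Z] submod_component[OF R M Z] by auto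
  then have "mgrade (submod (coarsen \<psi> M) Z) = mgrade (coarsen \<psi> (submod M Z))"
    by (intro HOL.ext) simp
  then show ?thesis by (intro gmod.equality) (simp_all, simp_all add: submod_def)
qed

definition coarsen_res :: "('g \<Rightarrow> 'h) \<Rightarrow> ('r, 'u, 'g, 'v) resolution \<Rightarrow> ('r, 'u, 'h, 'v) resolution" where
  "coarsen_res \<psi> P = \<lparr>pr = \<lambda>i. coarsen \<psi> (pr P i), df = df P, aug = aug P\<rparr>"

lemma coarsen_res_simps [simp]:
  "pr (coarsen_res \<psi> P) i = coarsen \<psi> (pr P i)" "df (coarsen_res \<psi> P) = df P" "aug (coarsen_res \<psi> P) = aug P"
  by (simp_all add: coarsen_res_def)

context
  fixes \<psi> :: "'g::ab_group_add \<Rightarrow> 'h::ab_group_add" and R :: "('r, 'g) gring"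
  assumes hom: "\<And>x y. \<psi> (x + y) = \<psi> x + \<psi> y" and R: "graded_cring R"
begin

text \<open>Exactness does not involve the grading, so the point is that the modules stay projective.\<close>

lemma coarsen_resolution:
  fixes P :: "('r, 'u, 'g, 'v) resolution"
  assumes U: "universe_for TYPE('u) R" and M: "graded_module R M" and P: "projective_resolution R M P"
  shows "projective_resolution (coarsen_ring \<psi> R) (coarsen \<psi> M) (coarsen_res \<psi> P)"
  unfolding projective_resolution_def
proof (intro conjI allI impI, goal_cases)
  case (1 i) then show ?case using gr_projective_coarsen[OF hom R U resolutionD(1)[OF P]] by simp
next
  case (2 i) then show ?case using resolutionD(3)[OF P] by simp
next
  case (3 i) then show ?case using coarsen_gr_hom[OF hom R resolutionD(2)[OF P] resolutionD(2)[OF P] resolutionD(4)[OF P]] by simp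
next
  case 4 then show ?case using coarsen_gr_hom[OF hom R resolutionD(2)[OF P] M resolutionD(5)[OF P]] by simp
next
  case 5 then show ?case using resolutionD(6)[OF P] by simp
next
  case 6 then show ?case using resolutionD(7)[OF P] by (simp add: a_kernel_def')
next
  case (7 i) then show ?case using resolutionD(8)[OF P] by (simp add: a_kernel_def')
qed

lemma coarsen_lifts:
  assumes P: "projective_resolution R M P" and P': "projective_resolution R M' P'" and \<phi>: "lifts R P P' f \<phi>"
  shows "lifts (coarsen_ring \<psi> R) (coarsen_res \<psi> P) (coarsen_res \<psi> P') f \<phi>"
  using \<phi> coarsen_gr_hom[OF hom R resolutionD(2)[OF P] resolutionD(2)[OF P']]
  by (simp add: lifts_def chain_map_def)

context
  assumes ker: "finite {g. \<psi> g = 0}"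
begin

lemma cocycles_coarsen:
  assumes P: "projective_resolution R M P" and N: "graded_module R N"
  shows "cocycles (coarsen_ring \<psi> R) (coarsen_res \<psi> P) (coarsen \<psi> N) i = cocycles R P N i"
  using ghom_coarsen_carrier[OF hom R resolutionD(2)[OF P] N ker] by (simp add: cocycles_def)

lemma coboundaries_coarsen:
  assumes P: "projective_resolution R M P" and N: "graded_module R N"
  shows "coboundaries (coarsen_ring \<psi> R) (coarsen_res \<psi> P) (coarsen \<psi> N) i = coboundaries R P N i"
  using ghom_coarsen_carrier[OF hom R resolutionD(2)[OF P] N ker] by (simp add: coboundaries_def)

lemma coset_ghom_coarsen:
  "K +>\<^bsub>ghom (coarsen_ring \<psi> R) (coarsen \<psi> M) (coarsen \<psi> N)\<^esub> u = K +>\<^bsub>ghom R M N\<^esub> u"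
  by (simp add: a_r_coset_def' ghom_def)

text \<open>The cocycles and coboundaries are the same sets before and after coarsening, because the graded Hom
  modules are. So this is the compatibility of coarsening with subquotients.\<close>

lemma ext_coarsen:
  assumes P: "projective_resolution R M P" and N: "graded_module R N"
  shows "ext_of (coarsen_ring \<psi> R) (coarsen_res \<psi> P) i (coarsen \<psi> N) = coarsen \<psi> (ext_of R P i N)"
proof -
  note G = ghom_graded_module[OF R resolutionD(2)[OF P, of i] N]
  note Z = cocycles_submodule[OF R P N, of i]
  note GZ = submod_graded_module[OF R G Z]
    and BZ = graded_submodule_within[OF R G Z coboundaries_submodule[OF R P N] coboundaries_cocycles[OF R P N]]
  have "ext_of (coarsen_ring \<psi> R) (coarsen_res \<psi> P) i (coarsen \<psi> N) =
      quotmod (submod (coarsen \<psi> (ghom R (pr P i) N)) (cocycles R P N i)) (coboundaries R P N i)"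
    by (simp add: ext_of_def cocycles_coarsen[OF P N] coboundaries_coarsen[OF P N] ghom_coarsen[OF hom R resolutionD(2)[OF P] N ker])
  then show ?thesis
    by (simp add: submod_coarsen[OF R G Z] quotmod_coarsen[OF R GZ BZ] ext_of_def)
qed

lemma pull_coarsen:
  assumes P: "projective_resolution R M P" and P': "projective_resolution R M' P'" and N: "graded_module R N"
  shows "pull (coarsen_ring \<psi> R) (coarsen_res \<psi> P) (coarsen_res \<psi> P') i (coarsen \<psi> N) \<phi> = pull R P P' i N \<phi>"
  by (simp add: pull_def induced_def ext_coarsen[OF P' N] coboundaries_coarsen[OF P N] coset_ghom_coarsen)

lemma push_coarsen:
  assumes P: "projective_resolution R M P" and N: "graded_module R N" and N': "graded_module R N'"
  shows "push (coarsen_ring \<psi> R) (coarsen_res \<psi> P) i (coarsen \<psi> N) (coarsen \<psi> N') f = push R P i N N' f"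
  by (simp add: push_def induced_def ext_coarsen[OF P N] coboundaries_coarsen[OF P N'] coset_ghom_coarsen)

lemma connect_coarsen:
  assumes P: "projective_resolution R M P" and A: "graded_module R A" and B: "graded_module R B" and C: "graded_module R C"
  shows "connect (coarsen_ring \<psi> R) (coarsen_res \<psi> P) i (coarsen \<psi> A) \<alpha> (coarsen \<psi> B) \<beta> (coarsen \<psi> C) = connect R P i A \<alpha> B \<beta> C"
  using ghom_coarsen_carrier[OF hom R resolutionD(2)[OF P] A ker] ghom_coarsen_carrier[OF hom R resolutionD(2)[OF P] B ker]
  by (simp add: connect_def ext_coarsen[OF P C] coboundaries_coarsen[OF P A] coset_ghom_coarsen)

end

end

lemma dl_class_coarsen: "dl_class (\<lambda>n. coarsen \<psi> (A n)) t = dl_class A t"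
  by (intro HOL.ext) (simp add: dl_class_def)

lemma dl_map_coarsen: "dl_map (\<lambda>n. coarsen \<psi> (A n)) t (\<lambda>n. coarsen \<psi> (B n)) s \<phi> = dl_map A t B s \<phi>"
  by (simp add: dl_map_def dirlim_def dl_class_coarsen)

section \<open>Existence of the canonical morphism\<close>

abbreviation std_res :: "('r, 'g::ab_group_add) gring \<Rightarrow> 'r set \<Rightarrow> nat \<Rightarrow> ('r, 'u, 'g, 'r set) resolution" where
  "std_res R a n \<equiv> resolution_of R (quot_pow R a n)"

abbreviation std_lift :: "('r, 'g::ab_group_add) gring \<Rightarrow> 'r set \<Rightarrow> ('r, 'u, 'g, 'r set) resolution itself \<Rightarrow> nat \<Rightarrow> int \<Rightarrow> 'u \<Rightarrow> 'u" where
  "std_lift R a T n \<equiv> chain_lift R (quot_pow R a (Suc n)) (quot_pow R a n)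
     (std_res R a (Suc n) :: ('r, 'u, 'g, 'r set) resolution) (std_res R a n) (quot_proj R a n)"

lemma local_cohomology_std:
  "(local_cohomology R a :: ('r, 'u, 'g::ab_group_add, (nat \<times> ('u \<Rightarrow> 'u) set) set, 'g) delta) =
    lc_delta R (std_res R a) (std_lift R a TYPE(('r, 'u, 'g, 'r set) resolution))"
  by (rule local_cohomology_lc_delta)

lemma lc_system_std:
  "lc_system R a i M = (\<lambda>n. ext_of R (std_res R a n) i M)"
  "lc_trans R a i (M :: ('r, 'u, 'g::ab_group_add) gmod) =
    (\<lambda>n. pull R (std_res R a (Suc n)) (std_res R a n) i M (std_lift R a TYPE(('r, 'u, 'g, 'r set) resolution) n))"
  by (intro HOL.ext, simp add: lc_system_def ext_def)
     (intro HOL.ext, simp add: lc_trans_def ext_map1_def Let_def pull_def ext_def)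

text \<open>Used for \<open>R\<close> and for the coarsened ring. What is assumed of the quotients holds for every graded ideal;
  over the coarsened ring it follows from the fact that these quotients are the coarsened ones.\<close>

locale lc_setup =
  fixes R :: "('r, 'g::ab_group_add) gring" and a :: "'r set" and u_type :: "'u itself"
  assumes R: "graded_cring R" and U: "universe_for TYPE('u) R"
    and X: "graded_module R (quot_pow R a n)"
    and p: "quot_proj R a n \<in> gr_hom R (quot_pow R a (Suc n)) (quot_pow R a n)"
begin

abbreviation Pn :: "nat \<Rightarrow> ('r, 'u, 'g, 'r set) resolution" where "Pn \<equiv> std_res R a"
abbreviation tn :: "nat \<Rightarrow> int \<Rightarrow> 'u \<Rightarrow> 'u" where "tn \<equiv> std_lift R a TYPE(('r, 'u, 'g, 'r set) resolution)"

lemma tower: "tower R (quot_pow R a) (quot_proj R a) Pn tn"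
  by (rule standard_tower[OF R U X p])

lemma torsion_direct_system:
  assumes M: "graded_module R M"
  shows "direct_system R (torsion_system R a M) (torsion_trans R a)"
proof
  fix n g x
  show "graded_module R (torsion_system R a M n)"
    unfolding torsion_system_def by (rule ghom_graded_module[OF R X M])
  note h = precompose_gr_hom[OF R X X M p, of n]
  let ?h = "\<lambda>u\<in>carrier (ghom R (quot_pow R a n) M). compose (carrier (quot_pow R a (Suc n))) u (quot_proj R a n)"
  have G: "graded_module R (ghom R (quot_pow R a n) M)" by (rule ghom_graded_module[OF R X M])
  show "linear_map R (torsion_system R a M n) (torsion_system R a M (Suc n)) (torsion_trans R a n)"
    unfolding torsion_system_def
    by (rule linear_map_cong[OF gr_homD(2)[OF h] graded_moduleD(3)[OF G] graded_moduleD(1)[OF G]]) (simp add: torsion_trans_def)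
  assume "x \<in> mgrade (torsion_system R a M n) g"
  then have x: "x \<in> mgrade (ghom R (quot_pow R a n) M) g" by (simp add: torsion_system_def)
  have "x \<in> carrier (ghom R (quot_pow R a n) M)" using graded_group.D_carrier[OF graded_moduleD(2)[OF G] x] .
  then show "torsion_trans R a n x \<in> mgrade (torsion_system R a M (Suc n)) g"
    using gr_homD(3)[OF h x] by (simp add: torsion_system_def torsion_trans_def)
qed

lemma aug_cocycle:
  fixes M :: "('r, 'u, 'g) gmod"
  assumes M: "graded_module R M" and u: "u \<in> carrier (ghom R (quot_pow R a n) M)"
  shows "compose (carrier (pr (Pn n) 0)) u (aug (Pn n)) \<in> cocycles R (Pn n) M 0"
proof -
  note P = towerD(3)[OF tower, of n]
  have "u (aug (Pn n) (df (Pn n) 1 x)) = \<zero>\<^bsub>M\<^esub>" if x: "x \<in> carrier (pr (Pn n) 1)" for x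
  proof -
    have "df (Pn n) 1 x \<in> a_kernel (pr (Pn n) 0) (quot_pow R a n) (aug (Pn n))" using resolutionD(7)[OF P] x by blast
    then show ?thesis using linear_map_zero[OF X M ghomD(2)[OF R X M u]] by (simp add: a_kernel_def')
  qed
  moreover have "df (Pn n) 1 x \<in> carrier (pr (Pn n) 0)" if "x \<in> carrier (pr (Pn n) 1)" for x
    using gr_homD(4)[OF resolution_df[OF P, of 0]] that by simp
  ultimately show ?thesis
    using ghom_compose_right[OF R resolutionD(2)[OF P] X M resolutionD(5)[OF P] u] by (simp add: cocycles_def compose_def)
qed

lemma torsion_iso_class:
  fixes M :: "('r, 'u, 'g) gmod"
  assumes M: "graded_module R M" and u: "u \<in> carrier (ghom R (quot_pow R a n) M)"
  shows "torsion_iso R a M (dl_class (torsion_system R a M) (torsion_trans R a) n u) =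
    dl_class (\<lambda>n. ext_of R (Pn n) 0 M) (\<lambda>n. pull R (Pn (Suc n)) (Pn n) 0 M (tn n)) n
      (ext_class R (Pn n) M 0 (compose (carrier (pr (Pn n) 0)) u (aug (Pn n))))"
proof -
  let ?\<phi> = "\<lambda>n u. ext_class R (Pn n) M 0 (compose (carrier (pr (Pn n) 0)) u (aug (Pn n)))"
  note PR = towerD(3)[OF tower]
  have "dl_map (torsion_system R a M) (torsion_trans R a) (\<lambda>n. ext_of R (Pn n) 0 M)
      (\<lambda>n. pull R (Pn (Suc n)) (Pn n) 0 M (tn n)) ?\<phi> (dl_class (torsion_system R a M) (torsion_trans R a) n u) =
    dl_class (\<lambda>n. ext_of R (Pn n) 0 M) (\<lambda>n. pull R (Pn (Suc n)) (Pn n) 0 M (tn n)) n (?\<phi> n u)"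
  proof (rule dl_map_class[OF torsion_direct_system[OF M] lsystem[OF tower M]])
    fix n x assume "x \<in> carrier (torsion_system R a M n)"
    then have x: "x \<in> carrier (ghom R (quot_pow R a n) M)" by (simp add: torsion_system_def)
    note c = aug_cocycle[OF M x]
    show "?\<phi> n x \<in> carrier (ext_of R (Pn n) 0 M)" by (rule ext_class_carrier[OF tower c])
    have "compose (carrier (pr (Pn (Suc n)) 0)) (compose (carrier (pr (Pn n) 0)) x (aug (Pn n))) (tn n 0) =
        compose (carrier (pr (Pn (Suc n)) 0)) (torsion_trans R a n x) (aug (Pn (Suc n)))"
      using towerD(4)[OF tower, of n] gr_homD(4)[OF chain_mapD(1)[OF towerD(5)[OF tower]]] gr_homD(4)[OF resolutionD(5)[OF PR]]
      by (simp add: compose_def restrict_def fun_eq_iff torsion_trans_def lifts_def)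
    then show "pull R (Pn (Suc n)) (Pn n) 0 M (tn n) (?\<phi> n x) = ?\<phi> (Suc n) (torsion_trans R a n x)"
      using pull_class[OF R PR PR towerD(5)[OF tower] M c] by simp
  next
    show "u \<in> carrier (torsion_system R a M n)" using u by (simp add: torsion_system_def)
  qed
  then show ?thesis by (simp add: torsion_iso_def lc_system_std Let_def)
qed

text \<open>Left exactness of Hom: a cocycle of degree 0 vanishes on the image of \<open>P 1\<close>, the kernel of the
  augmentation, so it factors through the augmentation.\<close>

lemma torsion_iso_surj:
  fixes M :: "('r, 'u, 'g) gmod"
  assumes M: "graded_module R M" and z: "z \<in> carrier (obj (lc_delta R Pn tn) 0 M)"
  shows "\<exists>y\<in>carrier (torsion R a M). z = torsion_iso R a M y"
proof -
  obtain n u where u: "u \<in> cocycles R (Pn n) M 0"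
    "z = dl_class (\<lambda>n. ext_of R (Pn n) 0 M) (\<lambda>n. pull R (Pn (Suc n)) (Pn n) 0 M (tn n)) n (ext_class R (Pn n) M 0 u)"
    by (rule lc_obj_cases[OF tower M z])
  note P = towerD(3)[OF tower, of n]
  have k: "u x = \<zero>\<^bsub>M\<^esub>" if x: "x \<in> carrier (pr (Pn n) 0)" "aug (Pn n) x = \<zero>\<^bsub>quot_pow R a n\<^esub>" for x
  proof -
    have "x \<in> df (Pn n) 1 ` carrier (pr (Pn n) 1)" unfolding resolutionD(7)[OF P] using x by (simp add: a_kernel_def')
    then show ?thesis using cocyclesD(5)[OF R P M u(1)] by auto
  qed
  obtain v where v: "v \<in> carrier (ghom R (quot_pow R a n) M)" "\<And>x. x \<in> carrier (pr (Pn n) 0) \<Longrightarrow> v (aug (Pn n) x) = u x"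
    using ghom_factor_surj[OF R resolutionD(2)[OF P] X M resolutionD(5,6)[OF P] cocyclesD(1)[OF R P M u(1)] k] by blast
  have "compose (carrier (pr (Pn n) 0)) v (aug (Pn n)) = u"
    using v(2) cocyclesD(2)[OF R P M u(1)] by (auto simp: compose_def restrict_def extensional_def fun_eq_iff)
  then have "z = torsion_iso R a M (dl_class (torsion_system R a M) (torsion_trans R a) n v)"
    unfolding u(2) torsion_iso_class[OF M v(1)] by simp
  moreover have "dl_class (torsion_system R a M) (torsion_trans R a) n v \<in> carrier (torsion R a M)"
    unfolding torsion_def using direct_system.dl_class_carrier[OF torsion_direct_system[OF M], of v n] v(1)
    by (simp add: torsion_system_def)
  ultimately show ?thesis by blast
qed

end

lemma ideal_prod_coarsen: "ideal_prod (coarsen_ring \<psi> R) I J = ideal_prod R I J"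
proof (intro equalityI subsetI)
  fix x assume "x \<in> ideal_prod (coarsen_ring \<psi> R) I J"
  then show "x \<in> ideal_prod R I J"
  proof (induction x)
    case (prod i j) then show ?case using ideal_prod.prod[of i I j J R] by simp
  next
    case (sum s t) then show ?case using ideal_prod.sum[of s R I J t] by simp
  qed
next
  fix x assume "x \<in> ideal_prod R I J"
  then show "x \<in> ideal_prod (coarsen_ring \<psi> R) I J"
  proof (induction x)
    case (prod i j) then show ?case using ideal_prod.prod[of i I j J "coarsen_ring \<psi> R"] by simp
  next
    case (sum s t) then show ?case using ideal_prod.sum[of s "coarsen_ring \<psi> R" I J t] by simp
  qed
qed

lemma ideal_pow_coarsen: "ideal_pow (coarsen_ring \<psi> R) a n = ideal_pow R a n"
  by (induction n) (simp_all add: ideal_pow_simps ideal_prod_coarsen del: nat_pow_0 nat_pow_Suc)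

lemma regular_coarsen: "regular (coarsen_ring \<psi> R) = coarsen \<psi> (regular R)"
proof (rule gmod.equality)
  show "mgrade (regular (coarsen_ring \<psi> R)) = mgrade (coarsen \<psi> (regular R))"
    by (rule HOL.ext) (simp add: coarse_grade_cong[of R "regular R"])
qed (simp_all, simp_all add: regular_def)

lemma quot_pow_coarsen:
  assumes R: "graded_cring R" and a: "graded_ideal a R"
  shows "quot_pow (coarsen_ring \<psi> R) a n = coarsen \<psi> (quot_pow R a n)"
  unfolding quot_pow_def ideal_pow_coarsen regular_coarsen
  by (rule quotmod_coarsen[OF R regular_graded_module[OF R] ideal_pow_submodule[OF R a]])

lemma quot_proj_coarsen:
  assumes R: "graded_cring R" and a: "graded_ideal a R"
  shows "quot_proj (coarsen_ring \<psi> R) a n = quot_proj R a n"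
  by (simp add: quot_proj_def induced_def quot_pow_coarsen[OF R a] ideal_pow_coarsen)

locale coarse_setup =
  fixes \<psi> :: "'g::ab_group_add \<Rightarrow> 'h::ab_group_add" and R :: "('r, 'g) gring" and a :: "'r set" and u_type :: "'u itself"
  assumes hom: "\<psi> (x + y) = \<psi> x + \<psi> y" and gr: "graded_cring R" and id: "graded_ideal a R"
    and ker: "finite {g. \<psi> g = 0}" and univ: "universe_for TYPE('u) R"
begin

abbreviation S where "S \<equiv> coarsen_ring \<psi> R"

sublocale G: lc_setup R a u_type
  by unfold_locales (rule gr univ quot_pow_graded_module[OF gr id] quot_proj_gr_hom[OF gr id])+

lemma S: "graded_cring S"
  by (rule coarsen_ring_graded[OF hom gr])

lemma cmod: "graded_module R M \<Longrightarrow> graded_module S (coarsen \<psi> M)"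
  by (rule coarsen_graded_module[OF hom gr])

lemma chom: "graded_module R M \<Longrightarrow> graded_module R N \<Longrightarrow> f \<in> gr_hom R M N \<Longrightarrow> f \<in> gr_hom S (coarsen \<psi> M) (coarsen \<psi> N)"
  by (rule coarsen_gr_hom[OF hom gr])

sublocale H: lc_setup S a u_type
proof
  show "graded_cring S" by (rule S)
  show "universe_for TYPE('u) S" using univ by (simp add: universe_for_def)
  show "graded_module S (quot_pow S a n)" for n unfolding quot_pow_coarsen[OF gr id] by (rule cmod[OF G.X])
  show "quot_proj S a n \<in> gr_hom S (quot_pow S a (Suc n)) (quot_pow S a n)" for n
    unfolding quot_pow_coarsen[OF gr id] quot_proj_coarsen[OF gr id] by (rule chom[OF G.X G.X G.p])
qed

abbreviation cP :: "nat \<Rightarrow> ('r, 'u, 'h, 'r set) resolution" where "cP n \<equiv> coarsen_res \<psi> (G.Pn n)"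

text \<open>The coarsened resolutions serve over the coarsened ring, with the same lifts as transition maps.\<close>

lemma coarse_tower: "tower S (quot_pow S a) (quot_proj S a) cP G.tn"
proof -
  note T = towerD[OF G.tower]
  have "projective_resolution S (quot_pow S a n) (cP n)" for n
    unfolding quot_pow_coarsen[OF gr id] by (rule coarsen_resolution[OF hom gr univ T(2,3)])
  moreover have "lifts S (cP (Suc n)) (cP n) (quot_proj S a n) (G.tn n)" for n
    unfolding quot_proj_coarsen[OF gr id] by (rule coarsen_lifts[OF hom gr T(3) T(3) T(4)])
  ultimately show ?thesis using S H.X by (simp add: tower_def)
qed

abbreviation csys where "csys i M \<equiv> \<lambda>n. ext_of S (cP n) i (coarsen \<psi> M)"
abbreviation ctrans where "ctrans i M \<equiv> \<lambda>n. pull S (cP (Suc n)) (cP n) i (coarsen \<psi> M) (G.tn n)"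

lemma csys: "graded_module R M \<Longrightarrow> csys i M = (\<lambda>n. coarsen \<psi> (ext_of R (G.Pn n) i M))"
  by (simp add: ext_coarsen[OF hom gr ker towerD(3)[OF G.tower]])

lemma ctrans: "graded_module R M \<Longrightarrow> ctrans i M = (\<lambda>n. pull R (G.Pn (Suc n)) (G.Pn n) i M (G.tn n))"
  by (simp add: pull_coarsen[OF hom gr ker towerD(3)[OF G.tower] towerD(3)[OF G.tower]])

text \<open>Coarsening commutes with Ext and with direct limits, so the coarsened local cohomology is a limit of Ext
  over \<open>S\<close>, with the coarsened resolutions in place of the chosen ones.\<close>

lemma source_obj:
  fixes M :: "('r, 'u, 'g) gmod"
  assumes M: "graded_module R M"
  shows "obj (lc_source \<psi> R a) i M = obj (lc_delta S cP G.tn) i (coarsen \<psi> M)"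
  unfolding lc_obj[OF coarse_tower] csys[OF M] ctrans[OF M]
  using direct_system.dirlim_coarsen[OF lsystem[OF G.tower M], of \<psi> i]
  by (simp add: lc_source_def coarsen_after_def local_cohomology_std lc_obj[OF G.tower])

lemma source_mor:
  fixes M N :: "('r, 'u, 'g) gmod"
  assumes M: "graded_module R M" and N: "graded_module R N"
  shows "mor (lc_source \<psi> R a) i M N f = mor (lc_delta S cP G.tn) i (coarsen \<psi> M) (coarsen \<psi> N) f"
proof -
  have "mor (lc_delta S cP G.tn) i (coarsen \<psi> M) (coarsen \<psi> N) f =
      dl_map (csys i M) (ctrans i M) (csys i N) (ctrans i N) (\<lambda>n. push S (cP n) i (coarsen \<psi> M) (coarsen \<psi> N) f)"
    by (simp add: lc_delta_def)
  also have "\<dots> = mor (lc_delta R G.Pn G.tn) i M N f"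
    unfolding csys[OF M] csys[OF N] ctrans[OF M] ctrans[OF N] dl_map_coarsen
      push_coarsen[OF hom gr ker towerD(3)[OF G.tower] M N] by (simp add: lc_delta_def)
  finally show ?thesis by (simp add: lc_source_def coarsen_after_def local_cohomology_std)
qed

lemma source_conn:
  fixes A B C :: "('r, 'u, 'g) gmod"
  assumes A: "graded_module R A" and B: "graded_module R B" and C: "graded_module R C"
  shows "conn (lc_source \<psi> R a) i A \<alpha> B \<beta> C = conn (lc_delta S cP G.tn) i (coarsen \<psi> A) \<alpha> (coarsen \<psi> B) \<beta> (coarsen \<psi> C)"
proof -
  have "conn (lc_delta S cP G.tn) i (coarsen \<psi> A) \<alpha> (coarsen \<psi> B) \<beta> (coarsen \<psi> C) =
      dl_map (csys i C) (ctrans i C) (csys (i + 1) A) (ctrans (i + 1) A)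
        (\<lambda>n. connect S (cP n) i (coarsen \<psi> A) \<alpha> (coarsen \<psi> B) \<beta> (coarsen \<psi> C))"
    by (simp add: lc_delta_def)
  also have "\<dots> = conn (lc_delta R G.Pn G.tn) i A \<alpha> B \<beta> C"
    unfolding csys[OF A] csys[OF C] ctrans[OF A] ctrans[OF C] dl_map_coarsen
      connect_coarsen[OF hom gr ker towerD(3)[OF G.tower] A B C] by (simp add: lc_delta_def)
  finally show ?thesis by (simp add: lc_source_def coarsen_after_def local_cohomology_std)
qed

lemma target:
  fixes M N A B C :: "('r, 'u, 'g) gmod"
  shows "obj (lc_target \<psi> R a) i M = obj (lc_delta S H.Pn H.tn) i (coarsen \<psi> M)"
    "mor (lc_target \<psi> R a) i M N f = mor (lc_delta S H.Pn H.tn) i (coarsen \<psi> M) (coarsen \<psi> N) f"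
    "conn (lc_target \<psi> R a) i A \<alpha> B \<beta> C = conn (lc_delta S H.Pn H.tn) i (coarsen \<psi> A) \<alpha> (coarsen \<psi> B) \<beta> (coarsen \<psi> C)"
  by (simp_all add: lc_target_def coarsen_before_def local_cohomology_std)

lemma short_exact_coarsen:
  fixes A B C :: "('r, 'u, 'g) gmod"
  assumes "short_exact R A \<alpha> B \<beta> C" shows "short_exact S (coarsen \<psi> A) \<alpha> (coarsen \<psi> B) \<beta> (coarsen \<psi> C)"
  using assms by (simp add: short_exact_def a_kernel_def' cmod chom)

definition to_coarse :: "nat \<Rightarrow> int \<Rightarrow> 'u \<Rightarrow> 'u" where
  "to_coarse n = (SOME \<phi>. lifts S (H.Pn n) (cP n) (\<lambda>x. x) \<phi>)"

definition from_coarse :: "nat \<Rightarrow> int \<Rightarrow> 'u \<Rightarrow> 'u" where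
  "from_coarse n = (SOME \<phi>. lifts S (cP n) (H.Pn n) (\<lambda>x. x) \<phi>)"

lemma lifts_identity_exist:
  fixes P Q :: "('r, 'u, 'h, 'r set) resolution"
  assumes X: "graded_module S X" and P: "projective_resolution S X P" and Q: "projective_resolution S X Q"
  shows "\<exists>\<phi>. lifts S P Q (\<lambda>x. x) \<phi>"
proof -
  obtain \<phi> where "lifts S P Q (\<lambda>x\<in>carrier X. x) \<phi>" using lifts_exist[OF S X X P Q gr_hom_id[OF X]] by blast
  then have "lifts S P Q (\<lambda>x. x) \<phi>" using gr_homD(4)[OF resolutionD(5)[OF P]] by (simp add: lifts_def)
  then show ?thesis by blast
qed

lemma to_coarse: "lifts S (H.Pn n) (cP n) (\<lambda>x. x) (to_coarse n)"
  unfolding to_coarse_def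
  by (rule someI_ex[OF lifts_identity_exist[OF H.X towerD(3)[OF H.tower] towerD(3)[OF coarse_tower]]])

lemma from_coarse: "lifts S (cP n) (H.Pn n) (\<lambda>x. x) (from_coarse n)"
  unfolding from_coarse_def
  by (rule someI_ex[OF lifts_identity_exist[OF H.X towerD(3)[OF coarse_tower] towerD(3)[OF H.tower]]])

text \<open>The comparison of the two families of resolutions. Outside the graded modules the value
  is the default one that \<open>delta_morphism\<close> prescribes.\<close>

definition eta :: "int \<Rightarrow> ('r, 'u, 'g) gmod \<Rightarrow> (nat \<times> ('u \<Rightarrow> 'u) set) set \<Rightarrow> (nat \<times> ('u \<Rightarrow> 'u) set) set" where
  "eta i M = (if graded_module R M then compare S cP G.tn H.Pn H.tn to_coarse i (coarsen \<psi> M) else undefined)"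

definition theta :: "int \<Rightarrow> ('r, 'u, 'g) gmod \<Rightarrow> (nat \<times> ('u \<Rightarrow> 'u) set) set \<Rightarrow> (nat \<times> ('u \<Rightarrow> 'u) set) set" where
  "theta i M = (if graded_module R M then compare S H.Pn H.tn cP G.tn from_coarse i (coarsen \<psi> M) else undefined)"

lemma eta_delta_morphism: "delta_morphism R S (lc_source \<psi> R a) (lc_target \<psi> R a) eta"
  unfolding delta_morphism_def
proof (intro conjI allI impI ballI; (elim conjE)?)
  fix i and M :: "('r, 'u, 'g) gmod" assume M: "graded_module R M"
  show "eta i M \<in> gr_hom S (obj (lc_source \<psi> R a) i M) (obj (lc_target \<psi> R a) i M)"
    using compare_gr_hom[OF coarse_tower H.tower to_coarse cmod[OF M]] M by (simp add: eta_def source_obj target)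
next
  fix i f x and M N :: "('r, 'u, 'g) gmod" assume M: "graded_module R M" and N: "graded_module R N" and f: "f \<in> gr_hom R M N"
    and x: "x \<in> carrier (obj (lc_source \<psi> R a) i M)"
  show "eta i N (mor (lc_source \<psi> R a) i M N f x) = mor (lc_target \<psi> R a) i M N f (eta i M x)"
    using compare_mor[OF coarse_tower H.tower to_coarse cmod[OF M] cmod[OF N] chom[OF M N f]] M N x
    by (simp add: eta_def source_obj source_mor target)
next
  fix i \<alpha> \<beta> x and A B C :: "('r, 'u, 'g) gmod" assume ex: "short_exact R A \<alpha> B \<beta> C"
    and x: "x \<in> carrier (obj (lc_source \<psi> R a) i C)"
  have ABC: "graded_module R A" "graded_module R B" "graded_module R C" using ex by (auto simp: short_exact_def)
  show "eta (i + 1) A (conn (lc_source \<psi> R a) i A \<alpha> B \<beta> C x) = conn (lc_target \<psi> R a) i A \<alpha> B \<beta> C (eta i C x)"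
    using compare_conn[OF coarse_tower H.tower to_coarse short_exact_coarsen[OF ex]] ABC x
    by (simp add: eta_def source_obj source_conn target)
next
  fix i and M :: "('r, 'u, 'g) gmod" assume "\<not> graded_module R M" then show "eta i M = undefined" by (simp add: eta_def)
qed

lemma theta_delta_morphism: "delta_morphism R S (lc_target \<psi> R a) (lc_source \<psi> R a) theta"
  unfolding delta_morphism_def
proof (intro conjI allI impI ballI; (elim conjE)?)
  fix i and M :: "('r, 'u, 'g) gmod" assume M: "graded_module R M"
  show "theta i M \<in> gr_hom S (obj (lc_target \<psi> R a) i M) (obj (lc_source \<psi> R a) i M)"
    using compare_gr_hom[OF H.tower coarse_tower from_coarse cmod[OF M]] M by (simp add: theta_def source_obj target)
next
  fix i f x and M N :: "('r, 'u, 'g) gmod" assume M: "graded_module R M" and N: "graded_module R N" and f: "f \<in> gr_hom R M N"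
    and x: "x \<in> carrier (obj (lc_target \<psi> R a) i M)"
  show "theta i N (mor (lc_target \<psi> R a) i M N f x) = mor (lc_source \<psi> R a) i M N f (theta i M x)"
    using compare_mor[OF H.tower coarse_tower from_coarse cmod[OF M] cmod[OF N] chom[OF M N f]] M N x
    by (simp add: theta_def source_mor target)
next
  fix i \<alpha> \<beta> x and A B C :: "('r, 'u, 'g) gmod" assume ex: "short_exact R A \<alpha> B \<beta> C"
    and x: "x \<in> carrier (obj (lc_target \<psi> R a) i C)"
  have ABC: "graded_module R A" "graded_module R B" "graded_module R C" using ex by (auto simp: short_exact_def)
  show "theta (i + 1) A (conn (lc_target \<psi> R a) i A \<alpha> B \<beta> C x) = conn (lc_source \<psi> R a) i A \<alpha> B \<beta> C (theta i C x)"
    using compare_conn[OF H.tower coarse_tower from_coarse short_exact_coarsen[OF ex]] ABC x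
    by (simp add: theta_def source_conn target)
next
  fix i and M :: "('r, 'u, 'g) gmod" assume "\<not> graded_module R M" then show "theta i M = undefined" by (simp add: theta_def)
qed

lemma eta_delta_isomorphism: "delta_isomorphism R S (lc_source \<psi> R a) (lc_target \<psi> R a) eta"
  unfolding delta_isomorphism_def
proof (intro conjI exI[of _ theta] allI impI ballI eta_delta_morphism theta_delta_morphism)
  fix i x and M :: "('r, 'u, 'g) gmod" assume M: "graded_module R M"
  show "theta i M (eta i M x) = x" if "x \<in> carrier (obj (lc_source \<psi> R a) i M)"
    using compare_inverse[OF coarse_tower H.tower to_coarse from_coarse cmod[OF M]] that M
    by (simp add: eta_def theta_def source_obj)
  show "eta i M (theta i M x) = x" if "x \<in> carrier (obj (lc_target \<psi> R a) i M)"
    using compare_inverse[OF H.tower coarse_tower from_coarse to_coarse cmod[OF M]] that M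
    by (simp add: eta_def theta_def target)
qed

lemma torsion_system_coarsen:
  assumes M: "graded_module R M"
  shows "torsion_system S a (coarsen \<psi> M) = (\<lambda>n. coarsen \<psi> (torsion_system R a M n))"
  by (intro HOL.ext) (simp add: torsion_system_def quot_pow_coarsen[OF gr id] ghom_coarsen[OF hom gr G.X M ker])

lemma torsion_trans_coarsen: "torsion_trans S a = torsion_trans R a"
  by (intro HOL.ext) (simp add: torsion_trans_def quot_pow_coarsen[OF gr id] quot_proj_coarsen[OF gr id])

lemma torsion_coarsen_class:
  assumes M: "graded_module R M" and u: "u \<in> carrier (ghom R (quot_pow R a n) M)"
  shows "torsion_coarsen \<psi> R a M (dl_class (torsion_system R a M) (torsion_trans R a) n u) =
    dl_class (torsion_system S a (coarsen \<psi> M)) (torsion_trans S a) n u"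
proof -
  note D = G.torsion_direct_system[OF M]
  have "dl_map (torsion_system R a M) (torsion_trans R a) (torsion_system R a M) (torsion_trans R a)
      (\<lambda>n. hom_coarsen R (quot_pow R a n) M) (dl_class (torsion_system R a M) (torsion_trans R a) n u) =
    dl_class (torsion_system R a M) (torsion_trans R a) n (hom_coarsen R (quot_pow R a n) M u)"
  proof (rule dl_map_class[OF D D])
    fix n x assume x: "x \<in> carrier (torsion_system R a M n)"
    then show "hom_coarsen R (quot_pow R a n) M x \<in> carrier (torsion_system R a M n)"
      by (simp add: hom_coarsen_def torsion_system_def)
    have "torsion_trans R a n x \<in> carrier (torsion_system R a M (Suc n))"
      using linear_mapD(2)[OF direct_system.t[OF D] x] .
    then show "torsion_trans R a n (hom_coarsen R (quot_pow R a n) M x) = hom_coarsen R (quot_pow R a (Suc n)) M (torsion_trans R a n x)"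
      using x by (simp add: hom_coarsen_def torsion_system_def)
  qed (use u in \<open>simp add: torsion_system_def\<close>)
  then show ?thesis
    using u by (simp add: torsion_coarsen_def torsion_system_coarsen[OF M] torsion_trans_coarsen dl_class_coarsen
        dl_map_def hom_coarsen_def)
qed

text \<open>A torsion class is represented by a map \<open>u\<close> on \<open>R/a\<^sup>n\<close>, and its image in degree 0 by the composite of \<open>u\<close>
  with the augmentation. A lift of the identity is compatible with the two augmentations.\<close>

lemma eta_extends: "extends_torsion_coarsen \<psi> R a eta"
  unfolding extends_torsion_coarsen_def
proof (intro conjI allI impI ballI eta_delta_morphism)
  fix M :: "('r, 'u, 'g) gmod" and y assume M: "graded_module R M" and y: "y \<in> carrier (torsion R a M)"
  have "\<exists>n u. u \<in> carrier (torsion_system R a M n) \<and> y = dl_class (torsion_system R a M) (torsion_trans R a) n u"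
    using y unfolding torsion_def by (rule iffD1[OF direct_system.dirlim_carrier[OF G.torsion_direct_system[OF M]]])
  then obtain n u where "u \<in> carrier (torsion_system R a M n)" and yu: "y = dl_class (torsion_system R a M) (torsion_trans R a) n u" by (elim exE conjE)
  then have u: "u \<in> carrier (ghom R (quot_pow R a n) M)" by (simp add: torsion_system_def)
  have u': "u \<in> carrier (ghom S (quot_pow S a n) (coarsen \<psi> M))"
    using u ghom_coarsen_carrier[OF hom gr G.X M ker] by (simp add: quot_pow_coarsen[OF gr id])
  let ?ua = "compose (carrier (pr (G.Pn n) 0)) u (aug (G.Pn n))"
  have cu: "?ua \<in> cocycles S (cP n) (coarsen \<psi> M) 0"
    using G.aug_cocycle[OF M u] by (simp add: cocycles_coarsen[OF hom gr ker towerD(3)[OF G.tower] M])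
  have ec: "ext_class R (G.Pn n) M 0 ?ua = ext_class S (cP n) (coarsen \<psi> M) 0 ?ua"
    by (simp add: coboundaries_coarsen[OF hom gr ker towerD(3)[OF G.tower] M] coset_ghom_coarsen[OF hom gr ker])
  have "dl_class (\<lambda>n. ext_of R (G.Pn n) 0 M) (\<lambda>n. pull R (G.Pn (Suc n)) (G.Pn n) 0 M (G.tn n)) = dl_class (csys 0 M) (ctrans 0 M)"
    unfolding csys[OF M] ctrans[OF M] dl_class_coarsen ..
  then have "torsion_iso R a M y = dl_class (csys 0 M) (ctrans 0 M) n (ext_class S (cP n) (coarsen \<psi> M) 0 ?ua)"
    unfolding yu G.torsion_iso_class[OF M u] ec by simp
  then have "eta 0 M (torsion_iso R a M y) =
      dl_class (\<lambda>n. ext_of S (H.Pn n) 0 (coarsen \<psi> M)) (\<lambda>n. pull S (H.Pn (Suc n)) (H.Pn n) 0 (coarsen \<psi> M) (H.tn n)) n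
        (pull S (H.Pn n) (cP n) 0 (coarsen \<psi> M) (to_coarse n) (ext_class S (cP n) (coarsen \<psi> M) 0 ?ua))"
    using compare_class[OF coarse_tower H.tower to_coarse cmod[OF M] ext_class_carrier[OF coarse_tower cu]] M
    by (simp add: eta_def)
  also have "pull S (H.Pn n) (cP n) 0 (coarsen \<psi> M) (to_coarse n) (ext_class S (cP n) (coarsen \<psi> M) 0 ?ua) =
      ext_class S (H.Pn n) (coarsen \<psi> M) 0 (compose (carrier (pr (H.Pn n) 0)) ?ua (to_coarse n 0))"
    using to_coarse[of n]
    by (intro pull_class[OF S towerD(3)[OF H.tower] towerD(3)[OF coarse_tower] _ cmod[OF M] cu]) (simp add: lifts_def)
  also have "compose (carrier (pr (H.Pn n) 0)) ?ua (to_coarse n 0) = compose (carrier (pr (H.Pn n) 0)) u (aug (H.Pn n))"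
    using to_coarse[of n] gr_homD(4)[OF chain_mapD(1), of S "H.Pn n" "cP n" "to_coarse n" _ 0]
    by (auto simp: lifts_def compose_def restrict_def fun_eq_iff)
  also have "dl_class (\<lambda>n. ext_of S (H.Pn n) 0 (coarsen \<psi> M)) (\<lambda>n. pull S (H.Pn (Suc n)) (H.Pn n) 0 (coarsen \<psi> M) (H.tn n)) n
        (ext_class S (H.Pn n) (coarsen \<psi> M) 0 (compose (carrier (pr (H.Pn n) 0)) u (aug (H.Pn n)))) =
      torsion_iso S a (coarsen \<psi> M) (torsion_coarsen \<psi> R a M y)"
    unfolding yu torsion_coarsen_class[OF M u] H.torsion_iso_class[OF cmod[OF M] u'] ..
  finally show "eta 0 M (torsion_iso R a M y) = torsion_iso S a (coarsen \<psi> M) (torsion_coarsen \<psi> R a M y)" .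
qed

end

section \<open>Uniqueness of the canonical morphism\<close>

text \<open>A coset is encoded in the universe by the image under \<open>j\<close> of one of its elements.\<close>

lemma quotient_in_universe:
  fixes R :: "('r, 'g::ab_group_add) gring" and M :: "('r, 'x, 'g) gmod" and j :: "'x \<Rightarrow> 'u"
  assumes R: "graded_cring R" and M: "graded_module R M" and K: "graded_submodule R M K" and j: "inj_on j (carrier M)"
  obtains N :: "('r, 'u, 'g) gmod" and q
  where "graded_module R N" "q \<in> gr_hom R M N" "q ` carrier M = carrier N"
    "\<And>x. x \<in> carrier M \<Longrightarrow> q x = \<zero>\<^bsub>N\<^esub> \<longleftrightarrow> x \<in> K"
proof -
  let ?c = "\<lambda>x. K +>\<^bsub>M\<^esub> x" and ?Q = "quotmod M K"
  let ?r = "inv_into (carrier M) ?c"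
  note Q = quotmod_graded_module[OF R M K] and pr = quotmod_projection[OF R M K]
  have rin: "?r X \<in> carrier M" if "X \<in> carrier ?Q" for X
    using that by (auto simp: quotmod_carrier intro: inv_into_into)
  have inj: "inj_on (\<lambda>X. j (?r X)) (carrier ?Q)"
  proof (rule inj_onI)
    fix X Y assume XY: "X \<in> carrier ?Q" "Y \<in> carrier ?Q" "j (?r X) = j (?r Y)"
    then have "?r X = ?r Y" using inj_onD[OF j] rin by blast
    moreover have "?c (?r X) = X" by (rule f_inv_into_f[of X ?c]) (use XY(1) in \<open>simp add: quotmod_carrier\<close>)
    moreover have "?c (?r Y) = Y" by (rule f_inv_into_f[of Y ?c]) (use XY(2) in \<open>simp add: quotmod_carrier\<close>)
    ultimately show "X = Y" by metis
  qed
  let ?e = "\<lambda>X. j (?r X)"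
  let ?N = "copymod ?e ?Q"
  note N = copymod_graded_module[OF R Q inj] and to = copymod_to[OF R Q inj] and car = copymod_carrier[OF R Q inj]
  let ?q = "compose (carrier M) (\<lambda>X\<in>carrier ?Q. ?e X) (\<lambda>x\<in>carrier M. ?c x)"
  have q: "?q \<in> gr_hom R M ?N" by (rule gr_hom_compose[OF M pr to])
  have qx: "?q x = ?e (?c x)" if "x \<in> carrier M" for x using that by (simp add: compose_def quotmod_carrier)
  have "?q ` carrier M = (\<lambda>x. ?e (?c x)) ` carrier M" by (rule image_cong[OF refl qx])
  also have "\<dots> = carrier ?N" unfolding car quotmod_carrier image_image ..
  finally have "?q ` carrier M = carrier ?N" .
  moreover have "?q x = \<zero>\<^bsub>?N\<^esub> \<longleftrightarrow> x \<in> K" if x: "x \<in> carrier M" for x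
  proof -
    have z: "\<zero>\<^bsub>?N\<^esub> = ?e K" by (simp add: copymod_def Let_def) (simp add: quotmod_def)
    have KQ: "K \<in> carrier ?Q"
      using abelian_monoid.zero_closed[OF abelian_group.axioms(1)[OF graded_moduleD(3)[OF Q]]] by (simp add: quotmod_def)
    have "?c x \<in> carrier ?Q" using x by (simp add: quotmod_carrier)
    then have "?q x = \<zero>\<^bsub>?N\<^esub> \<longleftrightarrow> ?c x = K" unfolding z qx[OF x] using inj_onD[OF inj _ _ KQ] by auto
    then show ?thesis using coset_eq_zero[OF graded_moduleD(3)[OF M] graded_submodule_subgroup[OF M K] x] by simp
  qed
  ultimately show ?thesis using that N q by blast
qed

text \<open>A homogeneous cocycle on \<open>P (k + 1)\<close> becomes a coboundary in the pushout of \<open>M\<close> and a shift of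
  \<open>P k\<close>. Hence each of its classes comes from a connecting map.\<close>

lemma class_is_connected:
  fixes R :: "('r, 'g::ab_group_add) gring" and P :: "('r, 'u, 'g, 'v) resolution" and M :: "('r, 'u, 'g) gmod"
  assumes R: "graded_cring R" and U: "universe_for TYPE('u) R" and P: "projective_resolution R L P"
    and M: "graded_module R M" and k: "k \<ge> 0"
    and u: "u \<in> cocycles R P M (k + 1)" and ug: "u \<in> gr_hom R (pr P (k + 1)) (shift M g)"
  obtains \<alpha> N \<beta> C w where "short_exact R M \<alpha> N \<beta> C" "w \<in> cocycles R P C k"
    "connect R P k M \<alpha> N \<beta> C (ext_class R P C k w) = ext_class R P M (k + 1) u"
proof -
  note Pm = resolutionD(2)[OF P] and d = resolution_df[OF P, of k]
  let ?A = "pr P (k + 1)" and ?B = "pr P k" and ?d = "df P (k + 1)"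
  let ?sA = "shift ?A (- g)" and ?sB = "shift ?B (- g)"
  note sA = shift_graded_module[OF Pm, of "k + 1" "- g"] and sB = shift_graded_module[OF Pm, of k "- g"]
  let ?X = "direct_sum M ?sB"
  note X = direct_sum_graded_module[OF R M sB]
  interpret M: abelian_group M using M by (rule graded_moduleD)
  interpret MM: module R M using M by (rule graded_moduleD)
  interpret B: graded_group ?B "mgrade ?B" using Pm by (rule graded_moduleD)
  interpret BB: module R ?B using Pm by (rule graded_moduleD)
  interpret MG: graded_group M "mgrade M" using M by (rule graded_moduleD)
  note ul = linear_mapD[OF cocyclesD(3)[OF R P M u]] and dl = linear_mapD[OF gr_homD(2)[OF d]]
  \<comment> \<open>the pushout of \<open>u\<close> and \<open>d\<close> is the quotient of the direct sum by the image of \<open>(u, -d)\<close>; the shift by \<open>-g\<close> gives \<open>u\<close> degree 0\<close>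
  let ?\<kappa> = "\<lambda>x. (u x, \<ominus>\<^bsub>?B\<^esub> ?d x)"
  have \<kappa>: "(\<lambda>x\<in>carrier ?sA. ?\<kappa> x) \<in> gr_hom R ?sA ?X"
  proof (rule gr_hom_restrict[OF sA])
    show "linear_map R ?sA ?X ?\<kappa>"
      using ul(2-) dl(2-) by (simp add: linear_map_def additive_map_def B.minus_add BB.smult_r_minus B.a_comm)
    fix j x assume x: "x \<in> mgrade ?sA j"
    then have xg: "x \<in> mgrade ?A (- g + j)" by (simp add: shift_def)
    have "u x \<in> mgrade M (g + (- g + j))" "?d x \<in> mgrade ?B (- g + j)"
      using gr_hom_degree[OF ug xg] gr_homD(3)[OF d xg] .
    then show "?\<kappa> x \<in> mgrade ?X j" by (simp add: B.D_minus)
  qed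
  let ?K = "(\<lambda>x\<in>carrier ?sA. ?\<kappa> x) ` carrier ?sA"
  have K: "?K = ?\<kappa> ` carrier ?A" by auto
  note Ks = image_graded_submodule[OF sA X \<kappa>]
  obtain b where "bij_betw b ((UNIV :: 'u set) \<times> (UNIV :: 'u set)) (UNIV :: 'u set)"
    using Times_same_infinite_bij_betw[OF universe_infinite(1)[OF R U]] by blast
  then have b: "inj_on b (carrier ?X)" by (auto simp: bij_betw_def intro: inj_on_subset)
  obtain N :: "('r, 'u, 'g) gmod" and q where N: "graded_module R N" and q: "q \<in> gr_hom R ?X N"
    and qs: "q ` carrier ?X = carrier N" and qk: "\<And>x. x \<in> carrier ?X \<Longrightarrow> q x = \<zero>\<^bsub>N\<^esub> \<longleftrightarrow> x \<in> ?K"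
    by (rule quotient_in_universe[OF R X Ks b]) blast
  interpret N: abelian_group N using N by (rule graded_moduleD)
  note ql = linear_mapD[OF gr_homD(2)[OF q]]
  define \<alpha> where "\<alpha> = (\<lambda>m\<in>carrier M. q (m, \<zero>\<^bsub>?B\<^esub>))"
  define v where "v = (\<lambda>y\<in>carrier ?B. q (\<zero>\<^bsub>M\<^esub>, y))"
  have qa: "q (m \<oplus>\<^bsub>M\<^esub> m', y \<oplus>\<^bsub>?B\<^esub> y') = q (m, y) \<oplus>\<^bsub>N\<^esub> q (m', y')"
    if "m \<in> carrier M" "m' \<in> carrier M" "y \<in> carrier ?B" "y' \<in> carrier ?B" for m m' y y'
    using ql(3)[of "(m, y)" "(m', y')"] that by simp
  have qsm: "q (r \<odot>\<^bsub>M\<^esub> m, r \<odot>\<^bsub>?B\<^esub> y) = r \<odot>\<^bsub>N\<^esub> q (m, y)"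
    if "r \<in> carrier R" "m \<in> carrier M" "y \<in> carrier ?B" for r m y
    using ql(4)[of r "(m, y)"] that by simp
  have qc: "q (m, y) \<in> carrier N" if "m \<in> carrier M" "y \<in> carrier ?B" for m y
    using ql(2)[of "(m, y)"] that by simp
  have \<alpha>: "\<alpha> \<in> gr_hom R M N"
    unfolding \<alpha>_def
  proof (rule gr_hom_restrict[OF M])
    show "linear_map R M N (\<lambda>m. q (m, \<zero>\<^bsub>?B\<^esub>))"
      unfolding linear_map_def additive_map_def
    proof (intro conjI ballI)
      fix x assume x: "x \<in> carrier M"
      show "q (x, \<zero>\<^bsub>?B\<^esub>) \<in> carrier N" using qc x by simp
      show "q (r \<odot>\<^bsub>M\<^esub> x, \<zero>\<^bsub>?B\<^esub>) = r \<odot>\<^bsub>N\<^esub> q (x, \<zero>\<^bsub>?B\<^esub>)" if "r \<in> carrier R" for r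
        using qsm[OF that x B.zero_closed] that by simp
      fix y assume y: "y \<in> carrier M"
      show "q (x \<oplus>\<^bsub>M\<^esub> y, \<zero>\<^bsub>?B\<^esub>) = q (x, \<zero>\<^bsub>?B\<^esub>) \<oplus>\<^bsub>N\<^esub> q (y, \<zero>\<^bsub>?B\<^esub>)"
        using qa[OF x y B.zero_closed B.zero_closed] by simp
    qed
    show "q (m, \<zero>\<^bsub>?B\<^esub>) \<in> mgrade N j" if "m \<in> mgrade M j" for m j
      using gr_homD(3)[OF q, of "(m, \<zero>\<^bsub>?B\<^esub>)" j] that by simp
  qed
  have v: "v \<in> gr_hom R ?B (shift N g)"
    unfolding v_def
  proof (rule gr_hom_restrict[OF Pm])
    show "linear_map R ?B (shift N g) (\<lambda>y. q (\<zero>\<^bsub>M\<^esub>, y))"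
      unfolding linear_map_shift unfolding linear_map_def additive_map_def
    proof (intro conjI ballI)
      fix x assume x: "x \<in> carrier ?B"
      show "q (\<zero>\<^bsub>M\<^esub>, x) \<in> carrier N" using qc x by simp
      show "q (\<zero>\<^bsub>M\<^esub>, r \<odot>\<^bsub>?B\<^esub> x) = r \<odot>\<^bsub>N\<^esub> q (\<zero>\<^bsub>M\<^esub>, x)" if "r \<in> carrier R" for r
        using qsm[OF that M.zero_closed x] that by simp
      fix y assume y: "y \<in> carrier ?B"
      show "q (\<zero>\<^bsub>M\<^esub>, x \<oplus>\<^bsub>?B\<^esub> y) = q (\<zero>\<^bsub>M\<^esub>, x) \<oplus>\<^bsub>N\<^esub> q (\<zero>\<^bsub>M\<^esub>, y)"
        using qa[OF M.zero_closed M.zero_closed x y] by simp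
    qed
    show "q (\<zero>\<^bsub>M\<^esub>, y) \<in> mgrade (shift N g) j" if "y \<in> mgrade ?B j" for y j
      using gr_homD(3)[OF q, of "(\<zero>\<^bsub>M\<^esub>, y)" "g + j"] that MG.D_zero by simp
  qed
  have vd: "\<alpha> (u x) = v (?d x)" if x: "x \<in> carrier ?A" for x
  proof -
    have c: "u x \<in> carrier M" "?d x \<in> carrier ?B" using ul(2) dl(2) x by auto
    have "?\<kappa> x \<in> ?K" unfolding K using x by (rule imageI)
    then have "q (?\<kappa> x) = \<zero>\<^bsub>N\<^esub>" using qk[of "?\<kappa> x"] c by simp
    then have "q (u x \<oplus>\<^bsub>M\<^esub> \<zero>\<^bsub>M\<^esub>, \<ominus>\<^bsub>?B\<^esub> ?d x \<oplus>\<^bsub>?B\<^esub> ?d x) = q (\<zero>\<^bsub>M\<^esub>, ?d x)"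
      using qa[of "u x" "\<zero>\<^bsub>M\<^esub>" "\<ominus>\<^bsub>?B\<^esub> ?d x" "?d x"] c qc[of "\<zero>\<^bsub>M\<^esub>" "?d x"] by simp
    then show ?thesis using c by (simp add: \<alpha>_def v_def B.l_neg)
  qed
  \<comment> \<open>injectivity: \<open>u\<close> vanishes on the kernel of \<open>d\<close>, which is the image of the next differential\<close>
  have \<alpha>0: "m = \<zero>\<^bsub>M\<^esub>" if m: "m \<in> carrier M" "\<alpha> m = \<zero>\<^bsub>N\<^esub>" for m
  proof -
    have "(m, \<zero>\<^bsub>?B\<^esub>) \<in> ?K" using qk[of "(m, \<zero>\<^bsub>?B\<^esub>)"] m by (simp add: \<alpha>_def)
    then obtain x where x: "x \<in> carrier ?A" "m = u x" "\<zero>\<^bsub>?B\<^esub> = \<ominus>\<^bsub>?B\<^esub> ?d x" unfolding K by blast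
    have "?d x = \<zero>\<^bsub>?B\<^esub>" using x(3) dl(2)[OF x(1)] B.add.inv_eq_1_iff by metis
    then have "x \<in> df P (k + 1 + 1) ` carrier (pr P (k + 1 + 1))"
      using resolutionD(8)[OF P, of "k + 1"] k x(1) by (simp add: a_kernel_def')
    then show ?thesis using x(2) cocyclesD(5)[OF R P M u] by auto
  qed
  have inj: "inj_on \<alpha> (carrier M)"
  proof (rule inj_onI)
    fix x y assume xy: "x \<in> carrier M" "y \<in> carrier M" "\<alpha> x = \<alpha> y"
    have "\<alpha> (x \<ominus>\<^bsub>M\<^esub> y) = \<alpha> x \<ominus>\<^bsub>N\<^esub> \<alpha> y" by (rule linear_map_diff[OF M N gr_homD(2)[OF \<alpha>] xy(1,2)])
    also have "\<dots> = \<zero>\<^bsub>N\<^esub>" using xy(3) gr_homD(4)[OF \<alpha> xy(2)] by (simp add: a_minus_def N.r_neg)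
    finally have "x \<ominus>\<^bsub>M\<^esub> y = \<zero>\<^bsub>M\<^esub>" using \<alpha>0 xy by (simp add: a_minus_def)
    then show "x = y" using M.minus_eq_zero xy by blast
  qed
  note Z = image_graded_submodule[OF M N \<alpha>]
  have idN: "inj_on (\<lambda>x. x) (carrier N)" by simp
  obtain C :: "('r, 'u, 'g) gmod" and \<beta> where C: "graded_module R C" and \<beta>: "\<beta> \<in> gr_hom R N C"
    and \<beta>s: "\<beta> ` carrier N = carrier C" and \<beta>k: "\<And>x. x \<in> carrier N \<Longrightarrow> \<beta> x = \<zero>\<^bsub>C\<^esub> \<longleftrightarrow> x \<in> \<alpha> ` carrier M"
    by (rule quotient_in_universe[OF R N Z idN]) blast
  have ab: "\<alpha> ` carrier M = a_kernel N C \<beta>"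
    using \<beta>k gr_homD(4)[OF \<alpha>] by (auto simp: a_kernel_def')
  have ex: "short_exact R M \<alpha> N \<beta> C" using M N C \<alpha> \<beta> inj ab \<beta>s by (simp add: short_exact_def)
  have vg: "v \<in> carrier (ghom R ?B N)" by (rule gr_hom_ghom[OF Pm N v])
  let ?w = "compose (carrier ?B) \<beta> v"
  have w: "?w \<in> cocycles R P C k"
  proof -
    have "\<beta> (v (?d x)) = \<zero>\<^bsub>C\<^esub>" if x: "x \<in> carrier ?A" for x
    proof -
      have "v (?d x) \<in> \<alpha> ` carrier M" using vd[OF x, symmetric] ul(2)[OF x] by (rule image_eqI)
      moreover have "v (?d x) \<in> carrier N" using vd[OF x, symmetric] gr_homD(4)[OF \<alpha> ul(2)[OF x]] by simp
      ultimately show ?thesis using \<beta>k[of "v (?d x)"] by simp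
    qed
    then show ?thesis using ghom_compose_left[OF R Pm N C vg \<beta>] dl(2) by (simp add: cocycles_def compose_def)
  qed
  have "connect R P k M \<alpha> N \<beta> C (ext_class R P C k ?w) = ext_class R P M (k + 1) u"
    by (rule connect_class[OF R P ex w vg u]) (simp_all add: compose_def vd)
  then show ?thesis using that ex w by blast
qed

lemma lc_negative:
  fixes R :: "('r, 'g::ab_group_add) gring" and P :: "nat \<Rightarrow> ('r, 'u, 'g, 'v) resolution"
  assumes T: "tower R X p P \<tau>" and N: "graded_module R N" and i: "i < 0"
    and z: "z \<in> carrier (obj (lc_delta R P \<tau>) i N)"
  shows "z = \<zero>\<^bsub>obj (lc_delta R P \<tau>) i N\<^esub>"
proof -
  obtain n u where u: "u \<in> cocycles R (P n) N i"
    "z = dl_class (\<lambda>n. ext_of R (P n) i N) (\<lambda>n. pull R (P (Suc n)) (P n) i N (\<tau> n)) n (ext_class R (P n) N i u)"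
    by (rule lc_obj_cases[OF T N z])
  note R = towerD(1)[OF T] and PR = towerD(3)[OF T, of n]
  note Pm = resolutionD(2)[OF PR]
  have "u = \<zero>\<^bsub>ghom R (pr (P n) i) N\<^esub>"
    using cocyclesD(2)[OF R PR N u(1)] resolutionD(3)[OF PR i] linear_map_zero[OF Pm N cocyclesD(3)[OF R PR N u(1)]]
    by (intro ghom_eqI[of _ "pr (P n) i"]) (auto simp: ghom_simps)
  then have "u \<in> coboundaries R (P n) N i"
    using graded_submoduleD(2)[OF coboundaries_submodule[OF R PR N]] by simp
  then have "ext_class R (P n) N i u = coboundaries R (P n) N i"
    using coset_eq_zero[OF ghom_abelian_group(1)[OF Pm N] graded_submodule_subgroup[OF ghom_graded_module[OF R Pm N]
      coboundaries_submodule[OF R PR N]] cocyclesD(1)[OF R PR N u(1)]] by blast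
  moreover have "\<zero>\<^bsub>ext_of R (P n) i N\<^esub> = coboundaries R (P n) N i" by (simp add: ext_of_def quotmod_def)
  ultimately show ?thesis
    unfolding u(2) lc_obj[OF T] using direct_system.dirlim_zero[OF lsystem[OF T N], of i n] by simp
qed

lemma lc_add:
  fixes R :: "('r, 'g::ab_group_add) gring" and P :: "nat \<Rightarrow> ('r, 'u, 'g, 'v) resolution"
  assumes T: "tower R X p P \<tau>" and N: "graded_module R N"
    and u: "u \<in> cocycles R (P n) N i" and v: "v \<in> cocycles R (P n) N i"
  shows "dl_class (\<lambda>n. ext_of R (P n) i N) (\<lambda>n. pull R (P (Suc n)) (P n) i N (\<tau> n)) n (ext_class R (P n) N i (u \<oplus>\<^bsub>ghom R (pr (P n) i) N\<^esub> v)) =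
    dl_class (\<lambda>n. ext_of R (P n) i N) (\<lambda>n. pull R (P (Suc n)) (P n) i N (\<tau> n)) n (ext_class R (P n) N i u)
    \<oplus>\<^bsub>obj (lc_delta R P \<tau>) i N\<^esub> dl_class (\<lambda>n. ext_of R (P n) i N) (\<lambda>n. pull R (P (Suc n)) (P n) i N (\<tau> n)) n (ext_class R (P n) N i v)"
  unfolding lc_obj[OF T] ext_add[OF towerD(1)[OF T] towerD(3)[OF T] N u v, symmetric]
  by (rule direct_system.dirlim_add[OF lsystem[OF T N] ext_class_carrier[OF T u] ext_class_carrier[OF T v], symmetric])

lemma delta_morphismD:
  assumes "delta_morphism R Q T T' \<eta>"
  shows "\<And>i M. graded_module R M \<Longrightarrow> \<eta> i M \<in> gr_hom Q (obj T i M) (obj T' i M)"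
    "\<And>i A \<alpha> B \<beta> C x. short_exact R A \<alpha> B \<beta> C \<Longrightarrow> x \<in> carrier (obj T i C) \<Longrightarrow>
       \<eta> (i + 1) A (conn T i A \<alpha> B \<beta> C x) = conn T' i A \<alpha> B \<beta> C (\<eta> i C x)"
    "\<And>i M. \<not> graded_module R M \<Longrightarrow> \<eta> i M = undefined"
  using assms by (simp_all add: delta_morphism_def)

context coarse_setup
begin

lemma source_R:
  fixes M N A B C :: "('r, 'u, 'g) gmod"
  shows "carrier (obj (lc_source \<psi> R a) i M) = carrier (obj (lc_delta R G.Pn G.tn) i M)"
    "add (obj (lc_source \<psi> R a) i M) = add (obj (lc_delta R G.Pn G.tn) i M)"
    "conn (lc_source \<psi> R a) i A \<alpha> B \<beta> C = conn (lc_delta R G.Pn G.tn) i A \<alpha> B \<beta> C"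
  by (simp_all add: lc_source_def coarsen_after_def local_cohomology_std)

text \<open>Two extensions agree in degree 0, where every class comes from the torsion functor. If they agree in
  degree \<open>k\<close>, then they agree on classes of homogeneous cocycles of degree \<open>k + 1\<close>, since these come from
  degree \<open>k\<close> by connecting maps, and by additivity on all classes.\<close>

lemma extension_unique:
  fixes \<eta> \<eta>' :: "int \<Rightarrow> ('r, 'u, 'g) gmod \<Rightarrow> (nat \<times> ('u \<Rightarrow> 'u) set) set \<Rightarrow> (nat \<times> ('u \<Rightarrow> 'u) set) set"
  assumes e: "extends_torsion_coarsen \<psi> R a \<eta>" and e': "extends_torsion_coarsen \<psi> R a \<eta>'"
  shows "\<eta> = \<eta>'"
proof -
  have dm: "delta_morphism R S (lc_source \<psi> R a) (lc_target \<psi> R a) \<eta>"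
      "delta_morphism R S (lc_source \<psi> R a) (lc_target \<psi> R a) \<eta>'"
    using e e' by (auto simp: extends_torsion_coarsen_def)
  note h = delta_morphismD(1)[OF dm(1)] delta_morphismD(1)[OF dm(2)]
  note cn = delta_morphismD(2)[OF dm(1)] delta_morphismD(2)[OF dm(2)]
  have agree_nat: "\<eta> (int m) M z = \<eta>' (int m) M z"
    if "graded_module R M" "z \<in> carrier (obj (lc_source \<psi> R a) (int m) M)" for m M z
    using that
  proof (induction m arbitrary: M z)
    case 0
    then have "z \<in> carrier (obj (lc_delta R G.Pn G.tn) 0 M)" by (simp add: source_R)
    then obtain y where y: "y \<in> carrier (torsion R a M)" "z = torsion_iso R a M y"
      using G.torsion_iso_surj[OF 0(1)] by blast
    then show ?case using e e' 0(1) by (simp add: extends_torsion_coarsen_def)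
  next
    case (Suc m)
    let ?k = "int m"
    have M: "graded_module R M" by (rule Suc.prems)
    have sk: "int (Suc m) = ?k + 1" by simp
    let ?cl = "\<lambda>n i M u. dl_class (\<lambda>n. ext_of R (G.Pn n) i M) (\<lambda>n. pull R (G.Pn (Suc n)) (G.Pn n) i M (G.tn n)) n
      (ext_class R (G.Pn n) M i u)"
    have "z \<in> carrier (obj (lc_delta R G.Pn G.tn) (?k + 1) M)" using Suc.prems(2) unfolding sk source_R .
    then obtain n u where u: "u \<in> cocycles R (G.Pn n) M (?k + 1)" and z: "z = ?cl n (?k + 1) M u"
      by (rule lc_obj_cases[OF G.tower M])
    note P = towerD(3)[OF G.tower, of n]
    note GM = ghom_graded_module[OF gr resolutionD(2)[OF P, of "?k + 1"] M]
    note Zs = cocycles_submodule[OF gr P M, of "?k + 1"]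
    interpret Z: graded_group "submod (ghom R (pr (G.Pn n) (?k + 1)) M) (cocycles R (G.Pn n) M (?k + 1))"
      "mgrade (submod (ghom R (pr (G.Pn n) (?k + 1)) M) (cocycles R (G.Pn n) M (?k + 1)))"
      using submod_graded_module[OF gr GM Zs] by (rule graded_moduleD)
    have hom_case: "\<eta> (?k + 1) M (?cl n (?k + 1) M u) = \<eta>' (?k + 1) M (?cl n (?k + 1) M u)"
      if u: "u \<in> cocycles R (G.Pn n) M (?k + 1)" and ug: "u \<in> gr_hom R (pr (G.Pn n) (?k + 1)) (shift M g)" for u g
    proof -
      have k0: "0 \<le> ?k" by simp
      obtain \<alpha> N \<beta> C w where ex: "short_exact R M \<alpha> N \<beta> C" and w: "w \<in> cocycles R (G.Pn n) C ?k"
        and cw: "connect R (G.Pn n) ?k M \<alpha> N \<beta> C (ext_class R (G.Pn n) C ?k w) = ext_class R (G.Pn n) M (?k + 1) u"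
        by (rule class_is_connected[OF gr univ P M k0 u ug])
      have C: "graded_module R C" using ex by (simp add: short_exact_def)
      have wc: "?cl n ?k C w \<in> carrier (obj (lc_source \<psi> R a) ?k C)"
        unfolding source_R lc_obj[OF G.tower]
        by (rule direct_system.dl_class_carrier[OF lsystem[OF G.tower C] ext_class_carrier[OF G.tower w]])
      have "?cl n (?k + 1) M u = conn (lc_source \<psi> R a) ?k M \<alpha> N \<beta> C (?cl n ?k C w)"
        unfolding source_R lc_conn_class[OF G.tower ex ext_class_carrier[OF G.tower w]] cw ..
      then show ?thesis using cn[OF ex wc] Suc.IH[OF C wc] by simp
    qed
    have "u \<in> carrier (submod (ghom R (pr (G.Pn n) (?k + 1)) M) (cocycles R (G.Pn n) M (?k + 1)))" using u by simp
    then have "\<eta> (?k + 1) M (?cl n (?k + 1) M u) = \<eta>' (?k + 1) M (?cl n (?k + 1) M u)"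
    proof (induction rule: Z.carrier_induct)
      case zero
      let ?z = "\<zero>\<^bsub>submod (ghom R (pr (G.Pn n) (?k + 1)) M) (cocycles R (G.Pn n) M (?k + 1))\<^esub>"
      have "?z \<in> cocycles R (G.Pn n) M (?k + 1)" "?z \<in> gr_hom R (pr (G.Pn n) (?k + 1)) (shift M 0)"
        using Z.D_zero[of 0] by (simp_all add: ghom_simps)
      then show ?case by (rule hom_case)
    next
      case (homog g x) then show ?case using hom_case[of x g] by (simp add: ghom_simps)
    next
      case (add x y)
      have xy: "x \<in> cocycles R (G.Pn n) M (?k + 1)" "y \<in> cocycles R (G.Pn n) M (?k + 1)" using add by simp_all
      have c: "?cl n (?k + 1) M u \<in> carrier (obj (lc_source \<psi> R a) (?k + 1) M)" if "u \<in> cocycles R (G.Pn n) M (?k + 1)" for u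
        unfolding source_R lc_obj[OF G.tower]
        by (rule direct_system.dl_class_carrier[OF lsystem[OF G.tower M] ext_class_carrier[OF G.tower that]])
      have s: "?cl n (?k + 1) M (x \<oplus>\<^bsub>ghom R (pr (G.Pn n) (?k + 1)) M\<^esub> y) =
          ?cl n (?k + 1) M x \<oplus>\<^bsub>obj (lc_source \<psi> R a) (?k + 1) M\<^esub> ?cl n (?k + 1) M y"
        unfolding source_R by (rule lc_add[OF G.tower M xy])
      show ?case
        unfolding submod_simps s linear_mapD(3)[OF gr_homD(2)[OF h(1)[OF M]] c[OF xy(1)] c[OF xy(2)]]
          linear_mapD(3)[OF gr_homD(2)[OF h(2)[OF M]] c[OF xy(1)] c[OF xy(2)]] add(3,4) ..
    qed
    then show ?case unfolding sk z .
  qed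
  have agree: "\<eta> i M z = \<eta>' i M z" if M: "graded_module R M" and z: "z \<in> carrier (obj (lc_source \<psi> R a) i M)" for i M z
  proof (cases "i < 0")
    case True
    have "\<eta> i M z \<in> carrier (obj (lc_delta S H.Pn H.tn) i (coarsen \<psi> M))"
      "\<eta>' i M z \<in> carrier (obj (lc_delta S H.Pn H.tn) i (coarsen \<psi> M))"
      using gr_homD(4)[OF h(1)[OF M] z] gr_homD(4)[OF h(2)[OF M] z] by (simp_all add: target)
    then show ?thesis
      by (intro trans[OF lc_negative[OF H.tower cmod[OF M] True] lc_negative[OF H.tower cmod[OF M] True, symmetric]])
  next
    case False
    then have "i = int (nat i)" by simp
    then show ?thesis using agree_nat[OF M, of z "nat i"] z by simp
  qed
  show ?thesis
  proof (intro HOL.ext)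
    fix i M z
    show "\<eta> i M z = \<eta>' i M z"
    proof (cases "graded_module R M")
      case True
      have "\<eta> i M = \<eta>' i M"
        by (rule extensionalityI[OF gr_homD(1)[OF h(1)[OF True]] gr_homD(1)[OF h(2)[OF True]] agree[OF True]])
      then show ?thesis by simp
    next
      case False
      then show ?thesis using delta_morphismD(3)[OF dm(1)] delta_morphismD(3)[OF dm(2)] by simp
    qed
  qed
qed

end

theorem mainTheorem2:
  fixes \<psi> :: "'g::ab_group_add \<Rightarrow> 'h::ab_group_add"
    and R :: "('r, 'g) gring"
    and a :: "'r set"
  assumes "\<forall>x y. \<psi> (x + y) = \<psi> x + \<psi> y" and "surj \<psi>"
    and "graded_cring R" and "graded_ideal a R"
    and "finite {g. \<psi> g = 0}"
    and "universe_for TYPE('u) R"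
  shows "(\<exists>!\<eta> :: int \<Rightarrow> ('r, 'u, 'g) gmod \<Rightarrow>
              (nat \<times> ('u \<Rightarrow> 'u) set) set \<Rightarrow> (nat \<times> ('u \<Rightarrow> 'u) set) set.
            extends_torsion_coarsen \<psi> R a \<eta>) \<and>
    delta_isomorphism R (coarsen_ring \<psi> R) (lc_source \<psi> R a) (lc_target \<psi> R a)
      (canonical_morphism \<psi> R a ::
        int \<Rightarrow> ('r, 'u, 'g) gmod \<Rightarrow> (nat \<times> ('u \<Rightarrow> 'u) set) set \<Rightarrow> (nat \<times> ('u \<Rightarrow> 'u) set) set)"
proof -
  interpret coarse_setup \<psi> R a "TYPE('u)"
    by unfold_locales (use assms in simp_all)
  have "canonical_morphism \<psi> R a = eta"
    unfolding canonical_morphism_def using eta_extends extension_unique by (intro the_equality)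
  then show ?thesis
    using eta_extends extension_unique eta_delta_isomorphism by (intro conjI ex1I[of _ eta]) simp_all
qed

end
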